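(* Let $\Gamma_i$ ($1\le i\le n$) and $\Lambda_j$ ($1\le j\le m$) be non-elementary torsion-free hyperbolic groups. If $\Gamma=\prod_{i=1}^n\Gamma_i$ is measure equivalent to $\Lambda=\prod_{j=1}^m\Lambda_j$, then $n=m$ and, after permutation of the indices, each $\Gamma_i$ is measure equivalent to $\Lambda_i$.
   Context: Hyperbolic group means Gromov-hyperbolic group; a hyperbolic group is elementary if it is virtually cyclic (finite groups included). Two countable groups $\Gamma$ and $\Lambda$ are measure equivalent (ME) if there is a (non-zero) $\sigma$-finite measure space $(\Sigma,m)$ with commuting measure preserving $\Gamma$- and $\Lambda$-actions, such that each one of the actions admits a finite measure fundamental domain. *)

theory Defs
  imports
    "HOL-Analysis.Analysis"
    "HOL-Algebra.Elementary_Groups"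
    "HOL-Algebra.Product_Groups"
    "HOL-Algebra.Group_Action"
    "HOL-Combinatorics.Permutations"
begin

subsection \<open>Hyperbolic groups\<close>

definition word_length :: "('a, 'c) monoid_scheme \<Rightarrow> 'a set \<Rightarrow> 'a \<Rightarrow> nat" where
  "word_length G S g =
     (LEAST k. \<exists>ws. length ws = k \<and> set ws \<subseteq> S \<union> m_inv G ` S \<and>
                    foldr (\<otimes>\<^bsub>G\<^esub>) ws \<one>\<^bsub>G\<^esub> = g)"

definition word_dist :: "('a, 'c) monoid_scheme \<Rightarrow> 'a set \<Rightarrow> 'a \<Rightarrow> 'a \<Rightarrow> real" where
  "word_dist G S x y = real (word_length G S (inv\<^bsub>G\<^esub> x \<otimes>\<^bsub>G\<^esub> y))"

definition gromov_product :: "('a \<Rightarrow> 'a \<Rightarrow> real) \<Rightarrow> 'a \<Rightarrow> 'a \<Rightarrow> 'a \<Rightarrow> real" where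
  "gromov_product d w x y = (d x w + d y w - d x y) / 2"

definition gromov_hyperbolic :: "'a set \<Rightarrow> ('a \<Rightarrow> 'a \<Rightarrow> real) \<Rightarrow> bool" where
  "gromov_hyperbolic X d \<longleftrightarrow>
     (\<exists>\<delta>\<ge>0. \<forall>w\<in>X. \<forall>x\<in>X. \<forall>y\<in>X. \<forall>z\<in>X.
        gromov_product d w x z \<ge> min (gromov_product d w x y) (gromov_product d w y z) - \<delta>)"

definition hyperbolic_group :: "('a, 'c) monoid_scheme \<Rightarrow> bool" where
  "hyperbolic_group G \<longleftrightarrow>
     Group.group G \<and>
     (\<exists>S. finite S \<and> S \<subseteq> carrier G \<and> generate G S = carrier G \<and>
          gromov_hyperbolic (carrier G) (word_dist G S))"

text \<open>The trivial subgroup is cyclic, so finite groups are virtually cyclic.\<close>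

definition virtually_cyclic :: "('a, 'c) monoid_scheme \<Rightarrow> bool" where
  "virtually_cyclic G \<longleftrightarrow>
     (\<exists>H. subgroup H G \<and> cyclic_group (G\<lparr>carrier := H\<rparr>) \<and> finite (rcosets\<^bsub>G\<^esub> H))"

definition torsion_free :: "('a, 'c) monoid_scheme \<Rightarrow> bool" where
  "torsion_free G \<longleftrightarrow>
     (\<forall>x\<in>carrier G. \<forall>k::nat. k > 0 \<longrightarrow> x [^]\<^bsub>G\<^esub> k = \<one>\<^bsub>G\<^esub> \<longrightarrow> x = \<one>\<^bsub>G\<^esub>)"

subsection \<open>Measure equivalence\<close>

definition measure_preserving_action ::
  "('a, 'c) monoid_scheme \<Rightarrow> 's measure \<Rightarrow> ('a \<Rightarrow> 's \<Rightarrow> 's) \<Rightarrow> bool" where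
  "measure_preserving_action G M \<phi> \<longleftrightarrow>
     group_action G (space M) \<phi> \<and>
     (\<forall>g\<in>carrier G. \<phi> g \<in> measurable M M \<and> distr M M (\<phi> g) = M)"

text \<open>The translates of a fundamental domain by distinct group elements partition the space
  up to null sets; in particular the action is essentially free.\<close>

definition fundamental_domain ::
  "('a, 'c) monoid_scheme \<Rightarrow> 's measure \<Rightarrow> ('a \<Rightarrow> 's \<Rightarrow> 's) \<Rightarrow> 's set \<Rightarrow> bool" where
  "fundamental_domain G M \<phi> X \<longleftrightarrow>
     X \<in> sets M \<and> (AE x in M. \<exists>!g. g \<in> carrier G \<and> x \<in> \<phi> g ` X)"

definition measure_coupling ::
  "('a, 'c) monoid_scheme \<Rightarrow> ('b, 'd) monoid_scheme \<Rightarrow> 's measure \<Rightarrow>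
   ('a \<Rightarrow> 's \<Rightarrow> 's) \<Rightarrow> ('b \<Rightarrow> 's \<Rightarrow> 's) \<Rightarrow> bool" where
  "measure_coupling G H M \<phi> \<psi> \<longleftrightarrow>
     sigma_finite_measure M \<and> emeasure M (space M) \<noteq> 0 \<and>
     measure_preserving_action G M \<phi> \<and> measure_preserving_action H M \<psi> \<and>
     (\<forall>g\<in>carrier G. \<forall>h\<in>carrier H. \<forall>x\<in>space M. \<phi> g (\<psi> h x) = \<psi> h (\<phi> g x)) \<and>
     (\<exists>X. fundamental_domain G M \<phi> X \<and> emeasure M X < \<infinity>) \<and>
     (\<exists>Y. fundamental_domain H M \<psi> Y \<and> emeasure M Y < \<infinity>)"

text \<open>An existential quantifier cannot range over types, so the type of points of the coupling
  space is a parameter. A coupling over an arbitrary type yields one over \<^typ>\<open>real\<close>: the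
  groups being countable, pass to an invariant countably generated sub-sigma-algebra containing
  both fundamental domains, push the measure forward to a Cantor space embedded in the reals, and
  discard an invariant null set. Hence \<^term>\<open>TYPE(real)\<close> is the strongest instance as a
  conclusion, while a type variable is the most general one as a hypothesis.\<close>

definition measure_equivalent ::
  "'s itself \<Rightarrow> ('a, 'c) monoid_scheme \<Rightarrow> ('b, 'd) monoid_scheme \<Rightarrow> bool" where
  "measure_equivalent (_ :: 's itself) G H \<longleftrightarrow>
     Group.group G \<and> Group.group H \<and> countable (carrier G) \<and> countable (carrier H) \<and>
     (\<exists>(M :: 's measure) \<phi> \<psi>. measure_coupling G H M \<phi> \<psi>)"

end

theory Submission
  imports Defs "HOL-Real_Asymp.Real_Asymp"
begin

text \<open>Non-elementary torsion-free hyperbolic groups are non-amenable, and they carry finitely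
  supported equivariant probability kernels \<open>\<mu>(w, z)\<close> that hardly change when \<open>w\<close> and \<open>z\<close> move by a
  bounded distance, as long as \<open>w\<close> and \<open>z\<close> are far apart. Let \<open>A\<close> be the product of all \<open>\<Gamma>\<^sub>k\<close> with
  \<open>k \<noteq> i\<close>. If \<open>A\<close> moved every finite-measure piece of every quotient of the coupling by
  \<open>\<Prod>\<^bsub>k \<noteq> j\<^esub> \<Lambda>\<^sub>k\<close> off itself, then the kernels evaluated at the \<open>\<Lambda>\<close>-positions of \<open>x\<close> and \<open>a x\<close>, for a
  suitable \<open>a \<in> A\<close>, would be almost \<open>\<Gamma>\<^sub>i\<close>-invariant, contradicting non-amenability of \<open>\<Gamma>\<^sub>i\<close>. Hence
  some such quotient has an \<open>A\<close>-invariant set of positive finite measure. As \<open>\<Lambda>\<^sub>j\<close> is torsion-free, it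
  acts freely on its nonempty finite subsets, and the invariant set yields a fundamental domain for
  \<open>\<Lambda>\<^sub>j\<close> that is invariant under \<open>A\<close> and under the other \<open>\<Lambda>\<^sub>k\<close>. Doing this for all factors on both
  sides matches them bijectively, and the quotient of the coupling by the complementary factors is
  a coupling of \<open>\<Gamma>\<^sub>i\<close> and \<open>\<Lambda>\<^sub>j\<close>.\<close>

section \<open>Hyperbolic word metrics\<close>

text \<open>No ergodicity is available, so a factor is split off only on an invariant piece of the
  coupling of positive measure. The pieces shrink finitely many times, and all notions are made to
  survive restriction. Quotients by infinite groups are never formed as spaces: a quotient keeps the
  points, takes the invariant sets as measurable sets and measures them inside a fundamental domain,
  whose choice does not matter. One element \<open>a\<close> must drive the positions apart in all
  \<Lambda>-coordinates at the same time; it comes from the disjoint union of all the quotients,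
  where an invariant set would arise from the vector of least norm in the convex hull of an orbit.
  The last obstacle is that the fundamental domains of \<Gamma>_i and \<Lambda>_j have finite mass
  for two different quotient measures on the same invariant sets. The density of one with respect to
  the other is invariant, and cutting down to a set where it is bounded makes both masses
  finite.\<close>

locale word_metric = group G for G (structure) +
  fixes S :: "'a set"
  assumes finite_gens: "finite S" and gens_subset: "S \<subseteq> carrier G"
    and gens_generate: "generate G S = carrier G"
begin

abbreviation len :: "'a \<Rightarrow> nat" where "len \<equiv> word_length G S"

text \<open>Distances are kept as natural numbers so that they can index spheres and lengths of
  initial segments; as a real function this is \<open>word_dist\<close>.\<close>

definition dst :: "'a \<Rightarrow> 'a \<Rightarrow> nat" where "dst x y = len (inv x \<otimes> y)"

definition word_for :: "'a list \<Rightarrow> 'a \<Rightarrow> bool" where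
  "word_for ws g \<longleftrightarrow> set ws \<subseteq> S \<union> m_inv G ` S \<and> foldr (\<otimes>) ws \<one> = g"

lemma letters_carrier: "S \<union> m_inv G ` S \<subseteq> carrier G"
  using gens_subset by auto

lemma foldr_carrier: "set ws \<subseteq> carrier G \<Longrightarrow> foldr (\<otimes>) ws \<one> \<in> carrier G"
  by (induction ws) auto

lemma foldr_append:
  "set us \<subseteq> carrier G \<Longrightarrow> set vs \<subseteq> carrier G \<Longrightarrow>
    foldr (\<otimes>) (us @ vs) \<one> = foldr (\<otimes>) us \<one> \<otimes> foldr (\<otimes>) vs \<one>"
  by (induction us) (auto simp: m_assoc foldr_carrier simp del: foldr_append)

lemma word_for_append:
  "word_for us g \<Longrightarrow> word_for vs h \<Longrightarrow> word_for (us @ vs) (g \<otimes> h)"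
  using letters_carrier foldr_append[of us vs] unfolding word_for_def by auto

lemma word_for_Nil: "word_for [] \<one>"
  by (simp add: word_for_def)

lemma word_for_carrier: "word_for ws g \<Longrightarrow> g \<in> carrier G"
  using letters_carrier foldr_carrier unfolding word_for_def by blast

lemma word_for_letter: "s \<in> S \<union> m_inv G ` S \<Longrightarrow> word_for [s] s"
  using letters_carrier by (auto simp: word_for_def)

lemma word_for_inv: "word_for ws g \<Longrightarrow> word_for (rev (map (m_inv G) ws)) (inv g)"
proof (induction ws arbitrary: g)
  case Nil
  then have "g = \<one>" by (simp add: word_for_def)
  then show ?case by (simp add: word_for_def)
next
  case (Cons s ws)
  let ?h = "foldr (\<otimes>) ws \<one>"
  have s: "s \<in> S \<union> m_inv G ` S" and h: "word_for ws ?h" and g: "g = s \<otimes> ?h"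
    using Cons.prems by (auto simp: word_for_def)
  have "inv s \<in> S \<union> m_inv G ` S"
    using s gens_subset by (auto simp: subset_eq)
  then have "word_for (rev (map (m_inv G) ws) @ [inv s]) (inv ?h \<otimes> inv s)"
    by (intro word_for_append Cons.IH h word_for_letter)
  moreover have "inv g = inv ?h \<otimes> inv s"
    using s letters_carrier word_for_carrier[OF h] by (auto simp: g inv_mult_group)
  ultimately show ?case by simp
qed

lemma word_for_ex: "g \<in> carrier G \<Longrightarrow> \<exists>ws. word_for ws g"
proof -
  assume "g \<in> carrier G"
  then have "g \<in> generate G S" by (simp add: gens_generate)
  then show ?thesis
  proof induction
    case one
    show ?case using word_for_Nil by blast
  next
    case (incl h)
    then show ?case using word_for_letter by blast
  next
    case (inv h)
    then show ?case using word_for_letter by blast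
  next
    case (eng h1 h2)
    then show ?case using word_for_append by blast
  qed
qed

lemma len_eq: "len g = (LEAST k. \<exists>ws. length ws = k \<and> word_for ws g)"
  by (simp add: word_length_def word_for_def)

lemma len_le: "word_for ws g \<Longrightarrow> len g \<le> length ws"
  unfolding len_eq by (rule Least_le) blast

lemma len_word: "g \<in> carrier G \<Longrightarrow> \<exists>ws. length ws = len g \<and> word_for ws g"
  unfolding len_eq by (rule LeastI_ex) (use word_for_ex in blast)

lemma len_one [simp]: "len \<one> = 0"
  using len_le[OF word_for_Nil] by simp

lemma len_mult: "g \<in> carrier G \<Longrightarrow> h \<in> carrier G \<Longrightarrow> len (g \<otimes> h) \<le> len g + len h"
  by (metis len_word word_for_append len_le length_append)

lemma len_inv [simp]: "g \<in> carrier G \<Longrightarrow> len (inv g) = len g"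
  by (metis inv_closed inv_inv le_antisym len_le len_word length_map length_rev word_for_inv)

text \<open>Cutting a shortest word after \<open>k\<close> letters gives pieces of length at most
  \<open>k\<close> and \<open>len g - k\<close>; subadditivity of \<open>len\<close> leaves no room
  for either to be shorter. Discrete geodesics are obtained from this.\<close>

lemma len_split:
  assumes "g \<in> carrier G" "k \<le> len g"
  obtains u v where "u \<in> carrier G" "v \<in> carrier G" "g = u \<otimes> v" "len u = k" "len v = len g - k"
proof -
  obtain ws where ws: "length ws = len g" "word_for ws g" using len_word assms by blast
  let ?u = "foldr (\<otimes>) (take k ws) \<one>" and ?v = "foldr (\<otimes>) (drop k ws) \<one>"
  have u: "word_for (take k ws) ?u" and v: "word_for (drop k ws) ?v"
    using ws set_take_subset[of k ws] set_drop_subset[of k ws] by (auto simp: word_for_def)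
  have "word_for (take k ws @ drop k ws) (?u \<otimes> ?v)"
    using u v by (rule word_for_append)
  then have g: "g = ?u \<otimes> ?v" using ws by (simp add: word_for_def)
  have lu: "len ?u \<le> k" and lv: "len ?v \<le> len g - k"
    using len_le[OF u] len_le[OF v] ws(1) assms(2) by auto
  have "len g \<le> len ?u + len ?v"
    using len_mult[of ?u ?v] g u v word_for_carrier by metis
  then have "len ?u = k" "len ?v = len g - k" using lu lv assms(2) by auto
  then show ?thesis using that g u v word_for_carrier by blast
qed

definition ball :: "nat \<Rightarrow> 'a set" where "ball n = {g \<in> carrier G. len g \<le> n}"

lemma ball_carrier: "ball n \<subseteq> carrier G" by (auto simp: ball_def)

lemma ball_mono: "n \<le> k \<Longrightarrow> ball n \<subseteq> ball k" by (auto simp: ball_def)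

lemma finite_ball [simp]: "finite (ball n)"
proof (rule finite_subset)
  let ?A = "S \<union> m_inv G ` S"
  show "ball n \<subseteq> (\<lambda>ws. foldr (\<otimes>) ws \<one>) ` {ws. set ws \<subseteq> ?A \<and> length ws \<le> n}"
  proof
    fix g assume g: "g \<in> ball n"
    then obtain ws where "length ws = len g" "word_for ws g"
      using len_word by (auto simp: ball_def)
    then show "g \<in> (\<lambda>ws. foldr (\<otimes>) ws \<one>) ` {ws. set ws \<subseteq> ?A \<and> length ws \<le> n}"
      using g by (intro image_eqI[of _ _ ws]) (auto simp: word_for_def ball_def)
  qed
  show "finite ((\<lambda>ws. foldr (\<otimes>) ws \<one>) ` {ws. set ws \<subseteq> ?A \<and> length ws \<le> n})"
    using finite_gens by (intro finite_imageI finite_lists_length_le) auto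
qed

lemma one_ball: "\<one> \<in> ball n" by (simp add: ball_def)

lemma card_ball_pos: "card (ball n) > 0"
  using one_ball finite_ball card_gt_0_iff by blast

lemma finite_subset_ball:
  assumes "finite C" "C \<subseteq> carrier G" shows "\<exists>n. C \<subseteq> ball n"
proof -
  have "C \<subseteq> ball (Max (insert 0 (len ` C)))"
    using assms by (auto simp: ball_def intro!: Max_ge)
  then show ?thesis by blast
qed

lemma countable_carrier: "countable (carrier G)"
proof -
  have "carrier G = (\<Union>n. ball n)" by (auto simp: ball_def)
  then show ?thesis by (simp add: countable_finite)
qed

lemma dst_self [simp]: "x \<in> carrier G \<Longrightarrow> dst x x = 0"
  by (simp add: dst_def)

lemma dst_sym: "x \<in> carrier G \<Longrightarrow> y \<in> carrier G \<Longrightarrow> dst x y = dst y x"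
  unfolding dst_def by (subst len_inv[symmetric]) (auto simp: inv_mult_group)

lemma dst_tri:
  assumes "x \<in> carrier G" "y \<in> carrier G" "z \<in> carrier G"
  shows "dst x z \<le> dst x y + dst y z"
proof -
  have "inv x \<otimes> z = (inv x \<otimes> y) \<otimes> (inv y \<otimes> z)"
    using assms by (metis inv_closed inv_solve_left' m_assoc m_closed)
  then show ?thesis using len_mult[of "inv x \<otimes> y" "inv y \<otimes> z"] assms by (simp add: dst_def)
qed

lemma dst_left:
  assumes "g \<in> carrier G" "x \<in> carrier G" "y \<in> carrier G"
  shows "dst (g \<otimes> x) (g \<otimes> y) = dst x y"
proof -
  have "inv (g \<otimes> x) \<otimes> (g \<otimes> y) = inv x \<otimes> y"
    using assms by (simp add: inv_mult_group m_assoc[symmetric]) (simp add: m_assoc)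
  then show ?thesis by (simp add: dst_def)
qed

lemma dst_one [simp]: "x \<in> carrier G \<Longrightarrow> dst \<one> x = len x"
  by (simp add: dst_def)

lemma dst_one2 [simp]: "x \<in> carrier G \<Longrightarrow> dst x \<one> = len x"
  by (simp add: dst_def)

lemma dst_geodesic:
  assumes "x \<in> carrier G" "y \<in> carrier G" "k \<le> dst x y"
  obtains z where "z \<in> carrier G" "dst x z = k" "dst z y = dst x y - k"
proof -
  obtain u v where uv: "u \<in> carrier G" "v \<in> carrier G" "inv x \<otimes> y = u \<otimes> v" "len u = k"
      "len v = dst x y - k"
    using len_split[of "inv x \<otimes> y" k] assms unfolding dst_def by blast
  have y: "y = x \<otimes> u \<otimes> v"
    using assms uv by (metis inv_closed inv_solve_left' m_assoc m_closed)
  have 1: "inv x \<otimes> (x \<otimes> u) = u"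
    using assms uv by (simp add: m_assoc[symmetric])
  have 2: "inv (x \<otimes> u) \<otimes> y = v"
    using assms uv y by (simp add: inv_solve_left')
  show ?thesis
    by (rule that[of "x \<otimes> u"]) (use assms uv 1 2 in \<open>auto simp: dst_def\<close>)
qed

abbreviation gp :: "'a \<Rightarrow> 'a \<Rightarrow> 'a \<Rightarrow> real" where "gp \<equiv> gromov_product (\<lambda>x y. real (dst x y))"

lemma gp_eq: "gp w x y = (real (dst x w) + real (dst y w) - real (dst x y)) / 2"
  by (simp add: gromov_product_def)

lemma gp_left:
  assumes "g \<in> carrier G" "w \<in> carrier G" "x \<in> carrier G" "y \<in> carrier G"
  shows "gp (g \<otimes> w) (g \<otimes> x) (g \<otimes> y) = gp w x y"
  using assms by (simp add: gp_eq dst_left)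

lemma gp_commute:
  assumes "x \<in> carrier G" "y \<in> carrier G" shows "gp w x y = gp w y x"
  using dst_sym[OF assms] by (simp add: gp_eq)

lemma gp_nonneg:
  assumes "w \<in> carrier G" "x \<in> carrier G" "y \<in> carrier G" shows "gp w x y \<ge> 0"
  using dst_tri[of x w y] dst_sym[of w y] assms by (simp add: gp_eq)

lemma gp_le:
  assumes "w \<in> carrier G" "x \<in> carrier G" "y \<in> carrier G" shows "gp w x y \<le> dst x w"
  using dst_tri[of y x w] dst_sym[of x y] assms by (simp add: gp_eq)

text \<open>Used to change the base point: a point \<open>p\<close> with small
  \<open>gp p w x\<close>, hence close to a geodesic from \<open>w\<close> to \<open>x\<close>, has
  \<open>gp w p x\<close> close to \<open>dst w p\<close>.\<close>

lemma gp_sum: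
  assumes "w \<in> carrier G" "x \<in> carrier G" "y \<in> carrier G"
  shows "gp w x y + gp x w y = dst w x"
  using dst_sym[of w x] dst_sym[of w y] dst_sym[of x y] assms by (simp add: gp_eq field_simps)

end

locale hyperbolic_metric = word_metric G S for G (structure) and S +
  fixes \<delta> :: real
  assumes delta_nonneg: "\<delta> \<ge> 0"
    and four_point: "\<lbrakk>w \<in> carrier G; x \<in> carrier G; y \<in> carrier G; z \<in> carrier G\<rbrakk> \<Longrightarrow>
      gp w x z \<ge> min (gp w x y) (gp w y z) - \<delta>"

lemma hyperbolic_group_metric:
  assumes "hyperbolic_group G"
  obtains S \<delta> where "hyperbolic_metric G S \<delta>"
proof -
  obtain S where S: "Group.group G" "finite S" "S \<subseteq> carrier G" "generate G S = carrier G"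
      "gromov_hyperbolic (carrier G) (word_dist G S)"
    using assms unfolding hyperbolic_group_def by blast
  interpret word_metric G S
    using S by (intro word_metric.intro word_metric_axioms.intro)
  have "(\<lambda>x y. real (dst x y)) = word_dist G S"
    by (auto simp: fun_eq_iff word_dist_def dst_def)
  then obtain \<delta> where "\<delta> \<ge> 0" "\<forall>w\<in>carrier G. \<forall>x\<in>carrier G. \<forall>y\<in>carrier G. \<forall>z\<in>carrier G.
      gp w x z \<ge> min (gp w x y) (gp w y z) - \<delta>"
    using S(5) unfolding gromov_hyperbolic_def by metis
  then have "hyperbolic_metric G S \<delta>"
    by unfold_locales auto
  then show thesis using that by blast
qed

context hyperbolic_metric
begin

text \<open>A small \<open>gp p w x\<close> says that \<open>p\<close> lies near a geodesic from
  \<open>w\<close> to \<open>x\<close>. At the base point \<open>w\<close> both \<open>p\<close> and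
  \<open>q\<close> then have almost full product with \<open>x\<close>, and the four-point
  inequality through \<open>x\<close> compares them with each other.\<close>

lemma thin_close:
  assumes "w \<in> carrier G" "x \<in> carrier G" "p \<in> carrier G" "q \<in> carrier G"
    and "dst w p = dst w q" "gp p w x \<le> \<kappa>" "gp q w x \<le> \<kappa>"
  shows "dst p q \<le> 2 * \<kappa> + 2 * \<delta>"
proof -
  have "gp w p x \<ge> dst w p - \<kappa>" "gp w x q \<ge> dst w p - \<kappa>"
    using gp_sum[of w p x] gp_sum[of w q x] gp_commute[of x q w] assms by auto
  then have "gp w p q \<ge> dst w p - \<kappa> - \<delta>"
    using four_point[of w p x q] assms by linarith
  then show ?thesis
    using assms dst_sym[of w p] dst_sym[of w q] by (simp add: gp_eq field_simps)
qed

text \<open>The points are sorted by their distance from \<open>w\<close>; by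
  \<open>thin_close\<close> those at a given distance lie in one ball around any of them. This count
  bounds both the tubes below and the parents of a point in the non-amenability argument.\<close>

lemma thin_count:
  assumes "w \<in> carrier G" "x \<in> carrier G" "A \<subseteq> carrier G" "finite T"
    and "\<And>p. p \<in> A \<Longrightarrow> dst w p \<in> T \<and> gp p w x \<le> \<kappa>"
  shows "finite A" "card A \<le> card T * card (ball (nat \<lceil>2 * \<kappa> + 2 * \<delta>\<rceil>))"
proof -
  let ?n = "nat \<lceil>2 * \<kappa> + 2 * \<delta>\<rceil>"
  have fib: "finite {p \<in> A. dst w p = t} \<and> card {p \<in> A. dst w p = t} \<le> card (ball ?n)" for t
  proof (cases "{p \<in> A. dst w p = t} = {}")
    case False
    then obtain q where q: "q \<in> A" "dst w q = t" by blast
    have "inv q \<otimes> p \<in> ball ?n" if "p \<in> A" "dst w p = t" for p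
    proof -
      have "real (dst q p) \<le> 2 * \<kappa> + 2 * \<delta>"
        using thin_close[of w x q p \<kappa>] assms that q by (metis subsetD)
      then have "dst q p \<le> ?n" by linarith
      then show ?thesis using that q assms by (auto simp: ball_def dst_def)
    qed
    then have sub: "(\<lambda>p. inv q \<otimes> p) ` {p \<in> A. dst w p = t} \<subseteq> ball ?n" by blast
    have inj: "inj_on (\<lambda>p. inv q \<otimes> p) {p \<in> A. dst w p = t}"
      using assms(3) q by (auto simp: inj_on_def subset_eq)
    show ?thesis
      using card_inj_on_le[OF inj sub finite_ball] inj_on_finite[OF inj sub finite_ball] by simp
  next
    case True
    show ?thesis by (simp only: True) simp
  qed
  have A: "A = (\<Union>t\<in>T. {p \<in> A. dst w p = t})" using assms by blast
  show "finite A" using fib assms(4) by (subst A) auto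
  have "card A \<le> (\<Sum>t\<in>T. card {p \<in> A. dst w p = t})"
    using A card_UN_le[OF assms(4), of "\<lambda>t. {p \<in> A. dst w p = t}"] by simp
  also have "\<dots> \<le> (\<Sum>t\<in>T. card (ball ?n))" using fib by (intro sum_mono) auto
  finally show "card A \<le> card T * card (ball ?n)" by simp
qed

end

section \<open>A two-point kernel on hyperbolic groups\<close>

definition unif :: "'a set \<Rightarrow> 'a \<Rightarrow> real" where
  "unif A x = (if x \<in> A then 1 / card A else 0)"

lemma unif_nonneg: "unif A x \<ge> 0"
  by (simp add: unif_def)

lemma sum_unif:
  assumes "finite U" "A \<subseteq> U" "A \<noteq> {}"
  shows "(\<Sum>x\<in>U. unif A x) = 1"
proof -
  have "finite A" using assms finite_subset by blast
  moreover have "U \<inter> A = A" using assms by blast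
  ultimately show ?thesis using assms by (simp add: unif_def sum.If_cases)
qed

text \<open>Over a set containing \<open>B\<close> the L1 distance equals
  \<open>2 * (1 - card A / card B)\<close>, and 1 - t is at most - ln t. The logarithmic form is
  chosen because it telescopes along an increasing chain of sets.\<close>

lemma unif_diff_subset:
  assumes "finite U" "finite B" "A \<subseteq> B" "A \<noteq> {}"
  shows "(\<Sum>x\<in>U. \<bar>unif A x - unif B x\<bar>) \<le> 2 * (ln (card B) - ln (card A))"
proof -
  let ?V = "U \<union> B"
  have A: "finite A" "card A > 0" "card A \<le> card B" "card B > 0"
    using assms finite_subset[of A B] card_mono[of B A] by (auto simp: card_gt_0_iff)
  have V: "finite ?V" "A \<subseteq> ?V" "A \<noteq> {}" "B \<subseteq> ?V" "B \<noteq> {}" using assms by auto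
  have "(\<Sum>x\<in>U. \<bar>unif A x - unif B x\<bar>) \<le> (\<Sum>x\<in>?V. \<bar>unif A x - unif B x\<bar>)"
    using assms by (intro sum_mono2) auto
  \<comment> \<open>On \<open>A\<close> the uniform density of \<open>A\<close> is the larger one,
    elsewhere that of \<open>B\<close>. The difference of the two densities sums to zero, so only
    the correction on \<open>A\<close> remains.\<close>
  also have "\<dots> = (\<Sum>x\<in>?V. unif B x - unif A x + 2 * (if x \<in> A then 1 / card A - 1 / card B else 0))"
    using A assms by (intro sum.cong) (auto simp: unif_def field_simps)
  also have "\<dots> = 2 * (\<Sum>x\<in>?V. (if x \<in> A then 1 / card A - 1 / card B else 0))"
    using sum_unif[of ?V A] sum_unif[of ?V B] V
    by (simp add: sum.distrib sum_subtractf sum_distrib_left)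
  also have "\<dots> = 2 * (1 - card A / card B)"
  proof -
    have "?V \<inter> A = A" using assms by blast
    then show ?thesis using A assms by (simp add: sum.If_cases field_simps)
  qed
  also have "\<dots> \<le> 2 * (ln (card B) - ln (card A))"
  proof -
    have "ln (real (card A) / card B) \<le> real (card A) / card B - 1"
      using A by (intro ln_le_minus_one) auto
    moreover have "ln (real (card A) / card B) = ln (card A) - ln (card B)"
      using A by (intro ln_divide_pos) auto
    ultimately show ?thesis by simp
  qed
  finally show ?thesis .
qed

text \<open>This is bi-exactness (membership in Ozawa's class S) in the form of a two-point kernel:
  \<open>\<mu> w z\<close> hardly changes when both points move a bounded amount, once they are far apart.\<close>

definition bi_exact :: "('a, 'c) monoid_scheme \<Rightarrow> bool" where
  "bi_exact G \<longleftrightarrow> (\<forall>\<epsilon>>0. \<forall>C. finite C \<and> C \<subseteq> carrier G \<longrightarrow>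
     (\<exists>K \<mu>. finite K \<and> K \<subseteq> carrier G \<and>
       (\<forall>w\<in>carrier G. \<forall>z\<in>carrier G. (\<forall>u. \<mu> w z u \<ge> (0::real)) \<and>
          (\<exists>U. finite U \<and> U \<subseteq> carrier G \<and> (\<forall>u. u \<notin> U \<longrightarrow> \<mu> w z u = 0) \<and> (\<Sum>u\<in>U. \<mu> w z u) = 1)) \<and>
       (\<forall>g\<in>carrier G. \<forall>w\<in>carrier G. \<forall>z\<in>carrier G. \<forall>u\<in>carrier G.
          \<mu> (g \<otimes>\<^bsub>G\<^esub> w) (g \<otimes>\<^bsub>G\<^esub> z) (g \<otimes>\<^bsub>G\<^esub> u) = \<mu> w z u) \<and>
       (\<forall>w\<in>carrier G. \<forall>z\<in>carrier G. \<forall>h\<in>C. \<forall>k\<in>C. inv\<^bsub>G\<^esub> w \<otimes>\<^bsub>G\<^esub> z \<notin> K \<longrightarrow>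
          (\<forall>U. finite U \<longrightarrow> (\<Sum>u\<in>U. \<bar>\<mu> w z u - \<mu> (w \<otimes>\<^bsub>G\<^esub> h) (z \<otimes>\<^bsub>G\<^esub> k) u\<bar>) \<le> \<epsilon>))))"

section \<open>Tubes along geodesics: monotone in the slack, of linear size\<close>

context hyperbolic_metric
begin

text \<open>The points at distance about \<open>R\<close> from \<open>w\<close> on geodesics whose endpoints are \<open>k\<close>-close to
  \<open>w\<close> and \<open>z\<close>. Letting the endpoints vary makes these sets monotone in \<open>k\<close> under moving \<open>w\<close> and
  \<open>z\<close>, while hyperbolicity keeps their size linear in \<open>k\<close>.\<close>

definition tube :: "nat \<Rightarrow> nat \<Rightarrow> 'a \<Rightarrow> 'a \<Rightarrow> 'a set" where
  "tube R k w z = {p \<in> carrier G. dst w p \<le> R + k \<and> R \<le> dst w p + k \<and>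
     (\<exists>y\<in>carrier G. \<exists>v\<in>carrier G. dst w y \<le> k \<and> dst z v \<le> k \<and> dst y p + dst p v = dst y v)}"

lemma tube_carrier: "tube R k w z \<subseteq> carrier G"
  by (auto simp: tube_def)

lemma finite_tube: 
  assumes "w \<in> carrier G"
  shows "finite (tube R k w z)"
proof (rule inj_on_finite)
  show "inj_on (\<lambda>p. inv w \<otimes> p) (tube R k w z)"
    using assms by (auto simp: inj_on_def tube_def)
  show "(\<lambda>p. inv w \<otimes> p) ` tube R k w z \<subseteq> ball (R + k)"
    using assms by (auto simp: tube_def ball_def dst_def)
qed simp

lemma tube_left:
  assumes "g \<in> carrier G" "w \<in> carrier G" "z \<in> carrier G" "p \<in> tube R k w z"
  shows "g \<otimes> p \<in> tube R k (g \<otimes> w) (g \<otimes> z)"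
proof -
  from assms(4) obtain y v where *: "p \<in> carrier G" "dst w p \<le> R + k" "R \<le> dst w p + k"
     "y \<in> carrier G" "v \<in> carrier G" "dst w y \<le> k" "dst z v \<le> k" "dst y p + dst p v = dst y v"
    by (auto simp: tube_def)
  have "\<exists>y\<in>carrier G. \<exists>v\<in>carrier G. dst (g \<otimes> w) y \<le> k \<and> dst (g \<otimes> z) v \<le> k \<and>
      dst y (g \<otimes> p) + dst (g \<otimes> p) v = dst y v"
    by (rule bexI[of _ "g \<otimes> y"], rule bexI[of _ "g \<otimes> v"])
      (use * assms in \<open>simp_all add: dst_left\<close>)
  then show ?thesis using * assms by (simp add: tube_def dst_left)
qed

lemma tube_left_iff:
  assumes "g \<in> carrier G" "w \<in> carrier G" "z \<in> carrier G" "p \<in> carrier G"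
  shows "g \<otimes> p \<in> tube R k (g \<otimes> w) (g \<otimes> z) \<longleftrightarrow> p \<in> tube R k w z"
proof
  assume "g \<otimes> p \<in> tube R k (g \<otimes> w) (g \<otimes> z)"
  then have "inv g \<otimes> (g \<otimes> p) \<in> tube R k (inv g \<otimes> (g \<otimes> w)) (inv g \<otimes> (g \<otimes> z))"
    using assms by (intro tube_left[of "inv g" "g \<otimes> w" "g \<otimes> z" "g \<otimes> p"]) auto
  moreover have "inv g \<otimes> (g \<otimes> x) = x" if "x \<in> carrier G" for x
    using that assms by (simp add: m_assoc[symmetric])
  ultimately show "p \<in> tube R k w z" using assms by simp
qed (use tube_left assms in blast)

lemma tube_left_eq:
  assumes "g \<in> carrier G" "w \<in> carrier G" "z \<in> carrier G"
  shows "tube R k (g \<otimes> w) (g \<otimes> z) = (\<lambda>p. g \<otimes> p) ` tube R k w z"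
proof
  show "tube R k (g \<otimes> w) (g \<otimes> z) \<subseteq> (\<lambda>p. g \<otimes> p) ` tube R k w z"
  proof
    fix q assume q: "q \<in> tube R k (g \<otimes> w) (g \<otimes> z)"
    then have qc: "q \<in> carrier G" using tube_carrier by blast
    have "q = g \<otimes> (inv g \<otimes> q)" using qc assms by (simp add: m_assoc[symmetric])
    moreover have "inv g \<otimes> q \<in> tube R k w z"
      using tube_left_iff[of g w z "inv g \<otimes> q"] q qc assms calculation by simp
    ultimately show "q \<in> (\<lambda>p. g \<otimes> p) ` tube R k w z" by blast
  qed
qed (use tube_left assms in blast)

text \<open>The slack \<open>k\<close> enters the radius and both endpoints, so the triangle
  inequality absorbs a displacement of \<open>w\<close> and \<open>z\<close> by \<open>c\<close> in
  all three places at once.\<close>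

lemma tube_mono:
  assumes "w \<in> carrier G" "z \<in> carrier G" "w' \<in> carrier G" "z' \<in> carrier G"
    and "dst w w' \<le> c" "dst z z' \<le> c"
  shows "tube R k w z \<subseteq> tube R (k + c) w' z'"
proof
  fix p assume "p \<in> tube R k w z"
  then obtain y v where *: "p \<in> carrier G" "dst w p \<le> R + k" "R \<le> dst w p + k"
     "y \<in> carrier G" "v \<in> carrier G" "dst w y \<le> k" "dst z v \<le> k" "dst y p + dst p v = dst y v"
    by (auto simp: tube_def)
  have "dst w p \<le> dst w w' + dst w' p" "dst w' p \<le> dst w' w + dst w p"
    "dst w' y \<le> dst w' w + dst w y" "dst z' v \<le> dst z' z + dst z v"
    using dst_tri * assms by auto
  moreover have "dst w' w \<le> c" "dst z' z \<le> c" using assms dst_sym by auto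
  ultimately have "dst w' p \<le> R + (k + c)" "R \<le> dst w' p + (k + c)" "dst w' y \<le> k + c" "dst z' v \<le> k + c"
    using * assms by linarith+
  then show "p \<in> tube R (k + c) w' z'" using * by (auto simp: tube_def)
qed

lemma tube_nonempty:
  assumes "w \<in> carrier G" "z \<in> carrier G" "R \<le> dst w z"
  shows "tube R k w z \<noteq> {}"
proof -
  obtain p where "p \<in> carrier G" "dst w p = R" "dst p z = dst w z - R"
    using dst_geodesic assms by metis
  moreover have "\<exists>y\<in>carrier G. \<exists>v\<in>carrier G. dst w y \<le> k \<and> dst z v \<le> k \<and> dst y p + dst p v = dst y v"
    by (rule bexI[of _ w], rule bexI[of _ z]) (use calculation assms in simp_all)
  ultimately have "p \<in> tube R k w z" by (simp add: tube_def)
  then show ?thesis by blast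
qed

text \<open>\<open>p\<close> lies on a geodesic from \<open>y\<close> to \<open>v\<close>, so
  \<open>gp p y v = 0\<close>. As \<open>p\<close> is far from \<open>w\<close> and from
  \<open>z\<close>, the products at \<open>p\<close> of \<open>y\<close> with \<open>w\<close> and
  of \<open>z\<close> with \<open>v\<close> exceed 2 \<delta>, and two uses of the four-point
  inequality carry the zero over to \<open>w\<close> and \<open>z\<close>. The bound does not
  involve \<open>k\<close>; this is what keeps the tubes of linear size.\<close>

lemma tube_thin:
  assumes "w \<in> carrier G" "z \<in> carrier G" "p \<in> tube R k w z"
    and "real R > 2 * k + 2 * \<delta>" "real (dst w z) > R + 2 * k + 2 * \<delta>"
  shows "gp p w z \<le> 2 * \<delta>"
proof (rule ccontr)
  assume contra: "\<not> gp p w z \<le> 2 * \<delta>"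
  from assms(3) obtain y v where *: "p \<in> carrier G" "dst w p \<le> R + k" "R \<le> dst w p + k"
     "y \<in> carrier G" "v \<in> carrier G" "dst w y \<le> k" "dst z v \<le> k" "dst y p + dst p v = dst y v"
    by (auto simp: tube_def)
  have 0: "gp p y v = 0" using * dst_sym[of p v] by (simp add: gp_eq)
  have "gp p y w \<ge> dst w p - real k"
    using dst_tri[of w y p] dst_sym[of w y] * assms by (simp add: gp_eq field_simps)
  then have 1: "gp p y w > 2 * \<delta>" using * assms by linarith
  have "gp p z v \<ge> dst p z - real k"
    using dst_tri[of z v p] dst_sym[of p z] * assms by (simp add: gp_eq field_simps)
  moreover have "dst w z \<le> dst w p + dst p z" using dst_tri * assms by auto
  ultimately have 2: "gp p z v > 2 * \<delta>" using * assms by linarith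
  have "gp p y z \<ge> min (gp p y w) (gp p w z) - \<delta>" using four_point * assms by auto
  then have 3: "gp p y z > \<delta>" using 1 contra by linarith
  have "gp p y v \<ge> min (gp p y z) (gp p z v) - \<delta>" using four_point * assms by auto
  then show False using 0 2 3 delta_nonneg by linarith
qed

text \<open>There are at most \<open>2 * k + 1\<close> possible distances from \<open>w\<close>, and
  6 \<delta> is the radius that \<open>thin_count\<close> yields for the product bound 2 \<delta> of
  \<open>tube_thin\<close>.\<close>

lemma card_tube:
  assumes "w \<in> carrier G" "z \<in> carrier G"
    and "real R > 2 * k + 2 * \<delta>" "real (dst w z) > R + 2 * k + 2 * \<delta>"
  shows "card (tube R k w z) \<le> (2 * k + 1) * card (ball (nat \<lceil>6 * \<delta>\<rceil>))"
proof -
  have "card (tube R k w z) \<le> card {R - k..R + k} * card (ball (nat \<lceil>2 * (2 * \<delta>) + 2 * \<delta>\<rceil>))"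
    using tube_thin[OF assms(1,2) _ assms(3,4)] assms(1,2) tube_carrier
    by (intro thin_count(2)[of w z]) (auto simp: tube_def)
  also have "\<dots> \<le> (2 * k + 1) * card (ball (nat \<lceil>6 * \<delta>\<rceil>))"
    by (intro mult_mono) auto
  finally show ?thesis .
qed

text \<open>Averaging over \<open>N\<close> scales divides a telescoped logarithm by
  \<open>N\<close>. For tubes of linear size this logarithm is of order ln \<open>N\<close>;
  \<open>c\<close> is the step between scales and \<open>V\<close> the size of a fixed ball.\<close>

lemma ex_scale:
  assumes "\<epsilon> > 0" "V > (0::nat)"
  shows "\<exists>N>0. 8 * ln (real ((2 * (c * (N + 1)) + 1) * V)) / real N \<le> \<epsilon>"
proof -
  have "((\<lambda>N. 8 * ln (real ((2 * (c * (N + 1)) + 1) * V)) / real N) \<longlongrightarrow> 0) at_top"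
  proof (rule Lim_null_comparison)
    let ?a = "(2 * real c + 1) * real V"
    show "((\<lambda>N. 8 * (ln ?a + ln (real N + 1)) / real N) \<longlongrightarrow> 0) at_top"
      by real_asymp
    show "\<forall>\<^sub>F N in at_top. norm (8 * ln (real ((2 * (c * (N + 1)) + 1) * V)) / real N) \<le> 8 * (ln ?a + ln (real N + 1)) / real N"
    proof (intro eventuallyI)
      fix N :: nat
      have "ln (real ((2 * (c * (N + 1)) + 1) * V)) \<le> ln (?a * (real N + 1))"
      proof (subst ln_le_cancel_iff)
        have "(2 * (c * (N + 1)) + 1) * V > 0" using assms by simp
        then show "0 < real ((2 * (c * (N + 1)) + 1) * V)" by (simp only: of_nat_0_less_iff)
        have "real V * (2 * (real c * (real N + 1)) + 1) \<le> real V * ((2 * real c + 1) * (real N + 1))"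
          by (intro mult_left_mono) (auto simp: algebra_simps)
        then show "real ((2 * (c * (N + 1)) + 1) * V) \<le> ?a * (real N + 1)"
          by (simp add: algebra_simps)
      qed (use assms in \<open>auto intro!: mult_pos_pos add_nonneg_pos\<close>)
      also have "\<dots> = ln ?a + ln (real N + 1)"
        using assms by (subst ln_mult) (auto intro!: mult_pos_pos add_nonneg_pos)
      finally have "ln (real ((2 * (c * (N + 1)) + 1) * V)) \<le> ln ?a + ln (real N + 1)" .
      moreover have "ln (real ((2 * (c * (N + 1)) + 1) * V)) \<ge> 0"
        using assms by (intro ln_ge_zero) (metis One_nat_def add_is_0 less_one linorder_not_less mult_is_0 nat_neq_iff of_nat_1 of_nat_le_iff)
      ultimately show "norm (8 * ln (real ((2 * (c * (N + 1)) + 1) * V)) / real N) \<le> 8 * (ln ?a + ln (real N + 1)) / real N"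
        by (auto intro!: divide_right_mono)
    qed
  qed
  then have "\<forall>\<^sub>F N in at_top. 8 * ln (real ((2 * (c * (N + 1)) + 1) * V)) / real N < \<epsilon>"
    using assms(1) by (auto dest: order_tendstoD(2))
  then have "\<forall>\<^sub>F N in at_top. 8 * ln (real ((2 * (c * (N + 1)) + 1) * V)) / real N < \<epsilon> \<and> N > 0"
    using eventually_gt_at_top[of "0::nat"] by (rule eventually_conj)
  then show ?thesis by (auto simp: eventually_at_top_linorder intro: less_imp_le)
qed

text \<open>Both tubes of level \<open>Suc k\<close> are caught between the tubes of
  \<open>w\<close> and \<open>z\<close> of levels \<open>k\<close> and \<open>k + 2\<close>, since
  moving the endpoints by \<open>c\<close> costs one level. Comparing both with the larger one, and
  bounding both sizes from below by the smaller one, leaves a two-step increment of the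
  logarithm.\<close>

lemma unif_tubes_close:
  assumes "w \<in> carrier G" "z \<in> carrier G" "w' \<in> carrier G" "z' \<in> carrier G"
    and "dst w w' \<le> c" "dst z z' \<le> c" "finite U" "R \<le> dst w z"
  shows "(\<Sum>u\<in>U. \<bar>unif (tube R (c * Suc k) w z) u - unif (tube R (c * Suc k) w' z') u\<bar>)
    \<le> 4 * (ln (card (tube R (c * Suc (Suc k)) w z)) - ln (card (tube R (c * k) w z)))"
proof -
  let ?T = "\<lambda>k. tube R (c * k) w z" and ?T' = "tube R (c * Suc k) w' z'"
  have ne: "?T j \<noteq> {}" for j using tube_nonempty assms by blast
  have fin: "finite (?T j)" "finite ?T'" for j using finite_tube assms by auto
  have sub: "?T k \<subseteq> ?T (Suc k)" "?T (Suc k) \<subseteq> ?T (Suc (Suc k))"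
    using tube_mono[of w z w z c R "c * k"] tube_mono[of w z w z c R "c * Suc k"] assms
    by (simp_all add: add.commute)
  have sub': "?T k \<subseteq> ?T'" "?T' \<subseteq> ?T (Suc (Suc k))"
    using tube_mono[of w z w' z' c R "c * k"] tube_mono[of w' z' w z c R "c * Suc k"] assms
      dst_sym[of w w'] dst_sym[of z z'] by (auto simp: algebra_simps)
  have ne': "?T' \<noteq> {}" using sub' ne by blast
  have pos: "card (?T k) > 0" using fin ne by (simp add: card_gt_0_iff)
  have le: "ln (card (?T k)) \<le> ln (card (?T (Suc k)))" "ln (card (?T k)) \<le> ln (card ?T')"
    using pos card_mono[OF fin(1) sub(1)] card_mono[OF fin(2) sub'(1)] by auto
  have "(\<Sum>u\<in>U. \<bar>unif (?T (Suc k)) u - unif ?T' u\<bar>) \<le>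
    (\<Sum>u\<in>U. \<bar>unif (?T (Suc k)) u - unif (?T (Suc (Suc k))) u\<bar> + \<bar>unif ?T' u - unif (?T (Suc (Suc k))) u\<bar>)"
    by (intro sum_mono) linarith
  also have "\<dots> \<le> 2 * (ln (card (?T (Suc (Suc k)))) - ln (card (?T (Suc k)))) + 2 * (ln (card (?T (Suc (Suc k)))) - ln (card ?T'))"
    unfolding sum.distrib using assms fin(2) fin(1)[of "Suc (Suc k)"] ne ne' sub sub'
    by (intro add_mono unif_diff_subset) auto
  also have "\<dots> \<le> 4 * (ln (card (?T (Suc (Suc k)))) - ln (card (?T k)))"
    using le by (simp add: algebra_simps)
  finally show ?thesis .
qed

text \<open>The kernel is the average of the uniform measures on the tubes of levels 1 to
  \<open>N\<close>, with \<open>c\<close> as step. Moving the points changes each of them by a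
  two-step increment of the logarithm of the tube size; the sum telescopes, and the linear bound on
  the size makes the average small.\<close>

theorem bi_exact: "bi_exact G"
  unfolding bi_exact_def
proof (intro allI impI)
  fix \<epsilon> :: real and C assume eps: "\<epsilon> > 0" and C: "finite C \<and> C \<subseteq> carrier G"
  obtain c where c: "C \<subseteq> ball c" using C finite_subset_ball by blast
  let ?V = "card (ball (nat \<lceil>6 * \<delta>\<rceil>))"
  obtain N where N: "N > 0" "8 * ln (real ((2 * (c * (N + 1)) + 1) * ?V)) / real N \<le> \<epsilon>"
    using ex_scale[OF eps card_ball_pos] by blast
  \<comment> \<open>\<open>R\<close> exceeds twice the largest slack \<open>c * (N + 1)\<close> plus
    2 \<delta>, as \<open>tube_thin\<close> demands; at distances beyond \<open>D\<close>, twice as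
    large, its second demand holds as well.\<close>
  define R where "R = 2 * (c * (N + 1)) + nat \<lceil>2 * \<delta>\<rceil> + 1"
  define D where "D = R + R"
  \<comment> \<open>An empty tube is replaced by \<open>{w}\<close> so that \<open>\<mu> w z\<close>
    is an equivariant probability for all pairs of points. In the estimate the points are far apart
    and the tubes in use are nonempty.\<close>
  define T where "T k w z = (if tube R (c * k) w z = {} then {w} else tube R (c * k) w z)" for k w z
  define \<mu> where "\<mu> w z u = (\<Sum>k<N. unif (T (Suc k) w z) u) / N" for w z u
  have T: "finite (T k w z)" "T k w z \<noteq> {}" "T k w z \<subseteq> carrier G" if "w \<in> carrier G" for k w z
    using that finite_tube tube_carrier by (auto simp: T_def)
  have T_left: "T k (g \<otimes> w) (g \<otimes> z) = (\<lambda>p. g \<otimes> p) ` T k w z"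
    if "g \<in> carrier G" "w \<in> carrier G" "z \<in> carrier G" for k g w z
    using that by (auto simp: T_def tube_left_eq)
  show "\<exists>K \<mu>. finite K \<and> K \<subseteq> carrier G \<and>
       (\<forall>w\<in>carrier G. \<forall>z\<in>carrier G. (\<forall>u. \<mu> w z u \<ge> (0::real)) \<and>
          (\<exists>U. finite U \<and> U \<subseteq> carrier G \<and> (\<forall>u. u \<notin> U \<longrightarrow> \<mu> w z u = 0) \<and> (\<Sum>u\<in>U. \<mu> w z u) = 1)) \<and>
       (\<forall>g\<in>carrier G. \<forall>w\<in>carrier G. \<forall>z\<in>carrier G. \<forall>u\<in>carrier G.
          \<mu> (g \<otimes> w) (g \<otimes> z) (g \<otimes> u) = \<mu> w z u) \<and>
       (\<forall>w\<in>carrier G. \<forall>z\<in>carrier G. \<forall>h\<in>C. \<forall>k\<in>C. inv w \<otimes> z \<notin> K \<longrightarrow>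
          (\<forall>U. finite U \<longrightarrow> (\<Sum>u\<in>U. \<bar>\<mu> w z u - \<mu> (w \<otimes> h) (z \<otimes> k) u\<bar>) \<le> \<epsilon>))"
  proof (rule exI[of _ "ball D"], rule exI[of _ \<mu>], intro conjI ballI impI allI)
    fix w z u
    show "\<mu> w z u \<ge> 0"
      by (auto simp: \<mu>_def intro!: divide_nonneg_nonneg sum_nonneg unif_nonneg)
  next
    fix w z assume wz: "w \<in> carrier G" "z \<in> carrier G"
    show "\<exists>U. finite U \<and> U \<subseteq> carrier G \<and> (\<forall>u. u \<notin> U \<longrightarrow> \<mu> w z u = 0) \<and> (\<Sum>u\<in>U. \<mu> w z u) = 1"
    proof (intro exI[of _ "\<Union>k<N. T (Suc k) w z"] conjI allI impI)
      have "(\<Sum>u\<in>(\<Union>k<N. T (Suc k) w z). \<Sum>k<N. unif (T (Suc k) w z) u) =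
            (\<Sum>k<N. \<Sum>u\<in>(\<Union>k<N. T (Suc k) w z). unif (T (Suc k) w z) u)" by (rule sum.swap)
      also have "\<dots> = (\<Sum>k<N. 1)" using T wz by (intro sum.cong sum_unif) auto
      finally show "(\<Sum>u\<in>(\<Union>k<N. T (Suc k) w z). \<mu> w z u) = 1"
        using N by (simp add: \<mu>_def sum_divide_distrib[symmetric])
    qed (use T(1)[OF wz(1)] subsetD[OF T(3)[OF wz(1)]] in \<open>auto simp: \<mu>_def unif_def\<close>)
  next
    fix g w z u assume *: "g \<in> carrier G" "w \<in> carrier G" "z \<in> carrier G" "u \<in> carrier G"
    have "unif (T k (g \<otimes> w) (g \<otimes> z)) (g \<otimes> u) = unif (T k w z) u" for k
    proof -
      have inj: "inj_on (\<lambda>p. g \<otimes> p) (carrier G)" using * by (auto simp: inj_on_def)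
      have "g \<otimes> u \<in> (\<lambda>p. g \<otimes> p) ` T k w z \<longleftrightarrow> u \<in> T k w z"
        using inj_on_image_mem_iff[OF inj, of u "T k w z"] T * by auto
      moreover have "card ((\<lambda>p. g \<otimes> p) ` T k w z) = card (T k w z)"
        using inj_on_subset[OF inj T(3)] * by (intro card_image) auto
      ultimately show ?thesis using * by (simp add: unif_def T_left)
    qed
    then show "\<mu> (g \<otimes> w) (g \<otimes> z) (g \<otimes> u) = \<mu> w z u" by (simp add: \<mu>_def)
  next
    fix w z h k U
    assume *: "w \<in> carrier G" "z \<in> carrier G" "h \<in> C" "k \<in> C" and far: "inv w \<otimes> z \<notin> ball D"
      and U: "finite (U :: 'a set)"
    let ?w = "w \<otimes> h" and ?z = "z \<otimes> k"
    have hk: "h \<in> ball c" "k \<in> ball c" using * c by auto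
    then have hk': "h \<in> carrier G" "k \<in> carrier G" by (auto simp: ball_def)
    have d: "dst w ?w \<le> c" "dst z ?z \<le> c"
      using * hk hk' by (auto simp: dst_def ball_def m_assoc[symmetric])
    have wz: "dst w z > D" using far * by (auto simp: ball_def dst_def)
    have Rwz: "R \<le> dst w z" using wz by (simp add: D_def)
    have ne: "tube R (c * j) w z \<noteq> {}" for j using tube_nonempty * Rwz by auto
    have ne': "tube R (c * Suc j) ?w ?z \<noteq> {}" for j
      using tube_mono[of w z ?w ?z c R "c * j"] ne[of j] * hk' d by (auto simp: algebra_simps)
    let ?t = "\<lambda>j. ln (card (tube R (c * j) w z))"
    have t0: "?t j \<ge> 0" for j
      using ne[of j] finite_tube[of w] * by (intro ln_ge_zero) (simp add: card_gt_0_iff Suc_leI)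
    have "(\<Sum>u\<in>U. \<bar>\<mu> w z u - \<mu> ?w ?z u\<bar>) =
        (\<Sum>u\<in>U. \<bar>\<Sum>j<N. unif (T (Suc j) w z) u - unif (T (Suc j) ?w ?z) u\<bar>) / N"
    proof -
      have "\<mu> w z u - \<mu> ?w ?z u = (\<Sum>j<N. unif (T (Suc j) w z) u - unif (T (Suc j) ?w ?z) u) / N" for u
        by (simp add: \<mu>_def sum_subtractf diff_divide_distrib)
      then show ?thesis by (simp add: abs_divide sum_divide_distrib[symmetric])
    qed
    also have "\<dots> \<le> (\<Sum>u\<in>U. \<Sum>j<N. \<bar>unif (T (Suc j) w z) u - unif (T (Suc j) ?w ?z) u\<bar>) / N"
      by (intro divide_right_mono sum_mono sum_abs) auto
    also have "\<dots> = (\<Sum>j<N. \<Sum>u\<in>U. \<bar>unif (T (Suc j) w z) u - unif (T (Suc j) ?w ?z) u\<bar>) / N"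
      by (subst sum.swap) simp
    also have "\<dots> \<le> (\<Sum>j<N. 4 * (?t (Suc (Suc j)) - ?t j)) / N"
      using ne ne' unif_tubes_close[of w z ?w ?z c U R] * hk' d U Rwz
      by (intro divide_right_mono sum_mono) (auto simp: T_def simp del: mult_Suc_right)
    \<comment> \<open>Two-step increments telescope to the two top terms minus the two bottom
      ones.\<close>
    also have "(\<Sum>j<N. 4 * (?t (Suc (Suc j)) - ?t j)) = 4 * (?t (Suc N) + ?t N - ?t 1 - ?t 0)"
      by (induction N) (auto simp: algebra_simps)
    also have "\<dots> \<le> 4 * (?t (Suc N) + ?t (Suc N))"
    proof -
      have "?t N \<le> ?t (Suc N)"
      proof (subst ln_le_cancel_iff)
        show "real (card (tube R (c * N) w z)) \<le> real (card (tube R (c * Suc N) w z))"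
          using tube_mono[of w z w z c R "c * N"] * finite_tube
          by (intro of_nat_mono card_mono) (auto simp: algebra_simps)
      qed (use ne finite_tube[of w] * in \<open>auto simp: card_gt_0_iff simp del: mult_Suc_right\<close>)
      then show ?thesis using t0[of 1] t0[of 0] by simp
    qed
    also have "\<dots> / N \<le> 8 * ln (real ((2 * (c * (N + 1)) + 1) * ?V)) / real N"
    proof -
      have "card (tube R (c * Suc N) w z) \<le> (2 * (c * (N + 1)) + 1) * ?V"
      proof -
        have "real R > 2 * real (c * Suc N) + 2 * \<delta>" unfolding R_def by (simp add: algebra_simps) linarith
        moreover have "real (dst w z) > R + 2 * real (c * Suc N) + 2 * \<delta>"
          using wz calculation by (simp add: D_def) 
        ultimately show ?thesis using card_tube[of w z "c * Suc N" R] * by simp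
      qed
      then have le: "real (card (tube R (c * Suc N) w z)) \<le> real ((2 * (c * (N + 1)) + 1) * ?V)"
        by (simp only: of_nat_le_iff)
      have pos: "0 < real (card (tube R (c * Suc N) w z))"
        using ne[of "Suc N"] finite_tube[of w] * by (simp add: card_gt_0_iff del: mult_Suc_right)
      have "?t (Suc N) \<le> ln (real ((2 * (c * (N + 1)) + 1) * ?V))"
        using le pos by (meson ln_le_cancel_iff order_less_le_trans)
      then show ?thesis by (intro divide_right_mono) auto
    qed
    also have "\<dots> \<le> \<epsilon>" by (rule N)
    finally show "(\<Sum>u\<in>U. \<bar>\<mu> w z u - \<mu> ?w ?z u\<bar>) \<le> \<epsilon>" by (simp add: divide_right_mono)
  qed (use ball_carrier in auto)
qed

end

section \<open>Non-amenability\<close>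

text \<open>Failure of Reiter's condition, that is, non-amenability.\<close>

definition no_reiter :: "('a, 'c) monoid_scheme \<Rightarrow> bool" where
  "no_reiter G \<longleftrightarrow> (\<exists>F \<epsilon>. finite F \<and> F \<subseteq> carrier G \<and> \<epsilon> > (0::real) \<and>
     (\<forall>f. (\<forall>x. f x \<ge> (0::real)) \<and> (\<integral>\<^sup>+x. f x \<partial>count_space (carrier G)) = 1 \<longrightarrow>
        (\<exists>s\<in>F. (\<integral>\<^sup>+x. \<bar>f (s \<otimes>\<^bsub>G\<^esub> x) - f x\<bar> \<partial>count_space (carrier G)) \<ge> \<epsilon>)))"

lemma (in group) bij_translate: "s \<in> carrier G \<Longrightarrow> bij_betw (\<lambda>x. s \<otimes> x) (carrier G) (carrier G)"
proof (rule bij_betwI[where g = "\<lambda>x. inv s \<otimes> x"])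
qed (auto simp: m_assoc[symmetric])

text \<open>A mass transport: every \<open>x\<close> sends a copy of its mass to each
  \<open>inv s \<otimes> x\<close> with \<open>s\<close> in \<open>desc x\<close>, at least
  \<open>n\<close> copies, while every \<open>v\<close> is reached from at most \<open>c\<close>
  points. If \<open>f\<close> hardly changes under inverses of elements of \<open>B\<close>, the
  mass sent is at least \<open>n\<close> and at most \<open>c\<close> plus a small error.\<close>

lemma (in group) no_reiterI:
  assumes B: "finite B" "B \<subseteq> carrier G"
    and desc: "\<And>x. x \<in> carrier G \<Longrightarrow> desc x \<subseteq> B \<and> n \<le> card (desc x)"
    and parents: "\<And>v. v \<in> carrier G \<Longrightarrow> card {s \<in> B. s \<in> desc (s \<otimes> v)} \<le> c"
    and less: "c < n"
  shows "no_reiter G"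
  unfolding no_reiter_def
\<comment> \<open>The tolerance \<open>1 / (1 + card B)\<close> makes the errors over
  \<open>B\<close> add up to less than 1, which is at most the gap \<open>n - c\<close>.\<close>
proof (intro exI[of _ "m_inv G ` B"] exI[of _ "1 / (1 + card B)"] conjI allI impI)
  fix f :: "'a \<Rightarrow> real"
  let ?C = "count_space (carrier G)"
  assume f: "(\<forall>x. f x \<ge> 0) \<and> (\<integral>\<^sup>+x. f x \<partial>?C) = 1"
  let ?e = "ennreal (1 / (1 + card B))"
  show "\<exists>s\<in>m_inv G ` B. (\<integral>\<^sup>+x. \<bar>f (s \<otimes> x) - f x\<bar> \<partial>?C) \<ge> ?e"
  proof (rule ccontr)
    assume "\<not> ?thesis"
    then have small: "(\<integral>\<^sup>+x. \<bar>f (inv s \<otimes> x) - f x\<bar> \<partial>?C) \<le> ?e" if "s \<in> B" for s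
      using that by (auto simp: not_le intro: less_imp_le)
    have meas: "g \<in> borel_measurable ?C" for g :: "'a \<Rightarrow> ennreal" by simp
    have "ennreal n = (\<integral>\<^sup>+x. ennreal n * f x \<partial>?C)"
      using f by (subst nn_integral_cmult) auto
    also have "\<dots> \<le> (\<integral>\<^sup>+x. (\<Sum>s\<in>B. if s \<in> desc x then ennreal (f x) else 0) \<partial>?C)"
    proof (rule nn_integral_mono)
      fix x assume "x \<in> space ?C"
      then have x: "desc x \<subseteq> B" "n \<le> card (desc x)" using desc by auto
      then have "B \<inter> desc x = desc x" by blast
      then have "(\<Sum>s\<in>B. if s \<in> desc x then ennreal (f x) else 0) = of_nat (card (desc x)) * ennreal (f x)"
        using B by (simp add: sum.If_cases)
      moreover have "ennreal n \<le> of_nat (card (desc x))"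
        using x by (simp add: ennreal_of_nat_eq_real_of_nat ennreal_leI)
      ultimately show "ennreal n * f x \<le> (\<Sum>s\<in>B. if s \<in> desc x then ennreal (f x) else 0)"
        by (simp add: mult_right_mono)
    qed
    also have "\<dots> = (\<Sum>s\<in>B. \<integral>\<^sup>+x. (if s \<in> desc x then ennreal (f x) else 0) \<partial>?C)"
      by (rule nn_integral_sum) simp
    also have "\<dots> \<le> (\<Sum>s\<in>B. (\<integral>\<^sup>+v. (if s \<in> desc (s \<otimes> v) then ennreal (f v) else 0) \<partial>?C) + ?e)"
    proof (rule sum_mono)
      fix s assume s: "s \<in> B"
      then have sc: "s \<in> carrier G" using B by auto
      have "(\<integral>\<^sup>+x. (if s \<in> desc x then ennreal (f x) else 0) \<partial>?C) \<le>
        (\<integral>\<^sup>+x. (if s \<in> desc x then ennreal (f (inv s \<otimes> x)) else 0) + ennreal \<bar>f (inv s \<otimes> x) - f x\<bar> \<partial>?C)"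
        using f by (intro nn_integral_mono) (auto simp: ennreal_plus[symmetric] simp del: ennreal_plus intro!: ennreal_leI)
      also have "\<dots> = (\<integral>\<^sup>+x. (if s \<in> desc x then ennreal (f (inv s \<otimes> x)) else 0) \<partial>?C) +
         (\<integral>\<^sup>+x. \<bar>f (inv s \<otimes> x) - f x\<bar> \<partial>?C)" by (rule nn_integral_add) auto
      also have "(\<integral>\<^sup>+x. (if s \<in> desc x then ennreal (f (inv s \<otimes> x)) else 0) \<partial>?C) =
        (\<integral>\<^sup>+v. (if s \<in> desc (s \<otimes> v) then ennreal (f (inv s \<otimes> (s \<otimes> v))) else 0) \<partial>?C)"
        by (rule nn_integral_bij_count_space[OF bij_translate[OF sc], symmetric])
      also have "\<dots> = (\<integral>\<^sup>+v. (if s \<in> desc (s \<otimes> v) then ennreal (f v) else 0) \<partial>?C)"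
        using sc by (intro nn_integral_cong) (auto simp: m_assoc[symmetric])
      finally show "(\<integral>\<^sup>+x. (if s \<in> desc x then ennreal (f x) else 0) \<partial>?C) \<le>
        (\<integral>\<^sup>+v. (if s \<in> desc (s \<otimes> v) then ennreal (f v) else 0) \<partial>?C) + ?e"
        using small[OF s] by (meson add_left_mono order_trans)
    qed
    also have "\<dots> = (\<integral>\<^sup>+v. (\<Sum>s\<in>B. if s \<in> desc (s \<otimes> v) then ennreal (f v) else 0) \<partial>?C) + of_nat (card B) * ?e"
      by (simp add: sum.distrib nn_integral_sum)
    also have "\<dots> \<le> (\<integral>\<^sup>+v. ennreal c * f v \<partial>?C) + of_nat (card B) * ?e"
    proof (intro add_right_mono nn_integral_mono)
      fix v assume "v \<in> space ?C"
      then have v: "card {s \<in> B. s \<in> desc (s \<otimes> v)} \<le> c" using parents by simp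
      have "(\<Sum>s\<in>B. if s \<in> desc (s \<otimes> v) then ennreal (f v) else 0) =
        of_nat (card {s \<in> B. s \<in> desc (s \<otimes> v)}) * ennreal (f v)"
        using B by (simp add: sum.If_cases Int_def)
      also have "\<dots> \<le> ennreal c * f v"
        using v by (intro mult_right_mono) (auto simp: ennreal_of_nat_eq_real_of_nat ennreal_leI)
      finally show "(\<Sum>s\<in>B. if s \<in> desc (s \<otimes> v) then ennreal (f v) else 0) \<le> ennreal c * f v" .
    qed
    also have "(\<integral>\<^sup>+v. ennreal c * f v \<partial>?C) = ennreal c"
      using f by (subst nn_integral_cmult) auto
    also have "of_nat (card B) * ?e = ennreal (card B / (1 + card B))"
      by (simp add: ennreal_of_nat_eq_real_of_nat ennreal_mult[symmetric])
    also have "ennreal c + ennreal (card B / (1 + card B)) = ennreal (c + card B / (1 + card B))"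
      by (simp add: ennreal_plus)
    finally have "real n \<le> c + card B / (1 + card B)"
      by (subst (asm) ennreal_le_iff) auto
    moreover have "card B / (1 + card B) < (1::real)" by simp
    moreover have "real c + 1 \<le> n" using less by simp
    ultimately show False by linarith
  qed
qed (use B in auto)

lemma ex_pow_gt_linear: "\<exists>k. (k * M + 1) * V < (2::nat) ^ k"
proof -
  have "((\<lambda>k. (real k * real M + 1) * real V / 2 ^ k) \<longlongrightarrow> 0) at_top"
    by real_asymp
  then have "\<forall>\<^sub>F k in at_top. (real k * real M + 1) * real V / 2 ^ k < 1"
    by (rule order_tendstoD) simp
  then obtain k where "(real k * real M + 1) * real V / 2 ^ k < 1"
    by (auto simp: eventually_at_top_linorder)
  then have "real ((k * M + 1) * V) < real (2 ^ k)" by (simp add: field_simps)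
  then show ?thesis by (intro exI[of _ k]) (simp only: of_nat_less_iff)
qed

section \<open>Exponential branching from three diverging directions\<close>

context hyperbolic_metric
begin

text \<open>Elements whose geodesics from the identity leave the direction of \<open>u\<close>
  within a distance of about \<open>K\<close>.\<close>

definition away :: "real \<Rightarrow> 'a \<Rightarrow> nat \<Rightarrow> 'a set" where
  "away K u L = {s \<in> ball L. gp \<one> u s \<le> K}"

lemma away_finite [simp]: "finite (away K u L)"
  by (simp add: away_def)

text \<open>If \<open>t\<close> points away from \<open>inv p\<close>, then
  \<open>p \<otimes> t\<close> continues past \<open>p\<close>: its product with \<open>p\<close> at
  the identity exceeds \<open>K\<close>, because \<open>len p\<close> exceeds \<open>2 * K\<close>.
  Hence it points away from \<open>u\<close> as \<open>p\<close> does, and the elements found behind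
  \<open>p\<close> and behind \<open>q\<close> are disjoint because \<open>p\<close> and
  \<open>q\<close> diverge early.\<close>

lemma away_branch:
  assumes "u \<in> carrier G" "p \<in> carrier G" "q \<in> carrier G" "K \<ge> 0"
    and "real (len p) > 2 * K" "real (len q) > 2 * K" "len p \<le> M" "len q \<le> M"
    and "gp \<one> u p \<le> K - \<delta>" "gp \<one> u q \<le> K - \<delta>" "gp \<one> p q < K - 2 * \<delta>"
  shows "card (away K (inv p) L) + card (away K (inv q) L) \<le> card (away K u (L + M))"
proof -
  have key: "p \<otimes> t \<in> away K u (L + M)" "gp \<one> p (p \<otimes> t) > K"
    if p: "p \<in> carrier G" "real (len p) > 2 * K" "len p \<le> M" "gp \<one> u p \<le> K - \<delta>"
      and t: "t \<in> away K (inv p) L" for p t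
  proof -
    have tc: "t \<in> carrier G" "len t \<le> L" "gp \<one> (inv p) t \<le> K"
      using t by (auto simp: away_def ball_def)
    have "gp (p \<otimes> \<one>) (p \<otimes> inv p) (p \<otimes> t) = gp \<one> (inv p) t"
      using p tc by (intro gp_left) auto
    then have "gp p \<one> (p \<otimes> t) \<le> K" using p tc by simp
    then show *: "gp \<one> p (p \<otimes> t) > K"
      using gp_sum[of \<one> p "p \<otimes> t"] p tc by simp
    have "gp \<one> u p \<ge> min (gp \<one> u (p \<otimes> t)) (gp \<one> (p \<otimes> t) p) - \<delta>"
      using p tc assms by (intro four_point) auto
    moreover have "gp \<one> (p \<otimes> t) p = gp \<one> p (p \<otimes> t)" using p tc by (intro gp_commute) auto
    ultimately have "gp \<one> u (p \<otimes> t) \<le> K" using * p by linarith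
    then show "p \<otimes> t \<in> away K u (L + M)"
      using p tc len_mult[of p t] by (auto simp: away_def ball_def)
  qed
  let ?P = "(\<lambda>t. p \<otimes> t) ` away K (inv p) L" and ?Q = "(\<lambda>t. q \<otimes> t) ` away K (inv q) L"
  have sub: "?P \<union> ?Q \<subseteq> away K u (L + M)"
    using key(1)[of p] key(1)[of q] assms by auto
  have "?P \<inter> ?Q = {}"
  proof (rule ccontr)
    assume "?P \<inter> ?Q \<noteq> {}"
    then obtain t r where tr: "t \<in> away K (inv p) L" "r \<in> away K (inv q) L" "p \<otimes> t = q \<otimes> r" by blast
    then have c: "t \<in> carrier G" "r \<in> carrier G" by (auto simp: away_def ball_def)
    have "gp \<one> p q \<ge> min (gp \<one> p (p \<otimes> t)) (gp \<one> (p \<otimes> t) q) - \<delta>"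
      using assms c by (intro four_point) auto
    moreover have "gp \<one> p (p \<otimes> t) > K" using key(2)[of p t] tr assms by auto
    moreover have "gp \<one> (p \<otimes> t) q > K"
      using key(2)[of q r] tr assms c gp_commute[of "q \<otimes> r" q \<one>] by auto
    ultimately show False using assms delta_nonneg by linarith
  qed
  moreover have "card ?P = card (away K (inv p) L)" "card ?Q = card (away K (inv q) L)"
    using assms by (auto intro!: card_image simp: inj_on_def away_def ball_def)
  ultimately have "card (?P \<union> ?Q) = card (away K (inv p) L) + card (away K (inv q) L)"
    by (simp add: card_Un_disjoint)
  then show ?thesis using card_mono[OF _ sub] by simp
qed

text \<open>Three long directions that separate early, the data for a ping-pong argument. Given any
  \<open>u\<close>, one direction that runs along \<open>u\<close> can be discarded and two remain
  for branching.\<close>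

definition tripod :: "real \<Rightarrow> 'a \<Rightarrow> 'a \<Rightarrow> 'a \<Rightarrow> bool" where
  "tripod K a b c \<longleftrightarrow> a \<in> carrier G \<and> b \<in> carrier G \<and> c \<in> carrier G \<and>
     real (len a) > 2 * K \<and> real (len b) > 2 * K \<and> real (len c) > 2 * K \<and>
     gp \<one> a b < K - 2 * \<delta> \<and> gp \<one> b c < K - 2 * \<delta> \<and> gp \<one> a c < K - 2 * \<delta>"

text \<open>By the four-point inequality any \<open>u\<close> runs along at most one of the three
  directions, so two of them are available for \<open>away_branch\<close>, with \<open>inv p\<close>
  and \<open>inv q\<close> as the new directions to be avoided. The count doubles each time the
  radius grows by the sum of the three lengths.\<close>

lemma away_growth:
  assumes "tripod K a b c" "K \<ge> 0" "u \<in> carrier G"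
  shows "2 ^ k \<le> card (away K u (k * (len a + len b + len c)))"
  using assms(3)
proof (induction k arbitrary: u)
  case 0
  have "\<one> \<in> away K u 0" using assms(2) 0 by (simp add: away_def one_ball gp_eq)
  then show ?case by (auto simp: Suc_le_eq card_gt_0_iff)
next
  case (Suc k)
  let ?M = "len a + len b + len c"
  have T: "a \<in> carrier G" "b \<in> carrier G" "c \<in> carrier G" "real (len a) > 2 * K" "real (len b) > 2 * K" "real (len c) > 2 * K"
      "gp \<one> a b < K - 2 * \<delta>" "gp \<one> b c < K - 2 * \<delta>" "gp \<one> a c < K - 2 * \<delta>"
    using assms(1) by (auto simp: tripod_def)
  have far: "gp \<one> u p \<le> K - \<delta> \<or> gp \<one> u q \<le> K - \<delta>"
    if "p \<in> carrier G" "q \<in> carrier G" "gp \<one> p q < K - 2 * \<delta>" for p q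
  proof -
    have "gp \<one> p q \<ge> min (gp \<one> p u) (gp \<one> u q) - \<delta>" using that Suc.prems by (intro four_point) auto
    moreover have "gp \<one> p u = gp \<one> u p" using that Suc.prems by (intro gp_commute) auto
    ultimately show ?thesis using that by linarith
  qed
  have "\<exists>p\<in>{a, b, c}. \<exists>q\<in>{a, b, c}. gp \<one> u p \<le> K - \<delta> \<and> gp \<one> u q \<le> K - \<delta> \<and> gp \<one> p q < K - 2 * \<delta>"
    using far[of a b] far[of b c] far[of a c] T by auto
  then obtain p q where pq: "p \<in> {a, b, c}" "q \<in> {a, b, c}"
    "gp \<one> u p \<le> K - \<delta>" "gp \<one> u q \<le> K - \<delta>" "gp \<one> p q < K - 2 * \<delta>" by blast
  have c: "p \<in> carrier G" "q \<in> carrier G" "real (len p) > 2 * K" "real (len q) > 2 * K" "len p \<le> ?M" "len q \<le> ?M"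
    using pq T by auto
  have "2 ^ Suc k \<le> card (away K (inv p) (k * ?M)) + card (away K (inv q) (k * ?M))"
    using Suc.IH[of "inv p"] Suc.IH[of "inv q"] c by simp
  also have "\<dots> \<le> card (away K u (k * ?M + ?M))"
    using Suc.prems c pq assms by (intro away_branch) auto
  finally show ?case by (simp add: algebra_simps)
qed

text \<open>In the transport, \<open>x\<close> uses the exponentially many \<open>s\<close> of the
  ball that point away from \<open>x\<close>. If \<open>s\<close> points away from
  \<open>s \<otimes> v\<close>, translation by \<open>inv s\<close> shows that \<open>inv s\<close>
  lies near a geodesic from the identity to \<open>v\<close>, so \<open>v\<close> is reached from
  only linearly many points.\<close>

lemma tripod_no_reiter:
  assumes "tripod K a b c" "K \<ge> 0"
  shows "no_reiter G"
proof -
  let ?M = "len a + len b + len c"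
  let ?V = "card (ball (nat \<lceil>2 * K + 2 * \<delta>\<rceil>))"
  obtain k where k: "(k * ?M + 1) * ?V < 2 ^ k" using ex_pow_gt_linear by blast
  let ?L = "k * ?M"
  show ?thesis
  proof (rule no_reiterI[of "ball ?L" "\<lambda>x. away K x ?L" "2 ^ k" "(?L + 1) * ?V"])
    show "card {s \<in> ball ?L. s \<in> away K (s \<otimes> v) ?L} \<le> (?L + 1) * ?V" if v: "v \<in> carrier G" for v
    proof -
      let ?A = "{s \<in> ball ?L. s \<in> away K (s \<otimes> v) ?L}"
      have sub: "?A \<subseteq> carrier G" by (auto simp: ball_def)
      have thin: "dst \<one> (inv s) \<in> {0..?L} \<and> gp (inv s) \<one> v \<le> K" if "s \<in> ?A" for s
      proof -
        have s: "s \<in> carrier G" "len s \<le> ?L" "gp \<one> (s \<otimes> v) s \<le> K"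
          using that by (auto simp: away_def ball_def)
        have "gp (inv s \<otimes> \<one>) (inv s \<otimes> (s \<otimes> v)) (inv s \<otimes> s) = gp \<one> (s \<otimes> v) s"
          using s v by (intro gp_left) auto
        moreover have "inv s \<otimes> (s \<otimes> v) = v" using s v by (simp add: m_assoc[symmetric])
        ultimately have "gp (inv s) v \<one> \<le> K" using s v by simp
        then show ?thesis using s v gp_commute[of v \<one> "inv s"] by auto
      qed
      have "card (m_inv G ` ?A) \<le> card {0..?L} * ?V"
        using sub thin v by (intro thin_count(2)[of \<one> v]) auto
      moreover have "card (m_inv G ` ?A) = card ?A"
        using sub by (intro card_image inj_onI) (metis (no_types, lifting) inv_inv subsetD)
      ultimately show ?thesis by simp
    qed
  qed (use k away_growth[OF assms] ball_carrier in \<open>auto simp: away_def\<close>)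
qed

end

section \<open>Torsion-free groups of linear growth\<close>

lemma (in group) virtually_cyclic_of_finite:
  assumes "finite (carrier G)" shows "virtually_cyclic G"
proof -
  have "cyclic_group (G\<lparr>carrier := {\<one>}\<rparr>)"
    unfolding cyclic_group_def
  proof (intro bexI[of _ "\<one>"])
    have "generate (G\<lparr>carrier := {\<one>}\<rparr>) {\<one>} = {\<one>}"
    proof -
      have "x = \<one>" if "x \<in> generate (G\<lparr>carrier := {\<one>}\<rparr>) {\<one>}" for x
        using that
      proof induction
        case (inv h)
        have "inv\<^bsub>G\<lparr>carrier := {\<one>}\<rparr>\<^esub> \<one> = \<one>"
          by (simp add: m_inv_def) (auto intro!: the_equality)
        then show ?case using inv by simp
      qed auto
      then show ?thesis using generate.one[of "G\<lparr>carrier := {\<one>}\<rparr>" "{\<one>}"] by auto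
    qed
    then show "subgroup_generated (G\<lparr>carrier := {\<one>}\<rparr>) {\<one>} = G\<lparr>carrier := {\<one>}\<rparr>"
      by (simp add: subgroup_generated_def)
  qed simp
  moreover have "subgroup {\<one>} G" by (rule triv_subgroup)
  moreover have "finite (rcosets {\<one>})" using assms by (simp add: RCOSETS_def)
  ultimately show ?thesis unfolding virtually_cyclic_def by blast
qed

context word_metric
begin

text \<open>If the balls of radius \<open>r\<close> and \<open>r + 1\<close> met the same cosets,
  appending one letter at a time would show that the ball of radius \<open>r\<close> meets all of
  them. So the number of cosets met increases strictly with the radius.\<close>

lemma cosets_grow:
  assumes H: "subgroup H G" and inf: "infinite (rcosets H)"
  shows "r < card ((\<lambda>y. H #> y) ` ball r)"
proof (induction r)
  case 0
  have "H #> \<one> \<in> (\<lambda>y. H #> y) ` ball 0" using one_ball by blast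
  then show ?case by (auto simp: card_gt_0_iff)
next
  case (Suc r)
  let ?C = "\<lambda>n. (\<lambda>y. H #> y) ` ball n"
  have HG: "H \<subseteq> carrier G" using H by (rule subgroup.subset)
  have "?C r \<noteq> ?C (Suc r)"
  proof
    assume eq: "?C r = ?C (Suc r)"
    have up: "?C n \<subseteq> ?C r" if "n \<ge> r" for n
      using that
    proof (induction n rule: dec_induct)
      case (step n)
      show ?case
      proof (clarify)
        fix y assume y: "y \<in> ball (Suc n)"
        show "H #> y \<in> ?C r"
        proof (cases "len y \<le> n")
          case True
          then show ?thesis using y step.IH by (auto simp: ball_def)
        next
          case False
          then have yl: "y \<in> carrier G" "len y = Suc n" using y by (auto simp: ball_def)
          have "n \<le> len y" using yl by simp
          then obtain u s where us: "u \<in> carrier G" "s \<in> carrier G" "y = u \<otimes> s" "len u = n" "len s = len y - n"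
            using len_split[OF yl(1)] by blast
          have ls: "len s = 1" using us(5) yl(2) by linarith
          have "H #> u \<in> ?C r" using step.IH us by (auto simp: ball_def)
          then obtain v where v: "v \<in> ball r" "H #> u = H #> v" by auto
          then have vc: "v \<in> carrier G" "len v \<le> r" by (auto simp: ball_def)
          have "H #> y = (H #> u) #> s" using us HG by (simp add: coset_mult_assoc)
          also have "\<dots> = H #> (v \<otimes> s)" using v vc us HG by (simp add: coset_mult_assoc)
          also have "\<dots> \<in> ?C (Suc r)"
            using len_mult[of v s] vc us ls by (intro imageI) (auto simp: ball_def)
          finally show ?thesis using eq by simp
        qed
      qed
    qed simp
    have "rcosets H \<subseteq> ?C r"
    proof
      fix c assume "c \<in> rcosets H"
      then obtain y where y: "y \<in> carrier G" "c = H #> y" by (auto simp: RCOSETS_def)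
      have "c \<in> ?C (max r (len y))" using y by (intro image_eqI[of _ _ y]) (auto simp: ball_def)
      then show "c \<in> ?C r" using up[of "max r (len y)"] by auto
    qed
    then show False using inf finite_subset[of "rcosets H" "?C r"] by simp
  qed
  moreover have "?C r \<subseteq> ?C (Suc r)" using ball_mono[of r "Suc r"] by auto
  ultimately have "card (?C r) < card (?C (Suc r))" by (intro psubset_card_mono) auto
  then show ?case using Suc by simp
qed

lemma pow_len: "g \<in> carrier G \<Longrightarrow> len (g [^] (k::nat)) \<le> k * len g"
proof (induction k)
  case (Suc k)
  then show ?case using len_mult[of "g [^] k" g] by (simp add: nat_pow_Suc)
qed simp

text \<open>A nontrivial \<open>g\<close> has infinite order. If its powers had infinite index, the
  products of the powers up to \<open>r\<close> with representatives of the more than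
  \<open>r\<close> cosets met by the ball of radius \<open>r\<close> would be distinct elements of a
  ball of radius linear in \<open>r\<close>, which makes the growth at least quadratic.\<close>

lemma virtually_cyclic_of_linear_growth:
  assumes tf: "torsion_free G" and lin: "\<And>n. card (ball n) \<le> P + Q * n"
  shows "virtually_cyclic G"
proof (cases "carrier G = {\<one>}")
  case True
  then show ?thesis by (intro virtually_cyclic_of_finite) simp
next
  case False
  then obtain g where g: "g \<in> carrier G" "g \<noteq> \<one>" by auto
  let ?H = "generate G {g}"
  have sub: "subgroup ?H G" using g by (intro generate_is_subgroup) auto
  have pow_inj: "k = l" if "g [^] (k::nat) = g [^] l" for k l
  proof -
    have *: "k = l" if "g [^] k = g [^] l" "k \<le> l" for k l :: nat
    proof (rule ccontr)
      assume "k \<noteq> l"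
      then have "l - k > 0" using that by simp
      have "g [^] k \<otimes> g [^] (l - k) = g [^] (k + (l - k))" by (rule nat_pow_mult[OF g(1)])
      then have "g [^] l = g [^] k \<otimes> g [^] (l - k)" using that(2) by simp
      then have "g [^] k \<otimes> g [^] (l - k) = g [^] k \<otimes> \<one>" using that(1) g by simp
      then have "g [^] (l - k) = \<one>" using g nat_pow_closed one_closed by simp
      then show False using tf g \<open>l - k > 0\<close> unfolding torsion_free_def by blast
    qed
    then show ?thesis using that by (metis nat_le_linear)
  qed
  have powH: "g [^] (k::nat) \<in> ?H" for k
  proof (induction k)
    case (Suc k)
    then show ?case using generate.eng[of "g [^] k" G "{g}" g] generate.incl[of g "{g}" G] by simp
  qed (simp add: generate.one)
  have "finite (rcosets ?H)"
  proof (rule ccontr)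
    assume inf: "infinite (rcosets ?H)"
    have quad: "(r + 1) * (r + 1) \<le> P + Q * (r * (len g + 1))" for r
    proof -
      let ?C = "(\<lambda>y. ?H #> y) ` ball r"
      define rep where "rep c = (SOME y. y \<in> ball r \<and> ?H #> y = c)" for c
      have rep: "rep c \<in> ball r" "?H #> rep c = c" if "c \<in> ?C" for c
      proof -
        have "\<exists>y. y \<in> ball r \<and> ?H #> y = c" using that by blast
        from someI_ex[OF this] show "rep c \<in> ball r" "?H #> rep c = c" by (auto simp: rep_def)
      qed
      let ?f = "\<lambda>(k::nat, c). g [^] k \<otimes> rep c"
      have coset: "?H #> (g [^] (k::nat) \<otimes> rep c) = c" if "c \<in> ?C" for k c
      proof -
        have "?H #> (g [^] k \<otimes> rep c) = (?H #> g [^] k) #> rep c"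
          using that g rep[OF that] sub ball_carrier by (subst coset_mult_assoc) (auto dest: subgroup.subset)
        also have "?H #> g [^] k = ?H"
          using coset_join2[OF _ sub powH[of k]] g by simp
        finally show ?thesis using rep[OF that] by simp
      qed
      have inj: "inj_on ?f ({0..r} \<times> ?C)"
      proof (rule inj_onI)
        fix a b assume ab: "a \<in> {0..r} \<times> ?C" "b \<in> {0..r} \<times> ?C" "?f a = ?f b"
        obtain k c l d where eq: "a = (k, c)" "b = (l, d)" by (metis prod.exhaust)
        have *: "c \<in> ?C" "d \<in> ?C" "g [^] k \<otimes> rep c = g [^] l \<otimes> rep d"
          using ab eq by auto
        then have cd: "c = d" using coset by metis
        have "rep c \<in> carrier G" using rep(1)[OF *(1)] ball_carrier by blast
        then have "g [^] k = g [^] l" using * cd g by simp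
        then show "a = b" using cd eq pow_inj[of k l] by simp
      qed
      have sub': "?f ` ({0..r} \<times> ?C) \<subseteq> ball (r * (len g + 1))"
      proof (rule image_subsetI)
        fix a assume "a \<in> {0..r} \<times> ?C"
        then obtain k c where kc: "a = (k, c)" "k \<in> {0..r}" "c \<in> ?C" by blast
        have rc: "rep c \<in> carrier G" "len (rep c) \<le> r" using rep(1)[OF kc(3)] by (auto simp: ball_def)
        have m: "k * len g \<le> r * len g" using kc(2) by (intro mult_le_mono1) simp
        have l: "len (g [^] k \<otimes> rep c) \<le> k * len g + len (rep c)"
          using len_mult[OF nat_pow_closed[OF g(1)] rc(1), of k] pow_len[OF g(1), of k] by linarith
        have "r * (len g + 1) = r * len g + r" by simp
        then have "len (g [^] k \<otimes> rep c) \<le> r * (len g + 1)" using l m rc(2) by linarith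
        moreover have "g [^] k \<otimes> rep c \<in> carrier G" using g(1) rc(1) by blast
        ultimately have "g [^] k \<otimes> rep c \<in> ball (r * (len g + 1))" unfolding ball_def by blast
        then show "?f a \<in> ball (r * (len g + 1))" unfolding kc(1) prod.case .
      qed
      have "(r + 1) * (r + 1) \<le> card {0..r} * card ?C"
      proof (rule mult_le_mono)
        show "r + 1 \<le> card ?C" using cosets_grow[OF sub inf, of r] by linarith
      qed simp
      also have "\<dots> = card (?f ` ({0..r} \<times> ?C))"
        by (simp only: card_image[OF inj] card_cartesian_product)
      also have "\<dots> \<le> card (ball (r * (len g + 1)))" using sub' by (intro card_mono) auto
      also have "\<dots> \<le> P + Q * (r * (len g + 1))" by (rule lin)
      finally show ?thesis .
    qed
    \<comment> \<open>For this \<open>r\<close> the linear bound is at most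
      \<open>r * r + r\<close>, which is less than the square of \<open>r + 1\<close>.\<close>
    define r where "r = P + Q * (len g + 1)"
    have "(r + 1) * (r + 1) = r * r + 2 * r + 1" by simp
    moreover have "Q * (r * (len g + 1)) = (r - P) * r" by (simp add: r_def algebra_simps)
    moreover have "(r - P) * r \<le> r * r" by (rule mult_le_mono1) (rule diff_le_self)
    moreover have "P \<le> r" by (simp add: r_def)
    ultimately show False using quad[of r] by linarith
  qed
  moreover have "cyclic_group (G\<lparr>carrier := ?H\<rparr>)"
  proof -
    have "carrier G \<inter> {g} = {g}" using g by blast
    then have "subgroup_generated G {g} = G\<lparr>carrier := ?H\<rparr>" unfolding subgroup_generated_def by simp
    moreover have "cyclic_group (subgroup_generated G {g})"
      using g cyclic_group_generated by blast
    ultimately show ?thesis by simp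
  qed
  ultimately show ?thesis unfolding virtually_cyclic_def using sub by (intro exI[of _ ?H] conjI)
qed

end

section \<open>Without tripods the growth is linear\<close>

context hyperbolic_metric
begin

text \<open>Translation by \<open>inv q\<close> brings the three points to the identity, where they
  would form a tripod with constant \<open>K + 2 * \<delta>\<close>; the shift by 2 \<delta> cancels
  the margin in the definition of \<open>tripod\<close>.\<close>

lemma no_tripod_pair:
  assumes "\<And>a b c K. K \<ge> 0 \<Longrightarrow> \<not> tripod K a b c" "K \<ge> 0"
    and "q \<in> carrier G" "a \<in> carrier G" "b \<in> carrier G" "c \<in> carrier G"
    and "real (dst q a) > 2 * K + 4 * \<delta>" "real (dst q b) > 2 * K + 4 * \<delta>" "real (dst q c) > 2 * K + 4 * \<delta>"
  shows "gp q a b \<ge> K \<or> gp q b c \<ge> K \<or> gp q a c \<ge> K"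
proof -
  have *: "gp \<one> (inv q \<otimes> x) (inv q \<otimes> y) = gp q x y" if "x \<in> carrier G" "y \<in> carrier G" for x y
    using gp_left[of "inv q" q x y] assms(3) that by simp
  have "\<not> tripod (K + 2 * \<delta>) (inv q \<otimes> a) (inv q \<otimes> b) (inv q \<otimes> c)"
    using assms delta_nonneg by auto
  moreover have "len (inv q \<otimes> x) = dst q x" for x by (simp add: dst_def)
  moreover have "gp q a b < K + 2 * \<delta> - 2 * \<delta> \<longleftrightarrow> \<not> gp q a b \<ge> K" for a b by auto
  ultimately show ?thesis
    using assms(3-9) unfolding tripod_def by (simp add: *) argo
qed

text \<open>The vertex \<open>q\<close> on a geodesic to \<open>a\<close>, at distance about
  \<open>gp \<one> a b\<close>, is the branch point of the triangle formed by the identity,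
  \<open>a\<close> and \<open>b\<close>. Seen from \<open>q\<close> the corners have pairwise
  products below \<delta> + 2, so without tripods one of the three legs is short, and this is the
  alternative claimed.\<close>

lemma no_tripod_products:
  assumes nt: "\<And>a b c K. K \<ge> 0 \<Longrightarrow> \<not> tripod K a b c"
    and a: "a \<in> carrier G" and b: "b \<in> carrier G"
  shows "gp \<one> a b \<le> 6 * \<delta> + 5 \<or> gp \<one> a b \<ge> min (len a) (len b) - (6 * \<delta> + 5)"
proof (rule ccontr)
  assume contra: "\<not> ?thesis"
  \<comment> \<open>Rounding down loses less than 1, which the constant
    \<open>6 * \<delta> + 5\<close> allows for: the legs only have to exceed
    \<open>6 * \<delta> + 4\<close>.\<close>
  define r where "r = nat \<lfloor>gp \<one> a b\<rfloor>"
  have r: "real r \<le> gp \<one> a b" "gp \<one> a b < r + 1"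
    using gp_nonneg[of \<one> a b] a b by (auto simp: r_def) linarith
  have "gp \<one> a b \<le> len a" using gp_le[of \<one> a b] a b by simp
  then have "r \<le> dst \<one> a" using r a by (simp add: of_nat_le_iff[symmetric, where 'a = real] del: of_nat_le_iff)
  then obtain q where q: "q \<in> carrier G" "dst \<one> q = r" "dst q a = len a - r"
    using dst_geodesic[of \<one> a r] a by auto
  have ra: "r \<le> len a" using \<open>r \<le> dst \<one> a\<close> a by simp
  have qa: "real (dst q a) = real (len a) - r" using q ra by simp
  have d1: "dst q \<one> = r" "dst a q = dst q a" "dst b q = dst q b" "dst a \<one> = len a" "dst b \<one> = len b" "dst \<one> b = len b"
    using q a b dst_sym by auto
  have "gp \<one> q a = r" using d1 qa by (simp add: gp_eq)
  moreover have "gp \<one> q b \<ge> min (gp \<one> q a) (gp \<one> a b) - \<delta>" using q a b by (intro four_point) auto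
  ultimately have qb: "gp \<one> q b \<ge> r - \<delta>" using r by simp
  then have qb': "real (dst q b) \<le> real (len b) - real r + 2 * \<delta>" using d1 by (simp add: gp_eq field_simps)
  have qb'': "real (dst q b) \<ge> real (len b) - r"
    using dst_tri[of \<one> q b] q a b by (simp add: d1)
  have p1: "gp q \<one> a < \<delta> + 2" using qa d1 a q delta_nonneg by (simp add: gp_eq)
  have p2: "gp q \<one> b < \<delta> + 2" using qb' d1 q delta_nonneg by (simp add: gp_eq field_simps)
  have "real (len a) + len b - dst a b = 2 * gp \<one> a b" using d1 by (simp add: gp_eq)
  then have p3: "gp q a b < \<delta> + 2" using qa qb' d1 r by (simp add: gp_eq field_simps)
  have "2 * (\<delta> + 2) + 4 * \<delta> < dst q \<one>" "2 * (\<delta> + 2) + 4 * \<delta> < dst q a" "2 * (\<delta> + 2) + 4 * \<delta> < dst q b"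
    using contra r qa qb'' d1 delta_nonneg by (auto simp: min_def split: if_splits)
  then have "gp q \<one> a \<ge> \<delta> + 2 \<or> gp q a b \<ge> \<delta> + 2 \<or> gp q \<one> b \<ge> \<delta> + 2"
    using no_tripod_pair[OF nt, of "\<delta> + 2" q \<one> a b] q a b delta_nonneg by auto
  then show False using p1 p2 p3 by linarith
qed

text \<open>Among three elements of a large sphere two have a product too large for the first
  alternative of \<open>no_tripod_products\<close>; their product is then almost their length, and
  their distance is bounded. So a large sphere is covered by two balls of fixed radius, and its size
  is bounded.\<close>

lemma no_tripod_linear:
  assumes nt: "\<And>a b c K. K \<ge> 0 \<Longrightarrow> \<not> tripod K a b c"
  shows "\<exists>P Q. \<forall>n. card (ball n) \<le> P + Q * n"
proof -
  define L where "L = 6 * \<delta> + 5"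
  \<comment> \<open>Large enough for \<open>no_tripod_pair\<close> to apply, with constant
    \<open>L + 1\<close>, to three elements of this length.\<close>
  define t0 where "t0 = nat \<lceil>2 * (L + 1) + 4 * \<delta>\<rceil> + 1"
  let ?V = "card (ball (nat \<lceil>2 * L\<rceil>))"
  have L: "L \<ge> 0" using delta_nonneg by (simp add: L_def)
  have near: "inv a \<otimes> b \<in> ball (nat \<lceil>2 * L\<rceil>)"
    if "a \<in> carrier G" "b \<in> carrier G" "len a = t" "len b = t" "gp \<one> a b \<ge> L + 1" for a b t
  proof -
    have "gp \<one> a b \<ge> t - L"
      using no_tripod_products[OF nt that(1,2)] that by (auto simp: L_def)
    then have "dst a b \<le> 2 * L" using that by (simp add: gp_eq field_simps)
    then have "dst a b \<le> nat \<lceil>2 * L\<rceil>" by linarith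
    then show ?thesis using that by (simp add: dst_def ball_def)
  qed
  have three: "inv a \<otimes> b \<in> ball (nat \<lceil>2 * L\<rceil>) \<or> inv b \<otimes> c \<in> ball (nat \<lceil>2 * L\<rceil>) \<or> inv a \<otimes> c \<in> ball (nat \<lceil>2 * L\<rceil>)"
    if "a \<in> carrier G" "b \<in> carrier G" "c \<in> carrier G" "len a = t" "len b = t" "len c = t" "t \<ge> t0" for a b c t
  proof -
    have "real t > 2 * (L + 1) + 4 * \<delta>" using that unfolding t0_def by linarith
    then have "gp \<one> a b \<ge> L + 1 \<or> gp \<one> b c \<ge> L + 1 \<or> gp \<one> a c \<ge> L + 1"
      using that L by (intro no_tripod_pair[OF nt]) auto
    then show ?thesis using near that by blast
  qed
  have cardN: "finite {b \<in> carrier G. inv a \<otimes> b \<in> ball n} \<and> card {b \<in> carrier G. inv a \<otimes> b \<in> ball n} \<le> card (ball n)"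
    if "a \<in> carrier G" for a n
  proof -
    have inj: "inj_on (\<lambda>b. inv a \<otimes> b) {b \<in> carrier G. inv a \<otimes> b \<in> ball n}"
      using that by (auto simp: inj_on_def)
    have im: "(\<lambda>b. inv a \<otimes> b) ` {b \<in> carrier G. inv a \<otimes> b \<in> ball n} \<subseteq> ball n" by auto
    show ?thesis using card_inj_on_le[OF inj im] inj_on_finite[OF inj im] by simp
  qed
  have sphere: "card {g \<in> carrier G. len g = t} \<le> 2 * ?V" if t: "t \<ge> t0" for t
  proof (cases "\<exists>a b. a \<in> carrier G \<and> b \<in> carrier G \<and> len a = t \<and> len b = t \<and> inv a \<otimes> b \<notin> ball (nat \<lceil>2 * L\<rceil>)")
    case True
    then obtain a b where ab: "a \<in> carrier G" "b \<in> carrier G" "len a = t" "len b = t" "inv a \<otimes> b \<notin> ball (nat \<lceil>2 * L\<rceil>)"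
      by blast
    let ?A = "{c \<in> carrier G. inv a \<otimes> c \<in> ball (nat \<lceil>2 * L\<rceil>)}" and ?B = "{c \<in> carrier G. inv b \<otimes> c \<in> ball (nat \<lceil>2 * L\<rceil>)}"
    have "{g \<in> carrier G. len g = t} \<subseteq> ?A \<union> ?B"
      using three[OF ab(1,2) _ ab(3,4) _ t] ab(5) by blast
    then have "card {g \<in> carrier G. len g = t} \<le> card (?A \<union> ?B)"
      using cardN ab by (intro card_mono) auto
    also have "\<dots> \<le> card ?A + card ?B" by (rule card_Un_le)
    also have "\<dots> \<le> 2 * ?V" using cardN[OF ab(1), of "nat \<lceil>2 * L\<rceil>"] cardN[OF ab(2), of "nat \<lceil>2 * L\<rceil>"] by linarith
    finally show ?thesis .
  next
    case False
    show ?thesis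
    proof (cases "{g \<in> carrier G. len g = t} = {}")
      case ne: False
      then obtain a where a: "a \<in> carrier G" "len a = t" by blast
      then have "{g \<in> carrier G. len g = t} \<subseteq> {c \<in> carrier G. inv a \<otimes> c \<in> ball (nat \<lceil>2 * L\<rceil>)}"
        using False by blast
      then have "card {g \<in> carrier G. len g = t} \<le> card {c \<in> carrier G. inv a \<otimes> c \<in> ball (nat \<lceil>2 * L\<rceil>)}"
        using cardN a by (intro card_mono) auto
      also have "\<dots> \<le> 2 * ?V" using cardN[OF a(1), of "nat \<lceil>2 * L\<rceil>"] by linarith
      finally show ?thesis .
    next
      case True
      then show ?thesis by (simp only: True) simp
    qed
  qed
  have "card (ball n) \<le> card (ball t0) + 2 * ?V * n" for n
  proof (induction n)
    case 0
    have "card (ball 0) \<le> card (ball t0)" by (intro card_mono ball_mono) auto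
    then show ?case by simp
  next
    case (Suc n)
    show ?case
    proof (cases "Suc n \<ge> t0")
      case True
      have "ball (Suc n) = ball n \<union> {g \<in> carrier G. len g = Suc n}" by (auto simp: ball_def)
      then have "card (ball (Suc n)) \<le> card (ball n) + card {g \<in> carrier G. len g = Suc n}"
        by (simp add: card_Un_le)
      then show ?thesis using Suc sphere[OF True] by simp
    next
      case False
      then have "card (ball (Suc n)) \<le> card (ball t0)" by (intro card_mono ball_mono) auto
      then show ?thesis by simp
    qed
  qed
  then show ?thesis by blast
qed

text \<open>A tripod gives non-amenability; without one the growth is linear, and a torsion-free
  group of linear growth is virtually cyclic.\<close>

theorem no_reiter:
  assumes "torsion_free G" "\<not> virtually_cyclic G"
  shows "no_reiter G"
proof -
  have "\<exists>a b c K. K \<ge> 0 \<and> tripod K a b c"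
    using no_tripod_linear virtually_cyclic_of_linear_growth[OF assms(1)] assms(2) by metis
  then show ?thesis using tripod_no_reiter by blast
qed

end

section \<open>Almost invariant sets\<close>

lemma AE_summable:
  fixes g :: "nat \<Rightarrow> 'a \<Rightarrow> real"
  assumes meas [measurable]: "\<And>n. g n \<in> borel_measurable N" and nonneg: "\<And>n x. x \<in> space N \<Longrightarrow> g n x \<ge> 0"
    and le: "\<And>n. (\<integral>\<^sup>+x. g n x \<partial>N) \<le> ennreal (b n)" and b: "summable b" "\<And>n. b n \<ge> 0"
  shows "AE x in N. summable (\<lambda>n. g n x)"
proof -
  have "(\<integral>\<^sup>+x. (\<Sum>n. ennreal (g n x)) \<partial>N) = (\<Sum>n. \<integral>\<^sup>+x. g n x \<partial>N)"
    by (rule nn_integral_suminf) simp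
  also have "\<dots> \<le> (\<Sum>n. ennreal (b n))"
    by (rule suminf_le[OF le]) auto
  also have "\<dots> = ennreal (\<Sum>n. b n)" using b by (intro suminf_ennreal2) auto
  finally have "(\<integral>\<^sup>+x. (\<Sum>n. ennreal (g n x)) \<partial>N) \<noteq> \<infinity>"
    by (auto simp: top_unique)
  then have "AE x in N. (\<Sum>n. ennreal (g n x)) \<noteq> \<infinity>"
    by (intro nn_integral_PInf_AE) auto
  then show ?thesis
  proof (rule AE_mp, intro AE_I2 impI)
    fix x assume "x \<in> space N" "(\<Sum>n. ennreal (g n x)) \<noteq> \<infinity>"
    then show "summable (\<lambda>n. g n x)"
      using nonneg by (intro summable_suminf_not_top) (auto simp: top_unique)
  qed
qed

text \<open>The midpoint-convex hull of the orbit of the indicator of \<open>D\<close>. Midpoints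
  are all that the parallelogram identity asks for, and working with functions rather than classes
  makes the bounds between 0 and 1 hold at every point.\<close>

inductive_set orbit_hull :: "'i set \<Rightarrow> ('i \<Rightarrow> 's \<Rightarrow> 's) \<Rightarrow> 's set \<Rightarrow> ('s \<Rightarrow> real) set"
  for A :: "'i set" and T :: "'i \<Rightarrow> 's \<Rightarrow> 's" and D :: "'s set" where
  base: "a \<in> A \<Longrightarrow> (\<lambda>x. indicator D (T a x)) \<in> orbit_hull A T D"
| trans: "f \<in> orbit_hull A T D \<Longrightarrow> a \<in> A \<Longrightarrow> (\<lambda>x. f (T a x)) \<in> orbit_hull A T D"
| mid: "f \<in> orbit_hull A T D \<Longrightarrow> g \<in> orbit_hull A T D \<Longrightarrow> (\<lambda>x. (f x + g x) / 2) \<in> orbit_hull A T D"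

locale recurrent_set =
  fixes N :: "'s measure" and A :: "'i set" and T :: "'i \<Rightarrow> 's \<Rightarrow> 's" and D :: "'s set" and c :: real
  assumes meas: "a \<in> A \<Longrightarrow> T a \<in> measurable N N"
    and distr: "a \<in> A \<Longrightarrow> distr N N (T a) = N"
    and comp: "a \<in> A \<Longrightarrow> b \<in> A \<Longrightarrow> \<exists>e\<in>A. \<forall>x\<in>space N. T a (T b x) = T e x"
    and D: "D \<in> sets N" "emeasure N D < \<infinity>" and c: "c > 0" and A_ne: "A \<noteq> {}"
    and rec: "a \<in> A \<Longrightarrow> emeasure N {x \<in> space N. x \<in> D \<and> T a x \<in> D} \<ge> c"
begin

abbreviation "C \<equiv> orbit_hull A T D"

lemma hull_meas: "f \<in> C \<Longrightarrow> f \<in> borel_measurable N"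
proof (induction rule: orbit_hull.induct)
  case (base a)
  then show ?case using meas[OF base] D
    by (intro measurable_compose[of "T a" N N "indicator D"]) auto
next
  case (trans f a)
  then show ?case using meas measurable_compose by blast
next
  case (mid f g)
  then show ?case by simp
qed

lemma hull_bounds: "f \<in> C \<Longrightarrow> 0 \<le> f x \<and> f x \<le> 1"
proof (induction arbitrary: x rule: orbit_hull.induct)
  case (base a)
  then show ?case by (auto simp: indicator_def)
next
  case (mid f g)
  from mid.IH(1)[of x] mid.IH(2)[of x] show ?case by auto
qed auto

lemma nn_integral_T:
  assumes "a \<in> A" "f \<in> borel_measurable N"
  shows "(\<integral>\<^sup>+x. f (T a x) \<partial>N) = (\<integral>\<^sup>+x. f x \<partial>N)"
proof -
  have "(\<integral>\<^sup>+x. f x \<partial>N) = (\<integral>\<^sup>+x. f x \<partial>distr N N (T a))" using distr assms by simp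
  also have "\<dots> = (\<integral>\<^sup>+x. f (T a x) \<partial>N)" using assms meas by (intro nn_integral_distr) auto
  finally show ?thesis by simp
qed

lemma hull_integral: "f \<in> C \<Longrightarrow> (\<integral>\<^sup>+x. f x \<partial>N) = emeasure N D"
proof (induction rule: orbit_hull.induct)
  case (base a)
  have "(\<integral>\<^sup>+x. ennreal (indicator D (T a x)) \<partial>N) = (\<integral>\<^sup>+x. ennreal (indicator D x) \<partial>N)"
    using D base by (intro nn_integral_T) auto
  also have "\<dots> = emeasure N D" using D by (simp add: ennreal_indicator)
  finally show ?case .
next
  case (trans f a)
  then show ?case using nn_integral_T[of a "\<lambda>x. ennreal (f x)"] hull_meas by simp
next
  case (mid f g)
  have [measurable]: "f \<in> borel_measurable N" "g \<in> borel_measurable N" using mid hull_meas by auto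
  have "(\<integral>\<^sup>+x. ennreal ((f x + g x) / 2) \<partial>N) = (\<integral>\<^sup>+x. ennreal (1/2) * ennreal (f x) + ennreal (1/2) * ennreal (g x) \<partial>N)"
  proof (rule nn_integral_cong)
    fix x
    have "(f x + g x) / 2 = 1/2 * f x + 1/2 * g x" by simp
    moreover have "0 \<le> f x" "0 \<le> g x" using hull_bounds mid by auto
    ultimately show "ennreal ((f x + g x) / 2) = ennreal (1/2) * ennreal (f x) + ennreal (1/2) * ennreal (g x)"
      by (simp only: ennreal_plus ennreal_mult divide_nonneg_nonneg zero_le_one zero_le_numeral mult_nonneg_nonneg)
  qed
  also have "\<dots> = ennreal (1/2) * emeasure N D + ennreal (1/2) * emeasure N D"
    using mid by (simp add: nn_integral_add nn_integral_cmult)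
  also have "\<dots> = (ennreal (1/2) + ennreal (1/2)) * emeasure N D" by (simp add: distrib_right)
  also have "ennreal (1/2) + ennreal (1/2) = 1" by (subst ennreal_plus[symmetric]) auto
  finally show ?case by simp
qed

lemma hull_integrable: "f \<in> C \<Longrightarrow> integrable N f"
  using hull_integral hull_meas hull_bounds D by (intro integrableI_nonneg) auto

lemma hull_integrable_mult:
  assumes "f \<in> C" "g \<in> C" shows "integrable N (\<lambda>x. f x * g x)"
proof (rule Bochner_Integration.integrable_bound[OF hull_integrable[OF assms(1)]])
  show "AE x in N. norm (f x * g x) \<le> norm (f x)"
    using hull_bounds assms by (intro AE_I2) (simp add: abs_mult mult_left_le)
  show "(\<lambda>x. f x * g x) \<in> borel_measurable N" using hull_meas assms by simp
qed

lemma hull_translate_eq: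
  assumes "f \<in> C" "b \<in> A" shows "(\<integral>x. f (T b x) ^ 2 \<partial>N) = (\<integral>x. f x ^ 2 \<partial>N)"
proof -
  have "(\<integral>x. f x ^ 2 \<partial>N) = (\<integral>x. f x ^ 2 \<partial>distr N N (T b))" using distr assms by simp
  also have "\<dots> = (\<integral>x. f (T b x) ^ 2 \<partial>N)"
    using meas hull_meas assms by (intro integral_distr) auto
  finally show ?thesis by simp
qed

lemma int_ind: "f \<in> C \<Longrightarrow> integrable N (\<lambda>x. f x * indicator D x)"
  using hull_meas D
  by (intro Bochner_Integration.integrable_bound[OF hull_integrable]) (auto simp: indicator_def intro!: AE_I2)

lemma hull_large_base: "a \<in> A \<Longrightarrow> (\<integral>x. indicator D (T a x) * indicator D x \<partial>N) \<ge> c"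
proof -
  assume a: "a \<in> A"
  let ?E = "{x \<in> space N. x \<in> D \<and> T a x \<in> D}"
  have m: "?E \<in> sets N" using meas[OF a] D by measurable
  have "emeasure N ?E \<le> emeasure N D" using D by (intro emeasure_mono) auto
  then have fin: "emeasure N ?E < \<infinity>" using D by auto
  have "(\<integral>x. indicator D (T a x) * indicator D x \<partial>N) = (\<integral>x. (indicator ?E x :: real) \<partial>N)"
    by (intro Bochner_Integration.integral_cong) (auto simp: indicator_def)
  also have "\<dots> = measure N ?E" using m by simp
  also have "\<dots> \<ge> c"
    using rec[OF a] fin c by (simp add: emeasure_eq_ennreal_measure top.not_eq_extremum)
  finally show ?thesis .
qed

text \<open>The clause about translates carries the induction through \<open>trans\<close>: by
  \<open>comp\<close>, a translate of a translate is a single translate, which \<open>rec\<close> or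
  the induction hypothesis controls.\<close>

lemma hull_large: "f \<in> C \<Longrightarrow> (\<integral>x. f x * indicator D x \<partial>N) \<ge> c \<and>
    (\<forall>b\<in>A. (\<integral>x. f (T b x) * indicator D x \<partial>N) \<ge> c)"
proof (induction rule: orbit_hull.induct)
  case (base a)
  have "(\<integral>x. indicator D (T a (T b x)) * indicator D x \<partial>N) \<ge> c" if b: "b \<in> A" for b
  proof -
    obtain e where e: "e \<in> A" "\<forall>x\<in>space N. T a (T b x) = T e x" using comp base b by blast
    have "(\<integral>x. indicator D (T a (T b x)) * indicator D x \<partial>N) = (\<integral>x. indicator D (T e x) * (indicator D x :: real) \<partial>N)"
      using e by (intro Bochner_Integration.integral_cong) auto
    then show ?thesis using hull_large_base[OF e(1)] by simp
  qed
  then show ?case using hull_large_base[OF base] by blast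
next
  case (trans f a)
  have "(\<integral>x. f (T a (T b x)) * indicator D x \<partial>N) \<ge> c" if b: "b \<in> A" for b
  proof -
    obtain e where e: "e \<in> A" "\<forall>x\<in>space N. T a (T b x) = T e x" using comp trans b by blast
    have "(\<integral>x. f (T a (T b x)) * indicator D x \<partial>N) = (\<integral>x. f (T e x) * indicator D x \<partial>N)"
      using e by (intro Bochner_Integration.integral_cong) auto
    then show ?thesis using trans e by simp
  qed
  then show ?case using trans by blast
next
  case (mid f g)
  have *: "(\<integral>x. (u x + v x) / 2 * indicator D x \<partial>N) \<ge> c"
    if "u \<in> C" "v \<in> C" "(\<integral>x. u x * indicator D x \<partial>N) \<ge> c" "(\<integral>x. v x * indicator D x \<partial>N) \<ge> c" for u v
  proof -
    have "(\<integral>x. (u x + v x) / 2 * indicator D x \<partial>N) = (\<integral>x. (u x * indicator D x + v x * indicator D x) / 2 \<partial>N)"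
      by (intro Bochner_Integration.integral_cong) (auto simp: field_simps)
    also have "\<dots> = ((\<integral>x. u x * indicator D x \<partial>N) + (\<integral>x. v x * indicator D x \<partial>N)) / 2"
      using int_ind that by simp
    finally show ?thesis using that by simp
  qed
  show ?case using mid by (intro conjI ballI *) (auto intro: orbit_hull.trans)
qed

definition q where "q f = (\<integral>x. f x ^ 2 \<partial>N)"
definition I where "I = (INF f\<in>C. q f)"

lemma I_le: "f \<in> C \<Longrightarrow> I \<le> q f"
  unfolding I_def by (rule cINF_lower) (auto intro!: bdd_belowI[of _ 0] simp: q_def)

text \<open>The midpoint of \<open>f\<close> and \<open>g\<close> lies in the hull, so its squared
  norm is at least \<open>I\<close>. Hence functions of nearly least norm are close to each other in
  L2.\<close>

lemma parallelogram:
  assumes "f \<in> C" "g \<in> C"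
  shows "(\<integral>\<^sup>+x. (f x - g x) ^ 2 \<partial>N) \<le> ennreal (2 * q f + 2 * q g - 4 * I)"
proof -
  let ?m = "\<lambda>x. (f x + g x) / 2"
  have m: "?m \<in> C" using assms by (rule orbit_hull.mid)
  have int: "integrable N (\<lambda>x. f x ^ 2)" "integrable N (\<lambda>x. g x ^ 2)" "integrable N (\<lambda>x. ?m x ^ 2)"
    using hull_integrable_mult[OF assms(1) assms(1)] hull_integrable_mult[OF assms(2) assms(2)]
      hull_integrable_mult[OF m m] by (simp_all only: power2_eq_square)
  have eq: "(f x - g x) ^ 2 = 2 * f x ^ 2 + 2 * g x ^ 2 - 4 * ?m x ^ 2" for x
    by (simp add: power2_eq_square field_simps)
  have "integrable N (\<lambda>x. (f x - g x) ^ 2)" unfolding eq using int by auto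
  then have "(\<integral>\<^sup>+x. (f x - g x) ^ 2 \<partial>N) = ennreal (\<integral>x. (f x - g x) ^ 2 \<partial>N)"
    by (rule nn_integral_eq_integral) auto
  also have "(\<integral>x. (f x - g x) ^ 2 \<partial>N) = 2 * q f + 2 * q g - 4 * q ?m"
    unfolding eq q_def using int by simp
  also have "ennreal \<dots> \<le> ennreal (2 * q f + 2 * q g - 4 * I)"
    using I_le[OF m] by (intro ennreal_leI) simp
  finally show ?thesis .
qed

text \<open>Functions of nearly least norm converge, and the limit is invariant because a translate
  of such a function has the same norm. Its integral over \<open>D\<close> is still at least
  \<open>c\<close>, so it exceeds some positive level on a set of positive measure; that set has
  finite measure because the whole integral is at most the measure of \<open>D\<close>.\<close>

lemma invariant_set:
  shows "\<exists>E\<in>sets N. 0 < emeasure N E \<and> emeasure N E < \<infinity> \<and> (\<forall>a\<in>A. AE x in N. T a x \<in> E \<longleftrightarrow> x \<in> E)"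
proof -
  have C_ne: "C \<noteq> {}" using A_ne orbit_hull.base by (metis equals0I ex_in_conv)
  \<comment> \<open>Errors of size \<open>(1/16) ^ n\<close> leave room for the weight
    \<open>4 ^ n\<close> used below, which turns L2 closeness of consecutive terms into geometric
    pointwise decay almost everywhere.\<close>
  have "\<exists>f\<in>C. q f < I + (1/16) ^ n" for n :: nat
  proof -
    have "\<not> (\<forall>f\<in>C. I + (1/16) ^ n \<le> q f)"
    proof
      assume "\<forall>f\<in>C. I + (1/16) ^ n \<le> q f"
      then have "I + (1/16) ^ n \<le> I" unfolding I_def using C_ne by (intro cINF_greatest) (auto simp: I_def)
      moreover have "(1/16::real) ^ n > 0" by simp
      ultimately show False by linarith
    qed
    then show ?thesis by force
  qed
  then obtain F where F: "\<And>n. F n \<in> C" "\<And>n. q (F n) < I + (1/16) ^ n" by metis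
  have [measurable]: "F n \<in> borel_measurable N" for n using F hull_meas by blast
  have "AE x in N. summable (\<lambda>n. 4 ^ n * (F (Suc n) x - F n x) ^ 2)"
  proof (rule AE_summable[where b = "\<lambda>n. 4 * (1/4) ^ n"])
    fix n
    have "(\<integral>\<^sup>+x. ennreal (4 ^ n * (F (Suc n) x - F n x) ^ 2) \<partial>N) =
        ennreal (4 ^ n) * (\<integral>\<^sup>+x. (F (Suc n) x - F n x) ^ 2 \<partial>N)"
      by (simp add: ennreal_mult nn_integral_cmult)
    also have "\<dots> \<le> ennreal (4 ^ n) * ennreal (2 * q (F (Suc n)) + 2 * q (F n) - 4 * I)"
      using F by (intro mult_left_mono parallelogram) auto
    also have "\<dots> \<le> ennreal (4 ^ n) * ennreal (4 * (1/16) ^ n)"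
    proof (intro mult_left_mono ennreal_leI)
      have "(1/16) ^ Suc n \<le> (1/16::real) ^ n" by (intro power_decreasing) auto
      then show "2 * q (F (Suc n)) + 2 * q (F n) - 4 * I \<le> 4 * (1/16) ^ n"
        using F(2)[of n] F(2)[of "Suc n"] by linarith
    qed simp
    also have "\<dots> = ennreal (4 ^ n * (4 * (1/16) ^ n))" by (simp add: ennreal_mult)
    also have "4 ^ n * (4 * (1/16) ^ n) = 4 * (1/4::real) ^ n"
      by (simp add: power_mult_distrib[symmetric])
    finally show "(\<integral>\<^sup>+x. ennreal (4 ^ n * (F (Suc n) x - F n x) ^ 2) \<partial>N) \<le> ennreal (4 * (1/4) ^ n)" .
  qed auto
  then have conv: "AE x in N. convergent (\<lambda>n. F n x)"
  proof (rule AE_mp, intro AE_I2 impI)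
    fix x assume s: "summable (\<lambda>n. 4 ^ n * (F (Suc n) x - F n x) ^ 2)"
    then have "(\<lambda>n. 4 ^ n * (F (Suc n) x - F n x) ^ 2) \<longlonglongrightarrow> 0" by (rule summable_LIMSEQ_zero)
    then have "Bseq (\<lambda>n. 4 ^ n * (F (Suc n) x - F n x) ^ 2)" by (intro convergent_imp_Bseq convergentI)
    then obtain B where B: "B > 0" "\<And>n. \<bar>4 ^ n * (F (Suc n) x - F n x) ^ 2\<bar> \<le> B" by (auto elim: BseqE)
    have bound: "norm (F (Suc n) x - F n x) \<le> sqrt B * (1/2) ^ n" for n
    proof -
      have "(2 ^ n * (F (Suc n) x - F n x)) ^ 2 \<le> B"
        using B(2)[of n] by (simp add: power_mult_distrib power_mult[symmetric] mult.commute[of n 2]) (simp add: power_mult)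
      then have "\<bar>2 ^ n * (F (Suc n) x - F n x)\<bar> \<le> sqrt B" by (metis real_sqrt_abs real_sqrt_le_iff)
      then have "2 ^ n * \<bar>F (Suc n) x - F n x\<bar> \<le> sqrt B" unfolding abs_mult by simp
      then show ?thesis by (simp add: pos_le_divide_eq power_divide mult.commute)
    qed
    have "summable (\<lambda>n. F (Suc n) x - F n x)"
    proof (rule summable_comparison_test')
      show "summable (\<lambda>n. sqrt B * (1/2) ^ n)" by (intro summable_mult summable_geometric) simp
    qed (rule bound)
    then have "convergent (\<lambda>n. F n x - F 0 x)"
      using sum_lessThan_telescope[of "\<lambda>n. F n x"] unfolding summable_iff_convergent by simp
    from convergent_add[OF this convergent_const[of "F 0 x"]] show "convergent (\<lambda>n. F n x)" by simp
  qed
  define f where "f x = lim (\<lambda>n. F n x)" for x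
  have f_meas [measurable]: "f \<in> borel_measurable N"
    unfolding f_def by (rule borel_measurable_lim_metric) simp
  have lim: "AE x in N. (\<lambda>n. F n x) \<longlonglongrightarrow> f x"
    using conv by eventually_elim (simp add: f_def convergent_LIMSEQ_iff)
  have f_inv: "AE x in N. f (T a x) = f x" if a: "a \<in> A" for a
  proof -
    have [measurable]: "T a \<in> measurable N N" using meas a by blast
    have "AE x in N. summable (\<lambda>n. (F n (T a x) - F n x) ^ 2)"
    proof (rule AE_summable[where b = "\<lambda>n. 4 * (1/16) ^ n"])
      fix n
      have FT: "(\<lambda>x. F n (T a x)) \<in> C" using F a by (intro orbit_hull.trans)
      have "(\<integral>\<^sup>+x. (F n (T a x) - F n x) ^ 2 \<partial>N) \<le> ennreal (2 * q (\<lambda>x. F n (T a x)) + 2 * q (F n) - 4 * I)"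
        using F FT by (intro parallelogram)
      also have "\<dots> \<le> ennreal (4 * (1/16) ^ n)"
        using F(2)[of n] hull_translate_eq[OF F(1)[of n] a] by (intro ennreal_leI) (simp add: q_def)
      finally show "(\<integral>\<^sup>+x. (F n (T a x) - F n x) ^ 2 \<partial>N) \<le> ennreal (4 * (1/16) ^ n)" .
    qed auto
    moreover have "AE x in N. (\<lambda>n. F n (T a x)) \<longlonglongrightarrow> f (T a x)"
    proof -
      have "AE x in distr N N (T a). (\<lambda>n. F n x) \<longlonglongrightarrow> f x" by (subst distr[OF a]) (rule lim)
      then show ?thesis by (rule AE_distrD[rotated]) simp
    qed
    ultimately show ?thesis using lim
    proof eventually_elim
      case (elim x)
      have "(\<lambda>n. (F n (T a x) - F n x) ^ 2) \<longlonglongrightarrow> 0" using elim(1) by (rule summable_LIMSEQ_zero)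
      moreover have "(\<lambda>n. (F n (T a x) - F n x) ^ 2) \<longlonglongrightarrow> (f (T a x) - f x) ^ 2"
        using elim by (intro tendsto_intros)
      ultimately have "(f (T a x) - f x) ^ 2 = 0" using LIMSEQ_unique by blast
      then show ?case by simp
    qed
  qed
  have fin: "(\<integral>\<^sup>+x. f x \<partial>N) \<le> emeasure N D"
  proof -
    have "(\<integral>\<^sup>+x. f x \<partial>N) = (\<integral>\<^sup>+x. liminf (\<lambda>n. ennreal (F n x)) \<partial>N)"
    proof (rule nn_integral_cong_AE)
      show "AE x in N. ennreal (f x) = liminf (\<lambda>n. ennreal (F n x))"
        using lim by eventually_elim (intro lim_imp_Liminf[symmetric] tendsto_ennrealI; simp)
    qed
    also have "\<dots> \<le> liminf (\<lambda>n. \<integral>\<^sup>+x. F n x \<partial>N)" by (rule nn_integral_liminf) simp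
    also have "\<dots> = emeasure N D" using F hull_integral by (simp add: Liminf_const)
    finally show ?thesis .
  qed
  have large: "(\<integral>x. f x * indicator D x \<partial>N) \<ge> c"
  proof -
    have "(\<lambda>n. \<integral>x. F n x * indicator D x \<partial>N) \<longlonglongrightarrow> (\<integral>x. f x * indicator D x \<partial>N)"
    proof (rule integral_dominated_convergence[where w = "indicator D"])
      show "AE x in N. (\<lambda>n. F n x * indicator D x) \<longlonglongrightarrow> f x * indicator D x"
        using lim by eventually_elim (intro tendsto_intros)
      show "AE x in N. norm (F n x * indicator D x) \<le> indicator D x" for n
        using hull_bounds[OF F(1)[of n]] by (intro AE_I2) (auto simp: indicator_def)
    qed (use D in \<open>auto intro: borel_measurable_times\<close>)
    then show ?thesis using hull_large[OF F(1)] by (intro LIMSEQ_le_const) auto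
  qed
  have "\<exists>k::nat. emeasure N {x \<in> space N. f x > 1 / Suc k} > 0"
  proof (rule ccontr)
    assume "\<not> ?thesis"
    then have "AE x in N. \<not> f x > 1 / Suc k" for k :: nat
      by (intro AE_I[of _ _ "{x \<in> space N. f x > 1 / Suc k}"]) (auto simp: not_less)
    then have "AE x in N. \<forall>k::nat. \<not> f x > 1 / Suc k" by (simp add: AE_all_countable)
    then have "AE x in N. f x * indicator D x \<le> 0"
    proof eventually_elim
      case (elim x)
      have "f x \<le> 0"
      proof (rule ccontr)
        assume "\<not> f x \<le> 0"
        then obtain k :: nat where "1 / Suc k < f x" by (metis not_le nat_approx_posE)
        then show False using elim by blast
      qed
      then show ?case by (auto simp: indicator_def)
    qed
    then have "AE x in N. 0 \<le> - (f x * indicator D x)" by eventually_elim simp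
    then have "0 \<le> (\<integral>x. - (f x * indicator D x) \<partial>N)" by (rule integral_nonneg_AE)
    then have "(\<integral>x. f x * indicator D x \<partial>N) \<le> 0" by simp
    then show False using large c by simp
  qed
  then obtain k :: nat where k: "emeasure N {x \<in> space N. f x > 1 / Suc k} > 0" by blast
  let ?E = "{x \<in> space N. f x > 1 / Suc k}"
  have "ennreal (1 / Suc k) * emeasure N ?E = (\<integral>\<^sup>+x. ennreal (1 / Suc k) * indicator ?E x \<partial>N)"
    by (subst nn_integral_cmult_indicator) auto
  also have "\<dots> \<le> (\<integral>\<^sup>+x. f x \<partial>N)"
    by (intro nn_integral_mono) (auto simp: indicator_def intro!: ennreal_leI)
  also have "\<dots> < \<infinity>" using fin D by auto
  finally have "emeasure N ?E < \<infinity>" by (auto simp: ennreal_mult_less_top less_top[symmetric])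
  moreover have "AE x in N. T a x \<in> ?E \<longleftrightarrow> x \<in> ?E" if "a \<in> A" for a
  proof -
    have T_space: "T a x \<in> space N" if "x \<in> space N" for x
      using meas[OF \<open>a \<in> A\<close>] that by (rule measurable_space)
    from f_inv[OF that] AE_space show ?thesis by eventually_elim (simp add: T_space)
  qed
  ultimately show ?thesis using k by (intro bexI[of _ ?E]) auto
qed

end

section \<open>Actions with a fundamental domain\<close>

text \<open>The laws are imposed only on the points of the space, so that the same function acts on
  restrictions to invariant sets and on coarser sigma-algebras. In \<open>group_action\<close> the
  maps would have to be extensional on the space.\<close>

locale mp_action = group G for G (structure) +
  fixes M :: "'s measure" and act :: "'a \<Rightarrow> 's \<Rightarrow> 's"
  assumes countable_carrier: "countable (carrier G)"
    and act_measurable: "g \<in> carrier G \<Longrightarrow> act g \<in> measurable M M"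
    and act_distr: "g \<in> carrier G \<Longrightarrow> distr M M (act g) = M"
    and act_one: "x \<in> space M \<Longrightarrow> act \<one> x = x"
    and act_mult: "g \<in> carrier G \<Longrightarrow> h \<in> carrier G \<Longrightarrow> x \<in> space M \<Longrightarrow> act (g \<otimes> h) x = act g (act h x)"
begin

lemma act_space: "g \<in> carrier G \<Longrightarrow> x \<in> space M \<Longrightarrow> act g x \<in> space M"
  using act_measurable by (rule measurable_space)

lemma act_inv_act: "g \<in> carrier G \<Longrightarrow> x \<in> space M \<Longrightarrow> act (inv g) (act g x) = x"
  by (simp add: act_mult[symmetric] act_one)

lemma act_act_inv: "g \<in> carrier G \<Longrightarrow> x \<in> space M \<Longrightarrow> act g (act (inv g) x) = x"
  by (simp add: act_mult[symmetric] act_one)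

lemma nn_integral_act:
  assumes "g \<in> carrier G" "f \<in> borel_measurable M"
  shows "(\<integral>\<^sup>+x. f (act g x) \<partial>M) = (\<integral>\<^sup>+x. f x \<partial>M)"
proof -
  have "(\<integral>\<^sup>+x. f x \<partial>M) = (\<integral>\<^sup>+x. f x \<partial>distr M M (act g))" using act_distr assms by simp
  also have "\<dots> = (\<integral>\<^sup>+x. f (act g x) \<partial>M)" using assms act_measurable by (intro nn_integral_distr) auto
  finally show ?thesis by simp
qed

lemma vimage_sets: "g \<in> carrier G \<Longrightarrow> E \<in> sets M \<Longrightarrow> {x \<in> space M. act g x \<in> E} \<in> sets M"
  using measurable_sets[OF act_measurable, of g E] by (simp add: vimage_def Int_def conj_commute)

lemma vimage_measure:
  assumes "g \<in> carrier G" "E \<in> sets M"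
  shows "emeasure M {x \<in> space M. act g x \<in> E} = emeasure M E"
proof -
  have "emeasure M E = emeasure (distr M M (act g)) E" using act_distr assms by simp
  also have "\<dots> = emeasure M (act g -` E \<inter> space M)" using assms act_measurable by (intro emeasure_distr) auto
  also have "act g -` E \<inter> space M = {x \<in> space M. act g x \<in> E}" by auto
  finally show ?thesis by simp
qed

definition inv_set :: "'a set \<Rightarrow> 's set \<Rightarrow> bool" where
  "inv_set H E \<longleftrightarrow> E \<in> sets M \<and> (\<forall>h\<in>H. \<forall>x\<in>space M. act h x \<in> E \<longleftrightarrow> x \<in> E)"

text \<open>Strict: every point, not just almost every one, has exactly one translate in
  \<open>Z\<close>. The null sets are removed once, in \<open>ex_double_product\<close>. The
  parameter \<open>H\<close> admits domains for subgroups of the acting group.\<close>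

definition fund :: "'a set \<Rightarrow> 's set \<Rightarrow> bool" where
  "fund H Z \<longleftrightarrow> Z \<in> sets M \<and> (\<forall>x\<in>space M. \<exists>!h. h \<in> H \<and> act h x \<in> Z)"

lemma fund_sets: "fund H Z \<Longrightarrow> Z \<in> sets M"
  by (simp add: fund_def)

definition retr :: "'a set \<Rightarrow> 's set \<Rightarrow> 's \<Rightarrow> 'a" where
  "retr H Z x = (THE h. h \<in> H \<and> act h x \<in> Z)"

lemma retr:
  assumes "fund H Z" "x \<in> space M" shows "retr H Z x \<in> H" "act (retr H Z x) x \<in> Z"
proof -
  have "\<exists>!h. h \<in> H \<and> act h x \<in> Z" using assms unfolding fund_def by blast
  from theI'[OF this] show "retr H Z x \<in> H" "act (retr H Z x) x \<in> Z" by (auto simp: retr_def)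
qed

lemma retr_eq:
  assumes "fund H Z" "x \<in> space M" "h \<in> H" "act h x \<in> Z" shows "retr H Z x = h"
proof -
  have "\<exists>!h. h \<in> H \<and> act h x \<in> Z" using assms unfolding fund_def by blast
  from the1_equality[OF this, of h] show ?thesis using assms by (simp add: retr_def)
qed

lemma fund_sum:
  assumes "fund H Z" "x \<in> space M"
  shows "(\<integral>\<^sup>+h. indicator Z (act h x) \<partial>count_space H) = 1"
proof -
  define k where "k = retr H Z x"
  have k: "k \<in> H" "act k x \<in> Z" using retr[OF assms] by (simp_all add: k_def)
  have "(\<integral>\<^sup>+h. indicator Z (act h x) \<partial>count_space H) = (\<integral>\<^sup>+h. indicator {k} h \<partial>count_space H)"
  proof (rule nn_integral_cong)
    fix h assume "h \<in> space (count_space H)"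
    then have "act h x \<in> Z \<longleftrightarrow> h = k" using k retr_eq[OF assms, of h] by (auto simp: k_def)
    then show "indicator Z (act h x) = (indicator {k} h :: ennreal)" by (simp add: indicator_def)
  qed
  also have "\<dots> = 1" using k by simp
  finally show ?thesis .
qed

text \<open>The constant 1 is written as the sum of \<open>indicator Z (act h x)\<close> over
  \<open>h\<close>; the sum is taken out of the integral, the variable is moved by
  \<open>inv h\<close>, and the sum is reindexed by inversion.\<close>

lemma unfold_aux:
  assumes H: "subgroup H G" and Z: "fund H Z" and f: "f \<in> borel_measurable M"
  shows "(\<integral>\<^sup>+x. f x \<partial>M) = (\<integral>\<^sup>+h. (\<integral>\<^sup>+x. f (act h x) * indicator Z x \<partial>M) \<partial>count_space H)"
proof -
  have HG: "H \<subseteq> carrier G" and Hinv: "\<And>h. h \<in> H \<Longrightarrow> inv h \<in> H"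
    using H subgroup.subset subgroup.m_inv_closed by auto
  have cH: "countable H" using HG countable_carrier countable_subset by blast
  have Zm [measurable]: "Z \<in> sets M" using Z by (rule fund_sets)
  have am [measurable]: "act h \<in> measurable M M" if "h \<in> H" for h using that HG act_measurable by auto
  note f [measurable]
  have m: "(\<lambda>x. f x * indicator Z (act h x)) \<in> borel_measurable M" if "h \<in> H" for h
    using that by measurable
  have "(\<integral>\<^sup>+x. f x \<partial>M) = (\<integral>\<^sup>+x. f x * (\<integral>\<^sup>+h. indicator Z (act h x) \<partial>count_space H) \<partial>M)"
    using fund_sum[OF Z] by (intro nn_integral_cong) simp
  also have "\<dots> = (\<integral>\<^sup>+x. (\<integral>\<^sup>+h. f x * indicator Z (act h x) \<partial>count_space H) \<partial>M)"
    by (intro nn_integral_cong nn_integral_cmult[symmetric]) simp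
  also have "\<dots> = (\<integral>\<^sup>+h. (\<integral>\<^sup>+x. f x * indicator Z (act h x) \<partial>M) \<partial>count_space H)"
    using m by (intro nn_integral_count_space_nn_integral cH) auto
  also have "\<dots> = (\<integral>\<^sup>+h. (\<integral>\<^sup>+x. f (act (inv h) x) * indicator Z x \<partial>M) \<partial>count_space H)"
  proof (rule nn_integral_cong)
    fix h assume "h \<in> space (count_space H)"
    then have h: "h \<in> H" "h \<in> carrier G" using HG by auto
    have "(\<integral>\<^sup>+x. f x * indicator Z (act h x) \<partial>M) = (\<integral>\<^sup>+x. f (act (inv h) x) * indicator Z (act h (act (inv h) x)) \<partial>M)"
      using h m by (intro nn_integral_act[symmetric, of "inv h"]) auto
    also have "\<dots> = (\<integral>\<^sup>+x. f (act (inv h) x) * indicator Z x \<partial>M)"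
      using h by (intro nn_integral_cong) (simp add: act_act_inv)
    finally show "(\<integral>\<^sup>+x. f x * indicator Z (act h x) \<partial>M) = (\<integral>\<^sup>+x. f (act (inv h) x) * indicator Z x \<partial>M)" .
  qed
  also have "\<dots> = (\<integral>\<^sup>+h. (\<integral>\<^sup>+x. f (act h x) * indicator Z x \<partial>M) \<partial>count_space H)"
  proof -
    have "bij_betw (\<lambda>h. inv h) H H"
      by (rule bij_betwI[where g = "\<lambda>h. inv h"]) (use Hinv HG in auto)
    from nn_integral_bij_count_space[OF this, of "\<lambda>h. \<integral>\<^sup>+x. f (act h x) * indicator Z x \<partial>M"]
    show ?thesis .
  qed
  finally show ?thesis .
qed

lemma unfold:
  assumes H: "subgroup H G" and Z: "fund H Z" and f: "f \<in> borel_measurable M"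
  shows "(\<integral>\<^sup>+x. f x \<partial>M) = (\<integral>\<^sup>+x. (\<integral>\<^sup>+h. f (act h x) \<partial>count_space H) * indicator Z x \<partial>M)"
proof -
  have HG: "H \<subseteq> carrier G" using H subgroup.subset by auto
  have cH: "countable H" using HG countable_carrier countable_subset by blast
  have Zm [measurable]: "Z \<in> sets M" using Z by (rule fund_sets)
  have am [measurable]: "act h \<in> measurable M M" if "h \<in> H" for h using that HG act_measurable by auto
  note f [measurable]
  have "(\<integral>\<^sup>+x. f x \<partial>M) = (\<integral>\<^sup>+h. (\<integral>\<^sup>+x. f (act h x) * indicator Z x \<partial>M) \<partial>count_space H)"
    by (rule unfold_aux[OF assms])
  also have "\<dots> = (\<integral>\<^sup>+x. (\<integral>\<^sup>+h. f (act h x) * indicator Z x \<partial>count_space H) \<partial>M)"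
    by (intro nn_integral_count_space_nn_integral[symmetric] cH) measurable
  also have "\<dots> = (\<integral>\<^sup>+x. (\<integral>\<^sup>+h. f (act h x) \<partial>count_space H) * indicator Z x \<partial>M)"
    by (intro nn_integral_cong nn_integral_multc) simp
  finally show ?thesis .
qed

text \<open>The integral of an invariant function over a fundamental domain is an integral over the
  quotient. In \<open>unfold\<close> for the domain \<open>Z'\<close>, applied to \<open>f\<close>
  times the indicator of \<open>Z\<close>, each orbit contributes exactly one term.\<close>

lemma fund_indep:
  assumes H: "subgroup H G" and Z: "fund H Z" "fund H Z'"
    and f: "f \<in> borel_measurable M" "\<And>h x. h \<in> H \<Longrightarrow> x \<in> space M \<Longrightarrow> f (act h x) = f x"
  shows "(\<integral>\<^sup>+x. f x * indicator Z x \<partial>M) = (\<integral>\<^sup>+x. f x * indicator Z' x \<partial>M)"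
proof -
  have [measurable]: "Z \<in> sets M" "Z' \<in> sets M" using Z fund_sets by auto
  note f(1) [measurable]
  have "(\<integral>\<^sup>+x. f x * indicator Z x \<partial>M) = (\<integral>\<^sup>+x. (\<integral>\<^sup>+h. f (act h x) * indicator Z (act h x) \<partial>count_space H) * indicator Z' x \<partial>M)"
    by (rule unfold[OF H Z(2)]) measurable
  also have "\<dots> = (\<integral>\<^sup>+x. f x * indicator Z' x \<partial>M)"
  proof (rule nn_integral_cong)
    fix x assume x: "x \<in> space M"
    have "(\<integral>\<^sup>+h. f (act h x) * indicator Z (act h x) \<partial>count_space H) = (\<integral>\<^sup>+h. f x * indicator Z (act h x) \<partial>count_space H)"
      using f x by (intro nn_integral_cong) auto
    also have "\<dots> = f x" using fund_sum[OF Z(1) x] by (subst nn_integral_cmult) auto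
    finally show "(\<integral>\<^sup>+h. f (act h x) * indicator Z (act h x) \<partial>count_space H) * indicator Z' x = f x * indicator Z' x"
      by simp
  qed
  finally show ?thesis .
qed

lemma fund_indep_measure:
  assumes H: "subgroup H G" and Z: "fund H Z" "fund H Z'" and E: "inv_set H E"
  shows "emeasure M (E \<inter> Z) = emeasure M (E \<inter> Z')"
proof -
  have [measurable]: "Z \<in> sets M" "Z' \<in> sets M" "E \<in> sets M" using Z E fund_sets by (auto simp: inv_set_def)
  have "(\<integral>\<^sup>+x. indicator E x * indicator Z x \<partial>M) = (\<integral>\<^sup>+x. indicator E x * indicator Z' x \<partial>M)"
    using E by (intro fund_indep[OF H Z]) (auto simp: inv_set_def indicator_def)
  then show ?thesis by (simp add: indicator_inter_arith[symmetric])
qed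

lemma inv_set_sets: "inv_set H E \<Longrightarrow> E \<in> sets M"
  by (simp add: inv_set_def)

lemma inv_set_D: "inv_set H E \<Longrightarrow> h \<in> H \<Longrightarrow> x \<in> space M \<Longrightarrow> act h x \<in> E \<longleftrightarrow> x \<in> E"
  by (simp add: inv_set_def)

lemma sigma_algebra_inv: 
  assumes "H \<subseteq> carrier G" shows "sigma_algebra (space M) {E. inv_set H E}"
  unfolding sigma_algebra_iff2
proof (intro conjI ballI allI impI)
  show "{E. inv_set H E} \<subseteq> Pow (space M)" using sets.sets_into_space by (auto simp: inv_set_def)
next
  fix E assume "E \<in> {E. inv_set H E}"
  then show "space M - E \<in> {E. inv_set H E}" using assms act_space by (auto simp: inv_set_def)
next
  fix F :: "nat \<Rightarrow> _" assume "range F \<subseteq> {E. inv_set H E}"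
  then have F: "inv_set H (F i)" for i by blast
  have "(\<Union>i. F i) \<in> sets M" using F by (intro sets.countable_UN) (auto simp: inv_set_def)
  then show "(\<Union>i. F i) \<in> {E. inv_set H E}" using F by (simp add: inv_set_def)
qed (simp add: inv_set_def)

text \<open>A countable intersection of preimages of \<open>E\<close>; it serves to replace a set
  that is invariant almost everywhere by a strictly invariant one.\<close>

lemma inv_strict:
  assumes H: "subgroup H G" and E: "E \<in> sets M"
  shows "inv_set H {x \<in> space M. \<forall>h\<in>H. act h x \<in> E}"
  unfolding inv_set_def
proof (intro conjI ballI)
  have HG: "H \<subseteq> carrier G" using H subgroup.subset by auto
  have cH: "countable H" using HG countable_carrier countable_subset by blast
  have "H \<noteq> {}" using subgroup.one_closed[OF H] by auto
  then have "{x \<in> space M. \<forall>h\<in>H. act h x \<in> E} = (\<Inter>h\<in>H. {x \<in> space M. act h x \<in> E})" by auto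
  also have "\<dots> \<in> sets M"
    using cH \<open>H \<noteq> {}\<close> HG E vimage_sets by (intro sets.countable_INT') auto
  finally show "{x \<in> space M. \<forall>h\<in>H. act h x \<in> E} \<in> sets M" .
  fix k x assume k: "k \<in> H" and x: "x \<in> space M"
  have kG: "k \<in> carrier G" using k HG by blast
  have "(\<forall>h\<in>H. act h (act k x) \<in> E) \<longleftrightarrow> (\<forall>h\<in>H. act h x \<in> E)"
  proof
    assume *: "\<forall>h\<in>H. act h (act k x) \<in> E"
    show "\<forall>h\<in>H. act h x \<in> E"
    proof
      fix h assume h: "h \<in> H"
      then have "h \<otimes> inv k \<in> H" using k H by (simp add: subgroup.m_closed subgroup.m_inv_closed)
      then have "act (h \<otimes> inv k) (act k x) \<in> E" using * by blast
      moreover have "act (h \<otimes> inv k) (act k x) = act h x"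
        using h kG HG x by (subst act_mult) (auto simp: act_space act_inv_act subset_eq)
      ultimately show "act h x \<in> E" by simp
    qed
  next
    assume *: "\<forall>h\<in>H. act h x \<in> E"
    show "\<forall>h\<in>H. act h (act k x) \<in> E"
    proof
      fix h assume h: "h \<in> H"
      then have "act (h \<otimes> k) x \<in> E" using * k H by (simp add: subgroup.m_closed)
      then show "act h (act k x) \<in> E" using h kG HG x by (subst (asm) act_mult) auto
    qed
  qed
  then show "act k x \<in> {x \<in> space M. \<forall>h\<in>H. act h x \<in> E} \<longleftrightarrow> x \<in> {x \<in> space M. \<forall>h\<in>H. act h x \<in> E}"
    using x kG act_space by auto
qed

lemma positive_fund:
  assumes "subgroup H G" "fund H Z" "emeasure M (space M) \<noteq> 0"
  shows "emeasure M Z \<noteq> 0"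
proof
  assume 0: "emeasure M Z = 0"
  have "emeasure M (space M) = (\<integral>\<^sup>+x. 1 \<partial>M)" by simp
  also have "\<dots> = (\<integral>\<^sup>+h. (\<integral>\<^sup>+x. 1 * indicator Z x \<partial>M) \<partial>count_space H)"
    by (rule unfold_aux[OF assms(1,2)]) simp
  also have "\<dots> = 0" using 0 fund_sets[OF assms(2)] by simp
  finally show False using assms(3) by simp
qed

text \<open>The position \<open>g\<close> with \<open>x \<in> g Z\<close>; it is an equivariant map to the group.\<close>

definition pos :: "'s set \<Rightarrow> 's \<Rightarrow> 'a" where
  "pos Z x = inv (retr (carrier G) Z x)"

lemma pos_closed [simp]: "fund (carrier G) Z \<Longrightarrow> x \<in> space M \<Longrightarrow> pos Z x \<in> carrier G"
  by (simp add: pos_def retr)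

lemma pos_eqI:
  assumes "fund (carrier G) Z" "x \<in> space M" "g \<in> carrier G" "act (inv g) x \<in> Z"
  shows "pos Z x = g"
  using retr_eq[OF assms(1,2) _ assms(4)] assms(3) by (simp add: pos_def)

lemma act_inv_pos:
  assumes "fund (carrier G) Z" "x \<in> space M" shows "act (inv (pos Z x)) x \<in> Z"
  using retr[OF assms] by (simp add: pos_def)

lemma pos_eq_iff:
  assumes "fund (carrier G) Z" "x \<in> space M" "g \<in> carrier G"
  shows "pos Z x = g \<longleftrightarrow> act (inv g) x \<in> Z"
  using pos_eqI[OF assms] act_inv_pos[OF assms(1,2)] by blast

lemma pos_act:
  assumes "fund (carrier G) Z" "x \<in> space M" "g \<in> carrier G"
  shows "pos Z (act g x) = g \<otimes> pos Z x"
proof (rule pos_eqI)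
  have "act (inv (g \<otimes> pos Z x)) (act g x) = act (inv (pos Z x)) (act (inv g) (act g x))"
    using assms by (simp add: inv_mult_group act_mult act_space)
  then show "act (inv (g \<otimes> pos Z x)) (act g x) \<in> Z"
    using assms act_inv_pos by (simp add: act_inv_act)
qed (simp_all add: assms act_space)

lemma pos_measurable:
  assumes "fund (carrier G) Z" shows "pos Z \<in> measurable M (count_space (carrier G))"
proof (rule measurableI)
  fix A assume "A \<in> sets (count_space (carrier G))"
  then have A: "A \<subseteq> carrier G" "countable A" using countable_carrier countable_subset by auto
  have "pos Z -` A \<inter> space M = (\<Union>g\<in>A. {x \<in> space M. act (inv g) x \<in> Z})"
    using pos_eq_iff[OF assms] A by blast
  also have "\<dots> \<in> sets M"
    using A fund_sets[OF assms] by (intro sets.countable_UN' vimage_sets) (auto intro: vimage_sets)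
  finally show "pos Z -` A \<inter> space M \<in> sets M" .
qed (simp add: assms)

lemma pos_one:
  assumes "fund (carrier G) Z" "x \<in> Z" shows "pos Z x = \<one>"
proof (rule pos_eqI)
  show x: "x \<in> space M" using assms fund_sets sets.sets_into_space by blast
  show "act (inv \<one>) x \<in> Z" using act_one[OF x] assms by simp
qed (simp_all add: assms)

end

text \<open>Models the quotient of \<open>M\<close> by a group with fundamental domain
  \<open>Z\<close> without changing the points: \<open>\<A>\<close> will consist of invariant sets,
  whose mass is read off inside \<open>Z\<close>.\<close>

definition sub_meas :: "'s measure \<Rightarrow> 's set set \<Rightarrow> 's set \<Rightarrow> 's measure" where
  "sub_meas M \<A> Z = measure_of (space M) \<A> (\<lambda>E. emeasure M (E \<inter> Z))"

lemma
  assumes "sigma_algebra (space M) \<A>"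
  shows space_sub_meas [simp]: "space (sub_meas M \<A> Z) = space M"
    and sets_sub_meas: "sets (sub_meas M \<A> Z) = \<A>"
  using assms by (simp_all add: sub_meas_def sigma_algebra.sets_measure_of_eq sigma_algebra.space_measure_of_eq)

lemma emeasure_sub_meas:
  assumes A: "sigma_algebra (space M) \<A>" "\<A> \<subseteq> sets M" and Z: "Z \<in> sets M" and E: "E \<in> \<A>"
  shows "emeasure (sub_meas M \<A> Z) E = emeasure M (E \<inter> Z)"
proof (rule emeasure_measure_of[OF sub_meas_def])
  show "\<A> \<subseteq> Pow (space M)" using A sets.sets_into_space by blast
  show "E \<in> sets (sub_meas M \<A> Z)" using A E by (simp add: sets_sub_meas)
  show "positive (sets (sub_meas M \<A> Z)) (\<lambda>E. emeasure M (E \<inter> Z))" by (simp add: positive_def)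
  show "countably_additive (sets (sub_meas M \<A> Z)) (\<lambda>E. emeasure M (E \<inter> Z))"
    unfolding countably_additive_def sets_sub_meas[OF A(1)]
  proof (intro allI impI)
    fix F :: "nat \<Rightarrow> _" assume F: "range F \<subseteq> \<A>" "disjoint_family F" "(\<Union>i. F i) \<in> \<A>"
    have "(\<Sum>i. emeasure M (F i \<inter> Z)) = emeasure M (\<Union>i. F i \<inter> Z)"
    proof (intro suminf_emeasure)
      show "range (\<lambda>i. F i \<inter> Z) \<subseteq> sets M" using F(1) A(2) Z by blast
      show "disjoint_family (\<lambda>i. F i \<inter> Z)" using F(2) by (auto simp: disjoint_family_on_def)
    qed
    then show "(\<Sum>i. emeasure M (F i \<inter> Z)) = emeasure M ((\<Union>i. F i) \<inter> Z)"
      by simp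
  qed
qed

text \<open>The disjoint union of the measures \<open>N j\<close>, all living on the same points. It
  is introduced because recurrence will be known only for a sum over \<open>j\<close>, not for an
  individual quotient.\<close>

definition family_meas :: "'s set \<Rightarrow> 'j set \<Rightarrow> ('j \<Rightarrow> 's measure) \<Rightarrow> ('s \<times> 'j) measure" where
  "family_meas \<Omega> J N = measure_of (\<Omega> \<times> J)
     {W. W \<subseteq> \<Omega> \<times> J \<and> (\<forall>j\<in>J. {x. (x, j) \<in> W} \<in> sets (N j))}
     (\<lambda>W. \<Sum>j\<in>J. emeasure (N j) {x. (x, j) \<in> W})"

context
  fixes \<Omega> :: "'s set" and J :: "'j set" and N :: "'j \<Rightarrow> 's measure"
  assumes sp: "\<And>j. j \<in> J \<Longrightarrow> space (N j) = \<Omega>" and J: "finite J"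
begin

lemma family_algebra: "sigma_algebra (\<Omega> \<times> J) {W. W \<subseteq> \<Omega> \<times> J \<and> (\<forall>j\<in>J. {x. (x, j) \<in> W} \<in> sets (N j))}"
  unfolding sigma_algebra_iff2
proof (intro conjI ballI allI impI)
  fix W assume W: "W \<in> {W. W \<subseteq> \<Omega> \<times> J \<and> (\<forall>j\<in>J. {x. (x, j) \<in> W} \<in> sets (N j))}"
  have "{x. (x, j) \<in> \<Omega> \<times> J - W} = space (N j) - {x. (x, j) \<in> W}" if "j \<in> J" for j
    using that by (auto simp: sp)
  then show "\<Omega> \<times> J - W \<in> {W. W \<subseteq> \<Omega> \<times> J \<and> (\<forall>j\<in>J. {x. (x, j) \<in> W} \<in> sets (N j))}"
    using W by auto
next
  fix F :: "nat \<Rightarrow> _"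
  assume F: "range F \<subseteq> {W. W \<subseteq> \<Omega> \<times> J \<and> (\<forall>j\<in>J. {x. (x, j) \<in> W} \<in> sets (N j))}"
  have "{x. (x, j) \<in> (\<Union>i. F i)} \<in> sets (N j)" if "j \<in> J" for j
  proof -
    have "(\<Union>i. {x. (x, j) \<in> F i}) \<in> sets (N j)" using F that by (intro sets.countable_UN) auto
    moreover have "{x. (x, j) \<in> (\<Union>i. F i)} = (\<Union>i. {x. (x, j) \<in> F i})" by auto
    ultimately show ?thesis by simp
  qed
  then show "(\<Union>i. F i) \<in> {W. W \<subseteq> \<Omega> \<times> J \<and> (\<forall>j\<in>J. {x. (x, j) \<in> W} \<in> sets (N j))}"
    using F by blast
qed auto

lemma space_family: "space (family_meas \<Omega> J N) = \<Omega> \<times> J"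
  using family_algebra by (simp add: family_meas_def sigma_algebra.space_measure_of_eq)

lemma sets_family:
  "W \<in> sets (family_meas \<Omega> J N) \<longleftrightarrow> W \<subseteq> \<Omega> \<times> J \<and> (\<forall>j\<in>J. {x. (x, j) \<in> W} \<in> sets (N j))"
  unfolding family_meas_def sigma_algebra.sets_measure_of_eq[OF family_algebra] by simp

lemma emeasure_family:
  assumes "W \<in> sets (family_meas \<Omega> J N)"
  shows "emeasure (family_meas \<Omega> J N) W = (\<Sum>j\<in>J. emeasure (N j) {x. (x, j) \<in> W})"
proof (rule emeasure_measure_of[OF family_meas_def])
  show "positive (sets (family_meas \<Omega> J N)) (\<lambda>W. \<Sum>j\<in>J. emeasure (N j) {x. (x, j) \<in> W})"
    by (simp add: positive_def)
  show "countably_additive (sets (family_meas \<Omega> J N)) (\<lambda>W. \<Sum>j\<in>J. emeasure (N j) {x. (x, j) \<in> W})"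
    unfolding countably_additive_def
  proof (intro allI impI)
    fix F :: "nat \<Rightarrow> _"
    assume F: "range F \<subseteq> sets (family_meas \<Omega> J N)" "disjoint_family F"
    have "(\<Sum>i. emeasure (N j) {x. (x, j) \<in> F i}) = emeasure (N j) {x. (x, j) \<in> (\<Union>i. F i)}" if "j \<in> J" for j
    proof -
      have "(\<Sum>i. emeasure (N j) {x. (x, j) \<in> F i}) = emeasure (N j) (\<Union>i. {x. (x, j) \<in> F i})"
      proof (rule suminf_emeasure)
        show "range (\<lambda>i. {x. (x, j) \<in> F i}) \<subseteq> sets (N j)" using F(1) that sets_family by blast
        show "disjoint_family (\<lambda>i. {x. (x, j) \<in> F i})" using F(2) unfolding disjoint_family_on_def by blast
      qed
      moreover have "{x. (x, j) \<in> (\<Union>i. F i)} = (\<Union>i. {x. (x, j) \<in> F i})" by auto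
      ultimately show ?thesis by simp
    qed
    then show "(\<Sum>i. \<Sum>j\<in>J. emeasure (N j) {x. (x, j) \<in> F i}) = (\<Sum>j\<in>J. emeasure (N j) {x. (x, j) \<in> (\<Union>i. F i)})"
      by (subst suminf_sum) auto
  qed
qed (use assms sets_family in auto)

text \<open>The maps act on all copies at once, so that the sum in \<open>rec\<close> is the measure
  of the returns to a single set of the disjoint union. An invariant set of the union has positive
  mass on some copy, and its trace there is invariant.\<close>

lemma family_recurrent:
  fixes A :: "'i set" and T :: "'i \<Rightarrow> 's \<Rightarrow> 's"
  assumes meas: "\<And>a j. a \<in> A \<Longrightarrow> j \<in> J \<Longrightarrow> T a \<in> measurable (N j) (N j)"
    and pres: "\<And>a j E. a \<in> A \<Longrightarrow> j \<in> J \<Longrightarrow> E \<in> sets (N j) \<Longrightarrow> emeasure (N j) {x \<in> \<Omega>. T a x \<in> E} = emeasure (N j) E"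
    and comp: "\<And>a b. a \<in> A \<Longrightarrow> b \<in> A \<Longrightarrow> \<exists>e\<in>A. \<forall>x\<in>\<Omega>. T a (T b x) = T e x"
    and D: "\<And>j. j \<in> J \<Longrightarrow> D j \<in> sets (N j)" "\<And>j. j \<in> J \<Longrightarrow> emeasure (N j) (D j) < \<infinity>"
    and c: "c > 0" and A: "A \<noteq> {}"
    and rec: "\<And>a. a \<in> A \<Longrightarrow> (\<Sum>j\<in>J. emeasure (N j) {x \<in> \<Omega>. x \<in> D j \<and> T a x \<in> D j}) \<ge> ennreal c"
  shows "\<exists>j\<in>J. \<exists>E\<in>sets (N j). 0 < emeasure (N j) E \<and> emeasure (N j) E < \<infinity> \<and>
    (\<forall>a\<in>A. AE x in N j. T a x \<in> E \<longleftrightarrow> x \<in> E)"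
proof -
  let ?N = "family_meas \<Omega> J N"
  define S where "S a = (\<lambda>(x, j :: 'j). (T a x, j))" for a
  define D' where "D' = {(x, j). j \<in> J \<and> x \<in> D j}"
  have T_space: "T a x \<in> \<Omega>" if "a \<in> A" "j \<in> J" "x \<in> \<Omega>" for a x j
    using measurable_space[OF meas[OF that(1,2)]] that sp by auto
  have D_sub: "D j \<subseteq> \<Omega>" if "j \<in> J" for j using D(1)[OF that] sets.sets_into_space sp[OF that] by blast
  have vim: "T a -` E \<inter> space (N j) = {x \<in> \<Omega>. T a x \<in> E}" if "j \<in> J" for a E j
    using sp[OF that] by auto
  have S_meas: "S a \<in> measurable ?N ?N" if a: "a \<in> A" for a
  proof (rule measurableI)
    fix z assume "z \<in> space ?N" then show "S a z \<in> space ?N"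
      using T_space a by (auto simp: space_family S_def)
  next
    fix W assume W: "W \<in> sets ?N"
    have "{x. (x, j) \<in> S a -` W \<inter> space ?N} \<in> sets (N j)" if j: "j \<in> J" for j
    proof -
      have "{x. (x, j) \<in> S a -` W \<inter> space ?N} = T a -` {x. (x, j) \<in> W} \<inter> space (N j)"
        using j by (auto simp: S_def space_family sp)
      moreover have "T a -` {x. (x, j) \<in> W} \<inter> space (N j) \<in> sets (N j)"
        using W j by (intro measurable_sets[OF meas[OF a j]]) (simp add: sets_family)
      ultimately show ?thesis by (simp only:)
    qed
    then show "S a -` W \<inter> space ?N \<in> sets ?N" by (auto simp: sets_family space_family)
  qed
  interpret R: recurrent_set ?N A S D' c
  proof
    fix a assume a: "a \<in> A"
    show "S a \<in> measurable ?N ?N" by (rule S_meas[OF a])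
    show "distr ?N ?N (S a) = ?N"
    proof (rule measure_eqI)
      fix W assume "W \<in> sets (distr ?N ?N (S a))"
      then have W: "W \<in> sets ?N" by simp
      have "emeasure (distr ?N ?N (S a)) W = emeasure ?N (S a -` W \<inter> space ?N)"
        using W S_meas[OF a] by (simp add: emeasure_distr)
      also have "\<dots> = (\<Sum>j\<in>J. emeasure (N j) {x. (x, j) \<in> S a -` W \<inter> space ?N})"
        using measurable_sets[OF S_meas[OF a] W] by (rule emeasure_family)
      also have "\<dots> = (\<Sum>j\<in>J. emeasure (N j) {x. (x, j) \<in> W})"
      proof (rule sum.cong)
        fix j assume j: "j \<in> J"
        have "{x. (x, j) \<in> S a -` W \<inter> space ?N} = {x \<in> \<Omega>. T a x \<in> {x. (x, j) \<in> W}}"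
          using j by (auto simp: S_def space_family)
        moreover have "emeasure (N j) {x \<in> \<Omega>. T a x \<in> {x. (x, j) \<in> W}} = emeasure (N j) {x. (x, j) \<in> W}"
          using W j by (intro pres[OF a j]) (simp add: sets_family)
        ultimately show "emeasure (N j) {x. (x, j) \<in> S a -` W \<inter> space ?N} = emeasure (N j) {x. (x, j) \<in> W}"
          by (simp only:)
      qed simp
      also have "\<dots> = emeasure ?N W" using W by (simp add: emeasure_family)
      finally show "emeasure (distr ?N ?N (S a)) W = emeasure ?N W" .
    qed simp
    have "{x. (x, j) \<in> {z \<in> space ?N. z \<in> D' \<and> S a z \<in> D'}} = {x \<in> \<Omega>. x \<in> D j \<and> T a x \<in> D j}" if "j \<in> J" for j
      using that by (auto simp: S_def space_family D'_def)
    moreover have "{x \<in> \<Omega>. x \<in> D j \<and> T a x \<in> D j} \<in> sets (N j)" if "j \<in> J" for j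
    proof -
      have "{x \<in> \<Omega>. x \<in> D j \<and> T a x \<in> D j} = D j \<inter> (T a -` D j \<inter> space (N j))"
        using D_sub[OF that] by (auto simp: sp[OF that])
      then show ?thesis using measurable_sets[OF meas[OF a that] D(1)[OF that]] D(1)[OF that] by simp
    qed
    ultimately have *: "{x. (x, j) \<in> {z \<in> space ?N. z \<in> D' \<and> S a z \<in> D'}} = {x \<in> \<Omega>. x \<in> D j \<and> T a x \<in> D j}"
        "{x. (x, j) \<in> {z \<in> space ?N. z \<in> D' \<and> S a z \<in> D'}} \<in> sets (N j)" if "j \<in> J" for j
      using that by auto
    have m: "{z \<in> space ?N. z \<in> D' \<and> S a z \<in> D'} \<in> sets ?N"
      using *(2) by (subst sets_family) (auto simp: space_family)
    show "emeasure ?N {z \<in> space ?N. z \<in> D' \<and> S a z \<in> D'} \<ge> ennreal c"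
    proof -
      have "(\<Sum>j\<in>J. emeasure (N j) {x. (x, j) \<in> {z \<in> space ?N. z \<in> D' \<and> S a z \<in> D'}}) =
          (\<Sum>j\<in>J. emeasure (N j) {x \<in> \<Omega>. x \<in> D j \<and> T a x \<in> D j})"
        by (intro sum.cong refl) (simp only: *(1))
      then show ?thesis using rec[OF a] unfolding emeasure_family[OF m] by (simp only:)
    qed
  next
    fix a b assume "a \<in> A" "b \<in> A"
    then obtain e where e: "e \<in> A" "\<forall>x\<in>\<Omega>. T a (T b x) = T e x" using comp by blast
    then show "\<exists>e\<in>A. \<forall>z\<in>space ?N. S a (S b z) = S e z"
      by (intro bexI[of _ e]) (auto simp: S_def space_family)
  next
    have Dj: "{x. (x, j) \<in> D'} = D j" if "j \<in> J" for j using that by (simp add: D'_def)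
    then show m: "D' \<in> sets ?N" using D(1) D_sub by (subst sets_family) (auto simp: D'_def)
    have "(\<Sum>j\<in>J. emeasure (N j) {x. (x, j) \<in> D'}) < \<infinity>"
      using D(2) Dj J by (auto simp: less_top[symmetric])
    then show "emeasure ?N D' < \<infinity>" by (simp add: emeasure_family[OF m])
  qed (use c A in auto)
  obtain E where E: "E \<in> sets ?N" "0 < emeasure ?N E" "emeasure ?N E < \<infinity>"
      "\<And>a. a \<in> A \<Longrightarrow> AE z in ?N. S a z \<in> E \<longleftrightarrow> z \<in> E"
    using R.invariant_set by blast
  let ?E = "\<lambda>j. {x. (x, j) \<in> E}"
  have eE: "emeasure ?N E = (\<Sum>j\<in>J. emeasure (N j) (?E j))" using E(1) by (rule emeasure_family)
  have "\<exists>j\<in>J. emeasure (N j) (?E j) \<noteq> 0"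
  proof (rule ccontr)
    assume "\<not> ?thesis"
    then have "emeasure ?N E = 0" using eE by simp
    then show False using E(2) by simp
  qed
  then obtain j where j: "j \<in> J" "emeasure (N j) (?E j) \<noteq> 0" by blast
  have Ej: "?E j \<in> sets (N j)" using E(1) j(1) by (simp add: sets_family)
  have "emeasure (N j) (?E j) \<le> emeasure ?N E"
    unfolding eE using J j by (intro sum_nonneg_leq_bound[OF _ _ refl]) auto
  then have fin: "emeasure (N j) (?E j) < \<infinity>" using E(3) by simp
  have "AE x in N j. T a x \<in> ?E j \<longleftrightarrow> x \<in> ?E j" if a: "a \<in> A" for a
  proof -
    let ?B = "{z \<in> space ?N. \<not> (S a z \<in> E \<longleftrightarrow> z \<in> E)}"
    have [measurable]: "S a \<in> measurable ?N ?N" "E \<in> sets ?N" using S_meas[OF a] E by auto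
    have B: "?B \<in> sets ?N" by measurable
    have "emeasure ?N ?B = 0" using E(4)[OF a] B by (subst AE_iff_measurable[symmetric, of ?B]) auto
    then have "(\<Sum>j\<in>J. emeasure (N j) {x. (x, j) \<in> ?B}) = 0" by (simp only: emeasure_family[OF B])
    then have "\<forall>j\<in>J. emeasure (N j) {x. (x, j) \<in> ?B} = 0" by (subst (asm) sum_eq_0_iff[OF J])
    then have "emeasure (N j) {x. (x, j) \<in> ?B} = 0" using j(1) by (rule bspec)
    moreover have "{x. (x, j) \<in> ?B} \<in> sets (N j)" using B j by (simp add: sets_family)
    moreover have "{x \<in> space (N j). \<not> (T a x \<in> ?E j \<longleftrightarrow> x \<in> ?E j)} = {x. (x, j) \<in> ?B}"
      using j by (auto simp: S_def space_family sp)
    ultimately show ?thesis by (intro AE_I[of _ _ "{x. (x, j) \<in> ?B}"]) auto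
  qed
  then show ?thesis using j Ej fin by (intro bexI[of _ j] bexI[of _ "?E j"]) (auto simp: zero_less_iff_neq_zero)
qed

end

section \<open>Finite approximation and products of finitely supported probabilities\<close>

lemma finite_range_approx:
  fixes k :: "'s \<Rightarrow> 'c"
  assumes k: "k \<in> measurable M (count_space I)" and I: "countable I"
    and Y: "Y \<in> sets M" "emeasure M Y < \<infinity>" and e: "e > 0"
  shows "\<exists>C. finite C \<and> C \<subseteq> I \<and> emeasure M {x \<in> Y. k x \<notin> C} < ennreal e"
proof -
  define F where "F n = {i \<in> I. to_nat_on I i \<le> n}" for n
  have finF: "finite (F n)" for n
  proof (rule inj_on_finite)
    show "inj_on (to_nat_on I) (F n)" using I by (auto simp: F_def inj_on_def)
    show "to_nat_on I ` F n \<subseteq> {..n}" by (auto simp: F_def)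
  qed simp
  let ?B = "\<lambda>n. {x \<in> Y. k x \<notin> F n}"
  have Ysp: "Y \<subseteq> space M" using Y sets.sets_into_space by blast
  have B: "?B n \<in> sets M" for n
  proof -
    have "?B n = Y - (k -` F n \<inter> space M)" using Ysp by auto
    moreover have "k -` F n \<inter> space M \<in> sets M" using k by (rule measurable_sets) (auto simp: F_def)
    ultimately show ?thesis using Y by simp
  qed
  have "(\<lambda>n. emeasure M (?B n)) \<longlonglongrightarrow> emeasure M (\<Inter>n. ?B n)"
  proof (rule Lim_emeasure_decseq)
    show "range ?B \<subseteq> sets M" using B by auto
    show "decseq ?B" by (auto simp: decseq_def F_def)
    show "emeasure M (?B n) \<noteq> \<infinity>" for n
    proof -
      have "emeasure M (?B n) \<le> emeasure M Y" using Y by (intro emeasure_mono) auto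
      then show ?thesis using Y by auto
    qed
  qed
  moreover have "(\<Inter>n. ?B n) = {}"
  proof -
    have "k x \<in> F (to_nat_on I (k x))" if "x \<in> Y" for x
      using measurable_space[OF k] that Ysp by (auto simp: F_def)
    then show ?thesis by blast
  qed
  ultimately have "(\<lambda>n. emeasure M (?B n)) \<longlonglongrightarrow> 0" by simp
  then have "\<forall>\<^sub>F n in sequentially. emeasure M (?B n) < ennreal e" using e by (intro order_tendstoD) auto
  then obtain n where "emeasure M (?B n) < ennreal e" by (auto simp: eventually_sequentially)
  then show ?thesis using finF by (intro exI[of _ "F n"]) (auto simp: F_def)
qed

lemma sum_PiE_insert:
  fixes f :: "_ \<Rightarrow> 'c::comm_monoid_add"
  assumes "i \<notin> I"
  shows "(\<Sum>l\<in>PiE (insert i I) W. f l) = (\<Sum>y\<in>W i. \<Sum>g\<in>PiE I W. f (g(i := y)))"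
proof -
  have inj: "inj_on (\<lambda>(y, g). g(i := y)) (W i \<times> PiE I W)"
  proof (rule inj_onI)
    fix a b assume ab: "a \<in> W i \<times> PiE I W" "b \<in> W i \<times> PiE I W" "(\<lambda>(y, g). g(i := y)) a = (\<lambda>(y, g). g(i := y)) b"
    obtain y g z h where eq: "a = (y, g)" "b = (z, h)" by (metis prod.exhaust)
    have gh: "g \<in> PiE I W" "h \<in> PiE I W" "g(i := y) = h(i := z)" using ab eq by auto
    have "g i = h i" using gh(1,2) assms by (auto simp: PiE_def extensional_def)
    then have "g = h" using gh(3) by (metis fun_upd_triv fun_upd_upd)
    moreover have "y = z" using fun_cong[OF gh(3), of i] by simp
    ultimately show "a = b" using eq by simp
  qed
  have "(\<Sum>l\<in>PiE (insert i I) W. f l) = (\<Sum>l\<in>(\<lambda>(y, g). g(i := y)) ` (W i \<times> PiE I W). f l)"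
    by (simp add: PiE_insert_eq)
  also have "\<dots> = (\<Sum>(y, g)\<in>W i \<times> PiE I W. f (g(i := y)))"
    using inj by (simp add: sum.reindex case_prod_unfold)
  also have "\<dots> = (\<Sum>y\<in>W i. \<Sum>g\<in>PiE I W. f (g(i := y)))" by (simp add: sum.cartesian_product)
  finally show ?thesis .
qed

lemma prod_prob_sum:
  fixes u :: "'j \<Rightarrow> 'b \<Rightarrow> real"
  assumes "finite J" "\<And>j. j \<in> J \<Longrightarrow> (\<Sum>x\<in>W j. u j x) = 1"
  shows "(\<Sum>l\<in>PiE J W. \<Prod>j\<in>J. u j (l j)) = 1"
proof -
  have "finite (W j)" if "j \<in> J" for j using assms(2)[OF that] by (metis sum.infinite zero_neq_one)
  then show ?thesis using assms by (simp add: prod_sum_PiE[symmetric])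
qed

text \<open>The factors are exchanged one at a time. The remaining factors form a product of
  probabilities of total mass 1, so each exchange costs at most \<open>e\<close>.\<close>

lemma prod_prob_diff:
  fixes u v :: "'j \<Rightarrow> 'b \<Rightarrow> real" and e :: real
  assumes "finite J" "\<And>j. j \<in> J \<Longrightarrow> (\<Sum>x\<in>W j. u j x) = 1" "\<And>j. j \<in> J \<Longrightarrow> (\<Sum>x\<in>W j. v j x) = 1"
    and "\<And>j x. j \<in> J \<Longrightarrow> u j x \<ge> 0" "\<And>j x. j \<in> J \<Longrightarrow> v j x \<ge> 0"
    and "\<And>j. j \<in> J \<Longrightarrow> (\<Sum>x\<in>W j. \<bar>u j x - v j x\<bar>) \<le> e"
  shows "(\<Sum>l\<in>PiE J W. \<bar>(\<Prod>j\<in>J. u j (l j)) - (\<Prod>j\<in>J. v j (l j))\<bar>) \<le> card J * e"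
  using assms
proof (induction J)
  case (insert i I)
  let ?U = "\<lambda>g. \<Prod>j\<in>I. u j (g j)" and ?V = "\<lambda>g. \<Prod>j\<in>I. v j (g j)"
  have U1: "(\<Sum>g\<in>PiE I W. ?U g) = 1" using insert by (intro prod_prob_sum) auto
  have "(\<Sum>l\<in>PiE (insert i I) W. \<bar>(\<Prod>j\<in>insert i I. u j (l j)) - (\<Prod>j\<in>insert i I. v j (l j))\<bar>) =
     (\<Sum>y\<in>W i. \<Sum>g\<in>PiE I W. \<bar>(\<Prod>j\<in>insert i I. u j ((g(i := y)) j)) - (\<Prod>j\<in>insert i I. v j ((g(i := y)) j))\<bar>)"
    by (rule sum_PiE_insert) (rule insert)
  also have "\<dots> \<le> (\<Sum>y\<in>W i. \<Sum>g\<in>PiE I W. \<bar>u i y - v i y\<bar> * ?U g + v i y * \<bar>?U g - ?V g\<bar>)"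
  proof (intro sum_mono)
    fix y g
    have "(\<Prod>j\<in>I. u j ((g(i := y)) j)) = ?U g" "(\<Prod>j\<in>I. v j ((g(i := y)) j)) = ?V g"
      using insert by (auto intro!: prod.cong)
    then have "(\<Prod>j\<in>insert i I. u j ((g(i := y)) j)) - (\<Prod>j\<in>insert i I. v j ((g(i := y)) j)) =
        (u i y - v i y) * ?U g + v i y * (?U g - ?V g)"
      using insert by (simp add: algebra_simps)
    moreover have "\<bar>(u i y - v i y) * ?U g + v i y * (?U g - ?V g)\<bar> \<le> \<bar>u i y - v i y\<bar> * ?U g + v i y * \<bar>?U g - ?V g\<bar>"
    proof -
      have "?U g \<ge> 0" "v i y \<ge> 0" using insert by (auto intro!: prod_nonneg)
      then have "\<bar>(u i y - v i y) * ?U g\<bar> = \<bar>u i y - v i y\<bar> * ?U g" "\<bar>v i y * (?U g - ?V g)\<bar> = v i y * \<bar>?U g - ?V g\<bar>"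
        by (simp_all add: abs_mult)
      then show ?thesis using abs_triangle_ineq[of "(u i y - v i y) * ?U g" "v i y * (?U g - ?V g)"] by linarith
    qed
    ultimately show "\<bar>(\<Prod>j\<in>insert i I. u j ((g(i := y)) j)) - (\<Prod>j\<in>insert i I. v j ((g(i := y)) j))\<bar> \<le>
      \<bar>u i y - v i y\<bar> * ?U g + v i y * \<bar>?U g - ?V g\<bar>" by simp
  qed
  also have "\<dots> = (\<Sum>y\<in>W i. \<bar>u i y - v i y\<bar>) + (\<Sum>y\<in>W i. v i y) * (\<Sum>g\<in>PiE I W. \<bar>?U g - ?V g\<bar>)"
    using U1 by (simp add: sum.distrib sum_distrib_left[symmetric] sum_distrib_right[symmetric])
  also have "\<dots> \<le> e + 1 * (card I * e)"
    using insert by (intro add_mono) auto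
  finally show ?case using insert by (simp add: algebra_simps)
qed simp

definition fin_prob :: "'b set \<Rightarrow> ('b \<Rightarrow> real) \<Rightarrow> bool" where
  "fin_prob C u \<longleftrightarrow> (\<forall>x. u x \<ge> 0) \<and>
     (\<exists>U. finite U \<and> U \<subseteq> C \<and> (\<forall>x. x \<notin> U \<longrightarrow> u x = 0) \<and> (\<Sum>x\<in>U. u x) = 1)"

lemma fin_prob_common:
  assumes "fin_prob C u" "fin_prob C v"
  obtains U where "finite U" "U \<subseteq> C" "\<And>x. x \<notin> U \<Longrightarrow> u x = 0" "\<And>x. x \<notin> U \<Longrightarrow> v x = 0"
    "(\<Sum>x\<in>U. u x) = 1" "(\<Sum>x\<in>U. v x) = 1"
proof -
  obtain U V where U: "finite U" "U \<subseteq> C" "\<forall>x. x \<notin> U \<longrightarrow> u x = 0" "(\<Sum>x\<in>U. u x) = 1"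
    and V: "finite V" "V \<subseteq> C" "\<forall>x. x \<notin> V \<longrightarrow> v x = 0" "(\<Sum>x\<in>V. v x) = 1"
    using assms unfolding fin_prob_def by blast
  have "(\<Sum>x\<in>U \<union> V. u x) = (\<Sum>x\<in>U. u x)" by (rule sum.mono_neutral_right) (use U V in auto)
  then have su: "(\<Sum>x\<in>U \<union> V. u x) = 1" using U(4) by simp
  have "(\<Sum>x\<in>U \<union> V. v x) = (\<Sum>x\<in>V. v x)" by (rule sum.mono_neutral_right) (use U V in auto)
  then have sv: "(\<Sum>x\<in>U \<union> V. v x) = 1" using V(4) by simp
  show thesis by (rule that[OF _ _ _ _ su sv]) (use U V in auto)
qed

text \<open>Both products vanish outside the finite product of the common supports \<open>W\<close>,
  so the integrals over the full carrier are finite sums. The bound 2, valid for any two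
  probabilities, is meant for the exceptional points.\<close>

lemma prod_prob_nn:
  fixes u v :: "'j \<Rightarrow> 'b \<Rightarrow> real" and e :: real
  assumes J: "finite J" and uv: "\<And>j. j \<in> J \<Longrightarrow> fin_prob (C j) (u j)" "\<And>j. j \<in> J \<Longrightarrow> fin_prob (C j) (v j)"
  shows "(\<integral>\<^sup>+l. (\<Prod>j\<in>J. u j (l j)) \<partial>count_space (PiE J C)) = 1"
    and "(\<integral>\<^sup>+l. \<bar>(\<Prod>j\<in>J. u j (l j)) - (\<Prod>j\<in>J. v j (l j))\<bar> \<partial>count_space (PiE J C)) \<le> 2"
    and "(\<And>j U. j \<in> J \<Longrightarrow> finite U \<Longrightarrow> (\<Sum>x\<in>U. \<bar>u j x - v j x\<bar>) \<le> e) \<Longrightarrow>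
      (\<integral>\<^sup>+l. \<bar>(\<Prod>j\<in>J. u j (l j)) - (\<Prod>j\<in>J. v j (l j))\<bar> \<partial>count_space (PiE J C)) \<le> ennreal (card J * e)"
proof -
  have "\<forall>j\<in>J. \<exists>U. finite U \<and> U \<subseteq> C j \<and> (\<forall>x. x \<notin> U \<longrightarrow> u j x = 0) \<and> (\<forall>x. x \<notin> U \<longrightarrow> v j x = 0) \<and>
    (\<Sum>x\<in>U. u j x) = 1 \<and> (\<Sum>x\<in>U. v j x) = 1"
    using fin_prob_common[OF uv] by (metis (no_types, lifting))
  then obtain W where W: "\<forall>j\<in>J. finite (W j) \<and> W j \<subseteq> C j \<and> (\<forall>x. x \<notin> W j \<longrightarrow> u j x = 0) \<and> (\<forall>x. x \<notin> W j \<longrightarrow> v j x = 0) \<and>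
    (\<Sum>x\<in>W j. u j x) = 1 \<and> (\<Sum>x\<in>W j. v j x) = 1"
    by (rule bchoice[THEN exE])
  have finP: "finite (PiE J W)" using J W by (intro finite_PiE) auto
  have sub: "PiE J W \<subseteq> PiE J C" using W by (intro PiE_mono) auto
  have pos: "u j x \<ge> 0" "v j x \<ge> 0" if "j \<in> J" for j x using uv that by (auto simp: fin_prob_def)
  have zero: "(\<Prod>j\<in>J. u j (l j)) = 0 \<and> (\<Prod>j\<in>J. v j (l j)) = 0" if "l \<in> PiE J C" "l \<notin> PiE J W" for l
  proof -
    obtain j where "j \<in> J" "l j \<notin> W j" using \<open>l \<in> PiE J C\<close> \<open>l \<notin> PiE J W\<close> by (auto simp: PiE_def Pi_def)
    then show ?thesis using W J by (auto simp: prod_zero_iff)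
  qed
  have eq: "(\<integral>\<^sup>+l. ennreal (f l) \<partial>count_space (PiE J C)) = ennreal (\<Sum>l\<in>PiE J W. f l)"
    if "\<And>l. l \<in> PiE J C \<Longrightarrow> l \<notin> PiE J W \<Longrightarrow> f l = 0" "\<And>l. l \<in> PiE J W \<Longrightarrow> f l \<ge> 0" for f :: "('j \<Rightarrow> 'b) \<Rightarrow> real"
  proof -
    have "(\<integral>\<^sup>+l. ennreal (f l) \<partial>count_space (PiE J C)) = (\<Sum>l\<in>PiE J W. ennreal (f l))"
      using finP sub that by (intro nn_integral_count_space') auto
    also have "\<dots> = ennreal (\<Sum>l\<in>PiE J W. f l)" using that by (intro sum_ennreal) auto
    finally show ?thesis .
  qed
  have su: "(\<Sum>l\<in>PiE J W. \<Prod>j\<in>J. u j (l j)) = 1" and sv: "(\<Sum>l\<in>PiE J W. \<Prod>j\<in>J. v j (l j)) = 1"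
    using J W by (auto intro!: prod_prob_sum)
  show "(\<integral>\<^sup>+l. (\<Prod>j\<in>J. u j (l j)) \<partial>count_space (PiE J C)) = 1"
    using zero pos su by (subst eq) (auto intro!: prod_nonneg)
  have diff: "(\<integral>\<^sup>+l. \<bar>(\<Prod>j\<in>J. u j (l j)) - (\<Prod>j\<in>J. v j (l j))\<bar> \<partial>count_space (PiE J C)) =
      ennreal (\<Sum>l\<in>PiE J W. \<bar>(\<Prod>j\<in>J. u j (l j)) - (\<Prod>j\<in>J. v j (l j))\<bar>)"
    using zero by (intro eq) auto
  have "(\<Sum>l\<in>PiE J W. \<bar>(\<Prod>j\<in>J. u j (l j)) - (\<Prod>j\<in>J. v j (l j))\<bar>) \<le>
     (\<Sum>l\<in>PiE J W. (\<Prod>j\<in>J. u j (l j)) + (\<Prod>j\<in>J. v j (l j)))"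
  proof (intro sum_mono)
    fix l
    have "(\<Prod>j\<in>J. u j (l j)) \<ge> 0" "(\<Prod>j\<in>J. v j (l j)) \<ge> 0" using pos by (auto intro!: prod_nonneg)
    then show "\<bar>(\<Prod>j\<in>J. u j (l j)) - (\<Prod>j\<in>J. v j (l j))\<bar> \<le> (\<Prod>j\<in>J. u j (l j)) + (\<Prod>j\<in>J. v j (l j))" by linarith
  qed
  also have "\<dots> = 2" using su sv by (simp add: sum.distrib)
  finally have "ennreal (\<Sum>l\<in>PiE J W. \<bar>(\<Prod>j\<in>J. u j (l j)) - (\<Prod>j\<in>J. v j (l j))\<bar>) \<le> ennreal 2"
    by (rule ennreal_leI)
  then show "(\<integral>\<^sup>+l. \<bar>(\<Prod>j\<in>J. u j (l j)) - (\<Prod>j\<in>J. v j (l j))\<bar> \<partial>count_space (PiE J C)) \<le> 2"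
    unfolding diff by simp
  show "(\<integral>\<^sup>+l. \<bar>(\<Prod>j\<in>J. u j (l j)) - (\<Prod>j\<in>J. v j (l j))\<bar> \<partial>count_space (PiE J C)) \<le> ennreal (card J * e)"
    if e: "\<And>j U. j \<in> J \<Longrightarrow> finite U \<Longrightarrow> (\<Sum>x\<in>U. \<bar>u j x - v j x\<bar>) \<le> e"
    unfolding diff using J W pos e by (intro ennreal_leI prod_prob_diff) auto
qed

section \<open>Couplings with a product\<close>

text \<open>The preimage of \<open>Z\<close> under \<open>T\<close> is another fundamental domain
  for \<open>H\<close>, and an invariant set has the same mass in both. So a measure preserving map
  that commutes with \<open>H\<close> also preserves the measure of the quotient.\<close>

lemma (in mp_action) commuting_quot:
  assumes H: "subgroup H G" and Z: "fund H Z" and E: "inv_set H E"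
    and T: "T \<in> measurable M M" "distr M M T = M"
    and comm: "\<And>h x. h \<in> H \<Longrightarrow> x \<in> space M \<Longrightarrow> T (act h x) = act h (T x)"
  shows "inv_set H {x \<in> space M. T x \<in> E}"
    and "emeasure M ({x \<in> space M. T x \<in> E} \<inter> Z) = emeasure M (E \<inter> Z)"
proof -
  have HG: "H \<subseteq> carrier G" using H subgroup.subset by auto
  have Tsp: "T x \<in> space M" if "x \<in> space M" for x using T(1) that by (rule measurable_space)
  have pre: "{x \<in> space M. T x \<in> S} \<in> sets M" if "S \<in> sets M" for S
    using measurable_sets[OF T(1) that] by (simp add: vimage_def Int_def conj_commute)
  have pre_m: "emeasure M {x \<in> space M. T x \<in> S} = emeasure M S" if S: "S \<in> sets M" for S
  proof -
    have "emeasure M S = emeasure (distr M M T) S" using T(2) by simp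
    also have "\<dots> = emeasure M (T -` S \<inter> space M)" using S T(1) by (simp add: emeasure_distr)
    also have "T -` S \<inter> space M = {x \<in> space M. T x \<in> S}" by auto
    finally show ?thesis by simp
  qed
  have Es: "E \<in> sets M" "Z \<in> sets M" using E Z inv_set_sets fund_sets by auto
  show inv: "inv_set H {x \<in> space M. T x \<in> E}"
    unfolding inv_set_def
  proof (intro conjI ballI pre[OF Es(1)])
    fix h x assume h: "h \<in> H" and x: "x \<in> space M"
    have "act h x \<in> space M" using h x HG act_space by auto
    then show "act h x \<in> {x \<in> space M. T x \<in> E} \<longleftrightarrow> x \<in> {x \<in> space M. T x \<in> E}"
      using x comm[OF h x] inv_set_D[OF E h Tsp[OF x]] by simp
  qed
  let ?Z = "{x \<in> space M. T x \<in> Z}"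
  have Z': "fund H ?Z"
    unfolding fund_def
  proof (intro conjI ballI pre[OF Es(2)])
    fix x assume x: "x \<in> space M"
    have "act h x \<in> ?Z \<longleftrightarrow> act h (T x) \<in> Z" if h: "h \<in> H" for h
      using comm[OF h x] act_space[of h x] x h HG by auto
    then have "(h \<in> H \<and> act h x \<in> ?Z) = (h \<in> H \<and> act h (T x) \<in> Z)" for h by blast
    moreover have "\<exists>!h. h \<in> H \<and> act h (T x) \<in> Z" using Z Tsp[OF x] unfolding fund_def by blast
    ultimately show "\<exists>!h. h \<in> H \<and> act h x \<in> ?Z" by presburger
  qed
  have "emeasure M ({x \<in> space M. T x \<in> E} \<inter> Z) = emeasure M ({x \<in> space M. T x \<in> E} \<inter> ?Z)"
    by (rule fund_indep_measure[OF H Z Z' inv])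
  also have "{x \<in> space M. T x \<in> E} \<inter> ?Z = {x \<in> space M. T x \<in> E \<inter> Z}" by auto
  also have "emeasure M \<dots> = emeasure M (E \<inter> Z)" using Es by (intro pre_m) auto
  finally show "emeasure M ({x \<in> space M. T x \<in> E} \<inter> Z) = emeasure M (E \<inter> Z)" .
qed

locale product_action = L: mp_action "product_group J \<Lambda>" M \<psi>
  for J :: "'j set" and \<Lambda> :: "'j \<Rightarrow> ('b, 'd) monoid_scheme" and M :: "'s measure" and \<psi> +
  fixes Y :: "'s set"
  assumes finJ: "finite J" and grp: "j \<in> J \<Longrightarrow> Group.group (\<Lambda> j)"
    and fundY: "L.fund (carrier (product_group J \<Lambda>)) Y" and finY: "emeasure M Y < \<infinity>"
    and nonzero: "emeasure M (space M) \<noteq> 0"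
begin

abbreviation "P \<equiv> product_group J \<Lambda>"
abbreviation "p \<equiv> L.pos Y"

text \<open>This is the product of the factors other than \<open>j\<close>, kept as a subgroup of
  full tuples so that no product over a smaller index set has to be formed.\<close>

definition ker :: "'j \<Rightarrow> ('j \<Rightarrow> 'b) set" where "ker j = {l \<in> carrier P. l j = \<one>\<^bsub>\<Lambda> j\<^esub>}"

definition emb :: "'j \<Rightarrow> 'b \<Rightarrow> 'j \<Rightarrow> 'b" where
  "emb j h = (\<lambda>k\<in>J. if k = j then h else \<one>\<^bsub>\<Lambda> k\<^esub>)"

text \<open>The union of the translates of \<open>Y\<close> by the factor \<open>j\<close>
  alone.\<close>

definition slice :: "'j \<Rightarrow> 's set" where
  "slice j = {x \<in> space M. \<forall>k\<in>J - {j}. p x k = \<one>\<^bsub>\<Lambda> k\<^esub>}"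

definition lev :: "'j \<Rightarrow> 'b set \<Rightarrow> 's set" where
  "lev j K = {x \<in> space M. p x j \<in> K}"

lemma P_comp [simp]:
  assumes "j \<in> J"
  shows "(l \<otimes>\<^bsub>P\<^esub> l') j = l j \<otimes>\<^bsub>\<Lambda> j\<^esub> l' j" "\<one>\<^bsub>P\<^esub> j = \<one>\<^bsub>\<Lambda> j\<^esub>"
    "l \<in> carrier P \<Longrightarrow> (inv\<^bsub>P\<^esub> l) j = inv\<^bsub>\<Lambda> j\<^esub> (l j)"
    "l \<in> carrier P \<Longrightarrow> l j \<in> carrier (\<Lambda> j)"
  using assms grp by auto

lemma P_eqI:
  assumes "l \<in> carrier P" "l' \<in> carrier P" "\<And>j. j \<in> J \<Longrightarrow> l j = l' j" shows "l = l'"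
  using assms by (auto intro: PiE_ext)

lemma ker_subset: "ker j \<subseteq> carrier P" by (auto simp: ker_def)

lemma subgroup_ker: assumes j: "j \<in> J" shows "subgroup (ker j) P"
proof (rule L.subgroupI)
  interpret j: group "\<Lambda> j" using grp[OF j] .
  show "ker j \<subseteq> carrier P" by (rule ker_subset)
  show "ker j \<noteq> {}" using P_comp(2)[OF j] L.one_closed unfolding ker_def by blast
  fix a assume a: "a \<in> ker j"
  then have ac: "a \<in> carrier P" "a j = \<one>\<^bsub>\<Lambda> j\<^esub>" by (simp_all only: ker_def mem_Collect_eq)
  show "inv\<^bsub>P\<^esub> a \<in> ker j"
    unfolding ker_def mem_Collect_eq using L.inv_closed[OF ac(1)] P_comp(3)[OF j ac(1)] ac(2) by (simp only: j.inv_one)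
  fix b assume b: "b \<in> ker j"
  then have bc: "b \<in> carrier P" "b j = \<one>\<^bsub>\<Lambda> j\<^esub>" by (simp_all only: ker_def mem_Collect_eq)
  show "a \<otimes>\<^bsub>P\<^esub> b \<in> ker j"
    unfolding ker_def mem_Collect_eq using L.m_closed[OF ac(1) bc(1)] P_comp(1)[OF j, of a b] ac(2) bc(2) j.l_one[OF j.one_closed]
    by (simp only:)
qed

lemma p_closed: "x \<in> space M \<Longrightarrow> p x \<in> carrier P"
  using L.pos_closed[OF fundY] .

lemma p_act: "x \<in> space M \<Longrightarrow> l \<in> carrier P \<Longrightarrow> p (\<psi> l x) = l \<otimes>\<^bsub>P\<^esub> p x"
  using L.pos_act[OF fundY] .

lemma Y_space: "Y \<subseteq> space M"
  using L.fund_sets[OF fundY] sets.sets_into_space by blast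

lemma slice_sets: "slice j \<in> sets M"
proof -
  have "slice j = p -` {l \<in> carrier P. \<forall>k\<in>J - {j}. l k = \<one>\<^bsub>\<Lambda> k\<^esub>} \<inter> space M"
    using p_closed by (auto simp: slice_def simp del: carrier_product_group)
  also have "\<dots> \<in> sets M" by (rule measurable_sets[OF L.pos_measurable[OF fundY]]) auto
  finally show ?thesis .
qed

text \<open>An element of \<open>ker j\<close> brings \<open>x\<close> into the slice exactly when
  it cancels the coordinates of \<open>p x\<close> outside \<open>j\<close>, and these coordinates
  determine it.\<close>

lemma fund_slice: assumes j: "j \<in> J" shows "L.fund (ker j) (slice j)"
  unfolding L.fund_def
proof (intro conjI ballI slice_sets)
  fix x assume x: "x \<in> space M"
  let ?q = "p x"
  have q: "?q \<in> carrier P" using p_closed x .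
  have qk: "?q k \<in> carrier (\<Lambda> k)" if "k \<in> J" for k using P_comp(4)[OF that q] .
  define h where "h = (\<lambda>k\<in>J. if k = j then \<one>\<^bsub>\<Lambda> j\<^esub> else inv\<^bsub>\<Lambda> k\<^esub> (?q k))"
  have hc: "h \<in> carrier P"
    using grp qk j by (auto simp: h_def group.is_monoid monoid.one_closed group.inv_closed)
  have in_slice: "\<psi> l x \<in> slice j \<longleftrightarrow> (\<forall>k\<in>J - {j}. l k = h k)" if l: "l \<in> carrier P" for l
  proof -
    have "l k \<otimes>\<^bsub>\<Lambda> k\<^esub> ?q k = \<one>\<^bsub>\<Lambda> k\<^esub> \<longleftrightarrow> l k = h k" if k: "k \<in> J - {j}" for k
    proof -
      interpret k: group "\<Lambda> k" using grp k by blast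
      have "l k \<in> carrier (\<Lambda> k)" "?q k \<in> carrier (\<Lambda> k)" using P_comp(4) l k qk by auto
      moreover have "h k = inv\<^bsub>\<Lambda> k\<^esub> (?q k)" using k by (simp add: h_def)
      ultimately show ?thesis by (metis k.inv_equality k.l_inv)
    qed
    then show ?thesis
      using L.act_space[OF l x] p_act[OF x l] by (auto simp: slice_def simp del: carrier_product_group mult_product_group)
  qed
  have "h \<in> ker j" using hc j by (simp only: ker_def mem_Collect_eq) (simp add: h_def)
  moreover have "\<psi> h x \<in> slice j" using in_slice[OF hc] by blast
  moreover have "l = h" if "l \<in> ker j \<and> \<psi> l x \<in> slice j" for l
  proof (rule P_eqI)
    show lc: "l \<in> carrier P" using that ker_subset by blast
    fix k assume k: "k \<in> J"
    show "l k = h k"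
    proof (cases "k = j")
      case True
      have "l j = \<one>\<^bsub>\<Lambda> j\<^esub>" using that by (simp only: ker_def mem_Collect_eq)
      then show ?thesis using True j by (simp add: h_def)
    next
      case False
      then show ?thesis using in_slice[OF lc] that k by blast
    qed
  qed (rule hc)
  ultimately show "\<exists>!l. l \<in> ker j \<and> \<psi> l x \<in> slice j" by (intro ex1I[of _ h]) blast+
qed

lemma lev_sets: "lev j K \<in> sets M"
proof -
  have "lev j K = p -` {l \<in> carrier P. l j \<in> K} \<inter> space M"
    using p_closed by (auto simp: lev_def simp del: carrier_product_group)
  also have "\<dots> \<in> sets M" by (rule measurable_sets[OF L.pos_measurable[OF fundY]]) auto
  finally show ?thesis .
qed

lemma inv_lev: assumes j: "j \<in> J" shows "L.inv_set (ker j) (lev j K)"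
  unfolding L.inv_set_def
proof (intro conjI ballI lev_sets)
  fix h x assume h: "h \<in> ker j" and x: "x \<in> space M"
  have hc: "h \<in> carrier P" "h j = \<one>\<^bsub>\<Lambda> j\<^esub>" using h by (simp_all only: ker_def mem_Collect_eq)
  interpret j: group "\<Lambda> j" using grp[OF j] .
  have "p (\<psi> h x) j = p x j"
    unfolding p_act[OF x hc(1)] P_comp(1)[OF j] hc(2) using P_comp(4)[OF j p_closed[OF x]] by (rule j.l_one)
  then show "\<psi> h x \<in> lev j K \<longleftrightarrow> x \<in> lev j K"
    using x L.act_space[OF hc(1) x] by (simp only: lev_def mem_Collect_eq)
qed

lemma emb_closed: "j \<in> J \<Longrightarrow> h \<in> carrier (\<Lambda> j) \<Longrightarrow> emb j h \<in> carrier P"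
  using grp by (auto simp: emb_def group.is_monoid monoid.one_closed)

text \<open>A point of \<open>slice j\<close> whose position has coordinate \<open>h\<close> lies in
  the translate of \<open>Y\<close> by \<open>emb j h\<close>, and only finitely many
  \<open>h\<close> occur.\<close>

lemma lev_finite: 
  assumes j: "j \<in> J" and K: "finite K"
  shows "emeasure M (lev j K \<inter> slice j) < \<infinity>"
proof -
  let ?K = "K \<inter> carrier (\<Lambda> j)"
  let ?U = "\<lambda>h. {x \<in> space M. \<psi> (inv\<^bsub>P\<^esub> (emb j h)) x \<in> Y}"
  have ec: "inv\<^bsub>P\<^esub> (emb j h) \<in> carrier P" if "h \<in> ?K" for h
    using that emb_closed[OF j] L.inv_closed by blast
  have sub: "lev j K \<inter> slice j \<subseteq> (\<Union>h\<in>?K. ?U h)"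
  proof
    fix x assume "x \<in> lev j K \<inter> slice j"
    then have x: "x \<in> space M" "p x j \<in> K" "\<forall>k\<in>J - {j}. p x k = \<one>\<^bsub>\<Lambda> k\<^esub>" by (auto simp: lev_def slice_def)
    have hK: "p x j \<in> ?K" using x P_comp(4)[OF j p_closed] by blast
    have "p x = emb j (p x j)"
    proof (rule P_eqI)
      show "p x \<in> carrier P" using p_closed x(1) .
      show "emb j (p x j) \<in> carrier P" using emb_closed[OF j] hK by blast
      fix k assume "k \<in> J" then show "p x k = emb j (p x j) k" using x(3) by (auto simp: emb_def)
    qed
    then have "\<psi> (inv\<^bsub>P\<^esub> (emb j (p x j))) x \<in> Y" using L.act_inv_pos[OF fundY x(1)] by simp
    then show "x \<in> (\<Union>h\<in>?K. ?U h)" using hK x(1) by blast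
  qed
  have "emeasure M (lev j K \<inter> slice j) \<le> emeasure M (\<Union>h\<in>?K. ?U h)"
    using ec K L.vimage_sets L.fund_sets[OF fundY] by (intro emeasure_mono sub sets.finite_UN) blast+
  also have "\<dots> \<le> (\<Sum>h\<in>?K. emeasure M (?U h))"
    using K ec L.vimage_sets L.fund_sets[OF fundY] by (intro emeasure_subadditive_finite) blast+
  also have "\<dots> = (\<Sum>h\<in>?K. emeasure M Y)"
    using ec L.vimage_measure L.fund_sets[OF fundY] by (intro sum.cong refl) blast
  also have "\<dots> < \<infinity>" using finY K by (simp add: ennreal_mult_less_top of_nat_less_top)
  finally show ?thesis .
qed

definition quot :: "'j \<Rightarrow> 's measure" where
  "quot j = sub_meas M {E. L.inv_set (ker j) E} (slice j)"

lemma space_quot: "space (quot j) = space M"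
  unfolding quot_def using L.sigma_algebra_inv[OF ker_subset] by (rule space_sub_meas)

lemma sets_quot: "sets (quot j) = {E. L.inv_set (ker j) E}"
  unfolding quot_def using L.sigma_algebra_inv[OF ker_subset] by (rule sets_sub_meas)

lemma emeasure_quot: "L.inv_set (ker j) E \<Longrightarrow> emeasure (quot j) E = emeasure M (E \<inter> slice j)"
  unfolding quot_def using L.sigma_algebra_inv[OF ker_subset] L.inv_set_sets slice_sets
  by (intro emeasure_sub_meas) blast+

end

locale product_coupling = product_action J \<Lambda> M \<psi> Y + G: mp_action G M \<phi>
  for J :: "'j set" and \<Lambda> :: "'j \<Rightarrow> ('b, 'd) monoid_scheme" and M :: "'s measure" and \<psi> Y
    and G :: "('a, 'c) monoid_scheme" and \<phi> +
  assumes comm: "\<lbrakk>g \<in> carrier G; l \<in> carrier (product_group J \<Lambda>); x \<in> space M\<rbrakk> \<Longrightarrow> \<phi> g (\<psi> l x) = \<psi> l (\<phi> g x)"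
begin

text \<open>Read through \<open>slice j\<close>, the set \<open>E\<close> is an
  \<open>A\<close>-invariant set of positive finite measure in the quotient by \<open>ker j\<close>,
  a witness that \<open>A\<close> does not drive all sets of finite measure off themselves
  there.\<close>

definition recurrent :: "'a set \<Rightarrow> 'j \<Rightarrow> 's set \<Rightarrow> bool" where
  "recurrent A j E \<longleftrightarrow> L.inv_set (ker j) E \<and> G.inv_set A E \<and>
     0 < emeasure M (E \<inter> slice j) \<and> emeasure M (E \<inter> slice j) < \<infinity>"

lemma comm_ker: "\<lbrakk>g \<in> carrier G; l \<in> ker j; x \<in> space M\<rbrakk> \<Longrightarrow> \<phi> g (\<psi> l x) = \<psi> l (\<phi> g x)"
  using comm ker_subset by blast

lemma quot_vimage:
  assumes "g \<in> carrier G" "j \<in> J" "L.inv_set (ker j) E"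
  shows "L.inv_set (ker j) {x \<in> space M. \<phi> g x \<in> E}"
    "emeasure M ({x \<in> space M. \<phi> g x \<in> E} \<inter> slice j) = emeasure M (E \<inter> slice j)"
  using L.commuting_quot[OF subgroup_ker[OF assms(2)] fund_slice[OF assms(2)] assms(3)
      G.act_measurable[OF assms(1)] G.act_distr[OF assms(1)] comm_ker[OF assms(1), where j = j]]
  by simp_all

text \<open>If no quotient has an invariant set of positive finite measure,
  \<open>family_recurrent\<close> excludes a uniform lower bound for the returns summed over
  \<open>j\<close>. Because of the sum, the element \<open>a\<close> found here works for every
  \<open>j\<close> simultaneously.\<close>

lemma escape:
  assumes A: "subgroup A G" and none: "\<And>j E. j \<in> J \<Longrightarrow> \<not> recurrent A j E"
    and D: "\<And>j. j \<in> J \<Longrightarrow> L.inv_set (ker j) (D j)" "\<And>j. j \<in> J \<Longrightarrow> emeasure M (D j \<inter> slice j) < \<infinity>"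
    and c: "c > 0"
  shows "\<exists>a\<in>A. (\<Sum>j\<in>J. emeasure M ({x \<in> space M. x \<in> D j \<and> \<phi> a x \<in> D j} \<inter> slice j)) < ennreal c"
proof (rule ccontr)
  assume neg: "\<not> ?thesis"
  have AG: "A \<subseteq> carrier G" using A subgroup.subset by auto
  have cA: "countable A" using AG G.countable_carrier countable_subset by blast
  have "\<exists>j\<in>J. \<exists>E\<in>sets (quot j). 0 < emeasure (quot j) E \<and> emeasure (quot j) E < \<infinity> \<and>
    (\<forall>a\<in>A. AE x in quot j. \<phi> a x \<in> E \<longleftrightarrow> x \<in> E)"
  proof (rule family_recurrent[OF space_quot finJ, where D = D and c = c])
    fix a j assume a: "a \<in> A" and j: "j \<in> J"
    have ag: "a \<in> carrier G" using a AG by blast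
    show "\<phi> a \<in> measurable (quot j) (quot j)"
    proof (rule measurableI)
      fix E assume "E \<in> sets (quot j)"
      then have "L.inv_set (ker j) {x \<in> space M. \<phi> a x \<in> E}" using quot_vimage(1)[OF ag j] by (simp add: sets_quot)
      moreover have "\<phi> a -` E \<inter> space (quot j) = {x \<in> space M. \<phi> a x \<in> E}" by (auto simp: space_quot)
      ultimately show "\<phi> a -` E \<inter> space (quot j) \<in> sets (quot j)" by (simp add: sets_quot)
    qed (simp add: space_quot G.act_space[OF ag])
    fix E assume "E \<in> sets (quot j)"
    then have E: "L.inv_set (ker j) E" by (simp add: sets_quot)
    show "emeasure (quot j) {x \<in> space M. \<phi> a x \<in> E} = emeasure (quot j) E"
      using quot_vimage[OF ag j E] E by (simp add: emeasure_quot)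
  next
    fix a b assume ab: "a \<in> A" "b \<in> A"
    have "a \<otimes>\<^bsub>G\<^esub> b \<in> A" using subgroup.m_closed[OF A ab] .
    moreover have "a \<in> carrier G" "b \<in> carrier G" using ab AG by blast+
    then have "\<forall>x\<in>space M. \<phi> a (\<phi> b x) = \<phi> (a \<otimes>\<^bsub>G\<^esub> b) x" by (simp add: G.act_mult)
    ultimately show "\<exists>e\<in>A. \<forall>x\<in>space M. \<phi> a (\<phi> b x) = \<phi> e x" by blast
  next
    fix j assume j: "j \<in> J"
    show "D j \<in> sets (quot j)" using D(1)[OF j] by (simp add: sets_quot)
    show "emeasure (quot j) (D j) < \<infinity>" using D[OF j] by (simp add: emeasure_quot)
  next
    fix a assume a: "a \<in> A"
    then have ag: "a \<in> carrier G" using AG by blast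
    have "emeasure (quot j) {x \<in> space M. x \<in> D j \<and> \<phi> a x \<in> D j} = emeasure M ({x \<in> space M. x \<in> D j \<and> \<phi> a x \<in> D j} \<inter> slice j)"
      if j: "j \<in> J" for j
    proof -
      have m: "D j \<in> sets (quot j)" "{x \<in> space M. \<phi> a x \<in> D j} \<in> sets (quot j)"
        using D(1)[OF j] quot_vimage(1)[OF ag j D(1)[OF j]] by (simp_all add: sets_quot)
      have "{x \<in> space M. x \<in> D j \<and> \<phi> a x \<in> D j} = D j \<inter> {x \<in> space M. \<phi> a x \<in> D j}" by auto
      then have "{x \<in> space M. x \<in> D j \<and> \<phi> a x \<in> D j} \<in> sets (quot j)" using sets.Int[OF m] by simp
      then show ?thesis by (simp add: sets_quot emeasure_quot)
    qed
    then have "(\<Sum>j\<in>J. emeasure (quot j) {x \<in> space M. x \<in> D j \<and> \<phi> a x \<in> D j}) =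
      (\<Sum>j\<in>J. emeasure M ({x \<in> space M. x \<in> D j \<and> \<phi> a x \<in> D j} \<inter> slice j))" by (intro sum.cong refl)
    then show "(\<Sum>j\<in>J. emeasure (quot j) {x \<in> space M. x \<in> D j \<and> \<phi> a x \<in> D j}) \<ge> ennreal c"
      using neg a by (simp add: not_less)
  next
    show "A \<noteq> {}" using subgroup.one_closed[OF A] by blast
  qed (use c in auto)
  then obtain j E where j: "j \<in> J" and E: "E \<in> sets (quot j)" "0 < emeasure (quot j) E" "emeasure (quot j) E < \<infinity>"
    "\<forall>a\<in>A. AE x in quot j. \<phi> a x \<in> E \<longleftrightarrow> x \<in> E" by blast
  have Einv: "L.inv_set (ker j) E" using E(1) by (simp add: sets_quot)
  \<comment> \<open>\<open>E\<close> is invariant only up to null sets of the quotient. As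
    \<open>A\<close> is countable, the set of points all of whose translates lie in \<open>E\<close>
    differs from it by a null set, and it is strictly invariant.\<close>
  define E' where "E' = {x \<in> space M. \<forall>a\<in>A. \<phi> a x \<in> E}"
  have GE: "G.inv_set A E'" unfolding E'_def using L.inv_set_sets[OF Einv] by (rule G.inv_strict[OF A])
  have LE: "L.inv_set (ker j) E'"
    unfolding L.inv_set_def
  proof (intro conjI ballI G.inv_set_sets[OF GE])
    fix h x assume h: "h \<in> ker j" and x: "x \<in> space M"
    have hs: "\<psi> h x \<in> space M" using h x ker_subset L.act_space by blast
    have "\<phi> a (\<psi> h x) \<in> E \<longleftrightarrow> \<phi> a x \<in> E" if "a \<in> A" for a
    proof -
      have ag: "a \<in> carrier G" using that AG by blast
      show ?thesis using comm_ker[OF ag h x] L.inv_set_D[OF Einv h G.act_space[OF ag x]] by simp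
    qed
    then show "\<psi> h x \<in> E' \<longleftrightarrow> x \<in> E'" using hs x unfolding E'_def by blast
  qed
  have "AE x in quot j. \<forall>a\<in>A. \<phi> a x \<in> E \<longleftrightarrow> x \<in> E"
    using E(4) cA by (simp add: AE_ball_countable)
  then have "AE x in quot j. x \<in> E' \<longleftrightarrow> x \<in> E"
  proof (rule AE_mp, intro AE_I2 impI)
    fix x assume x: "x \<in> space (quot j)" and *: "\<forall>a\<in>A. \<phi> a x \<in> E \<longleftrightarrow> x \<in> E"
    have "\<one>\<^bsub>G\<^esub> \<in> A" using subgroup.one_closed[OF A] .
    then show "x \<in> E' \<longleftrightarrow> x \<in> E" using * x unfolding E'_def space_quot by blast
  qed
  then have "emeasure (quot j) E' = emeasure (quot j) E"
    using LE E(1) by (intro emeasure_eq_AE) (auto simp: sets_quot)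
  then have "recurrent A j E'"
    using E GE LE by (simp add: recurrent_def emeasure_quot[OF LE])
  then show False using none[OF j] by blast
qed

end

section \<open>Almost invariant densities on the coupling\<close>

lemma nn_integral_abs_diff:
  fixes u v :: "'s \<Rightarrow> real"
  assumes meas [measurable]: "u \<in> borel_measurable M" "v \<in> borel_measurable M"
    and nonneg: "\<And>x. u x \<ge> 0" "\<And>x. v x \<ge> 0"
    and fin: "(\<integral>\<^sup>+x. u x \<partial>M) < \<infinity>" "(\<integral>\<^sup>+x. v x \<partial>M) < \<infinity>"
  shows "ennreal \<bar>enn2real (\<integral>\<^sup>+x. u x \<partial>M) - enn2real (\<integral>\<^sup>+x. v x \<partial>M)\<bar> \<le> (\<integral>\<^sup>+x. \<bar>u x - v x\<bar> \<partial>M)"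
proof -
  have *: "enn2real (\<integral>\<^sup>+x. a x \<partial>M) - enn2real (\<integral>\<^sup>+x. b x \<partial>M) \<le> enn2real (\<integral>\<^sup>+x. \<bar>a x - b x\<bar> \<partial>M)"
    if ab: "a \<in> borel_measurable M" "b \<in> borel_measurable M" "\<And>x. a x \<ge> 0" "\<And>x. b x \<ge> 0"
      and fin: "(\<integral>\<^sup>+x. a x \<partial>M) < \<infinity>" "(\<integral>\<^sup>+x. b x \<partial>M) < \<infinity>" "(\<integral>\<^sup>+x. \<bar>a x - b x\<bar> \<partial>M) < \<infinity>" for a b :: "'s \<Rightarrow> real"
  proof -
    note ab(1,2) [measurable]
    have "(\<integral>\<^sup>+x. a x \<partial>M) \<le> (\<integral>\<^sup>+x. ennreal (b x) + ennreal \<bar>a x - b x\<bar> \<partial>M)"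
    proof (rule nn_integral_mono)
      fix x
      have "a x \<le> b x + \<bar>a x - b x\<bar>" by linarith
      then have "ennreal (a x) \<le> ennreal (b x + \<bar>a x - b x\<bar>)" by (rule ennreal_leI)
      then show "ennreal (a x) \<le> ennreal (b x) + ennreal \<bar>a x - b x\<bar>" using ab by simp
    qed
    also have "\<dots> = (\<integral>\<^sup>+x. b x \<partial>M) + (\<integral>\<^sup>+x. \<bar>a x - b x\<bar> \<partial>M)" by (rule nn_integral_add) measurable
    finally have "enn2real (\<integral>\<^sup>+x. a x \<partial>M) \<le> enn2real ((\<integral>\<^sup>+x. b x \<partial>M) + (\<integral>\<^sup>+x. \<bar>a x - b x\<bar> \<partial>M))"
      using fin by (intro enn2real_mono) auto
    also have "\<dots> = enn2real (\<integral>\<^sup>+x. b x \<partial>M) + enn2real (\<integral>\<^sup>+x. \<bar>a x - b x\<bar> \<partial>M)"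
      using fin by (intro enn2real_plus) auto
    finally show ?thesis by simp
  qed
  have "(\<integral>\<^sup>+x. \<bar>u x - v x\<bar> \<partial>M) \<le> (\<integral>\<^sup>+x. ennreal (u x) + ennreal (v x) \<partial>M)"
  proof (rule nn_integral_mono)
    fix x
    have "\<bar>u x - v x\<bar> \<le> u x + v x" using nonneg[of x] by linarith
    then have "ennreal \<bar>u x - v x\<bar> \<le> ennreal (u x + v x)" by (rule ennreal_leI)
    then show "ennreal \<bar>u x - v x\<bar> \<le> ennreal (u x) + ennreal (v x)" using nonneg by simp
  qed
  also have "\<dots> = (\<integral>\<^sup>+x. u x \<partial>M) + (\<integral>\<^sup>+x. v x \<partial>M)" by (rule nn_integral_add) measurable
  also have "\<dots> < \<infinity>" using fin by simp
  finally have fin': "(\<integral>\<^sup>+x. \<bar>u x - v x\<bar> \<partial>M) < \<infinity>" .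
  have sym: "(\<integral>\<^sup>+x. \<bar>v x - u x\<bar> \<partial>M) = (\<integral>\<^sup>+x. \<bar>u x - v x\<bar> \<partial>M)" by (simp add: abs_minus_commute)
  have "\<bar>enn2real (\<integral>\<^sup>+x. u x \<partial>M) - enn2real (\<integral>\<^sup>+x. v x \<partial>M)\<bar> \<le> enn2real (\<integral>\<^sup>+x. \<bar>u x - v x\<bar> \<partial>M)"
    using *[OF meas nonneg fin fin'] *[OF meas(2,1) nonneg(2,1) fin(2,1)] fin' sym by (simp add: abs_le_iff)
  then have "ennreal \<bar>enn2real (\<integral>\<^sup>+x. u x \<partial>M) - enn2real (\<integral>\<^sup>+x. v x \<partial>M)\<bar> \<le> ennreal (enn2real (\<integral>\<^sup>+x. \<bar>u x - v x\<bar> \<partial>M))"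
    by (rule ennreal_leI)
  also have "\<dots> = (\<integral>\<^sup>+x. \<bar>u x - v x\<bar> \<partial>M)" using fin' by simp
  finally show ?thesis .
qed

text \<open>Averaging an almost invariant density over a fundamental domain yields almost invariant
  functions on the group.\<close>

lemma (in mp_action) no_reiter_density:
  assumes nr: "no_reiter G" and Z: "fund (carrier G) Z"
  obtains F \<epsilon> where "finite F" "F \<subseteq> carrier G" "\<epsilon> > (0::real)"
    "\<And>(\<xi> :: 's \<Rightarrow> real) (y :: real). \<xi> \<in> borel_measurable M \<Longrightarrow> (\<And>x. \<xi> x \<ge> 0) \<Longrightarrow> y > 0 \<Longrightarrow> (\<integral>\<^sup>+x. \<xi> x \<partial>M) = ennreal y \<Longrightarrow>
      \<exists>s\<in>F. (\<integral>\<^sup>+x. \<bar>\<xi> (act s x) - \<xi> x\<bar> \<partial>M) \<ge> ennreal (\<epsilon> * y)"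
proof -
  obtain F \<epsilon> where F: "finite F" "F \<subseteq> carrier G" "\<epsilon> > (0::real)"
    "\<And>f. (\<forall>x. f x \<ge> (0::real)) \<and> (\<integral>\<^sup>+x. f x \<partial>count_space (carrier G)) = 1 \<Longrightarrow>
        (\<exists>s\<in>F. (\<integral>\<^sup>+x. \<bar>f (s \<otimes> x) - f x\<bar> \<partial>count_space (carrier G)) \<ge> \<epsilon>)"
    using nr unfolding no_reiter_def by blast
  show thesis
  proof (rule that[OF F(1-3)])
    fix \<xi> :: "'s \<Rightarrow> real" and y :: real
    assume meas: "\<xi> \<in> borel_measurable M" and nonneg: "\<And>x. \<xi> x \<ge> 0" and y: "y > 0"
      and total: "(\<integral>\<^sup>+x. \<xi> x \<partial>M) = ennreal y"
    note sub = subgroup_self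
    have Zm [measurable]: "Z \<in> sets M" using Z by (rule fund_sets)
    note meas [measurable]
    have am [measurable]: "act g \<in> measurable M M" if "g \<in> carrier G" for g using act_measurable that .
    define u where "u b x = \<xi> (act b x) * indicator Z x" for b x
    have u_meas: "u b \<in> borel_measurable M" if "b \<in> carrier G" for b
      using that unfolding u_def by measurable
    have u_nonneg: "u b x \<ge> 0" for b x using nonneg by (simp add: u_def)
    have u_eq: "ennreal (u b x) = ennreal (\<xi> (act b x)) * indicator Z x" for b x
      by (simp add: u_def indicator_def)
    define I where "I b = (\<integral>\<^sup>+x. u b x \<partial>M)" for b
    have I_fin: "I b < \<infinity>" if b: "b \<in> carrier G" for b
    proof -
      have "I b \<le> (\<integral>\<^sup>+x. \<xi> (act b x) \<partial>M)"
        unfolding I_def u_eq by (intro nn_integral_mono) (auto simp: indicator_def)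
      also have "\<dots> = ennreal y" using nn_integral_act[OF b, of "\<lambda>x. ennreal (\<xi> x)"] total by simp
      finally show ?thesis by (auto simp: less_top[symmetric] top_unique)
    qed
    \<comment> \<open>\<open>f b\<close> is the share of the total mass of \<open>\<xi>\<close>
      carried by the translate of \<open>Z\<close> by \<open>b\<close>; by \<open>unfold_aux\<close>
      the shares add up to 1.\<close>
    define f where "f b = enn2real (I b) / y" for b
    have "(\<integral>\<^sup>+b. f b \<partial>count_space (carrier G)) = (\<integral>\<^sup>+b. ennreal (1 / y) * I b \<partial>count_space (carrier G))"
    proof (rule nn_integral_cong)
      fix b assume "b \<in> space (count_space (carrier G))"
      then have "I b = ennreal (enn2real (I b))" using I_fin by simp
      then show "ennreal (f b) = ennreal (1 / y) * I b"
        using y by (metis f_def divide_inverse ennreal_mult'' enn2real_nonneg inverse_eq_divide mult.commute)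
    qed
    also have "\<dots> = ennreal (1 / y) * (\<integral>\<^sup>+b. I b \<partial>count_space (carrier G))" by (rule nn_integral_cmult) simp
    also have "(\<integral>\<^sup>+b. I b \<partial>count_space (carrier G)) = (\<integral>\<^sup>+x. \<xi> x \<partial>M)"
      unfolding I_def u_eq by (rule unfold_aux[OF sub Z, symmetric]) measurable
    also have "ennreal (1 / y) * (\<integral>\<^sup>+x. \<xi> x \<partial>M) = 1"
      unfolding total using y by (simp add: ennreal_mult[symmetric])
    finally have one: "(\<integral>\<^sup>+b. f b \<partial>count_space (carrier G)) = 1" .
    have "\<forall>b. f b \<ge> 0" using y by (simp add: f_def)
    then obtain s where s: "s \<in> F" "(\<integral>\<^sup>+b. \<bar>f (s \<otimes> b) - f b\<bar> \<partial>count_space (carrier G)) \<ge> \<epsilon>"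
      using F(4)[of f] one by blast
    have sc: "s \<in> carrier G" using s F by blast
    let ?\<Delta> = "\<lambda>x. \<bar>\<xi> (act s x) - \<xi> x\<bar>"
    have "(\<integral>\<^sup>+b. \<bar>f (s \<otimes> b) - f b\<bar> \<partial>count_space (carrier G)) \<le>
      (\<integral>\<^sup>+b. ennreal (1 / y) * (\<integral>\<^sup>+x. ennreal (?\<Delta> (act b x)) * indicator Z x \<partial>M) \<partial>count_space (carrier G))"
    proof (rule nn_integral_mono)
      fix b assume "b \<in> space (count_space (carrier G))"
      then have b: "b \<in> carrier G" "s \<otimes> b \<in> carrier G" using sc by auto
      have "\<bar>f (s \<otimes> b) - f b\<bar> = (1 / y) * \<bar>enn2real (I (s \<otimes> b)) - enn2real (I b)\<bar>"
        using y by (simp add: f_def diff_divide_distrib[symmetric] abs_divide)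
      then have "ennreal \<bar>f (s \<otimes> b) - f b\<bar> = ennreal (1 / y) * ennreal \<bar>enn2real (I (s \<otimes> b)) - enn2real (I b)\<bar>"
        using y by (simp add: ennreal_mult[symmetric])
      also have "\<dots> \<le> ennreal (1 / y) * (\<integral>\<^sup>+x. \<bar>u (s \<otimes> b) x - u b x\<bar> \<partial>M)"
        unfolding I_def using b u_meas u_nonneg I_fin
        by (intro mult_left_mono nn_integral_abs_diff) (auto simp: I_def)
      also have "(\<integral>\<^sup>+x. \<bar>u (s \<otimes> b) x - u b x\<bar> \<partial>M) = (\<integral>\<^sup>+x. ennreal (?\<Delta> (act b x)) * indicator Z x \<partial>M)"
        using b sc by (intro nn_integral_cong) (auto simp: u_def act_mult indicator_def)
      finally show "ennreal \<bar>f (s \<otimes> b) - f b\<bar> \<le> ennreal (1 / y) * (\<integral>\<^sup>+x. ennreal (?\<Delta> (act b x)) * indicator Z x \<partial>M)" .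
    qed
    also have "\<dots> = ennreal (1 / y) * (\<integral>\<^sup>+b. (\<integral>\<^sup>+x. ennreal (?\<Delta> (act b x)) * indicator Z x \<partial>M) \<partial>count_space (carrier G))"
      by (rule nn_integral_cmult) simp
    also have "(\<integral>\<^sup>+b. (\<integral>\<^sup>+x. ennreal (?\<Delta> (act b x)) * indicator Z x \<partial>M) \<partial>count_space (carrier G)) = (\<integral>\<^sup>+x. ennreal (?\<Delta> x) \<partial>M)"
      by (rule unfold_aux[OF sub Z, symmetric]) (use sc in measurable)
    finally have "ennreal \<epsilon> \<le> ennreal (1 / y) * (\<integral>\<^sup>+x. ennreal (?\<Delta> x) \<partial>M)" using s(2) by (rule order_trans[rotated])
    then have "ennreal y * ennreal \<epsilon> \<le> ennreal y * (ennreal (1 / y) * (\<integral>\<^sup>+x. ennreal (?\<Delta> x) \<partial>M))"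
      by (rule mult_left_mono) simp
    also have "\<dots> = (\<integral>\<^sup>+x. ennreal (?\<Delta> x) \<partial>M)"
      using y by (simp add: mult.assoc[symmetric] ennreal_mult[symmetric])
    finally show "\<exists>s\<in>F. (\<integral>\<^sup>+x. \<bar>\<xi> (act s x) - \<xi> x\<bar> \<partial>M) \<ge> ennreal (\<epsilon> * y)"
      using s(1) y F(3) by (intro bexI[of _ s]) (simp_all add: ennreal_mult[symmetric] mult.commute)
  qed
qed

text \<open>\<open>B\<close> is the non-amenable group; in the application it is one factor
  \<Gamma>_i, and \<open>A\<close> is the kernel of the coordinate \<open>i\<close>, which commutes
  with it. The densities will compare the position of a point with that of its image under an
  element of \<open>A\<close>.\<close>

locale product_triple = product_coupling J \<Lambda> M \<psi> Y G \<phi> + B: mp_action B M \<theta>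
  for J :: "'j set" and \<Lambda> :: "'j \<Rightarrow> ('b, 'd) monoid_scheme" and M :: "'s measure" and \<psi> Y
    and G :: "('a, 'c) monoid_scheme" and \<phi> and B :: "('e, 'f) monoid_scheme" and \<theta> +
  fixes A :: "'a set"
  assumes A: "subgroup A G"
    and commB: "\<lbrakk>b \<in> carrier B; l \<in> carrier (product_group J \<Lambda>); x \<in> space M\<rbrakk> \<Longrightarrow> \<theta> b (\<psi> l x) = \<psi> l (\<theta> b x)"
    and commAB: "\<lbrakk>b \<in> carrier B; a \<in> A; x \<in> space M\<rbrakk> \<Longrightarrow> \<theta> b (\<phi> a x) = \<phi> a (\<theta> b x)"
begin

text \<open>The cocycle of \<open>b\<close> read in the positions. As \<open>\<psi>\<close>
  multiplies positions on the left, recording the displacement on the right makes it constant along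
  the orbits of \<open>\<psi>\<close>.\<close>

definition drift :: "'e \<Rightarrow> 's \<Rightarrow> 'j \<Rightarrow> 'b" where
  "drift b x = inv\<^bsub>P\<^esub> (p x) \<otimes>\<^bsub>P\<^esub> p (\<theta> b x)"

lemma drift_closed: "b \<in> carrier B \<Longrightarrow> x \<in> space M \<Longrightarrow> drift b x \<in> carrier P"
  unfolding drift_def using p_closed B.act_space by blast

lemma p_drift:
  assumes b: "b \<in> carrier B" and x: "x \<in> space M"
  shows "p (\<theta> b x) = p x \<otimes>\<^bsub>P\<^esub> drift b x"
proof -
  have c: "p x \<in> carrier P" "p (\<theta> b x) \<in> carrier P"
    using p_closed[OF x] p_closed[OF B.act_space[OF b x]] by auto
  have "p x \<otimes>\<^bsub>P\<^esub> drift b x = (p x \<otimes>\<^bsub>P\<^esub> inv\<^bsub>P\<^esub> (p x)) \<otimes>\<^bsub>P\<^esub> p (\<theta> b x)"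
    unfolding drift_def using c by (intro L.m_assoc[symmetric] L.inv_closed)
  also have "\<dots> = p (\<theta> b x)" unfolding L.r_inv[OF c(1)] using c(2) by (rule L.l_one)
  finally show ?thesis by (rule sym)
qed

lemma drift_act:
  assumes b: "b \<in> carrier B" and x: "x \<in> space M" and l: "l \<in> carrier P"
  shows "drift b (\<psi> l x) = drift b x"
proof -
  have tx: "\<theta> b x \<in> space M" using B.act_space[OF b x] .
  have c: "p x \<in> carrier P" "p (\<theta> b x) \<in> carrier P" using p_closed[OF x] p_closed[OF tx] by auto
  have "drift b (\<psi> l x) = inv\<^bsub>P\<^esub> (l \<otimes>\<^bsub>P\<^esub> p x) \<otimes>\<^bsub>P\<^esub> (l \<otimes>\<^bsub>P\<^esub> p (\<theta> b x))"
    unfolding drift_def commB[OF b l x] p_act[OF x l] p_act[OF tx l] ..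
  also have "inv\<^bsub>P\<^esub> (l \<otimes>\<^bsub>P\<^esub> p x) = inv\<^bsub>P\<^esub> (p x) \<otimes>\<^bsub>P\<^esub> inv\<^bsub>P\<^esub> l" by (rule L.inv_mult_group[OF l c(1)])
  also have "(inv\<^bsub>P\<^esub> (p x) \<otimes>\<^bsub>P\<^esub> inv\<^bsub>P\<^esub> l) \<otimes>\<^bsub>P\<^esub> (l \<otimes>\<^bsub>P\<^esub> p (\<theta> b x)) = inv\<^bsub>P\<^esub> (p x) \<otimes>\<^bsub>P\<^esub> (inv\<^bsub>P\<^esub> l \<otimes>\<^bsub>P\<^esub> (l \<otimes>\<^bsub>P\<^esub> p (\<theta> b x)))"
    using c l by (intro L.m_assoc L.inv_closed L.m_closed)
  also have "inv\<^bsub>P\<^esub> l \<otimes>\<^bsub>P\<^esub> (l \<otimes>\<^bsub>P\<^esub> p (\<theta> b x)) = (inv\<^bsub>P\<^esub> l \<otimes>\<^bsub>P\<^esub> l) \<otimes>\<^bsub>P\<^esub> p (\<theta> b x)"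
    using c l by (intro L.m_assoc[symmetric] L.inv_closed)
  also have "\<dots> = p (\<theta> b x)" unfolding L.l_inv[OF l] using c(2) by (rule L.l_one)
  finally show ?thesis unfolding drift_def .
qed

lemma countable_P: "countable (carrier P)"
  by (rule L.countable_carrier)

lemma p_compose_measurable:
  assumes "T \<in> measurable M M"
  shows "(\<lambda>x. p (T x)) \<in> measurable M (count_space (carrier P))"
  using measurable_compose[OF assms L.pos_measurable[OF fundY]] .

lemma two_positions_measurable:
  assumes "T \<in> measurable M M" "S \<in> measurable M M"
  shows "(\<lambda>x. f (p (T x)) (p (S x))) \<in> measurable M (count_space UNIV)"
proof (rule measurable_compose_countable'[OF _ p_compose_measurable[OF assms(1)] countable_P])
  fix l
  show "(\<lambda>x. f l (p (S x))) \<in> measurable M (count_space UNIV)"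
    by (rule measurable_compose[OF p_compose_measurable[OF assms(2)]]) simp
qed

lemma drift_measurable:
  assumes b: "b \<in> carrier B" shows "drift b \<in> measurable M (count_space (carrier P))"
proof (rule measurableI)
  fix C assume "C \<in> sets (count_space (carrier P))"
  have "(\<lambda>x. inv\<^bsub>P\<^esub> (p (id x)) \<otimes>\<^bsub>P\<^esub> p (\<theta> b x)) \<in> measurable M (count_space UNIV)"
    by (rule two_positions_measurable) (simp_all add: B.act_measurable[OF b])
  then have "drift b \<in> measurable M (count_space UNIV)" unfolding drift_def[abs_def] id_apply .
  then show "drift b -` C \<inter> space M \<in> sets M" by (rule measurable_sets) simp
next
  fix x assume "x \<in> space M" then show "drift b x \<in> space (count_space (carrier P))"
    using drift_closed[OF b] by (simp only: space_count_space)
qed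

context
  fixes \<mu> :: "'j \<Rightarrow> 'b \<Rightarrow> 'b \<Rightarrow> 'b \<Rightarrow> real"
  assumes mu_prob: "\<And>j w z. j \<in> J \<Longrightarrow> w \<in> carrier (\<Lambda> j) \<Longrightarrow> z \<in> carrier (\<Lambda> j) \<Longrightarrow> fin_prob (carrier (\<Lambda> j)) (\<mu> j w z)"
    and mu_equiv: "\<And>j g w z u. j \<in> J \<Longrightarrow> g \<in> carrier (\<Lambda> j) \<Longrightarrow> w \<in> carrier (\<Lambda> j) \<Longrightarrow> z \<in> carrier (\<Lambda> j) \<Longrightarrow> u \<in> carrier (\<Lambda> j) \<Longrightarrow>
      \<mu> j (g \<otimes>\<^bsub>\<Lambda> j\<^esub> w) (g \<otimes>\<^bsub>\<Lambda> j\<^esub> z) (g \<otimes>\<^bsub>\<Lambda> j\<^esub> u) = \<mu> j w z u"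
begin

text \<open>By equivariance of the kernels, the values at the identity along an orbit of
  \<open>\<psi>\<close> run through all values of one product kernel, so they sum to 1 over the
  orbit. The \<open>max 0\<close> matters only at points outside the space, where nothing is known
  about the kernels.\<close>

definition density_at :: "'a \<Rightarrow> 's \<Rightarrow> real" where
  "density_at a x = (\<Prod>j\<in>J. max 0 (\<mu> j (p x j) (p (\<phi> a x) j) \<one>\<^bsub>\<Lambda> j\<^esub>))"

lemma density_nonneg: "density_at a x \<ge> 0"
  unfolding density_at_def by (intro prod_nonneg) auto

lemma A_carrier: "a \<in> A \<Longrightarrow> a \<in> carrier G"
  using A subgroup.subset by blast

lemma mu_prob_at:
  assumes "j \<in> J" "x \<in> space M" "x' \<in> space M"
  shows "fin_prob (carrier (\<Lambda> j)) (\<mu> j (p x j) (p x' j))"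
  using assms mu_prob P_comp(4)[OF assms(1) p_closed] by blast

lemma density_measurable:
  assumes a: "a \<in> A" shows "density_at a \<in> borel_measurable M"
proof -
  have "(\<lambda>x. (\<lambda>l l'. \<Prod>j\<in>J. max 0 (\<mu> j (l j) (l' j) \<one>\<^bsub>\<Lambda> j\<^esub>)) (p (id x)) (p (\<phi> a x))) \<in> measurable M (count_space UNIV)"
    by (rule two_positions_measurable) (simp_all add: G.act_measurable[OF A_carrier[OF a]])
  then have "density_at a \<in> measurable M (count_space UNIV)" unfolding density_at_def[abs_def] id_apply .
  from measurable_compose[OF this, of "\<lambda>x. x" borel] show ?thesis by simp
qed

lemma density_orbit:
  assumes a: "a \<in> A" and x: "x \<in> space M" and l: "l \<in> carrier P"
  shows "density_at a (\<psi> l x) = (\<Prod>j\<in>J. \<mu> j (p x j) (p (\<phi> a x) j) ((inv\<^bsub>P\<^esub> l) j))"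
  unfolding density_at_def
proof (rule prod.cong[OF refl])
  fix j assume j: "j \<in> J"
  interpret j: group "\<Lambda> j" using grp[OF j] .
  have ag: "a \<in> carrier G" using a A_carrier by blast
  have ax: "\<phi> a x \<in> space M" using G.act_space[OF ag x] .
  have lc: "l j \<in> carrier (\<Lambda> j)" "p x j \<in> carrier (\<Lambda> j)" "p (\<phi> a x) j \<in> carrier (\<Lambda> j)"
    using P_comp(4)[OF j l] P_comp(4)[OF j p_closed[OF x]] P_comp(4)[OF j p_closed[OF ax]] by auto
  have 1: "p (\<psi> l x) j = l j \<otimes>\<^bsub>\<Lambda> j\<^esub> p x j" unfolding p_act[OF x l] P_comp(1)[OF j] ..
  have 2: "p (\<phi> a (\<psi> l x)) j = l j \<otimes>\<^bsub>\<Lambda> j\<^esub> p (\<phi> a x) j"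
    unfolding comm[OF ag l x] p_act[OF ax l] P_comp(1)[OF j] ..
  have "\<mu> j (l j \<otimes>\<^bsub>\<Lambda> j\<^esub> p x j) (l j \<otimes>\<^bsub>\<Lambda> j\<^esub> p (\<phi> a x) j) (l j \<otimes>\<^bsub>\<Lambda> j\<^esub> inv\<^bsub>\<Lambda> j\<^esub> (l j)) =
      \<mu> j (p x j) (p (\<phi> a x) j) (inv\<^bsub>\<Lambda> j\<^esub> (l j))"
    using mu_equiv[OF j lc j.inv_closed[OF lc(1)]] .
  then have "\<mu> j (p (\<psi> l x) j) (p (\<phi> a (\<psi> l x)) j) \<one>\<^bsub>\<Lambda> j\<^esub> = \<mu> j (p x j) (p (\<phi> a x) j) ((inv\<^bsub>P\<^esub> l) j)"
    unfolding 1 2 P_comp(3)[OF j l] j.r_inv[OF lc(1)] .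
  moreover have "\<mu> j (p x j) (p (\<phi> a x) j) u \<ge> 0" for u
    using mu_prob_at[OF j x ax] by (simp add: fin_prob_def)
  ultimately show "max 0 (\<mu> j (p (\<psi> l x) j) (p (\<phi> a (\<psi> l x)) j) \<one>\<^bsub>\<Lambda> j\<^esub>) = \<mu> j (p x j) (p (\<phi> a x) j) ((inv\<^bsub>P\<^esub> l) j)"
    by simp
qed

lemma inv_reindex:
  "(\<integral>\<^sup>+l. f (inv\<^bsub>P\<^esub> l) \<partial>count_space (carrier P)) = (\<integral>\<^sup>+l. f l \<partial>count_space (\<Pi>\<^sub>E j\<in>J. carrier (\<Lambda> j)))"
proof -
  have "bij_betw (\<lambda>l. inv\<^bsub>P\<^esub> l) (carrier P) (carrier P)"
  proof (rule bij_betwI[where g = "\<lambda>l. inv\<^bsub>P\<^esub> l"])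
    show "(\<lambda>l. inv\<^bsub>P\<^esub> l) \<in> carrier P \<rightarrow> carrier P" "(\<lambda>l. inv\<^bsub>P\<^esub> l) \<in> carrier P \<rightarrow> carrier P"
      using L.inv_closed by blast+
  qed (rule L.inv_inv, assumption)+
  from nn_integral_bij_count_space[OF this, of f] show ?thesis unfolding carrier_product_group .
qed

text \<open>Every orbit of \<open>\<psi>\<close> carries total density 1, and \<open>Y\<close> meets
  every orbit exactly once.\<close>

lemma density_total:
  assumes a: "a \<in> A" shows "(\<integral>\<^sup>+x. density_at a x \<partial>M) = emeasure M Y"
proof -
  have "(\<integral>\<^sup>+x. density_at a x \<partial>M) = (\<integral>\<^sup>+x. (\<integral>\<^sup>+l. density_at a (\<psi> l x) \<partial>count_space (carrier P)) * indicator Y x \<partial>M)"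
    using density_measurable[OF a] by (intro L.unfold[OF L.subgroup_self fundY]) simp
  also have "\<dots> = (\<integral>\<^sup>+x. indicator Y x \<partial>M)"
  proof (rule nn_integral_cong)
    fix x assume x: "x \<in> space M"
    have ax: "\<phi> a x \<in> space M" using G.act_space[OF A_carrier[OF a] x] .
    have "(\<integral>\<^sup>+l. density_at a (\<psi> l x) \<partial>count_space (carrier P)) =
       (\<integral>\<^sup>+l. (\<Prod>j\<in>J. \<mu> j (p x j) (p (\<phi> a x) j) ((inv\<^bsub>P\<^esub> l) j)) \<partial>count_space (carrier P))"
      using density_orbit[OF a x] by (intro nn_integral_cong) (simp only: space_count_space)
    also have "\<dots> = (\<integral>\<^sup>+l. (\<Prod>j\<in>J. \<mu> j (p x j) (p (\<phi> a x) j) (l j)) \<partial>count_space (\<Pi>\<^sub>E j\<in>J. carrier (\<Lambda> j)))"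
      by (rule inv_reindex)
    also have "\<dots> = 1"
      using mu_prob_at[OF _ x ax] by (intro prod_prob_nn(1)[OF finJ]) auto
    finally show "(\<integral>\<^sup>+l. density_at a (\<psi> l x) \<partial>count_space (carrier P)) * indicator Y x = indicator Y x" by simp
  qed
  also have "\<dots> = emeasure M Y" using L.fund_sets[OF fundY] by simp
  finally show ?thesis .
qed

text \<open>Unfolding over \<open>Y\<close> reduces the L1 distance to a distance of two product
  kernels for each orbit. It is at most \<open>card J * e\<close> when the representative in
  \<open>Y\<close> is off \<open>bad\<close>, and at most 2 in any case.\<close>

lemma density_diff:
  fixes e :: real
  assumes a: "a \<in> A" and b: "b \<in> carrier B" and bad: "bad \<in> sets M"
    and close: "\<And>x j U. x \<in> Y \<Longrightarrow> x \<notin> bad \<Longrightarrow> j \<in> J \<Longrightarrow> finite U \<Longrightarrow>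
      (\<Sum>u\<in>U. \<bar>\<mu> j (p (\<theta> b x) j) (p (\<phi> a (\<theta> b x)) j) u - \<mu> j (p x j) (p (\<phi> a x) j) u\<bar>) \<le> e"
    and e: "e \<ge> 0"
  shows "(\<integral>\<^sup>+x. \<bar>density_at a (\<theta> b x) - density_at a x\<bar> \<partial>M) \<le>
     ennreal (card J * e) * emeasure M Y + 2 * emeasure M (bad \<inter> Y)"
proof -
  have Ym: "Y \<in> sets M" using L.fund_sets[OF fundY] .
  have ag: "a \<in> carrier G" using a A_carrier by blast
  have dm [measurable]: "density_at a \<in> borel_measurable M" using density_measurable[OF a] .
  have tm [measurable]: "\<theta> b \<in> measurable M M" using B.act_measurable[OF b] .
  let ?d = "\<lambda>x. \<integral>\<^sup>+l. \<bar>density_at a (\<theta> b (\<psi> l x)) - density_at a (\<psi> l x)\<bar> \<partial>count_space (carrier P)"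
  have bound: "?d x * indicator Y x \<le> ennreal (card J * e) * indicator Y x + 2 * indicator (bad \<inter> Y) x" if x: "x \<in> space M" for x
  proof -
    have tx: "\<theta> b x \<in> space M" using B.act_space[OF b x] .
    have ax: "\<phi> a x \<in> space M" "\<phi> a (\<theta> b x) \<in> space M" using G.act_space[OF ag] x tx by auto
    let ?u = "\<lambda>j. \<mu> j (p (\<theta> b x) j) (p (\<phi> a (\<theta> b x)) j)" and ?v = "\<lambda>j. \<mu> j (p x j) (p (\<phi> a x) j)"
    have pr: "fin_prob (carrier (\<Lambda> j)) (?u j)" "fin_prob (carrier (\<Lambda> j)) (?v j)" if "j \<in> J" for j
      using mu_prob_at[OF that] x tx ax by auto
    have "?d x = (\<integral>\<^sup>+l. \<bar>(\<Prod>j\<in>J. ?u j ((inv\<^bsub>P\<^esub> l) j)) - (\<Prod>j\<in>J. ?v j ((inv\<^bsub>P\<^esub> l) j))\<bar> \<partial>count_space (carrier P))"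
    proof (rule nn_integral_cong)
      fix l assume "l \<in> space (count_space (carrier P))"
      then have l: "l \<in> carrier P" by (simp only: space_count_space)
      show "ennreal \<bar>density_at a (\<theta> b (\<psi> l x)) - density_at a (\<psi> l x)\<bar> =
        ennreal \<bar>(\<Prod>j\<in>J. ?u j ((inv\<^bsub>P\<^esub> l) j)) - (\<Prod>j\<in>J. ?v j ((inv\<^bsub>P\<^esub> l) j))\<bar>"
        unfolding commB[OF b l x] density_orbit[OF a x l] density_orbit[OF a tx l] ..
    qed
    also have "\<dots> = (\<integral>\<^sup>+l. \<bar>(\<Prod>j\<in>J. ?u j (l j)) - (\<Prod>j\<in>J. ?v j (l j))\<bar> \<partial>count_space (\<Pi>\<^sub>E j\<in>J. carrier (\<Lambda> j)))"
      by (rule inv_reindex[of "\<lambda>l. ennreal \<bar>(\<Prod>j\<in>J. ?u j (l j)) - (\<Prod>j\<in>J. ?v j (l j))\<bar>"])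
    finally have d: "?d x = (\<integral>\<^sup>+l. \<bar>(\<Prod>j\<in>J. ?u j (l j)) - (\<Prod>j\<in>J. ?v j (l j))\<bar> \<partial>count_space (\<Pi>\<^sub>E j\<in>J. carrier (\<Lambda> j)))" .
    have d2: "?d x \<le> 2" unfolding d by (rule prod_prob_nn(2)[OF finJ pr])
    have d1: "?d x \<le> ennreal (card J * e)" if "x \<in> Y" "x \<notin> bad"
      unfolding d by (rule prod_prob_nn(3)[OF finJ pr close[OF that]])
    show ?thesis using d1 d2 by (auto simp: indicator_def intro: add_increasing)
  qed
  have "(\<integral>\<^sup>+x. \<bar>density_at a (\<theta> b x) - density_at a x\<bar> \<partial>M) = (\<integral>\<^sup>+x. ?d x * indicator Y x \<partial>M)"
    by (rule L.unfold[OF L.subgroup_self fundY]) measurable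
  also have "\<dots> \<le> (\<integral>\<^sup>+x. ennreal (card J * e) * indicator Y x + 2 * indicator (bad \<inter> Y) x \<partial>M)"
    by (rule nn_integral_mono) (rule bound)
  also have "\<dots> = ennreal (card J * e) * emeasure M Y + 2 * emeasure M (bad \<inter> Y)"
    using Ym bad by (simp add: nn_integral_add nn_integral_cmult)
  finally show ?thesis .
qed

end

text \<open>For a point \<open>x\<close> of \<open>Y\<close> outside a small set, an element of
  \<open>F\<close> moves the positions of \<open>x\<close> and of \<open>\<phi> a x\<close> by
  elements of the finite set \<open>C'\<close>, while the choice of \<open>a\<close> keeps these
  positions far apart in every coordinate. Each kernel then changes by at most \<open>e\<close>, and
  the density becomes more invariant under \<open>F\<close> than \<open>no_reiter\<close>
  permits.\<close>

theorem ex_recurrent: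
  assumes ZB: "B.fund (carrier B) ZB" and nr: "no_reiter B" and be: "\<And>j. j \<in> J \<Longrightarrow> bi_exact (\<Lambda> j)"
  shows "\<exists>j\<in>J. \<exists>E. recurrent A j E"
proof (rule ccontr)
  assume none: "\<not> ?thesis"
  have AG: "a \<in> carrier G" if "a \<in> A" for a using A subgroup.subset that by blast
  have Ym: "Y \<in> sets M" using L.fund_sets[OF fundY] .
  obtain F \<epsilon> where F: "finite F" "F \<subseteq> carrier B" "\<epsilon> > (0::real)"
    "\<And>(\<xi> :: 's \<Rightarrow> real) (y :: real). \<xi> \<in> borel_measurable M \<Longrightarrow> (\<And>x. \<xi> x \<ge> 0) \<Longrightarrow> y > 0 \<Longrightarrow> (\<integral>\<^sup>+x. \<xi> x \<partial>M) = ennreal y \<Longrightarrow>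
      \<exists>s\<in>F. (\<integral>\<^sup>+x. \<bar>\<xi> (\<theta> s x) - \<xi> x\<bar> \<partial>M) \<ge> ennreal (\<epsilon> * y)"
    using B.no_reiter_density[OF nr ZB] by blast
  define y where "y = enn2real (emeasure M Y)"
  have My: "emeasure M Y = ennreal y" using finY by (simp add: y_def)
  have "emeasure M Y \<noteq> 0" by (rule L.positive_fund[OF L.subgroup_self fundY nonzero])
  then have "y \<noteq> 0" using My by auto
  then have y: "y > 0" using enn2real_nonneg[of "emeasure M Y"] unfolding y_def by linarith
  \<comment> \<open>The budget: through \<open>e\<close> the kernels contribute at most half of
    \<open>\<epsilon> * y\<close>; three exceptional sets of mass \<open>\<eta>\<close>, each
    weighted by 2, contribute \<open>6 * \<eta>\<close>, three eighths of it.\<close>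
  define \<eta> where "\<eta> = \<epsilon> * y / 16"
  have eta: "\<eta> > 0" using F y by (simp add: \<eta>_def)
  define e where "e = \<epsilon> / (2 * (card J + 1))"
  have e: "e > 0" using F by (simp add: e_def)
  text \<open>Off a small set the drift under \<open>F\<close> takes finitely many values.\<close>
  have "\<forall>b\<in>F. \<exists>C. finite C \<and> C \<subseteq> carrier P \<and> emeasure M {x \<in> Y. drift b x \<notin> C} < ennreal (\<eta> / (card F + 1))"
  proof (rule ballI, rule finite_range_approx[OF _ countable_P Ym finY])
    fix b assume "b \<in> F"
    then show "drift b \<in> measurable M (count_space (carrier P))" using F by (intro drift_measurable) blast
    show "0 < \<eta> / (card F + 1)" using eta by simp
  qed
  then obtain C where CF: "\<forall>b\<in>F. finite (C b) \<and> C b \<subseteq> carrier P \<and> emeasure M {x \<in> Y. drift b x \<notin> C b} < ennreal (\<eta> / (card F + 1))"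
    by (rule bchoice[THEN exE])
  have C: "finite (C b)" "C b \<subseteq> carrier P" "emeasure M {x \<in> Y. drift b x \<notin> C b} < ennreal (\<eta> / (card F + 1))"
    if "b \<in> F" for b using CF that by blast+
  define C' where "C' = (\<Union>b\<in>F. C b)"
  have C': "finite C'" "C' \<subseteq> carrier P" unfolding C'_def using C(1) F(1) UN_least[of F C "carrier P"] C(2) by blast+
  \<comment> \<open>The condition involves only the drift, which is constant along the orbits of
    \<open>\<psi>\<close>, so this is an invariant set.\<close>
  define bad where "bad = (\<Union>b\<in>F. {x \<in> space M. drift b x \<notin> C'})"
  have drift_sets: "{x \<in> space M. drift b x \<notin> C'} \<in> sets M" if "b \<in> F" for b
  proof -
    have "{x \<in> space M. drift b x \<notin> C'} = drift b -` (carrier P - C') \<inter> space M"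
      using drift_closed that F by (auto simp del: carrier_product_group)
    also have "\<dots> \<in> sets M" using that F by (intro measurable_sets[OF drift_measurable]) auto
    finally show ?thesis .
  qed
  have bad_inv: "L.inv_set (carrier P) bad"
    unfolding L.inv_set_def
  proof (intro conjI ballI)
    show "bad \<in> sets M" unfolding bad_def using drift_sets F by (intro sets.finite_UN) auto
    fix l x assume l: "l \<in> carrier P" and x: "x \<in> space M"
    have "drift b (\<psi> l x) = drift b x" if "b \<in> F" for b
      by (rule drift_act) (use that F l x in blast)+
    then show "\<psi> l x \<in> bad \<longleftrightarrow> x \<in> bad" unfolding bad_def using x L.act_space[OF l x] by simp
  qed
  have bad_small: "emeasure M (bad \<inter> Y) \<le> ennreal \<eta>"
  proof -
    have "bad \<inter> Y = (\<Union>b\<in>F. {x \<in> space M. drift b x \<notin> C'} \<inter> Y)" by (auto simp: bad_def)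
    also have "emeasure M \<dots> \<le> (\<Sum>b\<in>F. emeasure M ({x \<in> space M. drift b x \<notin> C'} \<inter> Y))"
      using drift_sets Ym F(1) by (intro emeasure_subadditive_finite) auto
    also have "\<dots> \<le> (\<Sum>b\<in>F. ennreal (\<eta> / (card F + 1)))"
    proof (rule sum_mono)
      fix b assume b: "b \<in> F"
      have meas: "{x \<in> Y. drift b x \<notin> C b} \<in> sets M"
      proof -
        have "{x \<in> Y. drift b x \<notin> C b} = Y \<inter> (drift b -` (carrier P - C b) \<inter> space M)"
          using drift_closed[OF subsetD[OF F(2) b]] Y_space by blast
        moreover have "drift b -` (carrier P - C b) \<inter> space M \<in> sets M"
          using subsetD[OF F(2) b] by (intro measurable_sets[OF drift_measurable]) auto
        ultimately show ?thesis using Ym by simp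
      qed
      have "emeasure M ({x \<in> space M. drift b x \<notin> C'} \<inter> Y) \<le> emeasure M {x \<in> Y. drift b x \<notin> C b}"
        using b by (intro emeasure_mono meas) (auto simp: C'_def)
      also have "\<dots> \<le> ennreal (\<eta> / (card F + 1))" using C(3)[OF b] by simp
      finally show "emeasure M ({x \<in> space M. drift b x \<notin> C'} \<inter> Y) \<le> ennreal (\<eta> / (card F + 1))" .
    qed
    also have "\<dots> = ennreal (card F * (\<eta> / (card F + 1)))"
      using eta by (simp add: ennreal_of_nat_eq_real_of_nat ennreal_mult[symmetric])
    also have "\<dots> \<le> ennreal \<eta>"
      using eta by (intro ennreal_leI) (simp add: field_simps)
    finally show ?thesis .
  qed
  define Cj where "Cj j = (\<lambda>l. l j) ` C'" for j
  have Cj: "finite (Cj j) \<and> Cj j \<subseteq> carrier (\<Lambda> j)" if "j \<in> J" for j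
  proof
    show "finite (Cj j)" unfolding Cj_def using C'(1) by (rule finite_imageI)
    show "Cj j \<subseteq> carrier (\<Lambda> j)" unfolding Cj_def
    proof (rule image_subsetI)
      fix l assume "l \<in> C'"
      then show "l j \<in> carrier (\<Lambda> j)" using P_comp(4)[OF that] C'(2) by blast
    qed
  qed
  have "\<forall>j\<in>J. \<exists>K\<mu>. finite (fst K\<mu>) \<and> fst K\<mu> \<subseteq> carrier (\<Lambda> j) \<and>
       (\<forall>w\<in>carrier (\<Lambda> j). \<forall>z\<in>carrier (\<Lambda> j). fin_prob (carrier (\<Lambda> j)) (snd K\<mu> w z)) \<and>
       (\<forall>g\<in>carrier (\<Lambda> j). \<forall>w\<in>carrier (\<Lambda> j). \<forall>z\<in>carrier (\<Lambda> j). \<forall>u\<in>carrier (\<Lambda> j).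
          snd K\<mu> (g \<otimes>\<^bsub>\<Lambda> j\<^esub> w) (g \<otimes>\<^bsub>\<Lambda> j\<^esub> z) (g \<otimes>\<^bsub>\<Lambda> j\<^esub> u) = snd K\<mu> w z u) \<and>
       (\<forall>w\<in>carrier (\<Lambda> j). \<forall>z\<in>carrier (\<Lambda> j). \<forall>h\<in>Cj j. \<forall>k\<in>Cj j. inv\<^bsub>\<Lambda> j\<^esub> w \<otimes>\<^bsub>\<Lambda> j\<^esub> z \<notin> fst K\<mu> \<longrightarrow>
          (\<forall>U. finite U \<longrightarrow> (\<Sum>u\<in>U. \<bar>snd K\<mu> w z u - snd K\<mu> (w \<otimes>\<^bsub>\<Lambda> j\<^esub> h) (z \<otimes>\<^bsub>\<Lambda> j\<^esub> k) u\<bar>) \<le> e))"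
  proof
    fix j assume j: "j \<in> J"
    from be[OF j, unfolded bi_exact_def, rule_format, OF e Cj[OF j]]
    obtain K \<mu> where K\<mu>: "finite K" "K \<subseteq> carrier (\<Lambda> j)"
       "\<forall>w\<in>carrier (\<Lambda> j). \<forall>z\<in>carrier (\<Lambda> j). (\<forall>u. \<mu> w z u \<ge> (0::real)) \<and>
          (\<exists>U. finite U \<and> U \<subseteq> carrier (\<Lambda> j) \<and> (\<forall>u. u \<notin> U \<longrightarrow> \<mu> w z u = 0) \<and> (\<Sum>u\<in>U. \<mu> w z u) = 1)"
       "\<forall>g\<in>carrier (\<Lambda> j). \<forall>w\<in>carrier (\<Lambda> j). \<forall>z\<in>carrier (\<Lambda> j). \<forall>u\<in>carrier (\<Lambda> j).
          \<mu> (g \<otimes>\<^bsub>\<Lambda> j\<^esub> w) (g \<otimes>\<^bsub>\<Lambda> j\<^esub> z) (g \<otimes>\<^bsub>\<Lambda> j\<^esub> u) = \<mu> w z u"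
       "\<forall>w\<in>carrier (\<Lambda> j). \<forall>z\<in>carrier (\<Lambda> j). \<forall>h\<in>Cj j. \<forall>k\<in>Cj j. inv\<^bsub>\<Lambda> j\<^esub> w \<otimes>\<^bsub>\<Lambda> j\<^esub> z \<notin> K \<longrightarrow>
          (\<forall>U. finite U \<longrightarrow> (\<Sum>u\<in>U. \<bar>\<mu> w z u - \<mu> (w \<otimes>\<^bsub>\<Lambda> j\<^esub> h) (z \<otimes>\<^bsub>\<Lambda> j\<^esub> k) u\<bar>) \<le> e)" by (elim exE conjE) (rule that; assumption)
    show "\<exists>K\<mu>. finite (fst K\<mu>) \<and> fst K\<mu> \<subseteq> carrier (\<Lambda> j) \<and>
       (\<forall>w\<in>carrier (\<Lambda> j). \<forall>z\<in>carrier (\<Lambda> j). fin_prob (carrier (\<Lambda> j)) (snd K\<mu> w z)) \<and>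
       (\<forall>g\<in>carrier (\<Lambda> j). \<forall>w\<in>carrier (\<Lambda> j). \<forall>z\<in>carrier (\<Lambda> j). \<forall>u\<in>carrier (\<Lambda> j).
          snd K\<mu> (g \<otimes>\<^bsub>\<Lambda> j\<^esub> w) (g \<otimes>\<^bsub>\<Lambda> j\<^esub> z) (g \<otimes>\<^bsub>\<Lambda> j\<^esub> u) = snd K\<mu> w z u) \<and>
       (\<forall>w\<in>carrier (\<Lambda> j). \<forall>z\<in>carrier (\<Lambda> j). \<forall>h\<in>Cj j. \<forall>k\<in>Cj j. inv\<^bsub>\<Lambda> j\<^esub> w \<otimes>\<^bsub>\<Lambda> j\<^esub> z \<notin> fst K\<mu> \<longrightarrow>
          (\<forall>U. finite U \<longrightarrow> (\<Sum>u\<in>U. \<bar>snd K\<mu> w z u - snd K\<mu> (w \<otimes>\<^bsub>\<Lambda> j\<^esub> h) (z \<otimes>\<^bsub>\<Lambda> j\<^esub> k) u\<bar>) \<le> e))"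
      unfolding fin_prob_def using K\<mu> by (intro exI[of _ "(K, \<mu>)"]) (simp only: fst_conv snd_conv simp_thms)
  qed
  then obtain K\<mu> where K\<mu>: "\<forall>j\<in>J. finite (fst (K\<mu> j)) \<and> fst (K\<mu> j) \<subseteq> carrier (\<Lambda> j) \<and>
       (\<forall>w\<in>carrier (\<Lambda> j). \<forall>z\<in>carrier (\<Lambda> j). fin_prob (carrier (\<Lambda> j)) (snd (K\<mu> j) w z)) \<and>
       (\<forall>g\<in>carrier (\<Lambda> j). \<forall>w\<in>carrier (\<Lambda> j). \<forall>z\<in>carrier (\<Lambda> j). \<forall>u\<in>carrier (\<Lambda> j).
          snd (K\<mu> j) (g \<otimes>\<^bsub>\<Lambda> j\<^esub> w) (g \<otimes>\<^bsub>\<Lambda> j\<^esub> z) (g \<otimes>\<^bsub>\<Lambda> j\<^esub> u) = snd (K\<mu> j) w z u) \<and>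
       (\<forall>w\<in>carrier (\<Lambda> j). \<forall>z\<in>carrier (\<Lambda> j). \<forall>h\<in>Cj j. \<forall>k\<in>Cj j. inv\<^bsub>\<Lambda> j\<^esub> w \<otimes>\<^bsub>\<Lambda> j\<^esub> z \<notin> fst (K\<mu> j) \<longrightarrow>
          (\<forall>U. finite U \<longrightarrow> (\<Sum>u\<in>U. \<bar>snd (K\<mu> j) w z u - snd (K\<mu> j) (w \<otimes>\<^bsub>\<Lambda> j\<^esub> h) (z \<otimes>\<^bsub>\<Lambda> j\<^esub> k) u\<bar>) \<le> e))"
    by (rule bchoice[THEN exE])
  define K where "K j = fst (K\<mu> j)" for j
  define \<mu> where "\<mu> j = snd (K\<mu> j)" for j
  note Kmu = K\<mu>[folded K_def \<mu>_def]
  have mu1: "fin_prob (carrier (\<Lambda> j)) (\<mu> j w z)" if "j \<in> J" "w \<in> carrier (\<Lambda> j)" "z \<in> carrier (\<Lambda> j)" for j w z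
    using Kmu that by blast
  have mu2: "\<mu> j (g \<otimes>\<^bsub>\<Lambda> j\<^esub> w) (g \<otimes>\<^bsub>\<Lambda> j\<^esub> z) (g \<otimes>\<^bsub>\<Lambda> j\<^esub> u) = \<mu> j w z u"
    if "j \<in> J" "g \<in> carrier (\<Lambda> j)" "w \<in> carrier (\<Lambda> j)" "z \<in> carrier (\<Lambda> j)" "u \<in> carrier (\<Lambda> j)" for j g w z u
    using Kmu that by blast
  have mu3: "(\<Sum>u\<in>U. \<bar>\<mu> j w z u - \<mu> j (w \<otimes>\<^bsub>\<Lambda> j\<^esub> h) (z \<otimes>\<^bsub>\<Lambda> j\<^esub> k) u\<bar>) \<le> e"
    if "j \<in> J" "w \<in> carrier (\<Lambda> j)" "z \<in> carrier (\<Lambda> j)" "h \<in> Cj j" "k \<in> Cj j" "inv\<^bsub>\<Lambda> j\<^esub> w \<otimes>\<^bsub>\<Lambda> j\<^esub> z \<notin> K j" "finite U" for j w z h k U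
    using Kmu that by blast
  have finK: "finite (K j)" if "j \<in> J" for j using Kmu that by blast
  \<comment> \<open>The identity is included because points of \<open>Y\<close> have trivial
    position: a point of \<open>Y\<close> that \<open>a\<close> brings to level \<open>K j\<close>
    is then a return to \<open>?D j\<close> inside \<open>slice j\<close>.\<close>
  let ?D = "\<lambda>j. lev j (insert \<one>\<^bsub>\<Lambda> j\<^esub> (K j))"
  have "\<exists>a\<in>A. (\<Sum>j\<in>J. emeasure M ({x \<in> space M. x \<in> ?D j \<and> \<phi> a x \<in> ?D j} \<inter> slice j)) < ennreal \<eta>"
  proof (rule escape[OF A _ _ _ eta])
    show "\<not> recurrent A j E" if "j \<in> J" for j E using none that by blast
    show "emeasure M (?D j \<inter> slice j) < \<infinity>" if "j \<in> J" for j using finK that by (intro lev_finite) auto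
  qed (rule inv_lev)
  then obtain a where a: "a \<in> A" "(\<Sum>j\<in>J. emeasure M ({x \<in> space M. x \<in> ?D j \<and> \<phi> a x \<in> ?D j} \<inter> slice j)) < ennreal \<eta>"
    by blast
  have ag: "a \<in> carrier G" using a AG by blast
  define near where "near = (\<Union>j\<in>J. {x \<in> space M. \<phi> a x \<in> lev j (K j)})"
  have near_sets: "{x \<in> space M. \<phi> a x \<in> lev j (K j)} \<in> sets M" for j
    by (rule G.vimage_sets[OF ag lev_sets])
  have near_small: "emeasure M (near \<inter> Y) \<le> ennreal \<eta>"
  proof -
    have "near \<inter> Y = (\<Union>j\<in>J. {x \<in> space M. \<phi> a x \<in> lev j (K j)} \<inter> Y)" by (auto simp: near_def)
    also have "emeasure M \<dots> \<le> (\<Sum>j\<in>J. emeasure M ({x \<in> space M. \<phi> a x \<in> lev j (K j)} \<inter> Y))"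
      using near_sets Ym finJ by (intro emeasure_subadditive_finite) auto
    also have "\<dots> \<le> (\<Sum>j\<in>J. emeasure M ({x \<in> space M. x \<in> ?D j \<and> \<phi> a x \<in> ?D j} \<inter> slice j))"
    proof (intro sum_mono emeasure_mono)
      fix j assume j: "j \<in> J"
      show "{x \<in> space M. \<phi> a x \<in> lev j (K j)} \<inter> Y \<subseteq> {x \<in> space M. x \<in> ?D j \<and> \<phi> a x \<in> ?D j} \<inter> slice j"
      proof
        fix x assume x: "x \<in> {x \<in> space M. \<phi> a x \<in> lev j (K j)} \<inter> Y"
        then have "p x = \<one>\<^bsub>P\<^esub>" using L.pos_one[OF fundY] by blast
        then have "p x k = \<one>\<^bsub>\<Lambda> k\<^esub>" if "k \<in> J" for k using P_comp(2)[OF that] by (simp only:)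
        then show "x \<in> {x \<in> space M. x \<in> ?D j \<and> \<phi> a x \<in> ?D j} \<inter> slice j"
          using x j by (auto simp: lev_def slice_def)
      qed
      have "{x \<in> space M. x \<in> ?D j \<and> \<phi> a x \<in> ?D j} = ?D j \<inter> {x \<in> space M. \<phi> a x \<in> ?D j}" by (auto simp: lev_def)
      also have "\<dots> \<in> sets M" by (intro sets.Int lev_sets G.vimage_sets[OF ag])
      finally show "{x \<in> space M. x \<in> ?D j \<and> \<phi> a x \<in> ?D j} \<inter> slice j \<in> sets M"
        using slice_sets by (rule sets.Int)
    qed
    also have "\<dots> \<le> ennreal \<eta>" using a(2) by simp
    finally show ?thesis .
  qed
  \<comment> \<open>The position of \<open>\<phi> a x\<close> must also drift by elements of
    \<open>C'\<close>. As \<open>\<phi> a\<close> commutes with \<open>\<psi>\<close>, it preserves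
    the measure of the quotient, so this preimage of the invariant set \<open>bad\<close> has the
    same mass inside \<open>Y\<close> as \<open>bad\<close> itself.\<close>
  define bad' where "bad' = {x \<in> space M. \<phi> a x \<in> bad}"
  have bad'_sets: "bad' \<in> sets M" unfolding bad'_def by (rule G.vimage_sets[OF ag L.inv_set_sets[OF bad_inv]])
  have bad'_small: "emeasure M (bad' \<inter> Y) \<le> ennreal \<eta>"
    unfolding bad'_def using L.commuting_quot(2)[OF L.subgroup_self fundY bad_inv G.act_measurable[OF ag] G.act_distr[OF ag] comm[OF ag]] bad_small
    by simp
  define all where "all = bad \<union> bad' \<union> near"
  have near_m: "near \<in> sets M" unfolding near_def using near_sets finJ by (intro sets.finite_UN) auto
  have all_sets: "all \<in> sets M"
    unfolding all_def by (intro sets.Un bad'_sets near_m L.inv_set_sets[OF bad_inv])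
  have all_small: "emeasure M (all \<inter> Y) \<le> ennreal (3 * \<eta>)"
  proof -
    have "all \<inter> Y = (bad \<inter> Y) \<union> (bad' \<inter> Y) \<union> (near \<inter> Y)" by (auto simp: all_def)
    also have "emeasure M \<dots> \<le> emeasure M ((bad \<inter> Y) \<union> (bad' \<inter> Y)) + emeasure M (near \<inter> Y)"
      using Ym bad'_sets near_m L.inv_set_sets[OF bad_inv] by (intro emeasure_subadditive) auto
    also have "\<dots> \<le> (emeasure M (bad \<inter> Y) + emeasure M (bad' \<inter> Y)) + emeasure M (near \<inter> Y)"
      using Ym bad'_sets near_m L.inv_set_sets[OF bad_inv] by (intro add_right_mono emeasure_subadditive) auto
    also have "\<dots> \<le> (ennreal \<eta> + ennreal \<eta>) + ennreal \<eta>"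
      by (intro add_mono bad_small bad'_small near_small)
    also have "\<dots> = ennreal (3 * \<eta>)" using eta by (simp add: ennreal_plus[symmetric] del: ennreal_plus)
    finally show ?thesis .
  qed
  let ?\<xi> = "density_at \<mu> a"
  note mu = mu1 mu2
  have xi: "?\<xi> \<in> borel_measurable M" "\<And>x. ?\<xi> x \<ge> 0" "(\<integral>\<^sup>+x. ?\<xi> x \<partial>M) = ennreal y"
    using density_measurable[where \<mu> = \<mu>, OF mu a(1)] density_nonneg[where \<mu> = \<mu>, OF mu] density_total[where \<mu> = \<mu>, OF mu a(1)] My by auto
  obtain s where s: "s \<in> F" "(\<integral>\<^sup>+x. \<bar>?\<xi> (\<theta> s x) - ?\<xi> x\<bar> \<partial>M) \<ge> ennreal (\<epsilon> * y)"
    using F(4)[OF xi(1,2) y xi(3)] by blast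
  have sB: "s \<in> carrier B" using s F by blast
  have "(\<integral>\<^sup>+x. \<bar>?\<xi> (\<theta> s x) - ?\<xi> x\<bar> \<partial>M) \<le> ennreal (card J * e) * emeasure M Y + 2 * emeasure M (all \<inter> Y)"
  proof (rule density_diff[where \<mu> = \<mu>, OF mu a(1) sB all_sets])
    fix x j and U :: "'b set" assume x: "x \<in> Y" "x \<notin> all" and j: "j \<in> J" and U: "finite U"
    interpret j: group "\<Lambda> j" using grp[OF j] .
    have xs: "x \<in> space M" using x Y_space by blast
    have ax: "\<phi> a x \<in> space M" using G.act_space[OF ag xs] .
    have in_C: "drift s x \<in> C'" "drift s (\<phi> a x) \<in> C'"
      using x xs ax s(1) by (auto simp: all_def bad'_def bad_def)
    have pc: "p x j \<in> carrier (\<Lambda> j)" "p (\<phi> a x) j \<in> carrier (\<Lambda> j)"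
      using P_comp(4)[OF j p_closed[OF xs]] P_comp(4)[OF j p_closed[OF ax]] by auto
    have p1: "p (\<theta> s x) j = p x j \<otimes>\<^bsub>\<Lambda> j\<^esub> drift s x j" unfolding p_drift[OF sB xs] P_comp(1)[OF j] ..
    have p2: "p (\<phi> a (\<theta> s x)) j = p (\<phi> a x) j \<otimes>\<^bsub>\<Lambda> j\<^esub> drift s (\<phi> a x) j"
      unfolding commAB[OF sB a(1) xs, symmetric] p_drift[OF sB ax] P_comp(1)[OF j] ..
    have "p x = \<one>\<^bsub>P\<^esub>" using L.pos_one[OF fundY x(1)] .
    then have px: "p x j = \<one>\<^bsub>\<Lambda> j\<^esub>" using P_comp(2)[OF j] by (simp only:)
    have "p (\<phi> a x) j \<notin> K j" using x xs ax j by (auto simp: all_def near_def lev_def)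
    then have far: "inv\<^bsub>\<Lambda> j\<^esub> (p x j) \<otimes>\<^bsub>\<Lambda> j\<^esub> p (\<phi> a x) j \<notin> K j" unfolding px using pc(2) by simp
    have "drift s x j \<in> Cj j" "drift s (\<phi> a x) j \<in> Cj j" using in_C by (auto simp: Cj_def)
    from mu3[OF j pc this far U]
    show "(\<Sum>u\<in>U. \<bar>\<mu> j (p (\<theta> s x) j) (p (\<phi> a (\<theta> s x)) j) u - \<mu> j (p x j) (p (\<phi> a x) j) u\<bar>) \<le> e"
      unfolding p1 p2 by (simp add: abs_minus_commute)
  qed (use e in auto)
  also have "\<dots> \<le> ennreal (card J * e) * ennreal y + 2 * ennreal (3 * \<eta>)"
    unfolding My by (intro add_left_mono mult_left_mono all_small) simp
  also have "\<dots> = ennreal (card J * e * y + 6 * \<eta>)"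
  proof -
    have "2 * ennreal (3 * \<eta>) = ennreal (6 * \<eta>)"
      using eta ennreal_mult[of 2 "3 * \<eta>"] by simp
    then show ?thesis using e y eta by (simp add: ennreal_mult[symmetric] ennreal_plus[symmetric] del: ennreal_plus)
  qed
  finally have "ennreal (\<epsilon> * y) \<le> ennreal (card J * e * y + 6 * \<eta>)" using s(2) by (rule order_trans[rotated])
  then have le: "\<epsilon> * y \<le> card J * e * y + 6 * \<eta>" using e y eta by (subst (asm) ennreal_le_iff) auto
  have "card J * e \<le> \<epsilon> / 2" using F(3) by (simp add: e_def field_simps)
  then have "card J * e * y \<le> \<epsilon> / 2 * y" using y by (intro mult_right_mono) auto
  moreover have "6 * \<eta> = 3/8 * (\<epsilon> * y)" by (simp add: \<eta>_def)
  moreover have "\<epsilon> * y > 0" using F(3) y by simp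
  ultimately show False using le by linarith
qed

end

section \<open>Splitting a factor off a coupling\<close>

context mp_action
begin

lemma sets_restrict: "W \<in> sets M \<Longrightarrow> E \<in> sets (restrict_space M W) \<longleftrightarrow> E \<in> sets M \<and> E \<subseteq> W"
  by (auto simp: sets_restrict_space_iff sets.Int_space_eq2)

lemma emeasure_restrict: "W \<in> sets M \<Longrightarrow> E \<subseteq> W \<Longrightarrow> emeasure (restrict_space M W) E = emeasure M E"
  by (rule emeasure_restrict_space) (simp_all add: sets.Int_space_eq2)

lemma space_restrict: "W \<in> sets M \<Longrightarrow> space (restrict_space M W) = W"
  by (simp add: space_restrict_space2)

lemma restrict_action:
  assumes W: "inv_set (carrier G) W"
  shows "mp_action G (restrict_space M W) act"
proof -
  have Ws: "W \<in> sets M" "W \<subseteq> space M" using inv_set_sets[OF W] sets.sets_into_space by auto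
  note sp = space_restrict[OF Ws(1)]
  have inW: "act g x \<in> W" if "g \<in> carrier G" "x \<in> W" for g x
    using inv_set_D[OF W that(1), of x] that Ws by blast
  have pre: "{x \<in> W. act g x \<in> E} = {x \<in> space M. act g x \<in> E}" if "g \<in> carrier G" "E \<subseteq> W" for g E
    using inv_set_D[OF W that(1)] that Ws by blast
  have meas: "act g \<in> measurable (restrict_space M W) (restrict_space M W)" if g: "g \<in> carrier G" for g
  proof (rule measurableI)
    fix E assume "E \<in> sets (restrict_space M W)"
    then have E: "E \<in> sets M" "E \<subseteq> W" by (simp_all add: sets_restrict[OF Ws(1)])
    have "act g -` E \<inter> space (restrict_space M W) = {x \<in> W. act g x \<in> E}" by (auto simp: sp)
    moreover have "{x \<in> W. act g x \<in> E} \<in> sets M" unfolding pre[OF g E(2)] using vimage_sets[OF g E(1)] .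
    ultimately show "act g -` E \<inter> space (restrict_space M W) \<in> sets (restrict_space M W)"
      by (simp add: sets_restrict[OF Ws(1)])
  qed (simp add: sp inW[OF g])
  show ?thesis
  proof (rule mp_action.intro[OF is_group], rule mp_action_axioms.intro)
    show "countable (carrier G)" by (rule countable_carrier)
    fix g assume g: "g \<in> carrier G"
    show "act g \<in> measurable (restrict_space M W) (restrict_space M W)" by (rule meas[OF g])
    show "distr (restrict_space M W) (restrict_space M W) (act g) = restrict_space M W"
    proof (rule measure_eqI)
      fix E assume "E \<in> sets (distr (restrict_space M W) (restrict_space M W) (act g))"
      then have Er: "E \<in> sets (restrict_space M W)" by simp
      then have E: "E \<in> sets M" "E \<subseteq> W" by (simp_all add: sets_restrict[OF Ws(1)])
      have "emeasure (distr (restrict_space M W) (restrict_space M W) (act g)) E =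
        emeasure (restrict_space M W) {x \<in> W. act g x \<in> E}"
        by (subst emeasure_distr[OF meas[OF g] Er]) (auto simp: sp vimage_def Int_def conj_commute intro!: arg_cong2[where f = emeasure])
      also have "\<dots> = emeasure M {x \<in> W. act g x \<in> E}" by (rule emeasure_restrict[OF Ws(1)]) blast
      also have "\<dots> = emeasure M E" unfolding pre[OF g E(2)] by (rule vimage_measure[OF g E(1)])
      also have "\<dots> = emeasure (restrict_space M W) E" by (rule emeasure_restrict[OF Ws(1) E(2), symmetric])
      finally show "emeasure (distr (restrict_space M W) (restrict_space M W) (act g)) E = emeasure (restrict_space M W) E" .
    qed simp
  next
    fix x assume "x \<in> space (restrict_space M W)"
    then have x: "x \<in> space M" using Ws(2) unfolding sp by blast
    show "act \<one> x = x" by (rule act_one[OF x])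
    fix g h assume gh: "g \<in> carrier G" "h \<in> carrier G"
    show "act (g \<otimes> h) x = act g (act h x)" by (rule act_mult[OF gh x])
  qed
qed

lemma restrict_inv_set:
  assumes W: "inv_set (carrier G) W" and H: "H \<subseteq> carrier G"
  shows "mp_action.inv_set (restrict_space M W) act H E \<longleftrightarrow> inv_set H E \<and> E \<subseteq> W"
proof -
  interpret R: mp_action G "restrict_space M W" act by (rule restrict_action[OF W])
  have Ws: "W \<in> sets M" "W \<subseteq> space M" using inv_set_sets[OF W] sets.sets_into_space by auto
  have "(\<forall>x\<in>W. act h x \<in> E \<longleftrightarrow> x \<in> E) \<longleftrightarrow> (\<forall>x\<in>space M. act h x \<in> E \<longleftrightarrow> x \<in> E)" if "h \<in> H" "E \<subseteq> W" for h
    using inv_set_D[OF W, of h] that H Ws by blast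
  then show ?thesis
    unfolding R.inv_set_def inv_set_def sets_restrict[OF Ws(1)] space_restrict[OF Ws(1)] by blast
qed

lemma restrict_fund:
  assumes W: "inv_set (carrier G) W" and H: "H \<subseteq> carrier G" and Z: "fund H Z"
  shows "mp_action.fund (restrict_space M W) act H (Z \<inter> W)"
proof -
  interpret R: mp_action G "restrict_space M W" act by (rule restrict_action[OF W])
  have Ws: "W \<in> sets M" "W \<subseteq> space M" using inv_set_sets[OF W] sets.sets_into_space by auto
  show ?thesis
    unfolding R.fund_def sets_restrict[OF Ws(1)] space_restrict[OF Ws(1)]
  proof (intro conjI ballI)
    show "Z \<inter> W \<in> sets M" using Ws(1) fund_sets[OF Z] by simp
    fix x assume x: "x \<in> W"
    have "(h \<in> H \<and> act h x \<in> Z \<inter> W) = (h \<in> H \<and> act h x \<in> Z)" for h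
      using inv_set_D[OF W, of h x] x H Ws by blast
    moreover have "\<exists>!h. h \<in> H \<and> act h x \<in> Z" using Z x Ws unfolding fund_def by blast
    ultimately show "\<exists>!h. h \<in> H \<and> act h x \<in> Z \<inter> W" by presburger
  qed simp
qed

end

lemma (in product_action) restrict_product:
  assumes W: "L.inv_set (carrier (product_group J \<Lambda>)) W" and pos: "emeasure M W \<noteq> 0"
  shows "product_action J \<Lambda> (restrict_space M W) \<psi> (Y \<inter> W)"
proof -
  interpret R: mp_action P "restrict_space M W" \<psi> by (rule L.restrict_action[OF W])
  have Ws: "W \<in> sets M" using L.inv_set_sets[OF W] .
  show ?thesis
  proof (rule product_action.intro[OF R.mp_action_axioms], rule product_action_axioms.intro)
    show "R.fund (carrier P) (Y \<inter> W)" by (rule L.restrict_fund[OF W subset_refl fundY])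
    have "emeasure (restrict_space M W) (Y \<inter> W) = emeasure M (Y \<inter> W)" by (rule L.emeasure_restrict[OF Ws]) blast
    also have "\<dots> \<le> emeasure M Y" using L.fund_sets[OF fundY] by (intro emeasure_mono) auto
    finally show "emeasure (restrict_space M W) (Y \<inter> W) < \<infinity>" using finY by (rule le_less_trans)
    show "emeasure (restrict_space M W) (space (restrict_space M W)) \<noteq> 0"
      unfolding L.space_restrict[OF Ws] L.emeasure_restrict[OF Ws subset_refl] by (rule pos)
  qed (use finJ grp in auto)
qed

lemma (in product_action) emb_mult:
  assumes j: "j \<in> J" and gh: "g \<in> carrier (\<Lambda> j)" "h \<in> carrier (\<Lambda> j)"
  shows "emb j (g \<otimes>\<^bsub>\<Lambda> j\<^esub> h) = emb j g \<otimes>\<^bsub>P\<^esub> emb j h"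
proof (rule P_eqI)
  interpret j: group "\<Lambda> j" using grp[OF j] .
  show "emb j (g \<otimes>\<^bsub>\<Lambda> j\<^esub> h) \<in> carrier P" using emb_closed[OF j] j.m_closed[OF gh] by blast
  show "emb j g \<otimes>\<^bsub>P\<^esub> emb j h \<in> carrier P" using emb_closed[OF j] gh L.m_closed by blast
  fix k assume k: "k \<in> J"
  interpret k: group "\<Lambda> k" using grp[OF k] .
  show "emb j (g \<otimes>\<^bsub>\<Lambda> j\<^esub> h) k = (emb j g \<otimes>\<^bsub>P\<^esub> emb j h) k"
    unfolding P_comp(1)[OF k] using k by (simp add: emb_def)
qed

lemma (in product_action) emb_one: assumes j: "j \<in> J" shows "emb j \<one>\<^bsub>\<Lambda> j\<^esub> = \<one>\<^bsub>P\<^esub>"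
proof (rule P_eqI)
  interpret j: group "\<Lambda> j" using grp[OF j] .
  show "emb j \<one>\<^bsub>\<Lambda> j\<^esub> \<in> carrier P" using emb_closed[OF j j.one_closed] .
  fix k assume k: "k \<in> J"
  show "emb j \<one>\<^bsub>\<Lambda> j\<^esub> k = \<one>\<^bsub>P\<^esub> k" unfolding P_comp(2)[OF k] using k by (simp add: emb_def)
qed (rule L.one_closed)

lemma (in product_action) emb_ker_commute:
  assumes j: "j \<in> J" and h: "h \<in> carrier (\<Lambda> j)" and l: "l \<in> ker j"
  shows "emb j h \<otimes>\<^bsub>P\<^esub> l = l \<otimes>\<^bsub>P\<^esub> emb j h"
proof (rule P_eqI)
  have lc: "l \<in> carrier P" "l j = \<one>\<^bsub>\<Lambda> j\<^esub>" using l by (simp_all only: ker_def mem_Collect_eq)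
  have e: "emb j h \<in> carrier P" using emb_closed[OF j h] .
  show "emb j h \<otimes>\<^bsub>P\<^esub> l \<in> carrier P" "l \<otimes>\<^bsub>P\<^esub> emb j h \<in> carrier P" using lc e L.m_closed by blast+
  fix k assume k: "k \<in> J"
  interpret k: group "\<Lambda> k" using grp[OF k] .
  show "(emb j h \<otimes>\<^bsub>P\<^esub> l) k = (l \<otimes>\<^bsub>P\<^esub> emb j h) k"
  proof (cases "k = j")
    case True
    then show ?thesis unfolding P_comp(1)[OF k] using True lc(2) h j k.l_one[of h] k.r_one[of h] by (simp add: emb_def)
  next
    case False
    then show ?thesis unfolding P_comp(1)[OF k] using P_comp(4)[OF k lc(1)] k by (simp add: emb_def)
  qed
qed

lemma (in product_action) emb_in_ker:
  assumes j: "j \<in> J" and k: "k \<in> J" "k \<noteq> j" and h: "h \<in> carrier (\<Lambda> j)"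
  shows "emb j h \<in> ker k"
  using emb_closed[OF j h] k by (simp only: ker_def mem_Collect_eq) (simp add: emb_def)

lemma (in product_action) split_ker:
  assumes j: "j \<in> J" and l: "l \<in> carrier P"
  obtains k where "k \<in> ker j" "l = k \<otimes>\<^bsub>P\<^esub> emb j (l j)"
proof
  interpret j: group "\<Lambda> j" using grp[OF j] .
  have lj: "l j \<in> carrier (\<Lambda> j)" using P_comp(4)[OF j l] .
  have e: "emb j (l j) \<in> carrier P" using emb_closed[OF j lj] .
  let ?k = "l \<otimes>\<^bsub>P\<^esub> inv\<^bsub>P\<^esub> (emb j (l j))"
  have kc: "?k \<in> carrier P" using l e L.m_closed L.inv_closed by blast
  have "emb j (l j) j = l j" using j by (simp add: emb_def)
  then have "?k j = \<one>\<^bsub>\<Lambda> j\<^esub>" unfolding P_comp(1)[OF j] P_comp(3)[OF j e] using j.r_inv[OF lj] by (simp only:)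
  then show "?k \<in> ker j" using kc by (simp only: ker_def mem_Collect_eq)
  have "?k \<otimes>\<^bsub>P\<^esub> emb j (l j) = l \<otimes>\<^bsub>P\<^esub> (inv\<^bsub>P\<^esub> (emb j (l j)) \<otimes>\<^bsub>P\<^esub> emb j (l j))"
    using l e L.inv_closed by (intro L.m_assoc)
  also have "\<dots> = l" unfolding L.l_inv[OF e] by (rule L.r_one[OF l])
  finally show "l = ?k \<otimes>\<^bsub>P\<^esub> emb j (l j)" by (rule sym)
qed

lemma (in product_action) factor_action:
  assumes j: "j \<in> J" shows "mp_action (\<Lambda> j) M (\<lambda>h. \<psi> (emb j h))"
proof -
  interpret j: group "\<Lambda> j" using grp[OF j] .
  show ?thesis
  proof (rule mp_action.intro[OF grp[OF j]], rule mp_action_axioms.intro)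
    have "(\<lambda>l. l j) ` carrier P = carrier (\<Lambda> j)"
    proof
      show "(\<lambda>l. l j) ` carrier P \<subseteq> carrier (\<Lambda> j)" using P_comp(4)[OF j] by blast
      show "carrier (\<Lambda> j) \<subseteq> (\<lambda>l. l j) ` carrier P"
      proof
        fix h assume h: "h \<in> carrier (\<Lambda> j)"
        show "h \<in> (\<lambda>l. l j) ` carrier P"
          by (rule image_eqI[OF _ emb_closed[OF j h]]) (simp add: emb_def j)
      qed
    qed
    then show "countable (carrier (\<Lambda> j))" using L.countable_carrier by (metis countable_image)
    fix g assume g: "g \<in> carrier (\<Lambda> j)"
    show "\<psi> (emb j g) \<in> measurable M M" by (rule L.act_measurable[OF emb_closed[OF j g]])
    show "distr M M (\<psi> (emb j g)) = M" by (rule L.act_distr[OF emb_closed[OF j g]])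
    fix h x assume h: "h \<in> carrier (\<Lambda> j)" and x: "x \<in> space M"
    show "\<psi> (emb j (g \<otimes>\<^bsub>\<Lambda> j\<^esub> h)) x = \<psi> (emb j g) (\<psi> (emb j h) x)"
      unfolding emb_mult[OF j g h] by (rule L.act_mult[OF emb_closed[OF j g] emb_closed[OF j h] x])
  next
    fix x assume x: "x \<in> space M"
    show "\<psi> (emb j \<one>\<^bsub>\<Lambda> j\<^esub>) x = x" unfolding emb_one[OF j] by (rule L.act_one[OF x])
  qed
qed

text \<open>The factor \<open>j\<close> multiplies the coordinate \<open>j\<close> of the position
  on the left, so the level of the identity meets each of its orbits once. The set consists of the
  translates of \<open>Y\<close> by all the other factors.\<close>

lemma (in product_action) factor_fund:
  assumes j: "j \<in> J"
  shows "mp_action.fund M (\<lambda>h. \<psi> (emb j h)) (carrier (\<Lambda> j)) (lev j {\<one>\<^bsub>\<Lambda> j\<^esub>})"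
proof -
  interpret j: group "\<Lambda> j" using grp[OF j] .
  interpret F: mp_action "\<Lambda> j" M "\<lambda>h. \<psi> (emb j h)" by (rule factor_action[OF j])
  show ?thesis unfolding F.fund_def
  proof (intro conjI ballI lev_sets)
    fix x assume x: "x \<in> space M"
    have q: "p x j \<in> carrier (\<Lambda> j)" using P_comp(4)[OF j p_closed[OF x]] .
    have iff: "\<psi> (emb j h) x \<in> lev j {\<one>\<^bsub>\<Lambda> j\<^esub>} \<longleftrightarrow> h = inv\<^bsub>\<Lambda> j\<^esub> (p x j)" if h: "h \<in> carrier (\<Lambda> j)" for h
    proof -
      have "p (\<psi> (emb j h) x) j = h \<otimes>\<^bsub>\<Lambda> j\<^esub> p x j"
        unfolding p_act[OF x emb_closed[OF j h]] P_comp(1)[OF j] using j by (simp add: emb_def)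
      moreover have "h \<otimes>\<^bsub>\<Lambda> j\<^esub> p x j = \<one>\<^bsub>\<Lambda> j\<^esub> \<longleftrightarrow> h = inv\<^bsub>\<Lambda> j\<^esub> (p x j)"
        using h q j.inv_equality j.l_inv by metis
      ultimately show ?thesis using F.act_space[OF h x] by (simp add: lev_def)
    qed
    show "\<exists>!h. h \<in> carrier (\<Lambda> j) \<and> \<psi> (emb j h) x \<in> lev j {\<one>\<^bsub>\<Lambda> j\<^esub>}"
    proof (rule ex1I)
      show "inv\<^bsub>\<Lambda> j\<^esub> (p x j) \<in> carrier (\<Lambda> j) \<and> \<psi> (emb j (inv\<^bsub>\<Lambda> j\<^esub> (p x j))) x \<in> lev j {\<one>\<^bsub>\<Lambda> j\<^esub>}"
        using iff[OF j.inv_closed[OF q]] j.inv_closed[OF q] by blast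
    qed (use iff in blast)
  qed
qed

text \<open>For \<open>h\<close> in \<open>s\<close> all the elements
  \<open>h \<otimes> g [^] k\<close> stay in the finite set \<open>s\<close>, so two powers of
  \<open>g\<close> coincide.\<close>

lemma (in group) translate_finite_free:
  assumes tf: "torsion_free G" and s: "finite s" "s \<noteq> {}" "s \<subseteq> carrier G"
    and g: "g \<in> carrier G" "(\<lambda>h. h \<otimes> g) ` s = s"
  shows "g = \<one>"
proof -
  obtain h where h: "h \<in> s" using s by blast
  have hc: "h \<in> carrier G" using h s by blast
  have pow: "h \<otimes> g [^] (k::nat) \<in> s" for k
  proof (induction k)
    case (Suc k)
    have "h \<otimes> g [^] Suc k = (h \<otimes> g [^] k) \<otimes> g" using hc g(1) by (simp add: m_assoc)
    also have "\<dots> \<in> (\<lambda>h. h \<otimes> g) ` s" using Suc by (rule imageI)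
    finally show ?case using g(2) by simp
  qed (use h hc in simp)
  have "\<not> inj_on (\<lambda>k::nat. h \<otimes> g [^] k) UNIV"
  proof
    assume "inj_on (\<lambda>k::nat. h \<otimes> g [^] k) UNIV"
    moreover have "range (\<lambda>k::nat. h \<otimes> g [^] k) \<subseteq> s" using pow by blast
    ultimately have "finite (UNIV :: nat set)" using s(1) by (rule inj_on_finite)
    then show False by simp
  qed
  then obtain k l :: nat where kl: "h \<otimes> g [^] k = h \<otimes> g [^] l" "k < l"
    unfolding inj_on_def by (metis linorder_neqE_nat)
  have "g [^] k = g [^] l" using kl(1) hc g(1) by simp
  also have "\<dots> = g [^] k \<otimes> g [^] (l - k)" using kl(2) g(1) nat_pow_mult[OF g(1), of k "l - k"] by simp
  finally have "g [^] k \<otimes> g [^] (l - k) = g [^] k \<otimes> \<one>" using g(1) by simp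
  then have "g [^] (l - k) = \<one>" using g(1) nat_pow_closed one_closed by simp
  then show ?thesis using tf g(1) kl(2) unfolding torsion_free_def by (metis zero_less_diff)
qed

text \<open>A torsion-free group acts freely on its nonempty finite subsets, so there is a set of orbit
  representatives.\<close>

lemma (in group) finite_subset_transversal:
  assumes tf: "torsion_free G"
  obtains \<T> where "\<And>s. finite s \<Longrightarrow> s \<noteq> {} \<Longrightarrow> s \<subseteq> carrier G \<Longrightarrow>
    \<exists>!g. g \<in> carrier G \<and> (\<lambda>h. h \<otimes> inv g) ` s \<in> \<T>"
proof
  define orb where "orb s = {(\<lambda>h. h \<otimes> inv g) ` s | g. g \<in> carrier G}" for s
  \<comment> \<open>The choice depends only on the orbit, so all translates of \<open>s\<close> have
    the same representative.\<close>
  define rep where "rep s = (SOME t. t \<in> orb s)" for s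
  let ?T = "{s. rep s = s}"
  fix s assume s: "finite s" "s \<noteq> {}" "s \<subseteq> carrier G"
  have comp: "(\<lambda>h. h \<otimes> inv g) ` ((\<lambda>h. h \<otimes> inv k) ` s) = (\<lambda>h. h \<otimes> inv (g \<otimes> k)) ` s"
    if "g \<in> carrier G" "k \<in> carrier G" for g k
    using that s(3) by (auto simp: image_image inv_mult_group m_assoc subset_eq intro!: image_cong)
  have orb_eq: "orb ((\<lambda>h. h \<otimes> inv k) ` s) = orb s" if k: "k \<in> carrier G" for k
  proof
    show "orb ((\<lambda>h. h \<otimes> inv k) ` s) \<subseteq> orb s"
      unfolding orb_def using comp k m_closed by blast
    show "orb s \<subseteq> orb ((\<lambda>h. h \<otimes> inv k) ` s)"
    proof
      fix t assume "t \<in> orb s"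
      then obtain g where g: "g \<in> carrier G" "t = (\<lambda>h. h \<otimes> inv g) ` s" by (auto simp: orb_def)
      have "t = (\<lambda>h. h \<otimes> inv (g \<otimes> inv k)) ` ((\<lambda>h. h \<otimes> inv k) ` s)"
        using comp[of "g \<otimes> inv k" k] g k by (simp add: m_assoc)
      then show "t \<in> orb ((\<lambda>h. h \<otimes> inv k) ` s)" unfolding orb_def using g k by blast
    qed
  qed
  have one: "(\<lambda>h. h \<otimes> inv \<one>) ` s = s" using s(3) by (force simp: subset_eq)
  have "s \<in> orb s" unfolding orb_def using one one_closed by blast
  then have "rep s \<in> orb s" unfolding rep_def by (rule someI)
  then obtain g where g: "g \<in> carrier G" "rep s = (\<lambda>h. h \<otimes> inv g) ` s" by (auto simp: orb_def)
  have rep_eq: "rep ((\<lambda>h. h \<otimes> inv k) ` s) = rep s" if "k \<in> carrier G" for k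
    unfolding rep_def orb_eq[OF that] ..
  show "\<exists>!g. g \<in> carrier G \<and> (\<lambda>h. h \<otimes> inv g) ` s \<in> ?T"
  proof (rule ex1I[of _ g])
    show "g \<in> carrier G \<and> (\<lambda>h. h \<otimes> inv g) ` s \<in> ?T" using g rep_eq by simp
    fix k assume k: "k \<in> carrier G \<and> (\<lambda>h. h \<otimes> inv k) ` s \<in> ?T"
    then have eq: "(\<lambda>h. h \<otimes> inv k) ` s = (\<lambda>h. h \<otimes> inv g) ` s" using rep_eq[of k] g by simp
    \<comment> \<open>Two solutions \<open>g\<close> and \<open>k\<close> send \<open>s\<close> to
      the same set, so \<open>inv k \<otimes> g\<close> stabilizes \<open>s\<close> and is trivial
      by freeness.\<close>
    have "(\<lambda>h. h \<otimes> (inv k \<otimes> g)) ` s = (\<lambda>h. h \<otimes> g) ` ((\<lambda>h. h \<otimes> inv k) ` s)"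
      using k g s(3) by (auto simp: image_image m_assoc subset_eq intro!: image_cong)
    also have "\<dots> = (\<lambda>h. h \<otimes> g) ` ((\<lambda>h. h \<otimes> inv g) ` s)" by (simp only: eq)
    also have "\<dots> = (\<lambda>h. h) ` s" unfolding image_image
      using g(1) s(3) by (intro image_cong) (auto simp: m_assoc)
    finally have "(\<lambda>h. h \<otimes> (inv k \<otimes> g)) ` s = (\<lambda>h. h) ` s" .
    then have stab: "(\<lambda>h. h \<otimes> (inv k \<otimes> g)) ` s = s" by (simp only: image_ident)
    have kc: "inv k \<otimes> g \<in> carrier G" using k g(1) by simp
    have "inv k \<otimes> g = \<one>" by (rule translate_finite_free[OF tf s kc stab])
    then have "inv g = inv k" using k g by (intro inv_equality) auto
    then have "inv (inv g) = inv (inv k)" by (rule arg_cong)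
    then show "k = g" using k g by simp
  qed
qed

locale double_product = GA: product_action I \<Gamma> M \<phi> X + LA: product_action J \<Lambda> M \<psi> Y
  for I :: "'i set" and \<Gamma> :: "'i \<Rightarrow> ('a, 'c) monoid_scheme"
    and J :: "'j set" and \<Lambda> :: "'j \<Rightarrow> ('b, 'd) monoid_scheme"
    and M :: "'s measure" and \<phi> X \<psi> Y +
  assumes comm: "\<lbrakk>g \<in> carrier (product_group I \<Gamma>); l \<in> carrier (product_group J \<Lambda>); x \<in> space M\<rbrakk> \<Longrightarrow>
    \<phi> g (\<psi> l x) = \<psi> l (\<phi> g x)"

lemma (in double_product) swap: "double_product J \<Lambda> I \<Gamma> M \<psi> Y \<phi> X"
  by (intro double_product.intro double_product_axioms.intro GA.product_action_axioms LA.product_action_axioms)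
    (simp add: comm del: carrier_product_group)

text \<open>Stated outside the locale because the measure is restricted repeatedly and the two sides
  get exchanged. The set \<open>F\<close> survives in the quotient by the other factors of both
  sides and is a fundamental domain for \<open>\<Lambda> j\<close> there.\<close>

definition splits ::
  "'i set \<Rightarrow> ('i \<Rightarrow> ('a, 'c) monoid_scheme) \<Rightarrow> 'j set \<Rightarrow> ('j \<Rightarrow> ('b, 'd) monoid_scheme) \<Rightarrow> 's measure \<Rightarrow>
   (('i \<Rightarrow> 'a) \<Rightarrow> 's \<Rightarrow> 's) \<Rightarrow> (('j \<Rightarrow> 'b) \<Rightarrow> 's \<Rightarrow> 's) \<Rightarrow> 'i \<Rightarrow> 'j \<Rightarrow> 's set \<Rightarrow> bool" where
  "splits I \<Gamma> J \<Lambda> M \<phi> \<psi> i j F \<longleftrightarrow>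
     mp_action.inv_set M \<phi> (product_action.ker I \<Gamma> i) F \<and>
     mp_action.inv_set M \<psi> (product_action.ker J \<Lambda> j) F \<and>
     mp_action.fund M (\<lambda>h. \<psi> (product_action.emb J \<Lambda> j h)) (carrier (\<Lambda> j)) F"

context double_product
begin

lemma restrict_double:
  assumes W: "GA.L.inv_set (carrier (product_group I \<Gamma>)) W" "LA.L.inv_set (carrier (product_group J \<Lambda>)) W"
    and pos: "emeasure M W \<noteq> 0"
  shows "double_product I \<Gamma> J \<Lambda> (restrict_space M W) \<phi> (X \<inter> W) \<psi> (Y \<inter> W)"
proof (intro double_product.intro double_product_axioms.intro)
  show "product_action I \<Gamma> (restrict_space M W) \<phi> (X \<inter> W)" by (rule GA.restrict_product[OF W(1) pos])
  show "product_action J \<Lambda> (restrict_space M W) \<psi> (Y \<inter> W)" by (rule LA.restrict_product[OF W(2) pos])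
  fix g l x assume gl: "g \<in> carrier (product_group I \<Gamma>)" "l \<in> carrier (product_group J \<Lambda>)"
    and "x \<in> space (restrict_space M W)"
  then have "x \<in> space M" by (simp add: space_restrict_space)
  then show "\<phi> g (\<psi> l x) = \<psi> l (\<phi> g x)" by (rule comm[OF gl])
qed

text \<open>From the set \<open>E\<close> given by \<open>ex_recurrent\<close> one forms the set
  \<open>R x\<close> of those \<open>h\<close> that bring \<open>x\<close> into \<open>E\<close>.
  Finite measure of \<open>E\<close> in the quotient makes \<open>R x\<close> finite and nonempty on
  a set of positive measure, and moving \<open>x\<close> by \<Lambda> translates \<open>R x\<close>
  on the right, so a transversal of the finite subsets singles out one \<open>h\<close> for each
  such \<open>x\<close>. The kernel of the coordinate \<open>i\<close> leaves \<open>R x\<close>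
  unchanged, which makes the domain invariant under it.\<close>

lemma split_exists:
  assumes i: "i \<in> I" and nr: "no_reiter (\<Gamma> i)"
    and be: "\<And>j. j \<in> J \<Longrightarrow> bi_exact (\<Lambda> j)" and tf: "\<And>j. j \<in> J \<Longrightarrow> torsion_free (\<Lambda> j)"
  shows "\<exists>W j F. GA.L.inv_set (carrier (product_group I \<Gamma>)) W \<and> LA.L.inv_set (carrier (product_group J \<Lambda>)) W \<and>
    emeasure M W \<noteq> 0 \<and> j \<in> J \<and> splits I \<Gamma> J \<Lambda> (restrict_space M W) \<phi> \<psi> i j F"
proof -
  let ?\<theta> = "\<lambda>b. \<phi> (GA.emb i b)"
  interpret B: mp_action "\<Gamma> i" M ?\<theta> by (rule GA.factor_action[OF i])
  interpret T: product_triple J \<Lambda> M \<psi> Y GA.P \<phi> "\<Gamma> i" ?\<theta> "GA.ker i"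
  proof (intro product_triple.intro product_coupling.intro product_coupling_axioms.intro product_triple_axioms.intro
      LA.product_action_axioms GA.L.mp_action_axioms B.mp_action_axioms GA.subgroup_ker[OF i])
    fix g l x assume "g \<in> carrier GA.P" "l \<in> carrier LA.P" "x \<in> space M"
    then show "\<phi> g (\<psi> l x) = \<psi> l (\<phi> g x)" by (rule comm)
  next
    fix b l x assume b: "b \<in> carrier (\<Gamma> i)" and lx: "l \<in> carrier LA.P" "x \<in> space M"
    show "?\<theta> b (\<psi> l x) = \<psi> l (?\<theta> b x)" by (rule comm[OF GA.emb_closed[OF i b] lx])
  next
    fix b a x assume b: "b \<in> carrier (\<Gamma> i)" and a: "a \<in> GA.ker i" and x: "x \<in> space M"
    have ac: "a \<in> carrier GA.P" using a GA.ker_subset by blast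
    have e: "GA.emb i b \<in> carrier GA.P" by (rule GA.emb_closed[OF i b])
    show "?\<theta> b (\<phi> a x) = \<phi> a (?\<theta> b x)"
      using GA.L.act_mult[OF e ac x] GA.L.act_mult[OF ac e x] GA.emb_ker_commute[OF i b a] by (simp only:)
  qed
  obtain j E where j: "j \<in> J" and rec: "T.recurrent (GA.ker i) j E"
    using T.ex_recurrent[OF GA.factor_fund[OF i] nr be] by blast
  have Ej: "LA.L.inv_set (LA.ker j) E" and Ei: "GA.L.inv_set (GA.ker i) E"
    and E0: "0 < emeasure M (E \<inter> LA.slice j)" "emeasure M (E \<inter> LA.slice j) < \<infinity>"
    using rec by (simp_all only: T.recurrent_def)
  interpret j: group "\<Lambda> j" by (rule LA.grp[OF j])
  let ?e = "LA.emb j" and ?\<epsilon> = "GA.emb i"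
  interpret H: mp_action "\<Lambda> j" M "\<lambda>h. \<psi> (?e h)" by (rule LA.factor_action[OF j])
  have ec: "?e h \<in> carrier LA.P" if "h \<in> carrier (\<Lambda> j)" for h by (rule LA.emb_closed[OF j that])
  have \<epsilon>c: "?\<epsilon> h \<in> carrier GA.P" if "h \<in> carrier (\<Gamma> i)" for h by (rule GA.emb_closed[OF i that])
  have Esets: "E \<in> sets M" by (rule LA.L.inv_set_sets[OF Ej])
  define R where "R x = {h \<in> carrier (\<Lambda> j). \<psi> (?e h) x \<in> E}" for x
  have RC: "R x \<subseteq> carrier (\<Lambda> j)" for x by (auto simp: R_def)
  have R1: "h \<in> R (\<psi> l x) \<longleftrightarrow> h \<otimes>\<^bsub>\<Lambda> j\<^esub> l j \<in> R x"
    if x: "x \<in> space M" and l: "l \<in> carrier LA.P" and h: "h \<in> carrier (\<Lambda> j)" for x l h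
  proof -
    obtain k where k: "k \<in> LA.ker j" "l = k \<otimes>\<^bsub>LA.P\<^esub> ?e (l j)" by (rule LA.split_ker[OF j l])
    have kc: "k \<in> carrier LA.P" using k(1) LA.ker_subset by blast
    have lj: "l j \<in> carrier (\<Lambda> j)" by (rule LA.P_comp(4)[OF j l])
    have hl: "h \<otimes>\<^bsub>\<Lambda> j\<^esub> l j \<in> carrier (\<Lambda> j)" using h lj by simp
    let ?y = "\<psi> (?e (l j)) x"
    have y: "?y \<in> space M" by (rule LA.L.act_space[OF ec[OF lj] x])
    have "\<psi> l x = \<psi> k ?y" by (subst k(2)) (rule LA.L.act_mult[OF kc ec[OF lj] x])
    then have "\<psi> (?e h) (\<psi> l x) = \<psi> (?e h \<otimes>\<^bsub>LA.P\<^esub> k) ?y" by (simp only: LA.L.act_mult[OF ec[OF h] kc y])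
    also have "\<dots> = \<psi> k (\<psi> (?e h) ?y)"
      unfolding LA.emb_ker_commute[OF j h k(1)] by (rule LA.L.act_mult[OF kc ec[OF h] y])
    also have "\<psi> (?e h) ?y = \<psi> (?e (h \<otimes>\<^bsub>\<Lambda> j\<^esub> l j)) x" by (rule H.act_mult[OF h lj x, symmetric])
    finally have "\<psi> (?e h) (\<psi> l x) = \<psi> k (\<psi> (?e (h \<otimes>\<^bsub>\<Lambda> j\<^esub> l j)) x)" .
    then have "\<psi> (?e h) (\<psi> l x) \<in> E \<longleftrightarrow> \<psi> (?e (h \<otimes>\<^bsub>\<Lambda> j\<^esub> l j)) x \<in> E"
      using LA.L.inv_set_D[OF Ej k(1) H.act_space[OF hl x]] by (simp only:)
    then show ?thesis using h hl by (simp only: R_def mem_Collect_eq simp_thms)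
  qed
  have R1': "R (\<psi> l x) = (\<lambda>h. h \<otimes>\<^bsub>\<Lambda> j\<^esub> inv\<^bsub>\<Lambda> j\<^esub> (l j)) ` R x" if x: "x \<in> space M" and l: "l \<in> carrier LA.P" for x l
  proof
    have lj: "l j \<in> carrier (\<Lambda> j)" by (rule LA.P_comp(4)[OF j l])
    show "R (\<psi> l x) \<subseteq> (\<lambda>h. h \<otimes>\<^bsub>\<Lambda> j\<^esub> inv\<^bsub>\<Lambda> j\<^esub> (l j)) ` R x"
    proof
      fix h assume h: "h \<in> R (\<psi> l x)"
      then have hc: "h \<in> carrier (\<Lambda> j)" using RC by blast
      have "h \<otimes>\<^bsub>\<Lambda> j\<^esub> l j \<in> R x" using R1[OF x l hc] h by blast
      moreover have "h = (h \<otimes>\<^bsub>\<Lambda> j\<^esub> l j) \<otimes>\<^bsub>\<Lambda> j\<^esub> inv\<^bsub>\<Lambda> j\<^esub> (l j)" using hc lj by (simp add: j.m_assoc)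
      ultimately show "h \<in> (\<lambda>h. h \<otimes>\<^bsub>\<Lambda> j\<^esub> inv\<^bsub>\<Lambda> j\<^esub> (l j)) ` R x" by (rule rev_image_eqI)
    qed
    show "(\<lambda>h. h \<otimes>\<^bsub>\<Lambda> j\<^esub> inv\<^bsub>\<Lambda> j\<^esub> (l j)) ` R x \<subseteq> R (\<psi> l x)"
    proof (rule image_subsetI)
      fix h assume h: "h \<in> R x"
      then have hc: "h \<in> carrier (\<Lambda> j)" using RC by blast
      have "(h \<otimes>\<^bsub>\<Lambda> j\<^esub> inv\<^bsub>\<Lambda> j\<^esub> (l j)) \<otimes>\<^bsub>\<Lambda> j\<^esub> l j = h" using hc lj by (simp add: j.m_assoc)
      then show "h \<otimes>\<^bsub>\<Lambda> j\<^esub> inv\<^bsub>\<Lambda> j\<^esub> (l j) \<in> R (\<psi> l x)"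
        using R1[OF x l, of "h \<otimes>\<^bsub>\<Lambda> j\<^esub> inv\<^bsub>\<Lambda> j\<^esub> (l j)"] h hc lj by simp
    qed
  qed
  have R2: "R (\<phi> g x) = R x" if g: "g \<in> GA.ker i" and x: "x \<in> space M" for g x
  proof -
    have gc: "g \<in> carrier GA.P" using g GA.ker_subset by blast
    have "\<psi> (?e h) (\<phi> g x) \<in> E \<longleftrightarrow> \<psi> (?e h) x \<in> E" if h: "h \<in> carrier (\<Lambda> j)" for h
      using GA.L.inv_set_D[OF Ei g H.act_space[OF h x]] comm[OF gc ec[OF h] x] by (simp only:)
    then show ?thesis unfolding R_def by blast
  qed
  have fin_tr: "finite (R (\<psi> l x)) \<longleftrightarrow> finite (R x)" "R (\<psi> l x) \<noteq> {} \<longleftrightarrow> R x \<noteq> {}"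
    if x: "x \<in> space M" and l: "l \<in> carrier LA.P" for x l
  proof -
    have lj: "l j \<in> carrier (\<Lambda> j)" by (rule LA.P_comp(4)[OF j l])
    have "inj_on (\<lambda>h. h \<otimes>\<^bsub>\<Lambda> j\<^esub> inv\<^bsub>\<Lambda> j\<^esub> (l j)) (R x)"
      using RC[of x] lj by (intro inj_onI) (auto simp: subset_eq)
    then show "finite (R (\<psi> l x)) \<longleftrightarrow> finite (R x)" unfolding R1'[OF x l] by (rule finite_image_iff)
    show "R (\<psi> l x) \<noteq> {} \<longleftrightarrow> R x \<noteq> {}" unfolding R1'[OF x l] by simp
  qed
  define lv where "lv s = {x \<in> space M. R x = s}" for s
  have lv_sets: "lv s \<in> sets M" if s: "s \<subseteq> carrier (\<Lambda> j)" for s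
  proof -
    have "lv s = {x \<in> space M. \<forall>h\<in>carrier (\<Lambda> j). \<psi> (?e h) x \<in> E \<longleftrightarrow> h \<in> s}"
      using s unfolding lv_def R_def by blast
    also have "\<dots> = (\<Inter>h\<in>carrier (\<Lambda> j). {x \<in> space M. \<psi> (?e h) x \<in> E \<longleftrightarrow> h \<in> s})"
      using j.one_closed by blast
    also have "\<dots> \<in> sets M"
    proof (rule sets.countable_INT'[OF H.countable_carrier])
      show "carrier (\<Lambda> j) \<noteq> {}" using j.one_closed by blast
      show "(\<lambda>h. {x \<in> space M. \<psi> (?e h) x \<in> E \<longleftrightarrow> h \<in> s}) ` carrier (\<Lambda> j) \<subseteq> sets M"
      proof (rule image_subsetI)
        fix h assume h: "h \<in> carrier (\<Lambda> j)"
        have m: "{x \<in> space M. \<psi> (?e h) x \<in> E} \<in> sets M" by (rule H.vimage_sets[OF h Esets])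
        show "{x \<in> space M. \<psi> (?e h) x \<in> E \<longleftrightarrow> h \<in> s} \<in> sets M"
        proof (cases "h \<in> s")
          case True
          then show ?thesis using m by simp
        next
          case False
          then have "{x \<in> space M. \<psi> (?e h) x \<in> E \<longleftrightarrow> h \<in> s} = space M - {x \<in> space M. \<psi> (?e h) x \<in> E}" by blast
          then show ?thesis using m by (simp add: sets.compl_sets)
        qed
      qed
    qed
    finally show ?thesis .
  qed
  let ?Fin = "{s. finite s \<and> s \<subseteq> carrier (\<Lambda> j)}"
  have cFin: "countable ?Fin" by (rule countable_Collect_finite_subset[OF H.countable_carrier])
  have lv_UN: "(\<Union>s\<in>S. lv s) \<in> sets M" if "S \<subseteq> ?Fin" for S
  proof (rule sets.countable_UN'[OF countable_subset[OF that cFin]])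
    show "lv ` S \<subseteq> sets M" using that lv_sets by blast
  qed
  define U where "U = {x \<in> space M. finite (R x) \<and> R x \<noteq> {}}"
  have U_eq: "U = (\<Union>s\<in>?Fin - {{}}. lv s)" using RC unfolding U_def lv_def by blast
  have U_sets: "U \<in> sets M" unfolding U_eq by (rule lv_UN) blast
  have U_L: "\<psi> l x \<in> U \<longleftrightarrow> x \<in> U" if "x \<in> space M" "l \<in> carrier LA.P" for x l
    unfolding U_def mem_Collect_eq using fin_tr[OF that] that(1) LA.L.act_space[OF that(2,1)] by (simp only:)
  have U_G: "\<phi> g x \<in> U \<longleftrightarrow> x \<in> U" if g: "g \<in> GA.ker i" and x: "x \<in> space M" for g x
  proof -
    have gc: "g \<in> carrier GA.P" using g GA.ker_subset by blast
    show ?thesis unfolding U_def mem_Collect_eq R2[OF g x] using x GA.L.act_space[OF gc x] by (simp only:)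
  qed
  \<comment> \<open>If \<open>U\<close> were null, \<open>R x\<close> would be empty or infinite
    almost everywhere. Unfolding the measure of \<open>E \<inter> LA.slice j\<close> along the
    factor \<open>j\<close> would then give 0 or infinity.\<close>
  have U_pos: "emeasure M U \<noteq> 0"
  proof
    assume U0: "emeasure M U = 0"
    let ?Z = "LA.lev j {\<one>\<^bsub>\<Lambda> j\<^esub>}" and ?S = "LA.slice j"
    let ?V = "(space M - (\<Union>s\<in>?Fin. lv s)) \<inter> (?S \<inter> ?Z)"
    have V: "?V \<in> sets M" using lv_UN[OF subset_refl] LA.slice_sets LA.lev_sets by (intro sets.Int sets.compl_sets)
    have S_inv: "\<psi> (?e h) x \<in> ?S \<longleftrightarrow> x \<in> ?S" if h: "h \<in> carrier (\<Lambda> j)" and x: "x \<in> space M" for h x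
    proof -
      have "LA.p (\<psi> (?e h) x) k = LA.p x k" if k: "k \<in> J - {j}" for k
      proof -
        have kJ: "k \<in> J" using k by blast
        interpret k: group "\<Lambda> k" by (rule LA.grp[OF kJ])
        have "?e h k = \<one>\<^bsub>\<Lambda> k\<^esub>" using k by (simp add: LA.emb_def)
        then show ?thesis
          unfolding LA.p_act[OF x ec[OF h]] LA.P_comp(1)[OF kJ]
          using LA.P_comp(4)[OF kJ LA.p_closed[OF x]] by simp
      qed
      then show ?thesis using H.act_space[OF h x] x unfolding LA.slice_def by simp
    qed
    have "emeasure M (E \<inter> ?S) = (\<integral>\<^sup>+x. indicator (E \<inter> ?S) x \<partial>M)"
      using Esets LA.slice_sets by simp
    also have "\<dots> = (\<integral>\<^sup>+x. (\<integral>\<^sup>+h. indicator (E \<inter> ?S) (\<psi> (?e h) x) \<partial>count_space (carrier (\<Lambda> j))) * indicator ?Z x \<partial>M)"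
      using Esets LA.slice_sets by (intro H.unfold[OF j.subgroup_self LA.factor_fund[OF j]]) simp
    also have "\<dots> = (\<integral>\<^sup>+x. \<infinity> * indicator ?V x \<partial>M)"
    proof (rule nn_integral_cong_AE)
      have "AE x in M. x \<notin> U" using U0 U_sets by (intro AE_not_in) (simp add: null_sets_def)
      then show "AE x in M. (\<integral>\<^sup>+h. indicator (E \<inter> ?S) (\<psi> (?e h) x) \<partial>count_space (carrier (\<Lambda> j))) * indicator ?Z x = \<infinity> * indicator ?V x"
      proof (rule AE_mp, intro AE_I2 impI)
        fix x assume x: "x \<in> space M" and nU: "x \<notin> U"
        have "(\<integral>\<^sup>+h. indicator (E \<inter> ?S) (\<psi> (?e h) x) \<partial>count_space (carrier (\<Lambda> j))) =
          (\<integral>\<^sup>+h. indicator (R x) h * indicator ?S x \<partial>count_space (carrier (\<Lambda> j)))"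
        proof (rule nn_integral_cong)
          fix h assume "h \<in> space (count_space (carrier (\<Lambda> j)))"
          then have h: "h \<in> carrier (\<Lambda> j)" by simp
          have "h \<in> R x \<longleftrightarrow> \<psi> (?e h) x \<in> E" unfolding R_def using h by blast
          then show "indicator (E \<inter> ?S) (\<psi> (?e h) x) = (indicator (R x) h * indicator ?S x :: ennreal)"
            using S_inv[OF h x] by (simp add: indicator_def)
        qed
        also have "\<dots> = emeasure (count_space (carrier (\<Lambda> j))) (R x) * indicator ?S x"
          using RC[of x] by (subst nn_integral_multc) simp_all
        finally have inner: "(\<integral>\<^sup>+h. indicator (E \<inter> ?S) (\<psi> (?e h) x) \<partial>count_space (carrier (\<Lambda> j))) =
          emeasure (count_space (carrier (\<Lambda> j))) (R x) * indicator ?S x" .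
        show "(\<integral>\<^sup>+h. indicator (E \<inter> ?S) (\<psi> (?e h) x) \<partial>count_space (carrier (\<Lambda> j))) * indicator ?Z x = \<infinity> * indicator ?V x"
        proof (cases "finite (R x)")
          case True
          then have "R x = {}" using nU x by (simp add: U_def)
          moreover have "x \<in> (\<Union>s\<in>?Fin. lv s)" using True RC[of x] x by (auto simp: lv_def)
          ultimately show ?thesis unfolding inner by simp
        next
          case False
          then have "x \<notin> (\<Union>s\<in>?Fin. lv s)" by (auto simp: lv_def)
          moreover have "emeasure (count_space (carrier (\<Lambda> j))) (R x) = \<infinity>"
            using False RC[of x] by (simp add: emeasure_count_space_infinite)
          ultimately show ?thesis unfolding inner using x by (simp add: indicator_def)
        qed
      qed
    qed
    also have "\<dots> = \<infinity> * emeasure M ?V" by (rule nn_integral_cmult_indicator[OF V])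
    finally have "emeasure M (E \<inter> ?S) = \<infinity> * emeasure M ?V" .
    then show False using E0 by (cases "emeasure M ?V = 0") (simp_all add: ennreal_top_mult)
  qed
  define \<gamma> where "\<gamma> = from_nat_into (carrier (\<Gamma> i))"
  have \<Gamma>ne: "carrier (\<Gamma> i) \<noteq> {}" using B.one_closed by blast
  have \<gamma>c: "\<gamma> n \<in> carrier (\<Gamma> i)" for n unfolding \<gamma>_def by (rule from_nat_into[OF \<Gamma>ne])
  have \<gamma>s: "\<exists>n. \<gamma> n = g" if "g \<in> carrier (\<Gamma> i)" for g
    unfolding \<gamma>_def using from_nat_into_surj[OF B.countable_carrier that] .
  define V where "V n = {x \<in> space M. \<phi> (?\<epsilon> (\<gamma> n)) x \<in> U}" for n
  have V_sets: "V n \<in> sets M" for n unfolding V_def by (rule B.vimage_sets[OF \<gamma>c U_sets])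
  \<comment> \<open>\<open>U\<close> need not be invariant under the factor \<open>i\<close>; its
    saturation under that factor is.\<close>
  define W where "W = (\<Union>n. V n)"
  have W_sets: "W \<in> sets M" unfolding W_def using V_sets by (intro sets.countable_UN) blast
  have W_iff: "x \<in> W \<longleftrightarrow> (\<exists>g\<in>carrier (\<Gamma> i). \<phi> (?\<epsilon> g) x \<in> U)" if "x \<in> space M" for x
    unfolding W_def V_def using that \<gamma>c \<gamma>s by blast
  have V_L: "\<psi> l x \<in> V n \<longleftrightarrow> x \<in> V n" if x: "x \<in> space M" and l: "l \<in> carrier LA.P" for x l n
    unfolding V_def mem_Collect_eq comm[OF \<epsilon>c[OF \<gamma>c] l x]
    using U_L[OF B.act_space[OF \<gamma>c x] l] x LA.L.act_space[OF l x] by (simp only:)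
  have ker_comm: "\<phi> (?\<epsilon> g) (\<phi> k x) = \<phi> k (\<phi> (?\<epsilon> g) x)"
    if g: "g \<in> carrier (\<Gamma> i)" and k: "k \<in> GA.ker i" and x: "x \<in> space M" for g k x
    using T.commAB[OF g k x] .
  have V_G: "\<phi> k x \<in> V n \<longleftrightarrow> x \<in> V n" if k: "k \<in> GA.ker i" and x: "x \<in> space M" for k x n
  proof -
    have kc: "k \<in> carrier GA.P" using k GA.ker_subset by blast
    show ?thesis unfolding V_def mem_Collect_eq ker_comm[OF \<gamma>c k x]
      using U_G[OF k B.act_space[OF \<gamma>c x]] x GA.L.act_space[OF kc x] by (simp only:)
  qed
  have WL: "LA.L.inv_set (carrier LA.P) W"
    unfolding LA.L.inv_set_def
  proof (intro conjI ballI W_sets)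
    fix l x assume l: "l \<in> carrier LA.P" and x: "x \<in> space M"
    show "\<psi> l x \<in> W \<longleftrightarrow> x \<in> W" unfolding W_def using V_L[OF x l] by blast
  qed
  have WG: "GA.L.inv_set (carrier GA.P) W"
    unfolding GA.L.inv_set_def
  proof (intro conjI ballI W_sets)
    fix l x assume l: "l \<in> carrier GA.P" and x: "x \<in> space M"
    obtain k where k: "k \<in> GA.ker i" "l = k \<otimes>\<^bsub>GA.P\<^esub> ?\<epsilon> (l i)" by (rule GA.split_ker[OF i l])
    have kc: "k \<in> carrier GA.P" using k(1) GA.ker_subset by blast
    have li: "l i \<in> carrier (\<Gamma> i)" by (rule GA.P_comp(4)[OF i l])
    let ?y = "\<phi> (?\<epsilon> (l i)) x"
    have y: "?y \<in> space M" by (rule B.act_space[OF li x])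
    have eq: "\<phi> (?\<epsilon> g) (\<phi> l x) \<in> U \<longleftrightarrow> \<phi> (?\<epsilon> (g \<otimes>\<^bsub>\<Gamma> i\<^esub> l i)) x \<in> U" if g: "g \<in> carrier (\<Gamma> i)" for g
    proof -
      have "\<phi> l x = \<phi> k ?y" by (subst k(2)) (rule GA.L.act_mult[OF kc \<epsilon>c[OF li] x])
      then have "\<phi> (?\<epsilon> g) (\<phi> l x) = \<phi> k (\<phi> (?\<epsilon> g) ?y)" by (simp only: ker_comm[OF g k(1) y])
      also have "\<phi> (?\<epsilon> g) ?y = \<phi> (?\<epsilon> (g \<otimes>\<^bsub>\<Gamma> i\<^esub> l i)) x" by (rule B.act_mult[OF g li x, symmetric])
      finally have "\<phi> (?\<epsilon> g) (\<phi> l x) = \<phi> k (\<phi> (?\<epsilon> (g \<otimes>\<^bsub>\<Gamma> i\<^esub> l i)) x)" .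
      then show ?thesis using U_G[OF k(1) B.act_space[OF B.m_closed[OF g li] x]] by (simp only:)
    qed
    have lx: "\<phi> l x \<in> space M" by (rule GA.L.act_space[OF l x])
    show "\<phi> l x \<in> W \<longleftrightarrow> x \<in> W"
      unfolding W_iff[OF x] W_iff[OF lx]
    proof
      assume "\<exists>g\<in>carrier (\<Gamma> i). \<phi> (?\<epsilon> g) (\<phi> l x) \<in> U"
      then show "\<exists>g\<in>carrier (\<Gamma> i). \<phi> (?\<epsilon> g) x \<in> U" using eq B.m_closed[OF _ li] by blast
    next
      assume "\<exists>g\<in>carrier (\<Gamma> i). \<phi> (?\<epsilon> g) x \<in> U"
      then obtain g where g: "g \<in> carrier (\<Gamma> i)" "\<phi> (?\<epsilon> g) x \<in> U" by blast
      have g': "g \<otimes>\<^bsub>\<Gamma> i\<^esub> inv\<^bsub>\<Gamma> i\<^esub> (l i) \<in> carrier (\<Gamma> i)" using g li by simp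
      have "(g \<otimes>\<^bsub>\<Gamma> i\<^esub> inv\<^bsub>\<Gamma> i\<^esub> (l i)) \<otimes>\<^bsub>\<Gamma> i\<^esub> l i = g" using g li by (simp add: B.m_assoc)
      then show "\<exists>g\<in>carrier (\<Gamma> i). \<phi> (?\<epsilon> g) (\<phi> l x) \<in> U" using eq[OF g'] g g' by auto
    qed
  qed
  have UW: "U \<subseteq> W"
  proof
    fix x assume x: "x \<in> U"
    then have xs: "x \<in> space M" by (simp add: U_def)
    have "\<phi> (?\<epsilon> \<one>\<^bsub>\<Gamma> i\<^esub>) x \<in> U" using x B.act_one[OF xs] by simp
    then show "x \<in> W" unfolding W_iff[OF xs] using B.one_closed by blast
  qed
  have W_pos: "emeasure M W \<noteq> 0"
    using U_pos emeasure_mono[OF UW W_sets] by (metis le_zero_eq)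
  obtain \<T> where \<T>: "\<And>s. finite s \<Longrightarrow> s \<noteq> {} \<Longrightarrow> s \<subseteq> carrier (\<Lambda> j) \<Longrightarrow>
    \<exists>!g. g \<in> carrier (\<Lambda> j) \<and> (\<lambda>h. h \<otimes>\<^bsub>\<Lambda> j\<^esub> inv\<^bsub>\<Lambda> j\<^esub> g) ` s \<in> \<T>"
    using that by (rule j.finite_subset_transversal[OF tf[OF j]])
  define F0 where "F0 = {x \<in> U. R x \<in> \<T>}"
  have F0_sets: "F0 \<in> sets M"
  proof -
    have "F0 = (\<Union>s\<in>(?Fin - {{}}) \<inter> \<T>. lv s)" unfolding F0_def U_eq lv_def by blast
    also have "\<dots> \<in> sets M" by (rule lv_UN) blast
    finally show ?thesis .
  qed
  have F0_G: "\<phi> k x \<in> F0 \<longleftrightarrow> x \<in> F0" if k: "k \<in> GA.ker i" and x: "x \<in> space M" for k x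
    unfolding F0_def mem_Collect_eq R2[OF k x] U_G[OF k x] ..
  have F0_L: "\<psi> l x \<in> F0 \<longleftrightarrow> x \<in> F0" if l: "l \<in> LA.ker j" and x: "x \<in> space M" for l x
  proof -
    have lc: "l \<in> carrier LA.P" "l j = \<one>\<^bsub>\<Lambda> j\<^esub>" using l by (simp_all only: LA.ker_def mem_Collect_eq)
    have "R (\<psi> l x) = (\<lambda>h. h) ` R x" unfolding R1'[OF x lc(1)]
      using RC[of x] lc(2) by (intro image_cong) (auto simp: subset_eq)
    then have "R (\<psi> l x) = R x" by simp
    then show ?thesis unfolding F0_def mem_Collect_eq using U_L[OF x lc(1)] by (simp only:)
  qed
  have F0_fund: "\<exists>!h. h \<in> carrier (\<Lambda> j) \<and> \<psi> (?e h) x \<in> F0" if x: "x \<in> U" for x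
  proof -
    have xs: "x \<in> space M" "finite (R x)" "R x \<noteq> {}" using x by (auto simp: U_def)
    have "(h \<in> carrier (\<Lambda> j) \<and> \<psi> (?e h) x \<in> F0) = (h \<in> carrier (\<Lambda> j) \<and> (\<lambda>k. k \<otimes>\<^bsub>\<Lambda> j\<^esub> inv\<^bsub>\<Lambda> j\<^esub> h) ` R x \<in> \<T>)" for h
    proof (cases "h \<in> carrier (\<Lambda> j)")
      case True
      have "?e h j = h" using j by (simp add: LA.emb_def)
      then have "R (\<psi> (?e h) x) = (\<lambda>k. k \<otimes>\<^bsub>\<Lambda> j\<^esub> inv\<^bsub>\<Lambda> j\<^esub> h) ` R x" using R1'[OF xs(1) ec[OF True]] by (simp only:)
      moreover have "\<psi> (?e h) x \<in> U" using U_L[OF xs(1) ec[OF True]] x by blast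
      ultimately show ?thesis unfolding F0_def by (simp only: mem_Collect_eq simp_thms)
    qed blast
    with \<T>[OF xs(2,3) RC] show ?thesis by (simp only:)
  qed
  \<comment> \<open>A point of \<open>W\<close> is moved into \<open>U\<close> by the earliest
    \<open>\<gamma> n\<close> that does so, and membership in \<open>F0\<close> is tested there. The
    sets \<open>V n\<close> are invariant under \<open>\<psi>\<close> and under the kernel of
    \<open>i\<close>, so the index \<open>n\<close> is constant along those orbits.\<close>
  define F where "F = (\<Union>n. V n \<inter> (space M - (\<Union>m\<in>{..<n}. V m)) \<inter> {x \<in> space M. \<phi> (?\<epsilon> (\<gamma> n)) x \<in> F0})"
  have F_iff: "x \<in> F \<longleftrightarrow> (\<exists>n. x \<in> V n \<and> (\<forall>m<n. x \<notin> V m) \<and> \<phi> (?\<epsilon> (\<gamma> n)) x \<in> F0)" if "x \<in> space M" for x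
    unfolding F_def using that by blast
  have F_sets: "F \<in> sets M"
  proof -
    have "V n \<inter> (space M - (\<Union>m\<in>{..<n}. V m)) \<inter> {x \<in> space M. \<phi> (?\<epsilon> (\<gamma> n)) x \<in> F0} \<in> sets M" for n
      using V_sets B.vimage_sets[OF \<gamma>c F0_sets, of n] sets.finite_UN[of "{..<n}" V M]
      by (intro sets.Int sets.compl_sets) auto
    then show ?thesis unfolding F_def by (intro sets.countable_UN) blast
  qed
  have FW: "F \<subseteq> W" unfolding F_def W_def by blast
  have F_G: "GA.L.inv_set (GA.ker i) F"
    unfolding GA.L.inv_set_def
  proof (intro conjI ballI F_sets)
    fix k x assume k: "k \<in> GA.ker i" and x: "x \<in> space M"
    have kc: "k \<in> carrier GA.P" using k GA.ker_subset by blast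
    show "\<phi> k x \<in> F \<longleftrightarrow> x \<in> F"
      unfolding F_iff[OF x] F_iff[OF GA.L.act_space[OF kc x]] V_G[OF k x] ker_comm[OF \<gamma>c k x] F0_G[OF k B.act_space[OF \<gamma>c x]] ..
  qed
  have F_L: "LA.L.inv_set (LA.ker j) F"
    unfolding LA.L.inv_set_def
  proof (intro conjI ballI F_sets)
    fix l x assume l: "l \<in> LA.ker j" and x: "x \<in> space M"
    have lc: "l \<in> carrier LA.P" using l LA.ker_subset by blast
    show "\<psi> l x \<in> F \<longleftrightarrow> x \<in> F"
      unfolding F_iff[OF x] F_iff[OF LA.L.act_space[OF lc x]] V_L[OF x lc] comm[OF \<epsilon>c[OF \<gamma>c] lc x] F0_L[OF l B.act_space[OF \<gamma>c x]] ..
  qed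
  have F_fund: "\<exists>!h. h \<in> carrier (\<Lambda> j) \<and> \<psi> (?e h) x \<in> F" if xW: "x \<in> W" for x
  proof -
    have x: "x \<in> space M" using xW sets.sets_into_space[OF W_sets] by blast
    define n where "n = (LEAST n. x \<in> V n)"
    have "\<exists>n. x \<in> V n" using xW by (simp add: W_def)
    then have xn: "x \<in> V n" unfolding n_def by (rule LeastI_ex)
    have least: "x \<notin> V m" if "m < n" for m using not_less_Least that unfolding n_def by blast
    have uniq: "k = n" if "x \<in> V k" "\<forall>m<k. x \<notin> V m" for k
      using that xn least by (metis linorder_neqE_nat)
    let ?y = "\<phi> (?\<epsilon> (\<gamma> n)) x"
    have yU: "?y \<in> U" using xn by (simp add: V_def)
    have "(h \<in> carrier (\<Lambda> j) \<and> \<psi> (?e h) x \<in> F) = (h \<in> carrier (\<Lambda> j) \<and> \<psi> (?e h) ?y \<in> F0)" for h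
    proof (cases "h \<in> carrier (\<Lambda> j)")
      case True
      have "\<psi> (?e h) x \<in> F \<longleftrightarrow> (\<exists>k. x \<in> V k \<and> (\<forall>m<k. x \<notin> V m) \<and> \<psi> (?e h) (\<phi> (?\<epsilon> (\<gamma> k)) x) \<in> F0)"
        unfolding F_iff[OF H.act_space[OF True x]] V_L[OF x ec[OF True]] comm[OF \<epsilon>c[OF \<gamma>c] ec[OF True] x] ..
      also have "\<dots> \<longleftrightarrow> \<psi> (?e h) ?y \<in> F0" using uniq xn least by blast
      finally show ?thesis by blast
    qed blast
    with F0_fund[OF yU] show ?thesis by (simp only:)
  qed
  interpret D: double_product I \<Gamma> J \<Lambda> "restrict_space M W" \<phi> "X \<inter> W" \<psi> "Y \<inter> W"
    by (rule restrict_double[OF WG WL W_pos])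
  interpret DH: mp_action "\<Lambda> j" "restrict_space M W" "\<lambda>h. \<psi> (?e h)" by (rule D.LA.factor_action[OF j])
  have "splits I \<Gamma> J \<Lambda> (restrict_space M W) \<phi> \<psi> i j F"
    unfolding splits_def
  proof (intro conjI)
    show "D.GA.L.inv_set (GA.ker i) F"
      using GA.L.restrict_inv_set[OF WG GA.ker_subset] F_G FW by blast
    show "D.LA.L.inv_set (LA.ker j) F"
      using LA.L.restrict_inv_set[OF WL LA.ker_subset] F_L FW by blast
    show "DH.fund (carrier (\<Lambda> j)) F"
      unfolding DH.fund_def GA.L.space_restrict[OF W_sets] GA.L.sets_restrict[OF W_sets]
      using F_sets FW F_fund by blast
  qed
  then show ?thesis using WG WL W_pos j by blast
qed

end

section \<open>Matching of the factors\<close>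

lemma (in mp_action) inv_set_Int:
  assumes "H \<subseteq> carrier G" "inv_set H E" "inv_set H W" shows "inv_set H (E \<inter> W)"
  using assms unfolding inv_set_def by blast

lemma (in mp_action) inv_set_mono: "inv_set H E \<Longrightarrow> K \<subseteq> H \<Longrightarrow> inv_set K E"
  unfolding inv_set_def by blast

lemma (in mp_action) inv_space: "H \<subseteq> carrier G \<Longrightarrow> inv_set H (space M)"
  unfolding inv_set_def using act_space by blast

context double_product
begin

lemma splits_restrict:
  assumes W: "GA.L.inv_set (carrier GA.P) W" "LA.L.inv_set (carrier LA.P) W" "emeasure M W \<noteq> 0"
    and j: "j \<in> J" and F: "splits I \<Gamma> J \<Lambda> M \<phi> \<psi> i j F"
  shows "splits I \<Gamma> J \<Lambda> (restrict_space M W) \<phi> \<psi> i j (F \<inter> W)"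
proof -
  interpret H: mp_action "\<Lambda> j" M "\<lambda>h. \<psi> (LA.emb j h)" by (rule LA.factor_action[OF j])
  have WH: "H.inv_set (carrier (\<Lambda> j)) W"
    using W(2) LA.emb_closed[OF j] unfolding H.inv_set_def LA.L.inv_set_def by blast
  show ?thesis
    unfolding splits_def
  proof (intro conjI)
    show "mp_action.inv_set (restrict_space M W) \<phi> (GA.ker i) (F \<inter> W)"
      unfolding GA.L.restrict_inv_set[OF W(1) GA.ker_subset]
      using F GA.L.inv_set_Int[OF GA.ker_subset _ GA.L.inv_set_mono[OF W(1) GA.ker_subset]] unfolding splits_def by blast
    show "mp_action.inv_set (restrict_space M W) \<psi> (LA.ker j) (F \<inter> W)"
      unfolding LA.L.restrict_inv_set[OF W(2) LA.ker_subset]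
      using F LA.L.inv_set_Int[OF LA.ker_subset _ LA.L.inv_set_mono[OF W(2) LA.ker_subset]] unfolding splits_def by blast
    show "mp_action.fund (restrict_space M W) (\<lambda>h. \<psi> (LA.emb j h)) (carrier (\<Lambda> j)) (F \<inter> W)"
      using F by (intro H.restrict_fund[OF WH subset_refl]) (simp only: splits_def)
  qed
qed

text \<open>One factor is split off at a time, on a smaller invariant set each time. Splittings
  found earlier persist by \<open>splits_restrict\<close>, so finitely many steps end on one common
  set of positive measure.\<close>

lemma iterate_splits:
  assumes "finite I'" "I' \<subseteq> I" and nr: "\<And>i. i \<in> I \<Longrightarrow> no_reiter (\<Gamma> i)"
    and be: "\<And>j. j \<in> J \<Longrightarrow> bi_exact (\<Lambda> j)" and tf: "\<And>j. j \<in> J \<Longrightarrow> torsion_free (\<Lambda> j)"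
  shows "\<exists>W. GA.L.inv_set (carrier GA.P) W \<and> LA.L.inv_set (carrier LA.P) W \<and> emeasure M W \<noteq> 0 \<and>
    (\<forall>i\<in>I'. \<exists>j\<in>J. \<exists>F. splits I \<Gamma> J \<Lambda> (restrict_space M W) \<phi> \<psi> i j F)"
  using assms(1,2)
proof (induction I')
  case empty
  show ?case
    using GA.L.inv_space[OF subset_refl] LA.L.inv_space[OF subset_refl] GA.nonzero by blast
next
  case (insert i I')
  obtain W where W: "GA.L.inv_set (carrier GA.P) W" "LA.L.inv_set (carrier LA.P) W" "emeasure M W \<noteq> 0"
    and sp: "\<forall>i\<in>I'. \<exists>j\<in>J. \<exists>F. splits I \<Gamma> J \<Lambda> (restrict_space M W) \<phi> \<psi> i j F"
    using insert by blast
  have Ws: "W \<in> sets M" by (rule GA.L.inv_set_sets[OF W(1)])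
  interpret D: double_product I \<Gamma> J \<Lambda> "restrict_space M W" \<phi> "X \<inter> W" \<psi> "Y \<inter> W"
    by (rule restrict_double[OF W])
  have i: "i \<in> I" using insert.prems by blast
  obtain W' j F where W': "D.GA.L.inv_set (carrier GA.P) W'" "D.LA.L.inv_set (carrier LA.P) W'"
      "emeasure (restrict_space M W) W' \<noteq> 0"
    and j: "j \<in> J" and F: "splits I \<Gamma> J \<Lambda> (restrict_space (restrict_space M W) W') \<phi> \<psi> i j F"
    using D.split_exists[OF i nr[OF i] be tf] by blast
  have W'': "GA.L.inv_set (carrier GA.P) W'" "LA.L.inv_set (carrier LA.P) W'" "W' \<subseteq> W"
    using W' unfolding GA.L.restrict_inv_set[OF W(1) subset_refl] LA.L.restrict_inv_set[OF W(2) subset_refl] by blast+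
  have pos: "emeasure M W' \<noteq> 0" using W'(3) GA.L.emeasure_restrict[OF Ws W''(3)] by simp
  have rr: "restrict_space (restrict_space M W) W' = restrict_space M W'"
    using Ws GA.L.inv_set_sets[OF W''(1)] W''(3) by (subst restrict_restrict_space) (auto simp: Int_absorb1)
  have "\<exists>j\<in>J. \<exists>F. splits I \<Gamma> J \<Lambda> (restrict_space M W') \<phi> \<psi> k j F" if k: "k \<in> insert i I'" for k
  proof (cases "k = i")
    case True
    then show ?thesis using j F unfolding rr by blast
  next
    case False
    then obtain l F where l: "l \<in> J" "splits I \<Gamma> J \<Lambda> (restrict_space M W) \<phi> \<psi> k l F" using k sp by blast
    from D.splits_restrict[OF W' l] show ?thesis using l(1) unfolding rr by blast
  qed
  then show ?case using W'' pos by blast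
qed

lemma both_split:
  assumes nr: "\<And>i. i \<in> I \<Longrightarrow> no_reiter (\<Gamma> i)" "\<And>j. j \<in> J \<Longrightarrow> no_reiter (\<Lambda> j)"
    and be: "\<And>i. i \<in> I \<Longrightarrow> bi_exact (\<Gamma> i)" "\<And>j. j \<in> J \<Longrightarrow> bi_exact (\<Lambda> j)"
    and tf: "\<And>i. i \<in> I \<Longrightarrow> torsion_free (\<Gamma> i)" "\<And>j. j \<in> J \<Longrightarrow> torsion_free (\<Lambda> j)"
  shows "\<exists>W X' Y'. double_product I \<Gamma> J \<Lambda> (restrict_space M W) \<phi> X' \<psi> Y' \<and>
    (\<forall>i\<in>I. \<exists>j\<in>J. \<exists>F. splits I \<Gamma> J \<Lambda> (restrict_space M W) \<phi> \<psi> i j F) \<and>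
    (\<forall>j\<in>J. \<exists>i\<in>I. \<exists>F. splits J \<Lambda> I \<Gamma> (restrict_space M W) \<psi> \<phi> j i F)"
proof -
  obtain W where W: "GA.L.inv_set (carrier GA.P) W" "LA.L.inv_set (carrier LA.P) W" "emeasure M W \<noteq> 0"
    and sp: "\<forall>i\<in>I. \<exists>j\<in>J. \<exists>F. splits I \<Gamma> J \<Lambda> (restrict_space M W) \<phi> \<psi> i j F"
    using iterate_splits[OF GA.finJ subset_refl nr(1) be(2) tf(2)] by blast
  have Ws: "W \<in> sets M" by (rule GA.L.inv_set_sets[OF W(1)])
  interpret D: double_product I \<Gamma> J \<Lambda> "restrict_space M W" \<phi> "X \<inter> W" \<psi> "Y \<inter> W"
    by (rule restrict_double[OF W])
  interpret S: double_product J \<Lambda> I \<Gamma> "restrict_space M W" \<psi> "Y \<inter> W" \<phi> "X \<inter> W"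
    by (rule D.swap)
  obtain W' where W': "D.GA.L.inv_set (carrier GA.P) W'" "D.LA.L.inv_set (carrier LA.P) W'"
      "emeasure (restrict_space M W) W' \<noteq> 0"
    and sp': "\<forall>j\<in>J. \<exists>i\<in>I. \<exists>F. splits J \<Lambda> I \<Gamma> (restrict_space (restrict_space M W) W') \<psi> \<phi> j i F"
    using S.iterate_splits[OF LA.finJ subset_refl nr(2) be(1) tf(1)] by blast
  have W'': "GA.L.inv_set (carrier GA.P) W'" "W' \<subseteq> W"
    using W' unfolding GA.L.restrict_inv_set[OF W(1) subset_refl] by blast+
  have rr: "restrict_space (restrict_space M W) W' = restrict_space M W'"
    using Ws GA.L.inv_set_sets[OF W''(1)] W''(2) by (subst restrict_restrict_space) (auto simp: Int_absorb1)
  have "\<exists>j\<in>J. \<exists>F. splits I \<Gamma> J \<Lambda> (restrict_space M W') \<phi> \<psi> i j F" if i: "i \<in> I" for i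
  proof -
    obtain l F where l: "l \<in> J" "splits I \<Gamma> J \<Lambda> (restrict_space M W) \<phi> \<psi> i l F" using i sp by blast
    from D.splits_restrict[OF W' l] show ?thesis using l(1) unfolding rr by blast
  qed
  then show ?thesis using D.restrict_double[OF W'] sp' unfolding rr by blast
qed

text \<open>A point is moved into \<open>Q\<close> by the factor \<open>i\<close> and then into
  \<open>slice i\<close> by \<open>ker i\<close>, which keeps it in \<open>Q\<close>. Both moves are
  forced, hence so is their product.\<close>

lemma fund_combine:
  assumes i: "i \<in> I" and inv: "GA.L.inv_set (GA.ker i) Q"
    and Q: "mp_action.fund M (\<lambda>g. \<phi> (GA.emb i g)) (carrier (\<Gamma> i)) Q"
  shows "GA.L.fund (carrier GA.P) (Q \<inter> GA.slice i)"
proof -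
  interpret B: mp_action "\<Gamma> i" M "\<lambda>g. \<phi> (GA.emb i g)" by (rule GA.factor_action[OF i])
  show ?thesis
    unfolding GA.L.fund_def
  proof (intro conjI ballI)
    show "Q \<inter> GA.slice i \<in> sets M" using B.fund_sets[OF Q] GA.slice_sets by (rule sets.Int)
    fix x assume x: "x \<in> space M"
    let ?a = "B.retr (carrier (\<Gamma> i)) Q x"
    have a: "?a \<in> carrier (\<Gamma> i)" "\<phi> (GA.emb i ?a) x \<in> Q" using B.retr[OF Q x] by auto
    let ?y = "\<phi> (GA.emb i ?a) x"
    have ea: "GA.emb i ?a \<in> carrier GA.P" by (rule GA.emb_closed[OF i a(1)])
    have y: "?y \<in> space M" by (rule B.act_space[OF a(1) x])
    let ?k = "GA.L.retr (GA.ker i) (GA.slice i) ?y"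
    have k: "?k \<in> GA.ker i" "\<phi> ?k ?y \<in> GA.slice i" using GA.L.retr[OF GA.fund_slice[OF i] y] by auto
    have kc: "?k \<in> carrier GA.P" using k(1) GA.ker_subset by blast
    show "\<exists>!g. g \<in> carrier GA.P \<and> \<phi> g x \<in> Q \<inter> GA.slice i"
    proof (rule ex1I[of _ "?k \<otimes>\<^bsub>GA.P\<^esub> GA.emb i ?a"])
      have "\<phi> (?k \<otimes>\<^bsub>GA.P\<^esub> GA.emb i ?a) x = \<phi> ?k ?y" by (rule GA.L.act_mult[OF kc ea x])
      moreover have "\<phi> ?k ?y \<in> Q" using GA.L.inv_set_D[OF inv k(1) y] a(2) by blast
      ultimately show "?k \<otimes>\<^bsub>GA.P\<^esub> GA.emb i ?a \<in> carrier GA.P \<and> \<phi> (?k \<otimes>\<^bsub>GA.P\<^esub> GA.emb i ?a) x \<in> Q \<inter> GA.slice i"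
        using k(2) GA.L.m_closed[OF kc ea] by (simp only: Int_iff simp_thms)
    next
      fix g assume g: "g \<in> carrier GA.P \<and> \<phi> g x \<in> Q \<inter> GA.slice i"
      obtain l where l: "l \<in> GA.ker i" "g = l \<otimes>\<^bsub>GA.P\<^esub> GA.emb i (g i)" using GA.split_ker[OF i] g by blast
      have lc: "l \<in> carrier GA.P" using l(1) GA.ker_subset by blast
      have gi: "g i \<in> carrier (\<Gamma> i)" using GA.P_comp(4)[OF i] g by blast
      have z: "\<phi> (GA.emb i (g i)) x \<in> space M" by (rule B.act_space[OF gi x])
      have eq: "\<phi> g x = \<phi> l (\<phi> (GA.emb i (g i)) x)"
        by (subst l(2)) (rule GA.L.act_mult[OF lc GA.emb_closed[OF i gi] x])
      then have "\<phi> (GA.emb i (g i)) x \<in> Q" using g GA.L.inv_set_D[OF inv l(1) z] by auto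
      then have a': "?a = g i" by (rule B.retr_eq[OF Q x gi])
      have "\<phi> l ?y \<in> GA.slice i" using g eq unfolding a' by auto
      then have "?k = l" by (rule GA.L.retr_eq[OF GA.fund_slice[OF i] y l(1)])
      then show "g = ?k \<otimes>\<^bsub>GA.P\<^esub> GA.emb i ?a" using l(2) unfolding a' by simp
    qed
  qed
qed

text \<open>Both sets are fundamental domains of the whole product, so they have the same mass. This
  is how the finiteness of \<open>X\<close> is passed on to the quotient by
  \<open>ker i\<close>.\<close>

lemma fund_combine_measure:
  assumes i: "i \<in> I" and inv: "GA.L.inv_set (GA.ker i) Q"
    and Q: "mp_action.fund M (\<lambda>g. \<phi> (GA.emb i g)) (carrier (\<Gamma> i)) Q"
  shows "emeasure M (Q \<inter> GA.slice i) = emeasure M X"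
proof -
  have Z: "GA.L.fund (carrier GA.P) (Q \<inter> GA.slice i)" by (rule fund_combine[OF assms])
  have "emeasure M (space M \<inter> (Q \<inter> GA.slice i)) = emeasure M (space M \<inter> X)"
    by (rule GA.L.fund_indep_measure[OF GA.L.subgroup_self Z GA.fundY GA.L.inv_space[OF subset_refl]])
  moreover have "space M \<inter> (Q \<inter> GA.slice i) = Q \<inter> GA.slice i" "space M \<inter> X = X"
    using GA.L.fund_sets[OF Z] GA.L.fund_sets[OF GA.fundY] by (auto dest: sets.sets_into_space)
  ultimately show ?thesis by simp
qed

text \<open>If \<open>k\<close> differed from \<open>j\<close>, the factor \<open>j\<close> would
  preserve \<open>Q\<close>. In the quotient by \<open>ker i\<close> the set \<open>Q\<close> has
  the mass of \<open>X\<close>, and the translates of \<open>F\<close> by the infinite group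
  \<open>\<Lambda> j\<close> would cut it into infinitely many pieces of equal mass, although this
  mass is positive and finite.\<close>

lemma splits_match:
  assumes i: "i \<in> I" and j: "j \<in> J" and k: "k \<in> J" and inf: "infinite (carrier (\<Lambda> j))"
    and F: "splits I \<Gamma> J \<Lambda> M \<phi> \<psi> i j F" and Q: "splits J \<Lambda> I \<Gamma> M \<psi> \<phi> k i Q"
  shows "k = j"
proof (rule ccontr)
  assume kj: "k \<noteq> j"
  let ?e = "LA.emb j"
  interpret H: mp_action "\<Lambda> j" M "\<lambda>h. \<psi> (?e h)" by (rule LA.factor_action[OF j])
  have Fi: "GA.L.inv_set (GA.ker i) F" and FH: "H.fund (carrier (\<Lambda> j)) F"
    using F by (simp_all only: splits_def)
  have Qi: "GA.L.inv_set (GA.ker i) Q" and Qk: "LA.L.inv_set (LA.ker k) Q"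
    and QB: "mp_action.fund M (\<lambda>g. \<phi> (GA.emb i g)) (carrier (\<Gamma> i)) Q"
    using Q by (simp_all only: splits_def)
  let ?Z = "Q \<inter> GA.slice i"
  have Zs [measurable]: "?Z \<in> sets M" using GA.L.inv_set_sets[OF Qi] GA.slice_sets by (rule sets.Int)
  have Fs: "F \<in> sets M" by (rule H.fund_sets[OF FH])
  have MZ: "emeasure M ?Z = emeasure M X" by (rule fund_combine_measure[OF i Qi QB])
  \<comment> \<open>The element \<open>?e h\<close> belongs to \<open>ker k\<close>, hence preserves
    \<open>Q\<close>; it commutes with \<open>ker i\<close>, hence preserves the measure of the
    quotient by \<open>ker i\<close>.\<close>
  have const: "emeasure M ({x \<in> space M. \<psi> (?e h) x \<in> F} \<inter> ?Z) = emeasure M ((Q \<inter> F) \<inter> GA.slice i)"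
    if h: "h \<in> carrier (\<Lambda> j)" for h
  proof -
    have e: "?e h \<in> carrier LA.P" "?e h \<in> LA.ker k" using LA.emb_closed[OF j h] LA.emb_in_ker[OF j k kj h] by auto
    have inv: "GA.L.inv_set (GA.ker i) (Q \<inter> F)" by (rule GA.L.inv_set_Int[OF GA.ker_subset Qi Fi])
    have cm: "\<psi> (?e h) (\<phi> g x) = \<phi> g (\<psi> (?e h) x)" if "g \<in> GA.ker i" "x \<in> space M" for g x
      using comm[of g "?e h" x] that GA.ker_subset e(1) by (metis subsetD)
    have "{x \<in> space M. \<psi> (?e h) x \<in> F} \<inter> ?Z = {x \<in> space M. \<psi> (?e h) x \<in> Q \<inter> F} \<inter> GA.slice i"
      using LA.L.inv_set_D[OF Qk e(2)] by blast
    also have "emeasure M \<dots> = emeasure M ((Q \<inter> F) \<inter> GA.slice i)"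
      by (rule GA.L.commuting_quot(2)[OF GA.subgroup_ker[OF i] GA.fund_slice[OF i] inv LA.L.act_measurable[OF e(1)] LA.L.act_distr[OF e(1)] cm])
    finally show ?thesis .
  qed
  have m: "{x \<in> space M. \<psi> (?e h) x \<in> F} \<in> sets M" if "h \<in> carrier (\<Lambda> j)" for h
    by (rule H.vimage_sets[OF that Fs])
  have "emeasure M ?Z = (\<integral>\<^sup>+x. indicator ?Z x \<partial>M)" by simp
  also have "\<dots> = (\<integral>\<^sup>+x. (\<integral>\<^sup>+h. indicator ({x \<in> space M. \<psi> (?e h) x \<in> F} \<inter> ?Z) x \<partial>count_space (carrier (\<Lambda> j))) \<partial>M)"
  proof (rule nn_integral_cong)
    fix x assume x: "x \<in> space M"
    have "(\<integral>\<^sup>+h. indicator ({x \<in> space M. \<psi> (?e h) x \<in> F} \<inter> ?Z) x \<partial>count_space (carrier (\<Lambda> j))) =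
      (\<integral>\<^sup>+h. indicator F (\<psi> (?e h) x) * indicator ?Z x \<partial>count_space (carrier (\<Lambda> j)))"
      using x by (intro nn_integral_cong) (simp add: indicator_def)
    also have "\<dots> = (\<integral>\<^sup>+h. indicator F (\<psi> (?e h) x) \<partial>count_space (carrier (\<Lambda> j))) * indicator ?Z x"
      by (rule nn_integral_multc) simp
    also have "\<dots> = indicator ?Z x" unfolding H.fund_sum[OF FH x] by simp
    finally show "indicator ?Z x = (\<integral>\<^sup>+h. indicator ({x \<in> space M. \<psi> (?e h) x \<in> F} \<inter> ?Z) x \<partial>count_space (carrier (\<Lambda> j)))" by simp
  qed
  also have "\<dots> = (\<integral>\<^sup>+h. (\<integral>\<^sup>+x. indicator ({x \<in> space M. \<psi> (?e h) x \<in> F} \<inter> ?Z) x \<partial>M) \<partial>count_space (carrier (\<Lambda> j)))"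
    using sets.Int[OF m Zs] by (intro nn_integral_count_space_nn_integral H.countable_carrier borel_measurable_indicator)
  also have "\<dots> = (\<integral>\<^sup>+h. emeasure M ((Q \<inter> F) \<inter> GA.slice i) \<partial>count_space (carrier (\<Lambda> j)))"
    using const m Zs GA.L.inv_set_sets[OF Qi] GA.slice_sets by (intro nn_integral_cong) (simp add: sets.Int)
  also have "\<dots> = emeasure M ((Q \<inter> F) \<inter> GA.slice i) * \<infinity>"
    using inf by (simp add: nn_integral_const emeasure_count_space_infinite)
  finally have "emeasure M X = emeasure M ((Q \<inter> F) \<inter> GA.slice i) * \<infinity>" unfolding MZ .
  moreover have "emeasure M X \<noteq> 0" by (rule GA.L.positive_fund[OF GA.L.subgroup_self GA.fundY GA.nonzero])
  ultimately show False using GA.finY by (cases "emeasure M ((Q \<inter> F) \<inter> GA.slice i) = 0") (simp_all add: ennreal_mult_top)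
qed

end

section \<open>Couplings over the reals\<close>

context mp_action
begin

lemma sigma_finite_of_fund:
  assumes Z: "fund (carrier G) Z" and fin: "emeasure M Z < \<infinity>"
  shows "sigma_finite_measure M"
proof
  let ?A = "(\<lambda>g. {x \<in> space M. act g x \<in> Z}) ` carrier G"
  have "countable ?A" using countable_carrier by (rule countable_image)
  moreover have "?A \<subseteq> sets M" using vimage_sets fund_sets[OF Z] by blast
  moreover have "\<Union>?A = space M"
  proof
    show "space M \<subseteq> \<Union>?A"
    proof
      fix x assume x: "x \<in> space M"
      have "retr (carrier G) Z x \<in> carrier G" "act (retr (carrier G) Z x) x \<in> Z" using retr[OF Z x] by auto
      then show "x \<in> \<Union>?A" using x by blast
    qed
  qed blast
  moreover have "\<forall>a\<in>?A. emeasure M a \<noteq> \<infinity>"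
    using fin vimage_measure[OF _ fund_sets[OF Z]] by auto
  ultimately show "\<exists>A. countable A \<and> A \<subseteq> sets M \<and> \<Union>A = space M \<and> (\<forall>a\<in>A. emeasure M a \<noteq> \<infinity>)"
    by blast
qed

lemma image_iff_act_inv:
  assumes "Z \<subseteq> space M" "g \<in> carrier G" "x \<in> space M"
  shows "x \<in> act g ` Z \<longleftrightarrow> act (inv g) x \<in> Z"
proof
  assume "x \<in> act g ` Z"
  then obtain z where z: "z \<in> Z" "x = act g z" by blast
  then show "act (inv g) x \<in> Z" using act_inv_act[OF assms(2), of z] assms(1) by auto
next
  assume "act (inv g) x \<in> Z"
  then show "x \<in> act g ` Z" using act_act_inv[OF assms(2,3)] by (metis imageI)
qed

text \<open>Reconciles two conventions: \<open>fundamental_domain\<close> asks for \<open>g\<close>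
  such that \<open>x\<close> lies in the translate of \<open>Z\<close> by \<open>g\<close>, whereas
  \<open>fund\<close> asks for \<open>g\<close> that brings \<open>x\<close> into
  \<open>Z\<close>.\<close>

lemma ex1_inv: "(\<exists>!g. g \<in> carrier G \<and> P (inv g)) \<longleftrightarrow> (\<exists>!g. g \<in> carrier G \<and> P g)"
proof -
  have one: "\<exists>!g. g \<in> carrier G \<and> R (inv g)" if "\<exists>!g. g \<in> carrier G \<and> R g" for R
  proof -
    from that obtain g where g: "(g \<in> carrier G \<and> R g) \<and> (\<forall>h. h \<in> carrier G \<and> R h \<longrightarrow> h = g)"
      unfolding Ex1_def by (rule exE)
    show ?thesis
    proof (rule ex1I[of _ "inv g"])
      show "inv g \<in> carrier G \<and> R (inv (inv g))" using g by simp
      fix h assume h: "h \<in> carrier G \<and> R (inv h)"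
      then have "inv h = g" using g[THEN conjunct2, rule_format, of "inv h"] by simp
      then have "inv (inv h) = inv g" by (rule arg_cong)
      then show "h = inv g" using h by simp
    qed
  qed
  have eq: "(\<exists>!g. g \<in> carrier G \<and> P (inv (inv g))) \<longleftrightarrow> (\<exists>!g. g \<in> carrier G \<and> P g)"
    by (intro arg_cong[where f = Ex1] ext) (simp cong: conj_cong)
  show ?thesis
  proof
    assume "\<exists>!g. g \<in> carrier G \<and> P (inv g)"
    then have "\<exists>!g. g \<in> carrier G \<and> P (inv (inv g))" by (rule one)
    then show "\<exists>!g. g \<in> carrier G \<and> P g" by (simp only: eq)
  qed (rule one)
qed

lemma fundamental_domain_of_fund:
  assumes Z: "fund (carrier G) Z" shows "fundamental_domain G M act Z"
  unfolding fundamental_domain_def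
proof (intro conjI AE_I2 fund_sets[OF Z])
  fix x assume x: "x \<in> space M"
  have Zs: "Z \<subseteq> space M" using fund_sets[OF Z] by (rule sets.sets_into_space)
  have "(\<exists>!g. g \<in> carrier G \<and> x \<in> act g ` Z) \<longleftrightarrow> (\<exists>!g. g \<in> carrier G \<and> act (inv g) x \<in> Z)"
    using image_iff_act_inv[OF Zs _ x] by (intro arg_cong[where f = Ex1] ext) blast
  also have "\<dots> \<longleftrightarrow> (\<exists>!g. g \<in> carrier G \<and> act g x \<in> Z)" by (rule ex1_inv)
  also have "\<dots>" using Z x unfolding fund_def by blast
  finally show "\<exists>!g. g \<in> carrier G \<and> x \<in> act g ` Z" by simp
qed

text \<open>The elements of \<open>BijGroup\<close> are extensional maps, hence the hypothesis; the
  action pushed to the reals will satisfy it because it is defined by restriction to its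
  space.\<close>

lemma preserving_of_extensional:
  assumes ext: "\<And>g. g \<in> carrier G \<Longrightarrow> act g \<in> extensional (space M)"
  shows "measure_preserving_action G M act"
  unfolding measure_preserving_action_def
proof (intro conjI ballI)
  have bij: "act g \<in> Bij (space M)" if g: "g \<in> carrier G" for g
  proof -
    have "bij_betw (act g) (space M) (space M)"
    proof (rule bij_betwI[where g = "act (inv g)"])
      show "act g \<in> space M \<rightarrow> space M" "act (inv g) \<in> space M \<rightarrow> space M" using act_space g by auto
    qed (use act_inv_act act_act_inv g in auto)
    then show ?thesis using ext[OF g] by (simp add: Bij_def)
  qed
  have "act \<in> hom G (BijGroup (space M))"
  proof (rule homI)
    fix g h assume gh: "g \<in> carrier G" "h \<in> carrier G"
    have "act (g \<otimes> h) = compose (space M) (act g) (act h)"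
    proof (rule extensionalityI[where A = "space M"])
      show "act (g \<otimes> h) \<in> extensional (space M)" using ext gh by simp
      show "compose (space M) (act g) (act h) \<in> extensional (space M)" by (rule compose_extensional)
      fix x assume "x \<in> space M"
      then show "act (g \<otimes> h) x = compose (space M) (act g) (act h) x" using gh by (simp add: compose_eq act_mult)
    qed
    then show "act (g \<otimes> h) = act g \<otimes>\<^bsub>BijGroup (space M)\<^esub> act h"
      using bij gh by (simp add: BijGroup_def)
  qed (simp add: BijGroup_def bij)
  then show "group_action G (space M) act"
    unfolding group_action_def group_hom_def group_hom_axioms_def using is_group group_BijGroup by blast
qed (use act_measurable act_distr in auto)

end

text \<open>A point is coded by the pairs of group elements that bring it into \<open>Q\<close> or
  into \<open>F\<close>: a subset of a countable set, hence a real number. The code of a translate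
  depends only on the code of the point, so both actions descend to the image of the code, and
  \<open>Q\<close> and \<open>F\<close> are unions of fibres.\<close>

lemma real_coupling:
  fixes N :: "'s measure"
  assumes A: "mp_action H1 N \<alpha>" and B: "mp_action H2 N \<beta>"
    and comm: "\<And>g h x. g \<in> carrier H1 \<Longrightarrow> h \<in> carrier H2 \<Longrightarrow> x \<in> space N \<Longrightarrow> \<alpha> g (\<beta> h x) = \<beta> h (\<alpha> g x)"
    and Q: "mp_action.fund N \<alpha> (carrier H1) Q" "emeasure N Q < \<infinity>"
    and F: "mp_action.fund N \<beta> (carrier H2) F" "emeasure N F < \<infinity>"
    and nz: "emeasure N (space N) \<noteq> 0"
  shows "measure_equivalent TYPE(real) H1 H2"
proof -
  interpret A: mp_action H1 N \<alpha> by (rule A)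
  interpret B: mp_action H2 N \<beta> by (rule B)
  let ?C = "(carrier H1 \<times> carrier H2) \<times> (UNIV :: bool set)"
  have cC: "countable ?C" using A.countable_carrier B.countable_carrier by (intro countable_SIGMA) auto
  define f where "f = to_nat_on ?C"
  have f_inj: "inj_on f ?C" unfolding f_def using cC by (rule inj_on_to_nat_on)
  obtain r :: "nat set \<Rightarrow> real" where "bij_betw r UNIV UNIV"
    using nat_sets_eqpoll_reals unfolding eqpoll_def by blast
  then have r_inj: "inj r" by (simp add: bij_betw_def)
  \<comment> \<open>The boolean tells which of the two domains is tested, so that one set records
    the itineraries through both.\<close>
  define D where "D x = {t \<in> ?C. \<alpha> (fst (fst t)) (\<beta> (snd (fst t)) x) \<in> (if snd t then Q else F)}" for x
  define c where "c x = r (f ` D x)" for x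
  have DC: "D x \<subseteq> ?C" for x by (auto simp: D_def)
  have c_eq: "c x = c y \<longleftrightarrow> (\<forall>g\<in>carrier H1. \<forall>h\<in>carrier H2. (\<alpha> g (\<beta> h x) \<in> Q \<longleftrightarrow> \<alpha> g (\<beta> h y) \<in> Q) \<and> (\<alpha> g (\<beta> h x) \<in> F \<longleftrightarrow> \<alpha> g (\<beta> h y) \<in> F))" for x y
  proof -
    have "c x = c y \<longleftrightarrow> f ` D x = f ` D y" unfolding c_def using r_inj by (simp add: inj_eq)
    also have "\<dots> \<longleftrightarrow> D x = D y" by (rule inj_on_image_eq_iff[OF f_inj DC DC])
    also have "\<dots> \<longleftrightarrow> (\<forall>g\<in>carrier H1. \<forall>h\<in>carrier H2. \<forall>b. ((g, h), b) \<in> D x \<longleftrightarrow> ((g, h), b) \<in> D y)"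
      using DC[of x] DC[of y] by (auto simp: set_eq_iff subset_eq)
    also have "\<dots> \<longleftrightarrow> (\<forall>g\<in>carrier H1. \<forall>h\<in>carrier H2. (\<alpha> g (\<beta> h x) \<in> Q \<longleftrightarrow> \<alpha> g (\<beta> h y) \<in> Q) \<and> (\<alpha> g (\<beta> h x) \<in> F \<longleftrightarrow> \<alpha> g (\<beta> h y) \<in> F))"
      by (simp add: D_def all_bool_eq cong: ball_cong)
    finally show ?thesis .
  qed
  have c_\<alpha>: "c (\<alpha> k x) = c (\<alpha> k y)" if k: "k \<in> carrier H1" and xy: "x \<in> space N" "y \<in> space N" and eq: "c x = c y" for k x y
    unfolding c_eq
  proof (intro ballI)
    fix g h assume g: "g \<in> carrier H1" and h: "h \<in> carrier H2"
    have *: "\<alpha> g (\<beta> h (\<alpha> k z)) = \<alpha> (g \<otimes>\<^bsub>H1\<^esub> k) (\<beta> h z)" if z: "z \<in> space N" for z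
      using comm[OF k h z] A.act_mult[OF g k B.act_space[OF h z]] by simp
    have gk: "g \<otimes>\<^bsub>H1\<^esub> k \<in> carrier H1" using g k by simp
    show "(\<alpha> g (\<beta> h (\<alpha> k x)) \<in> Q \<longleftrightarrow> \<alpha> g (\<beta> h (\<alpha> k y)) \<in> Q) \<and> (\<alpha> g (\<beta> h (\<alpha> k x)) \<in> F \<longleftrightarrow> \<alpha> g (\<beta> h (\<alpha> k y)) \<in> F)"
      unfolding *[OF xy(1)] *[OF xy(2)] using eq[unfolded c_eq] gk h by blast
  qed
  have c_\<beta>: "c (\<beta> k x) = c (\<beta> k y)" if k: "k \<in> carrier H2" and xy: "x \<in> space N" "y \<in> space N" and eq: "c x = c y" for k x y
    unfolding c_eq
  proof (intro ballI)
    fix g h assume g: "g \<in> carrier H1" and h: "h \<in> carrier H2"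
    have *: "\<beta> h (\<beta> k z) = \<beta> (h \<otimes>\<^bsub>H2\<^esub> k) z" if z: "z \<in> space N" for z
      by (rule B.act_mult[OF h k z, symmetric])
    have hk: "h \<otimes>\<^bsub>H2\<^esub> k \<in> carrier H2" using h k by simp
    show "(\<alpha> g (\<beta> h (\<beta> k x)) \<in> Q \<longleftrightarrow> \<alpha> g (\<beta> h (\<beta> k y)) \<in> Q) \<and> (\<alpha> g (\<beta> h (\<beta> k x)) \<in> F \<longleftrightarrow> \<alpha> g (\<beta> h (\<beta> k y)) \<in> F)"
      unfolding *[OF xy(1)] *[OF xy(2)] using eq[unfolded c_eq] g hk by blast
  qed
  have c_QF: "(x \<in> Q \<longleftrightarrow> y \<in> Q) \<and> (x \<in> F \<longleftrightarrow> y \<in> F)" if xy: "x \<in> space N" "y \<in> space N" and eq: "c x = c y" for x y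
    using eq[unfolded c_eq, rule_format, OF A.one_closed B.one_closed] xy by (simp add: A.act_one B.act_one)
  define S where "S = c ` space N"
  \<comment> \<open>The largest sigma-algebra that makes \<open>c\<close> measurable, not the trace
    of the Borel sets; measurability on \<open>S\<close> is thus tested on preimages alone.\<close>
  define \<B> where "\<B> = {E. E \<subseteq> S \<and> {x \<in> space N. c x \<in> E} \<in> sets N}"
  have sB: "sigma_algebra S \<B>"
    unfolding sigma_algebra_iff2
  proof (intro conjI ballI allI impI)
    fix E assume E: "E \<in> \<B>"
    have "{x \<in> space N. c x \<in> S - E} = space N - {x \<in> space N. c x \<in> E}" by (auto simp: S_def)
    then show "S - E \<in> \<B>" using E by (auto simp: \<B>_def)
  next
    fix E :: "nat \<Rightarrow> _" assume E: "range E \<subseteq> \<B>"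
    have "{x \<in> space N. c x \<in> (\<Union>i. E i)} = (\<Union>i. {x \<in> space N. c x \<in> E i})" by auto
    moreover have "(\<Union>i. {x \<in> space N. c x \<in> E i}) \<in> sets N" using E by (intro sets.countable_UN) (auto simp: \<B>_def)
    ultimately show "(\<Union>i. E i) \<in> \<B>" using E by (auto simp: \<B>_def)
  qed (auto simp: \<B>_def)
  \<comment> \<open>The zero measure is a placeholder: \<open>distr\<close> takes from
    \<open>R0\<close> only the space and the measurable sets.\<close>
  define R0 where "R0 = measure_of S \<B> (\<lambda>_. 0)"
  have R0: "space R0 = S" "sets R0 = \<B>"
    unfolding R0_def using sB by (simp_all add: sigma_algebra.space_measure_of_eq sigma_algebra.sets_measure_of_eq)
  have c_meas: "c \<in> measurable N R0"
  proof (rule measurableI)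
    fix E assume "E \<in> sets R0"
    then have "{x \<in> space N. c x \<in> E} \<in> sets N" by (simp add: R0 \<B>_def)
    moreover have "c -` E \<inter> space N = {x \<in> space N. c x \<in> E}" by auto
    ultimately show "c -` E \<inter> space N \<in> sets N" by simp
  qed (simp add: R0 S_def)
  define R where "R = distr N R0 c"
  have Rsp: "space R = S" and Rse: "sets R = \<B>" by (simp_all add: R_def R0)
  have Rem: "emeasure R E = emeasure N {x \<in> space N. c x \<in> E}" if "E \<in> \<B>" for E
    unfolding R_def using that c_meas by (subst emeasure_distr) (auto simp: R0 vimage_def Int_def conj_commute)
  \<comment> \<open>A point is chosen in each fibre of \<open>c\<close>. By
    \<open>c_\<alpha>\<close> and \<open>c_\<beta>\<close> the pushed actions do not depend on the
    choice.\<close>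
  define pre where "pre s = (SOME x. x \<in> space N \<and> c x = s)" for s
  have pre: "pre s \<in> space N" "c (pre s) = s" if "s \<in> S" for s
  proof -
    have "\<exists>x. x \<in> space N \<and> c x = s" using that by (auto simp: S_def)
    from someI_ex[OF this] show "pre s \<in> space N" "c (pre s) = s" by (auto simp: pre_def)
  qed
  have push: "mp_action H R (\<lambda>g. \<lambda>s\<in>S. c (\<tau> g (pre s)))"
    if T: "mp_action H N \<tau>" and inv: "\<And>k x y. k \<in> carrier H \<Longrightarrow> x \<in> space N \<Longrightarrow> y \<in> space N \<Longrightarrow> c x = c y \<Longrightarrow> c (\<tau> k x) = c (\<tau> k y)"
    for H :: "('x, 'y) monoid_scheme" and \<tau>
  proof -
    interpret T: mp_action H N \<tau> by (rule T)
    let ?\<tau> = "\<lambda>g. \<lambda>s\<in>S. c (\<tau> g (pre s))"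
    have ev: "?\<tau> g (c x) = c (\<tau> g x)" if g: "g \<in> carrier H" and x: "x \<in> space N" for g x
    proof -
      have s: "c x \<in> S" using x by (auto simp: S_def)
      then show ?thesis using inv[OF g pre(1)[OF s] x pre(2)[OF s]] by simp
    qed
    have vim: "{x \<in> space N. c x \<in> {s \<in> S. ?\<tau> g s \<in> E}} = {x \<in> space N. \<tau> g x \<in> {x \<in> space N. c x \<in> E}}" if g: "g \<in> carrier H" for g E
    proof (rule Collect_cong, rule conj_cong[OF refl])
      fix x assume x: "x \<in> space N"
      have "c x \<in> S" using x by (auto simp: S_def)
      then show "c x \<in> {s \<in> S. ?\<tau> g s \<in> E} \<longleftrightarrow> \<tau> g x \<in> {x \<in> space N. c x \<in> E}"
        unfolding mem_Collect_eq ev[OF g x] using T.act_space[OF g x] by (simp only: simp_thms)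
    qed
    have vB: "{s \<in> S. ?\<tau> g s \<in> E} \<in> \<B>" if g: "g \<in> carrier H" and E: "E \<in> \<B>" for g E
    proof -
      have "{x \<in> space N. c x \<in> E} \<in> sets N" using E by (simp add: \<B>_def)
      from T.vimage_sets[OF g this] have "{x \<in> space N. c x \<in> {s \<in> S. ?\<tau> g s \<in> E}} \<in> sets N"
        unfolding vim[OF g] .
      then show ?thesis unfolding \<B>_def by blast
    qed
    have meas: "?\<tau> g \<in> measurable R R" if g: "g \<in> carrier H" for g
    proof (rule measurableI)
      fix s assume "s \<in> space R"
      then have "s \<in> S" by (simp add: Rsp)
      then show "?\<tau> g s \<in> space R" using T.act_space[OF g pre(1)] by (simp add: Rsp S_def)
    next
      fix E assume "E \<in> sets R"
      then have "{s \<in> S. ?\<tau> g s \<in> E} \<in> \<B>" using vB[OF g] by (simp add: Rse)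
      moreover have "?\<tau> g -` E \<inter> space R = {s \<in> S. ?\<tau> g s \<in> E}" by (auto simp: Rsp)
      ultimately show "?\<tau> g -` E \<inter> space R \<in> sets R" by (simp add: Rse)
    qed
    show "mp_action H R (\<lambda>g. \<lambda>s\<in>S. c (\<tau> g (pre s)))"
    proof (rule mp_action.intro[OF T.is_group], rule mp_action_axioms.intro)
      show "countable (carrier H)" by (rule T.countable_carrier)
      fix g assume g: "g \<in> carrier H"
      show "?\<tau> g \<in> measurable R R" by (rule meas[OF g])
      show "distr R R (?\<tau> g) = R"
      proof (rule measure_eqI)
        fix E assume "E \<in> sets (distr R R (?\<tau> g))"
        then have E: "E \<in> \<B>" by (simp add: Rse)
        have Em: "{x \<in> space N. c x \<in> E} \<in> sets N" using E by (simp add: \<B>_def)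
        have "emeasure (distr R R (?\<tau> g)) E = emeasure R (?\<tau> g -` E \<inter> space R)"
          using E by (intro emeasure_distr meas[OF g]) (simp add: Rse)
        also have "?\<tau> g -` E \<inter> space R = {s \<in> S. ?\<tau> g s \<in> E}" by (auto simp: Rsp)
        also have "emeasure R \<dots> = emeasure N {x \<in> space N. \<tau> g x \<in> {x \<in> space N. c x \<in> E}}"
          unfolding Rem[OF vB[OF g E]] vim[OF g] ..
        also have "\<dots> = emeasure R E" unfolding T.vimage_measure[OF g Em] Rem[OF E] ..
        finally show "emeasure (distr R R (?\<tau> g)) E = emeasure R E" .
      qed simp
    next
      fix s assume "s \<in> space R"
      then obtain x where x: "x \<in> space N" "s = c x" by (auto simp: Rsp S_def)
      show "?\<tau> \<one>\<^bsub>H\<^esub> s = s" using ev[OF T.one_closed x(1)] T.act_one[OF x(1)] x(2) by simp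
      fix g h assume gh: "g \<in> carrier H" "h \<in> carrier H"
      show "?\<tau> (g \<otimes>\<^bsub>H\<^esub> h) s = ?\<tau> g (?\<tau> h s)"
        unfolding x(2) ev[OF T.m_closed[OF gh] x(1)] ev[OF gh(2) x(1)] ev[OF gh(1) T.act_space[OF gh(2) x(1)]] T.act_mult[OF gh x(1)] ..
    qed
  qed
  let ?\<alpha> = "\<lambda>g. \<lambda>s\<in>S. c (\<alpha> g (pre s))" and ?\<beta> = "\<lambda>g. \<lambda>s\<in>S. c (\<beta> g (pre s))"
  interpret A': mp_action H1 R ?\<alpha> by (rule push[OF A c_\<alpha>])
  interpret B': mp_action H2 R ?\<beta> by (rule push[OF B c_\<beta>])
  have cS: "c x \<in> S" if "x \<in> space N" for x using that by (auto simp: S_def)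
  have ev\<alpha>: "?\<alpha> g (c x) = c (\<alpha> g x)" if g: "g \<in> carrier H1" and x: "x \<in> space N" for g x
    using c_\<alpha>[OF g pre(1)[OF cS[OF x]] x pre(2)[OF cS[OF x]]] cS[OF x] by simp
  have ev\<beta>: "?\<beta> g (c x) = c (\<beta> g x)" if g: "g \<in> carrier H2" and x: "x \<in> space N" for g x
    using c_\<beta>[OF g pre(1)[OF cS[OF x]] x pre(2)[OF cS[OF x]]] cS[OF x] by simp
  have img: "c x \<in> c ` P \<longleftrightarrow> x \<in> P" if P: "P \<in> {Q, F}" and x: "x \<in> space N" for P x
  proof
    have Ps: "P \<subseteq> space N" using P A.fund_sets[OF Q(1)] B.fund_sets[OF F(1)] by (auto dest: sets.sets_into_space)
    assume "c x \<in> c ` P"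
    then obtain y where y: "y \<in> P" "c x = c y" by blast
    then have "y \<in> space N" using Ps by blast
    then show "x \<in> P" using c_QF[OF x _ y(2)] y(1) P by auto
  qed blast
  have imgB: "c ` P \<in> \<B>" "emeasure R (c ` P) = emeasure N P" if P: "P \<in> {Q, F}" for P
  proof -
    have Pm: "P \<in> sets N" using P A.fund_sets[OF Q(1)] B.fund_sets[OF F(1)] by auto
    have Ps: "P \<subseteq> space N" using Pm by (rule sets.sets_into_space)
    have eq: "{x \<in> space N. c x \<in> c ` P} = P" using img[OF P] Ps by blast
    show B: "c ` P \<in> \<B>" unfolding \<B>_def mem_Collect_eq eq using Pm Ps by (auto simp: S_def)
    show "emeasure R (c ` P) = emeasure N P" unfolding Rem[OF B] eq ..
  qed
  have fQ: "A'.fund (carrier H1) (c ` Q)"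
    unfolding A'.fund_def
  proof (intro conjI ballI)
    show "c ` Q \<in> sets R" using imgB(1) by (simp add: Rse)
    fix s assume "s \<in> space R"
    then obtain x where x: "x \<in> space N" "s = c x" by (auto simp: Rsp S_def)
    have "(g \<in> carrier H1 \<and> ?\<alpha> g s \<in> c ` Q) = (g \<in> carrier H1 \<and> \<alpha> g x \<in> Q)" for g
    proof (rule conj_cong[OF refl])
      assume g: "g \<in> carrier H1"
      show "?\<alpha> g s \<in> c ` Q \<longleftrightarrow> \<alpha> g x \<in> Q"
        unfolding x(2) ev\<alpha>[OF g x(1)] by (rule img[OF _ A.act_space[OF g x(1)]]) simp
    qed
    moreover have "\<exists>!g. g \<in> carrier H1 \<and> \<alpha> g x \<in> Q" using Q(1) x(1) unfolding A.fund_def by blast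
    ultimately show "\<exists>!g. g \<in> carrier H1 \<and> ?\<alpha> g s \<in> c ` Q" by (simp only:)
  qed
  have fF: "B'.fund (carrier H2) (c ` F)"
    unfolding B'.fund_def
  proof (intro conjI ballI)
    show "c ` F \<in> sets R" using imgB(1) by (simp add: Rse)
    fix s assume "s \<in> space R"
    then obtain x where x: "x \<in> space N" "s = c x" by (auto simp: Rsp S_def)
    have "(g \<in> carrier H2 \<and> ?\<beta> g s \<in> c ` F) = (g \<in> carrier H2 \<and> \<beta> g x \<in> F)" for g
    proof (rule conj_cong[OF refl])
      assume g: "g \<in> carrier H2"
      show "?\<beta> g s \<in> c ` F \<longleftrightarrow> \<beta> g x \<in> F"
        unfolding x(2) ev\<beta>[OF g x(1)] by (rule img[OF _ B.act_space[OF g x(1)]]) simp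
    qed
    moreover have "\<exists>!g. g \<in> carrier H2 \<and> \<beta> g x \<in> F" using F(1) x(1) unfolding B.fund_def by blast
    ultimately show "\<exists>!g. g \<in> carrier H2 \<and> ?\<beta> g s \<in> c ` F" by (simp only:)
  qed
  have "measure_coupling H1 H2 R ?\<alpha> ?\<beta>"
    unfolding measure_coupling_def
  proof (intro conjI ballI)
    have finQ: "emeasure R (c ` Q) < \<infinity>" using imgB(2)[of Q] Q(2) by simp
    show "sigma_finite_measure R" by (rule A'.sigma_finite_of_fund[OF fQ finQ])
    have "{x \<in> space N. c x \<in> S} = space N" by (auto simp: S_def)
    then have "S \<in> \<B>" by (simp add: \<B>_def)
    then show "emeasure R (space R) \<noteq> 0" using nz Rem[of S] \<open>{x \<in> space N. c x \<in> S} = space N\<close> by (simp add: Rsp)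
    show "measure_preserving_action H1 R ?\<alpha>" by (rule A'.preserving_of_extensional) (simp add: Rsp)
    show "measure_preserving_action H2 R ?\<beta>" by (rule B'.preserving_of_extensional) (simp add: Rsp)
    show "\<exists>X. fundamental_domain H1 R ?\<alpha> X \<and> emeasure R X < \<infinity>"
      using A'.fundamental_domain_of_fund[OF fQ] finQ by blast
    have "emeasure R (c ` F) < \<infinity>" using imgB(2)[of F] F(2) by simp
    then show "\<exists>X. fundamental_domain H2 R ?\<beta> X \<and> emeasure R X < \<infinity>"
      using B'.fundamental_domain_of_fund[OF fF] by blast
    fix g h s assume g: "g \<in> carrier H1" and h: "h \<in> carrier H2" and "s \<in> space R"
    then obtain x where x: "x \<in> space N" "s = c x" by (auto simp: Rsp S_def)
    show "?\<alpha> g (?\<beta> h s) = ?\<beta> h (?\<alpha> g s)"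
      unfolding x(2) ev\<alpha>[OF g x(1)] ev\<beta>[OF h x(1)] ev\<alpha>[OF g B.act_space[OF h x(1)]] ev\<beta>[OF h A.act_space[OF g x(1)]]
        comm[OF g h x(1)] ..
  qed
  then show ?thesis
    unfolding measure_equivalent_def using A.is_group B.is_group A.countable_carrier B.countable_carrier by blast
qed

section \<open>The quotient of the coupling by the complementary factors\<close>

lemma (in mp_action) null_of_null_fund:
  assumes H: "subgroup H G" and Z: "fund H Z" and E: "inv_set H E" and 0: "emeasure M (E \<inter> Z) = 0"
  shows "emeasure M E = 0"
proof -
  have HG: "H \<subseteq> carrier G" using H subgroup.subset by auto
  have [measurable]: "E \<in> sets M" "Z \<in> sets M" using E Z inv_set_sets fund_sets by auto
  have z: "(\<integral>\<^sup>+x. indicator E (act h x) * indicator Z x \<partial>M) = 0" if h: "h \<in> H" for h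
  proof -
    have "(\<integral>\<^sup>+x. indicator E (act h x) * indicator Z x \<partial>M) = (\<integral>\<^sup>+x. indicator (E \<inter> Z) x \<partial>M)"
      using inv_set_D[OF E h] by (intro nn_integral_cong) (simp add: indicator_def)
    then show ?thesis using 0 by simp
  qed
  have "emeasure M E = (\<integral>\<^sup>+x. indicator E x \<partial>M)" by simp
  also have "\<dots> = (\<integral>\<^sup>+h. (\<integral>\<^sup>+x. indicator E (act h x) * indicator Z x \<partial>M) \<partial>count_space H)"
    by (rule unfold_aux[OF H Z]) measurable
  also have "\<dots> = (\<integral>\<^sup>+h. 0 \<partial>count_space H)" by (rule nn_integral_cong) (simp add: z)
  finally show ?thesis by simp
qed

text \<open>The algebra \<open>\<A>\<close> may be smaller than that of all
  \<open>H\<close>-invariant sets. This lets quotient measures for two different groups live on the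
  same measurable space.\<close>

lemma (in mp_action) quotient_action:
  assumes H: "subgroup H G" and Z: "fund H Z" and A: "sigma_algebra (space M) \<A>" "\<And>E. E \<in> \<A> \<Longrightarrow> inv_set H E"
    and T: "mp_action K M \<tau>"
    and comm: "\<And>k h x. k \<in> carrier K \<Longrightarrow> h \<in> H \<Longrightarrow> x \<in> space M \<Longrightarrow> \<tau> k (act h x) = act h (\<tau> k x)"
    and closed: "\<And>k E. k \<in> carrier K \<Longrightarrow> E \<in> \<A> \<Longrightarrow> {x \<in> space M. \<tau> k x \<in> E} \<in> \<A>"
  shows "mp_action K (sub_meas M \<A> Z) \<tau>"
proof -
  interpret T: mp_action K M \<tau> by (rule T)
  have sub: "\<A> \<subseteq> sets M" using A(2) inv_set_sets by blast
  have sp: "space (sub_meas M \<A> Z) = space M" and se: "sets (sub_meas M \<A> Z) = \<A>"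
    using space_sub_meas[OF A(1)] sets_sub_meas[OF A(1)] by blast+
  note em = emeasure_sub_meas[OF A(1) sub fund_sets[OF Z]]
  have meas: "\<tau> k \<in> measurable (sub_meas M \<A> Z) (sub_meas M \<A> Z)" if k: "k \<in> carrier K" for k
  proof (rule measurableI)
    fix E assume "E \<in> sets (sub_meas M \<A> Z)"
    then have "{x \<in> space M. \<tau> k x \<in> E} \<in> \<A>" using closed[OF k] by (simp add: se)
    moreover have "\<tau> k -` E \<inter> space (sub_meas M \<A> Z) = {x \<in> space M. \<tau> k x \<in> E}" by (auto simp: sp)
    ultimately show "\<tau> k -` E \<inter> space (sub_meas M \<A> Z) \<in> sets (sub_meas M \<A> Z)" by (simp add: se)
  qed (simp add: sp T.act_space[OF k])
  show ?thesis
  proof (rule mp_action.intro[OF T.is_group], rule mp_action_axioms.intro)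
    show "countable (carrier K)" by (rule T.countable_carrier)
    fix k assume k: "k \<in> carrier K"
    show "\<tau> k \<in> measurable (sub_meas M \<A> Z) (sub_meas M \<A> Z)" by (rule meas[OF k])
    show "distr (sub_meas M \<A> Z) (sub_meas M \<A> Z) (\<tau> k) = sub_meas M \<A> Z"
    proof (rule measure_eqI)
      fix E assume "E \<in> sets (distr (sub_meas M \<A> Z) (sub_meas M \<A> Z) (\<tau> k))"
      then have E: "E \<in> \<A>" by (simp add: se)
      have "emeasure (distr (sub_meas M \<A> Z) (sub_meas M \<A> Z) (\<tau> k)) E = emeasure (sub_meas M \<A> Z) (\<tau> k -` E \<inter> space (sub_meas M \<A> Z))"
        using E by (intro emeasure_distr meas[OF k]) (simp add: se)
      also have "\<tau> k -` E \<inter> space (sub_meas M \<A> Z) = {x \<in> space M. \<tau> k x \<in> E}" by (auto simp: sp)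
      also have "emeasure (sub_meas M \<A> Z) \<dots> = emeasure M ({x \<in> space M. \<tau> k x \<in> E} \<inter> Z)" by (rule em[OF closed[OF k E]])
      also have "\<dots> = emeasure M (E \<inter> Z)"
        by (rule commuting_quot(2)[OF H Z A(2)[OF E] T.act_measurable[OF k] T.act_distr[OF k] comm[OF k]])
      also have "\<dots> = emeasure (sub_meas M \<A> Z) E" by (rule em[OF E, symmetric])
      finally show "emeasure (distr (sub_meas M \<A> Z) (sub_meas M \<A> Z) (\<tau> k)) E = emeasure (sub_meas M \<A> Z) E" .
    qed simp
  next
    fix x assume "x \<in> space (sub_meas M \<A> Z)"
    then have x: "x \<in> space M" by (simp add: sp)
    show "\<tau> \<one>\<^bsub>K\<^esub> x = x" by (rule T.act_one[OF x])
    fix g h assume gh: "g \<in> carrier K" "h \<in> carrier K"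
    show "\<tau> (g \<otimes>\<^bsub>K\<^esub> h) x = \<tau> g (\<tau> h x)" by (rule T.act_mult[OF gh x])
  qed
qed

text \<open>The function \<open>w\<close> composed with the action of \<open>k\<close> is again a
  density of \<open>N\<close> with respect to \<open>N'\<close>, since \<open>k\<close> preserves
  both measures, and densities over a sigma-finite measure are unique up to null sets.\<close>

lemma density_act_invariant:
  assumes T: "mp_action K N \<tau>" "mp_action K N' \<tau>" and sf: "sigma_finite_measure N'"
    and w: "w \<in> borel_measurable N'" "density N' w = N" and k: "k \<in> carrier K"
  shows "AE x in N'. w (\<tau> k x) = w x"
proof -
  interpret N: mp_action K N \<tau> by (rule T)
  interpret N': mp_action K N' \<tau> by (rule T)
  interpret sigma_finite_measure N' by (rule sf)
  have ik: "inv\<^bsub>K\<^esub> k \<in> carrier K" using k by (rule N.inv_closed)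
  have se: "sets N = sets N'" and sp: "space N = space N'" using w(2) by auto
  note [measurable] = w(1) N'.act_measurable[OF k]
  have "density N' (\<lambda>x. w (\<tau> k x)) = density N' w"
  proof (rule measure_eqI)
    fix E assume "E \<in> sets (density N' (\<lambda>x. w (\<tau> k x)))"
    then have E [measurable]: "E \<in> sets N'" by simp
    let ?E = "{x \<in> space N'. \<tau> (inv\<^bsub>K\<^esub> k) x \<in> E}"
    have E' [measurable]: "?E \<in> sets N'" by (rule N'.vimage_sets[OF ik E])
    have "emeasure (density N' (\<lambda>x. w (\<tau> k x))) E = (\<integral>\<^sup>+x. w (\<tau> k x) * indicator E x \<partial>N')"
      by (rule emeasure_density) measurable
    also have "\<dots> = (\<integral>\<^sup>+x. w (\<tau> k x) * indicator ?E (\<tau> k x) \<partial>N')"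
    proof (rule nn_integral_cong)
      fix x assume x: "x \<in> space N'"
      show "w (\<tau> k x) * indicator E x = w (\<tau> k x) * indicator ?E (\<tau> k x)"
        using N'.act_space[OF k x] N'.act_inv_act[OF k x] by (simp add: indicator_def)
    qed
    also have "\<dots> = (\<integral>\<^sup>+x. w x * indicator ?E x \<partial>N')"
      by (rule N'.nn_integral_act[OF k, of "\<lambda>x. w x * indicator ?E x"]) measurable
    also have "\<dots> = emeasure (density N' w) ?E" by (rule emeasure_density[symmetric]) measurable
    also have "\<dots> = emeasure N {x \<in> space N. \<tau> (inv\<^bsub>K\<^esub> k) x \<in> E}" unfolding w(2) sp ..
    also have "\<dots> = emeasure N E" using E by (intro N.vimage_measure[OF ik]) (simp add: se)
    finally show "emeasure (density N' (\<lambda>x. w (\<tau> k x))) E = emeasure (density N' w) E" unfolding w(2) .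
  qed simp
  then show ?thesis by (intro density_unique) measurable
qed

text \<open>The core of \<open>L\<close> for the second group is taken first, then the core of the
  result for the first group; since the actions commute, the second step keeps the invariance gained
  in the first.\<close>

lemma common_core:
  assumes A: "mp_action H1 N \<alpha>" and B: "mp_action H2 N \<beta>"
    and comm: "\<And>g h x. g \<in> carrier H1 \<Longrightarrow> h \<in> carrier H2 \<Longrightarrow> x \<in> space N \<Longrightarrow> \<alpha> g (\<beta> h x) = \<beta> h (\<alpha> g x)"
    and L: "L \<in> sets N"
  shows "mp_action.inv_set N \<alpha> (carrier H1) {x \<in> space N. \<forall>g\<in>carrier H1. \<forall>h\<in>carrier H2. \<beta> h (\<alpha> g x) \<in> L}"
    and "mp_action.inv_set N \<beta> (carrier H2) {x \<in> space N. \<forall>g\<in>carrier H1. \<forall>h\<in>carrier H2. \<beta> h (\<alpha> g x) \<in> L}"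
proof -
  interpret A: mp_action H1 N \<alpha> by (rule A)
  interpret B: mp_action H2 N \<beta> by (rule B)
  let ?W = "{x \<in> space N. \<forall>g\<in>carrier H1. \<forall>h\<in>carrier H2. \<beta> h (\<alpha> g x) \<in> L}"
  define V where "V = {x \<in> space N. \<forall>h\<in>carrier H2. \<beta> h x \<in> L}"
  have V: "B.inv_set (carrier H2) V" unfolding V_def by (rule B.inv_strict[OF B.subgroup_self L])
  have W: "?W = {x \<in> space N. \<forall>g\<in>carrier H1. \<alpha> g x \<in> V}" using A.act_space by (auto simp: V_def)
  show W1: "A.inv_set (carrier H1) ?W"
    unfolding W by (rule A.inv_strict[OF A.subgroup_self B.inv_set_sets[OF V]])
  show "B.inv_set (carrier H2) ?W"
    unfolding B.inv_set_def
  proof (intro conjI ballI A.inv_set_sets[OF W1])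
    fix h x assume h: "h \<in> carrier H2" and x: "x \<in> space N"
    have "\<alpha> g (\<beta> h x) \<in> V \<longleftrightarrow> \<alpha> g x \<in> V" if g: "g \<in> carrier H1" for g
      unfolding comm[OF g h x] by (rule B.inv_set_D[OF V h A.act_space[OF g x]])
    then show "\<beta> h x \<in> ?W \<longleftrightarrow> x \<in> ?W" unfolding W using x B.act_space[OF h x] by simp
  qed
qed

text \<open>\<open>Q\<close> has finite mass for \<open>N'\<close> and \<open>F\<close> for
  \<open>N\<close>. The density of \<open>N\<close> with respect to \<open>N'\<close> is invariant
  under both actions, so it is bounded by some number \<open>C\<close> on an invariant set of
  positive measure. There the mass of \<open>Q\<close> for \<open>N\<close> is at most
  \<open>C\<close> times its mass for \<open>N'\<close>, and \<open>N\<close> restricted to this set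
  is a coupling.\<close>

lemma measure_equivalent_of_two_measures:
  fixes \<alpha> :: "'a \<Rightarrow> 's \<Rightarrow> 's" and \<beta> :: "'b \<Rightarrow> 's \<Rightarrow> 's" and H1 :: "('a, 'c) monoid_scheme" and H2 :: "('b, 'd) monoid_scheme"
  assumes A: "mp_action H1 N \<alpha>" "mp_action H1 N' \<alpha>" and B: "mp_action H2 N \<beta>" "mp_action H2 N' \<beta>"
    and se: "sets N = sets N'" and ac: "absolutely_continuous N' N"
    and comm: "\<And>g h x. g \<in> carrier H1 \<Longrightarrow> h \<in> carrier H2 \<Longrightarrow> x \<in> space N \<Longrightarrow> \<alpha> g (\<beta> h x) = \<beta> h (\<alpha> g x)"
    and Q: "mp_action.fund N \<alpha> (carrier H1) Q" "emeasure N' Q < \<infinity>"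
    and F: "mp_action.fund N \<beta> (carrier H2) F" "emeasure N F < \<infinity>"
    and nz: "emeasure N (space N) \<noteq> 0"
  shows "measure_equivalent TYPE(real) H1 H2"
proof -
  interpret A: mp_action H1 N \<alpha> by (rule A)
  interpret A': mp_action H1 N' \<alpha> by (rule A)
  interpret B: mp_action H2 N \<beta> by (rule B)
  interpret B': mp_action H2 N' \<beta> by (rule B)
  have sp: "space N = space N'" using se by (rule sets_eq_imp_space_eq)
  have Q': "A'.fund (carrier H1) Q" using Q(1) unfolding A.fund_def A'.fund_def se sp .
  interpret N: sigma_finite_measure N by (rule B.sigma_finite_of_fund[OF F])
  interpret N': sigma_finite_measure N' by (rule A'.sigma_finite_of_fund[OF Q' Q(2)])
  define w where "w = RN_deriv N' N"
  have w [measurable]: "w \<in> borel_measurable N'" by (simp add: w_def)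
  have dw: "density N' w = N" unfolding w_def by (rule N'.density_RN_deriv[OF ac se])
  have wf: "AE x in N'. w x \<noteq> \<infinity>" unfolding w_def by (rule N'.RN_deriv_finite[OF N.sigma_finite_measure_axioms ac se])
  have w\<alpha>: "AE x in N'. w (\<alpha> g x) = w x" if "g \<in> carrier H1" for g
    by (rule density_act_invariant[OF A N'.sigma_finite_measure_axioms w dw that])
  have w\<beta>: "AE x in N'. w (\<beta> h x) = w x" if "h \<in> carrier H2" for h
    by (rule density_act_invariant[OF B N'.sigma_finite_measure_axioms w dw that])
  have w\<beta>\<alpha>: "AE x in N'. w (\<beta> h (\<alpha> g x)) = w x" if g: "g \<in> carrier H1" and h: "h \<in> carrier H2" for g h
  proof -
    have "AE x in distr N' N' (\<alpha> g). w (\<beta> h x) = w x" unfolding A'.act_distr[OF g] by (rule w\<beta>[OF h])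
    from AE_distrD[OF A'.act_measurable[OF g] this] have "AE x in N'. w (\<beta> h (\<alpha> g x)) = w (\<alpha> g x)" .
    with w\<alpha>[OF g] show ?thesis by eventually_elim simp
  qed
  define L where "L C = {x \<in> space N'. w x \<le> of_nat C}" for C :: nat
  have Lm: "L C \<in> sets N" for C unfolding L_def se by measurable
  \<comment> \<open>The bound is imposed on all translates, which makes the set strictly invariant
    although \<open>w\<close> is invariant only almost everywhere.\<close>
  define W where "W C = {x \<in> space N. \<forall>g\<in>carrier H1. \<forall>h\<in>carrier H2. \<beta> h (\<alpha> g x) \<in> L C}" for C
  have W1: "A.inv_set (carrier H1) (W C)" and W2: "B.inv_set (carrier H2) (W C)" for C
    unfolding W_def by (rule common_core[OF A(1) B(1) comm Lm]; assumption)+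
  have "AE x in N'. \<forall>g\<in>carrier H1. \<forall>h\<in>carrier H2. w (\<beta> h (\<alpha> g x)) = w x"
    using w\<beta>\<alpha> by (simp add: AE_ball_countable A.countable_carrier B.countable_carrier)
  with wf AE_space have "AE x in N'. \<exists>C. x \<in> W C"
  proof eventually_elim
    fix x assume "w x \<noteq> \<infinity>" and x: "x \<in> space N'" and inv: "\<forall>g\<in>carrier H1. \<forall>h\<in>carrier H2. w (\<beta> h (\<alpha> g x)) = w x"
    then obtain C :: nat where C: "w x \<le> of_nat C" using ennreal_Ex_less_of_nat[of "w x"] by (auto simp: less_top intro: less_imp_le)
    have "\<beta> h (\<alpha> g x) \<in> L C" if "g \<in> carrier H1" "h \<in> carrier H2" for g h
      using inv that C A'.act_space[OF that(1) x] B'.act_space[OF that(2)] by (simp add: L_def)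
    then have "x \<in> W C" using x A'.act_space by (simp add: W_def sp)
    then show "\<exists>C. x \<in> W C" ..
  qed
  then have AEW: "AE x in N. \<exists>C. x \<in> W C" by (rule absolutely_continuous_AE[OF se ac])
  obtain C where C: "emeasure N (W C) \<noteq> 0"
  proof (rule ccontr)
    assume "\<not> thesis"
    then have "emeasure N (W C) = 0" for C using that by blast
    then have "W C \<in> null_sets N" for C using A.inv_set_sets[OF W1] by (simp add: null_sets_def)
    then have "(\<Union>C. W C) \<in> null_sets N" by (intro null_sets_UN) simp
    from AE_not_in[OF this] AEW have "AE x in N. False" by eventually_elim blast
    then have "emeasure N (space N) = 0" by (simp add: AE_iff_measurable[OF sets.top])
    then show False using nz by simp
  qed
  have Ws: "W C \<in> sets N" by (rule A.inv_set_sets[OF W1])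
  have Qs: "Q \<in> sets N'" using A.fund_sets[OF Q(1)] se by simp
  note [measurable] = Qs Ws[unfolded se]
  have WC: "w x \<le> of_nat C" if x: "x \<in> W C" for x
  proof -
    have xs: "x \<in> space N" using x by (simp add: W_def)
    have "\<beta> \<one>\<^bsub>H2\<^esub> (\<alpha> \<one>\<^bsub>H1\<^esub> x) \<in> L C" using x by (simp add: W_def)
    then show ?thesis by (simp add: A.act_one[OF xs] B.act_one[OF xs] L_def)
  qed
  have QW: "emeasure N (Q \<inter> W C) < \<infinity>"
  proof -
    have "emeasure N (Q \<inter> W C) = (\<integral>\<^sup>+x. w x * indicator (Q \<inter> W C) x \<partial>N')"
      unfolding dw[symmetric] by (rule emeasure_density) measurable
    also have "\<dots> \<le> (\<integral>\<^sup>+x. of_nat C * indicator Q x \<partial>N')"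
      by (rule nn_integral_mono) (auto simp: indicator_def intro: WC)
    also have "\<dots> = of_nat C * emeasure N' Q" by (rule nn_integral_cmult_indicator[OF Qs])
    also have "\<dots> < \<infinity>" using Q(2) by (simp add: ennreal_mult_less_top of_nat_less_top)
    finally show ?thesis .
  qed
  show ?thesis
  proof (rule real_coupling[OF A.restrict_action[OF W1[of C]] B.restrict_action[OF W2[of C]], of "Q \<inter> W C" "F \<inter> W C"])
    show "mp_action.fund (restrict_space N (W C)) \<alpha> (carrier H1) (Q \<inter> W C)"
      by (rule A.restrict_fund[OF W1 subset_refl Q(1)])
    show "mp_action.fund (restrict_space N (W C)) \<beta> (carrier H2) (F \<inter> W C)"
      by (rule B.restrict_fund[OF W2 subset_refl F(1)])
    show "emeasure (restrict_space N (W C)) (Q \<inter> W C) < \<infinity>" using QW by (simp add: A.emeasure_restrict[OF Ws])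
    have "emeasure N (F \<inter> W C) \<le> emeasure N F" using B.fund_sets[OF F(1)] by (intro emeasure_mono) auto
    then show "emeasure (restrict_space N (W C)) (F \<inter> W C) < \<infinity>" using F(2) by (simp add: A.emeasure_restrict[OF Ws])
    show "emeasure (restrict_space N (W C)) (space (restrict_space N (W C))) \<noteq> 0"
      unfolding A.space_restrict[OF Ws] using C by (simp add: A.emeasure_restrict[OF Ws])
    fix g h x assume "g \<in> carrier H1" "h \<in> carrier H2" "x \<in> space (restrict_space N (W C))"
    then show "\<alpha> g (\<beta> h x) = \<beta> h (\<alpha> g x)"
      using sets.sets_into_space[OF Ws] unfolding A.space_restrict[OF Ws] by (intro comm) auto
  qed
qed

text \<open>The quotient by all other factors is given by the algebra \<open>\<A>\<close> of sets
  invariant under both kernels. It carries two measures: through \<open>LA.slice j\<close> the set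
  \<open>F\<close> has the mass of \<open>Y\<close>, and through \<open>GA.slice i\<close> the set
  \<open>Q\<close> has the mass of \<open>X\<close>. A set of \<open>\<A>\<close> that is null for
  the second is null in \<open>M\<close>, hence null for the first.\<close>

lemma (in double_product) measure_equivalent_of_splits:
  assumes i: "i \<in> I" and j: "j \<in> J" and F: "splits I \<Gamma> J \<Lambda> M \<phi> \<psi> i j F" and Q: "splits J \<Lambda> I \<Gamma> M \<psi> \<phi> j i Q"
  shows "measure_equivalent TYPE(real) (\<Gamma> i) (\<Lambda> j)"
proof -
  interpret S: double_product J \<Lambda> I \<Gamma> M \<psi> Y \<phi> X by (rule swap)
  let ?\<alpha> = "\<lambda>g. \<phi> (GA.emb i g)" and ?\<beta> = "\<lambda>h. \<psi> (LA.emb j h)"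
  interpret A: mp_action "\<Gamma> i" M ?\<alpha> by (rule GA.factor_action[OF i])
  interpret B: mp_action "\<Lambda> j" M ?\<beta> by (rule LA.factor_action[OF j])
  define \<A> where "\<A> = {E. GA.L.inv_set (GA.ker i) E \<and> LA.L.inv_set (LA.ker j) E}"
  have \<A>: "GA.L.inv_set (GA.ker i) E" "LA.L.inv_set (LA.ker j) E" if "E \<in> \<A>" for E using that by (simp_all add: \<A>_def)
  have sa: "sigma_algebra (space M) \<A>"
  proof -
    have "sigma_algebra (space M) {E. GA.L.inv_set (GA.ker i) E}" "sigma_algebra (space M) {E. LA.L.inv_set (LA.ker j) E}"
      by (rule GA.L.sigma_algebra_inv[OF GA.ker_subset], rule LA.L.sigma_algebra_inv[OF LA.ker_subset])
    then show ?thesis unfolding \<A>_def sigma_algebra_iff2 by (simp add: subset_iff image_subset_iff) blast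
  qed
  have sub: "\<A> \<subseteq> sets M" using GA.L.inv_set_sets[OF \<A>(1)] by blast
  have \<alpha>c: "?\<alpha> g (\<phi> h x) = \<phi> h (?\<alpha> g x)" if g: "g \<in> carrier (\<Gamma> i)" and h: "h \<in> GA.ker i" and x: "x \<in> space M" for g h x
  proof -
    have hc: "h \<in> carrier GA.P" using h GA.ker_subset by blast
    have e: "GA.emb i g \<in> carrier GA.P" by (rule GA.emb_closed[OF i g])
    show ?thesis unfolding GA.L.act_mult[OF e hc x, symmetric] GA.emb_ker_commute[OF i g h] by (rule GA.L.act_mult[OF hc e x])
  qed
  have \<beta>c: "?\<beta> g (\<psi> h x) = \<psi> h (?\<beta> g x)" if g: "g \<in> carrier (\<Lambda> j)" and h: "h \<in> LA.ker j" and x: "x \<in> space M" for g h x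
  proof -
    have hc: "h \<in> carrier LA.P" using h LA.ker_subset by blast
    have e: "LA.emb j g \<in> carrier LA.P" by (rule LA.emb_closed[OF j g])
    show ?thesis unfolding LA.L.act_mult[OF e hc x, symmetric] LA.emb_ker_commute[OF j g h] by (rule LA.L.act_mult[OF hc e x])
  qed
  have \<alpha>\<psi>: "?\<alpha> g (\<psi> h x) = \<psi> h (?\<alpha> g x)" if g: "g \<in> carrier (\<Gamma> i)" and h: "h \<in> LA.ker j" and x: "x \<in> space M" for g h x
    by (rule comm[OF GA.emb_closed[OF i g] subsetD[OF LA.ker_subset h] x])
  have \<beta>\<phi>: "?\<beta> g (\<phi> h x) = \<phi> h (?\<beta> g x)" if g: "g \<in> carrier (\<Lambda> j)" and h: "h \<in> GA.ker i" and x: "x \<in> space M" for g h x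
    by (rule comm[OF subsetD[OF GA.ker_subset h] LA.emb_closed[OF j g] x, symmetric])
  note kG = GA.subgroup_ker[OF i] GA.fund_slice[OF i] and kL = LA.subgroup_ker[OF j] LA.fund_slice[OF j]
  have \<alpha>A: "{x \<in> space M. ?\<alpha> g x \<in> E} \<in> \<A>" if g: "g \<in> carrier (\<Gamma> i)" and E: "E \<in> \<A>" for g E
    unfolding \<A>_def mem_Collect_eq
    by (rule conjI[OF GA.L.commuting_quot(1)[OF kG \<A>(1)[OF E] A.act_measurable[OF g] A.act_distr[OF g] \<alpha>c[OF g]]
      LA.L.commuting_quot(1)[OF kL \<A>(2)[OF E] A.act_measurable[OF g] A.act_distr[OF g] \<alpha>\<psi>[OF g]]])
  have \<beta>A: "{x \<in> space M. ?\<beta> g x \<in> E} \<in> \<A>" if g: "g \<in> carrier (\<Lambda> j)" and E: "E \<in> \<A>" for g E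
    unfolding \<A>_def mem_Collect_eq
    by (rule conjI[OF GA.L.commuting_quot(1)[OF kG \<A>(1)[OF E] B.act_measurable[OF g] B.act_distr[OF g] \<beta>\<phi>[OF g]]
      LA.L.commuting_quot(1)[OF kL \<A>(2)[OF E] B.act_measurable[OF g] B.act_distr[OF g] \<beta>c[OF g]]])
  let ?N = "sub_meas M \<A> (LA.slice j)" and ?N' = "sub_meas M \<A> (GA.slice i)"
  have sp: "space ?N = space M" "space ?N' = space M" using space_sub_meas[OF sa] by blast+
  have se: "sets ?N = \<A>" "sets ?N' = \<A>" using sets_sub_meas[OF sa] by blast+
  note em = emeasure_sub_meas[OF sa sub LA.slice_sets] and em' = emeasure_sub_meas[OF sa sub GA.slice_sets]
  have AN: "mp_action (\<Gamma> i) ?N ?\<alpha>" by (rule LA.L.quotient_action[OF kL sa \<A>(2) A.mp_action_axioms \<alpha>\<psi> \<alpha>A])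
  have AN': "mp_action (\<Gamma> i) ?N' ?\<alpha>" by (rule GA.L.quotient_action[OF kG sa \<A>(1) A.mp_action_axioms \<alpha>c \<alpha>A])
  have BN: "mp_action (\<Lambda> j) ?N ?\<beta>" by (rule LA.L.quotient_action[OF kL sa \<A>(2) B.mp_action_axioms \<beta>c \<beta>A])
  have BN': "mp_action (\<Lambda> j) ?N' ?\<beta>" by (rule GA.L.quotient_action[OF kG sa \<A>(1) B.mp_action_axioms \<beta>\<phi> \<beta>A])
  have F': "GA.L.inv_set (GA.ker i) F" "LA.L.inv_set (LA.ker j) F" "B.fund (carrier (\<Lambda> j)) F"
    using F unfolding splits_def by blast+
  have Q': "GA.L.inv_set (GA.ker i) Q" "LA.L.inv_set (LA.ker j) Q" "A.fund (carrier (\<Gamma> i)) Q"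
    using Q unfolding splits_def by blast+
  have FA: "F \<in> \<A>" "Q \<in> \<A>" using F' Q' by (simp_all add: \<A>_def)
  show ?thesis
  proof (rule measure_equivalent_of_two_measures[OF AN AN' BN BN'])
    show "sets ?N = sets ?N'" by (simp only: se)
    show "absolutely_continuous ?N' ?N"
      unfolding absolutely_continuous_def
    proof
      fix E assume "E \<in> null_sets ?N'"
      then have E: "E \<in> \<A>" "emeasure M (E \<inter> GA.slice i) = 0" using em' by (auto simp: null_sets_def se)
      have "emeasure M E = 0" by (rule GA.L.null_of_null_fund[OF kG \<A>(1)[OF E(1)] E(2)])
      then have "E \<in> null_sets M" using E(1) sub by (auto simp: null_sets_def)
      from null_setsD1[OF null_set_Int2[OF this LA.slice_sets]] have "emeasure M (E \<inter> LA.slice j) = 0" .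
      then show "E \<in> null_sets ?N" using E(1) em by (simp add: null_sets_def se)
    qed
    show "?\<alpha> g (?\<beta> h x) = ?\<beta> h (?\<alpha> g x)" if "g \<in> carrier (\<Gamma> i)" "h \<in> carrier (\<Lambda> j)" "x \<in> space ?N" for g h x
      by (rule comm[OF GA.emb_closed[OF i that(1)] LA.emb_closed[OF j that(2)] that(3)[unfolded sp]])
    show "mp_action.fund ?N ?\<alpha> (carrier (\<Gamma> i)) Q"
      using Q'(3) FA(2) unfolding mp_action.fund_def[OF AN] A.fund_def sp se by (elim conjE) (rule conjI)
    show "mp_action.fund ?N ?\<beta> (carrier (\<Lambda> j)) F"
      using F'(3) FA(1) unfolding mp_action.fund_def[OF BN] B.fund_def sp se by (elim conjE) (rule conjI)
    show "emeasure ?N' Q < \<infinity>" unfolding em'[OF FA(2)] fund_combine_measure[OF i Q'(1,3)] by (rule GA.finY)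
    show "emeasure ?N F < \<infinity>" unfolding em[OF FA(1)] S.fund_combine_measure[OF j F'(2,3)] by (rule LA.finY)
    have "space M \<in> \<A>" using sets.top[of ?N] unfolding sp se .
    then have "emeasure ?N (space M) = emeasure M (space M \<inter> LA.slice j)" by (rule em)
    also have "space M \<inter> LA.slice j = LA.slice j" using sets.sets_into_space[OF LA.slice_sets] by blast
    also have "emeasure M \<dots> \<noteq> 0" by (rule LA.L.positive_fund[OF kL LA.nonzero])
    finally show "emeasure ?N (space ?N) \<noteq> 0" unfolding sp .
  qed
qed

section \<open>From a coupling of products to matched factors\<close>

lemma mp_action_of_preserving:
  assumes "measure_preserving_action G M \<phi>" "countable (carrier G)"
  shows "mp_action G M \<phi>"
proof -
  interpret A: group_action G "space M" \<phi> using assms(1) by (simp add: measure_preserving_action_def)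
  show ?thesis
  proof (rule mp_action.intro[OF group_hom.axioms(1)[OF A.group_hom]], rule mp_action_axioms.intro)
    fix x assume x: "x \<in> space M"
    show "\<phi> \<one>\<^bsub>G\<^esub> x = x" using fun_cong[OF A.id_eq_one, of x] x by simp
    show "\<phi> (g \<otimes>\<^bsub>G\<^esub> h) x = \<phi> g (\<phi> h x)" if "g \<in> carrier G" "h \<in> carrier G" for g h
      by (rule A.composition_rule[OF x that])
  qed (use assms in \<open>auto simp: measure_preserving_action_def\<close>)
qed

context mp_action
begin

lemma AE_translates:
  assumes "fundamental_domain G M act Z" shows "AE x in M. \<exists>!g. g \<in> carrier G \<and> act g x \<in> Z"
proof -
  have Zs: "Z \<subseteq> space M" using assms sets.sets_into_space unfolding fundamental_domain_def by blast
  have "AE x in M. \<exists>!g. g \<in> carrier G \<and> x \<in> act g ` Z" using assms unfolding fundamental_domain_def by (rule conjunct2)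
  then show ?thesis
  proof (rule AE_mp, intro AE_I2 impI)
    fix x assume x: "x \<in> space M" and u: "\<exists>!g. g \<in> carrier G \<and> x \<in> act g ` Z"
    have "(\<exists>!g. g \<in> carrier G \<and> x \<in> act g ` Z) \<longleftrightarrow> (\<exists>!g. g \<in> carrier G \<and> act (inv g) x \<in> Z)"
      using image_iff_act_inv[OF Zs _ x] by (intro arg_cong[where f = Ex1] ext) blast
    also have "\<dots> \<longleftrightarrow> (\<exists>!g. g \<in> carrier G \<and> act g x \<in> Z)" by (rule ex1_inv)
    finally show "\<exists>!g. g \<in> carrier G \<and> act g x \<in> Z" using u by (simp only:)
  qed
qed

lemma translates_sets:
  assumes "Z \<in> sets M" shows "{x \<in> space M. \<exists>!g. g \<in> carrier G \<and> act g x \<in> Z} \<in> sets M"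
  using vimage_sets[OF _ assms] countable_carrier by (intro sets.sets_Collect_countable_Ex1') auto

lemma AE_act:
  assumes "g \<in> carrier G" "AE x in M. P x" shows "AE x in M. P (act g x)"
  by (rule AE_distrD[OF act_measurable[OF assms(1)], unfolded act_distr[OF assms(1)], OF assms(2)])

lemma fund_restrict_space:
  assumes Z: "Z \<in> sets M" and W: "inv_set (carrier G) W" "\<And>x. x \<in> W \<Longrightarrow> \<exists>!g. g \<in> carrier G \<and> act g x \<in> Z"
  shows "mp_action.fund (restrict_space M W) act (carrier G) (Z \<inter> W)"
proof -
  interpret R: mp_action G "restrict_space M W" act by (rule restrict_action[OF W(1)])
  have Ws: "W \<in> sets M" by (rule inv_set_sets[OF W(1)])
  show ?thesis
    unfolding R.fund_def
  proof (intro conjI ballI)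
    show "Z \<inter> W \<in> sets (restrict_space M W)" using Z Ws by (simp add: sets_restrict)
    fix x assume "x \<in> space (restrict_space M W)"
    then have x: "x \<in> W" "x \<in> space M" using sets.sets_into_space[OF Ws] by (auto simp: space_restrict[OF Ws])
    have "(g \<in> carrier G \<and> act g x \<in> Z \<inter> W) = (g \<in> carrier G \<and> act g x \<in> Z)" for g
      using inv_set_D[OF W(1) _ x(2), of g] x(1) by blast
    then show "\<exists>!g. g \<in> carrier G \<and> act g x \<in> Z \<inter> W" using W(2)[OF x(1)] by (simp only:)
  qed
qed

end

text \<open>Almost every point has exactly one translate in each of the two domains. The points all
  of whose translates have this property form a set of full measure, invariant under both groups, on
  which both domains are strict.\<close>

lemma ex_double_product:
  fixes \<Gamma> :: "'i \<Rightarrow> ('a, 'c) monoid_scheme" and \<Lambda> :: "'j \<Rightarrow> ('b, 'd) monoid_scheme"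
  assumes fin: "finite I" "finite J" and grp: "\<And>i. i \<in> I \<Longrightarrow> Group.group (\<Gamma> i)" "\<And>j. j \<in> J \<Longrightarrow> Group.group (\<Lambda> j)"
    and c: "countable (carrier (product_group I \<Gamma>))" "countable (carrier (product_group J \<Lambda>))"
    and mc: "measure_coupling (product_group I \<Gamma>) (product_group J \<Lambda>) M \<phi> \<psi>"
  shows "\<exists>W X Y. double_product I \<Gamma> J \<Lambda> (restrict_space M W) \<phi> X \<psi> Y"
proof -
  let ?G = "product_group I \<Gamma>" and ?L = "product_group J \<Lambda>"
  interpret G: mp_action ?G M \<phi> by (rule mp_action_of_preserving[OF _ c(1)]) (use mc in \<open>simp only: measure_coupling_def\<close>)
  interpret L: mp_action ?L M \<psi> by (rule mp_action_of_preserving[OF _ c(2)]) (use mc in \<open>simp only: measure_coupling_def\<close>)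
  have nz: "emeasure M (space M) \<noteq> 0" using mc by (simp only: measure_coupling_def simp_thms)
  have comm: "\<phi> g (\<psi> l x) = \<psi> l (\<phi> g x)" if "g \<in> carrier ?G" "l \<in> carrier ?L" "x \<in> space M" for g l x
    using mc that unfolding measure_coupling_def by blast
  obtain X Y where X: "fundamental_domain ?G M \<phi> X" "emeasure M X < \<infinity>" and Y: "fundamental_domain ?L M \<psi> Y" "emeasure M Y < \<infinity>"
    using mc unfolding measure_coupling_def by (elim conjE exE)
  have Xs: "X \<in> sets M" and Ys: "Y \<in> sets M" using X Y by (simp_all only: fundamental_domain_def)
  define S where "S = {x \<in> space M. \<exists>!g. g \<in> carrier ?G \<and> \<phi> g x \<in> X} \<inter> {x \<in> space M. \<exists>!l. l \<in> carrier ?L \<and> \<psi> l x \<in> Y}"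
  have Ss: "S \<in> sets M" unfolding S_def by (rule sets.Int[OF G.translates_sets[OF Xs] L.translates_sets[OF Ys]])
  define W where "W = {x \<in> space M. \<forall>g\<in>carrier ?G. \<forall>l\<in>carrier ?L. \<psi> l (\<phi> g x) \<in> S}"
  have W: "G.inv_set (carrier ?G) W" "L.inv_set (carrier ?L) W"
    unfolding W_def by (rule common_core[OF G.mp_action_axioms L.mp_action_axioms comm Ss]; assumption)+
  have Ws: "W \<in> sets M" by (rule G.inv_set_sets[OF W(1)])
  have WS: "x \<in> S" if x: "x \<in> W" for x
  proof -
    have xs: "x \<in> space M" using x sets.sets_into_space[OF Ws] by (rule rev_subsetD)
    have "\<psi> \<one>\<^bsub>?L\<^esub> (\<phi> \<one>\<^bsub>?G\<^esub> x) \<in> S"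
      using x G.one_closed L.one_closed unfolding W_def mem_Collect_eq by blast
    then show ?thesis unfolding G.act_one[OF xs] L.act_one[OF xs] .
  qed
  have "AE x in M. x \<in> S"
    using G.AE_translates[OF X(1)] L.AE_translates[OF Y(1)] AE_space
    by eventually_elim (simp only: S_def Int_iff mem_Collect_eq simp_thms)
  then have "AE x in M. \<psi> l (\<phi> g x) \<in> S" if "g \<in> carrier ?G" "l \<in> carrier ?L" for g l
    by (rule G.AE_act[OF that(1) L.AE_act[OF that(2)]])
  then have "AE x in M. \<forall>g\<in>carrier ?G. \<forall>l\<in>carrier ?L. \<psi> l (\<phi> g x) \<in> S"
    using c by (simp only: AE_ball_countable) (intro ballI)
  then have "AE x in M. x \<in> W \<longleftrightarrow> x \<in> space M"
    using AE_space by eventually_elim (simp only: W_def mem_Collect_eq simp_thms)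
  then have "emeasure M W = emeasure M (space M)" using Ws by (intro emeasure_eq_AE) auto
  then have pos: "emeasure M W \<noteq> 0" using nz by simp
  have re: "emeasure (restrict_space M W) (Z \<inter> W) < \<infinity>" if "Z \<in> sets M" "emeasure M Z < \<infinity>" for Z
  proof -
    have "emeasure (restrict_space M W) (Z \<inter> W) = emeasure M (Z \<inter> W)" by (rule G.emeasure_restrict[OF Ws]) blast
    also have "\<dots> \<le> emeasure M Z" using that(1) by (intro emeasure_mono) auto
    finally show ?thesis using that(2) by (rule le_less_trans)
  qed
  have rpos: "emeasure (restrict_space M W) (space (restrict_space M W)) \<noteq> 0"
    unfolding G.space_restrict[OF Ws] G.emeasure_restrict[OF Ws subset_refl] by (rule pos)
  have PG: "product_action I \<Gamma> (restrict_space M W) \<phi> (X \<inter> W)"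
  proof (rule product_action.intro[OF G.restrict_action[OF W(1)]], rule product_action_axioms.intro)
    show "mp_action.fund (restrict_space M W) \<phi> (carrier ?G) (X \<inter> W)"
    proof (rule G.fund_restrict_space[OF Xs W(1)])
      fix x assume "x \<in> W"
      then show "\<exists>!g. g \<in> carrier ?G \<and> \<phi> g x \<in> X" using WS unfolding S_def by (simp only: Int_iff mem_Collect_eq)
    qed
  qed (fact fin grp re[OF Xs X(2)] rpos)+
  have PL: "product_action J \<Lambda> (restrict_space M W) \<psi> (Y \<inter> W)"
  proof (rule product_action.intro[OF L.restrict_action[OF W(2)]], rule product_action_axioms.intro)
    show "mp_action.fund (restrict_space M W) \<psi> (carrier ?L) (Y \<inter> W)"
    proof (rule L.fund_restrict_space[OF Ys W(2)])
      fix x assume "x \<in> W"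
      then show "\<exists>!g. g \<in> carrier ?L \<and> \<psi> g x \<in> Y" using WS unfolding S_def by (simp only: Int_iff mem_Collect_eq)
    qed
  qed (fact fin grp re[OF Ys Y(2)] rpos)+
  have "double_product I \<Gamma> J \<Lambda> (restrict_space M W) \<phi> (X \<inter> W) \<psi> (Y \<inter> W)"
  proof (rule double_product.intro[OF PG PL], rule double_product_axioms.intro)
    fix g l x assume gl: "g \<in> carrier ?G" "l \<in> carrier ?L" and "x \<in> space (restrict_space M W)"
    then have "x \<in> space M" by (simp add: space_restrict_space)
    then show "\<phi> g (\<psi> l x) = \<psi> l (\<phi> g x)" by (rule comm[OF gl])
  qed
  then show ?thesis by blast
qed

text \<open>On a common invariant set every factor of either side has a partner on the other. By
  \<open>splits_match\<close>, used also for the exchanged coupling, the choices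
  \<open>\<sigma>\<close> and \<open>\<tau>\<close> are inverse to each other; so each matched pair
  comes with both splittings that \<open>measure_equivalent_of_splits\<close> asks for.\<close>

lemma (in double_product) factor_bijection:
  assumes nr: "\<And>i. i \<in> I \<Longrightarrow> no_reiter (\<Gamma> i)" "\<And>j. j \<in> J \<Longrightarrow> no_reiter (\<Lambda> j)"
    and be: "\<And>i. i \<in> I \<Longrightarrow> bi_exact (\<Gamma> i)" "\<And>j. j \<in> J \<Longrightarrow> bi_exact (\<Lambda> j)"
    and tf: "\<And>i. i \<in> I \<Longrightarrow> torsion_free (\<Gamma> i)" "\<And>j. j \<in> J \<Longrightarrow> torsion_free (\<Lambda> j)"
    and inf: "\<And>i. i \<in> I \<Longrightarrow> infinite (carrier (\<Gamma> i))" "\<And>j. j \<in> J \<Longrightarrow> infinite (carrier (\<Lambda> j))"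
  shows "\<exists>\<sigma>. bij_betw \<sigma> I J \<and> (\<forall>i\<in>I. measure_equivalent TYPE(real) (\<Gamma> i) (\<Lambda> (\<sigma> i)))"
proof -
  have "\<exists>W X' Y'. double_product I \<Gamma> J \<Lambda> (restrict_space M W) \<phi> X' \<psi> Y' \<and>
    (\<forall>i\<in>I. \<exists>j\<in>J. \<exists>F. splits I \<Gamma> J \<Lambda> (restrict_space M W) \<phi> \<psi> i j F) \<and>
    (\<forall>j\<in>J. \<exists>i\<in>I. \<exists>F. splits J \<Lambda> I \<Gamma> (restrict_space M W) \<psi> \<phi> j i F)"
    by (rule both_split[OF nr be tf])
  then obtain W X' Y' where D: "double_product I \<Gamma> J \<Lambda> (restrict_space M W) \<phi> X' \<psi> Y'"
    and f: "\<forall>i\<in>I. \<exists>j\<in>J. \<exists>F. splits I \<Gamma> J \<Lambda> (restrict_space M W) \<phi> \<psi> i j F"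
    and b: "\<forall>j\<in>J. \<exists>i\<in>I. \<exists>F. splits J \<Lambda> I \<Gamma> (restrict_space M W) \<psi> \<phi> j i F" by (elim exE conjE)
  let ?f = "\<lambda>i j. j \<in> J \<and> (\<exists>F. splits I \<Gamma> J \<Lambda> (restrict_space M W) \<phi> \<psi> i j F)"
  let ?b = "\<lambda>j i. i \<in> I \<and> (\<exists>F. splits J \<Lambda> I \<Gamma> (restrict_space M W) \<psi> \<phi> j i F)"
  have "\<forall>i\<in>I. \<exists>j. ?f i j" "\<forall>j\<in>J. \<exists>i. ?b j i" using f b unfolding Bex_def by simp_all
  then obtain \<sigma> \<tau> where \<sigma>: "\<forall>i\<in>I. ?f i (\<sigma> i)" and \<tau>: "\<forall>j\<in>J. ?b j (\<tau> j)"
    by (elim bchoice[THEN exE])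
  have \<sigma>\<tau>: "\<sigma> (\<tau> k) = k" if k: "k \<in> J" for k
  proof -
    obtain Q where i: "\<tau> k \<in> I" and Q: "splits J \<Lambda> I \<Gamma> (restrict_space M W) \<psi> \<phi> k (\<tau> k) Q" using \<tau> k by blast
    obtain F where j: "\<sigma> (\<tau> k) \<in> J" and F: "splits I \<Gamma> J \<Lambda> (restrict_space M W) \<phi> \<psi> (\<tau> k) (\<sigma> (\<tau> k)) F" using \<sigma> i by blast
    show ?thesis by (rule double_product.splits_match[OF D i j k inf(2)[OF j] F Q, symmetric])
  qed
  have \<tau>\<sigma>: "\<tau> (\<sigma> k) = k" if k: "k \<in> I" for k
  proof -
    obtain Q where i: "\<sigma> k \<in> J" and Q: "splits I \<Gamma> J \<Lambda> (restrict_space M W) \<phi> \<psi> k (\<sigma> k) Q" using \<sigma> k by blast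
    obtain F where j: "\<tau> (\<sigma> k) \<in> I" and F: "splits J \<Lambda> I \<Gamma> (restrict_space M W) \<psi> \<phi> (\<sigma> k) (\<tau> (\<sigma> k)) F" using \<tau> i by blast
    show ?thesis by (rule double_product.splits_match[OF double_product.swap[OF D] i j k inf(1)[OF j] F Q, symmetric])
  qed
  show ?thesis
  proof (intro exI[of _ \<sigma>] conjI ballI)
    show "bij_betw \<sigma> I J"
      by (rule bij_betw_byWitness[where f' = \<tau>]) (use \<sigma> \<tau> \<sigma>\<tau> \<tau>\<sigma> in auto)
    fix i assume i: "i \<in> I"
    obtain F where j: "\<sigma> i \<in> J" and F: "splits I \<Gamma> J \<Lambda> (restrict_space M W) \<phi> \<psi> i (\<sigma> i) F" using \<sigma> i by blast
    obtain Q where "splits J \<Lambda> I \<Gamma> (restrict_space M W) \<psi> \<phi> (\<sigma> i) (\<tau> (\<sigma> i)) Q" using \<tau> j by blast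
    then have Q: "splits J \<Lambda> I \<Gamma> (restrict_space M W) \<psi> \<phi> (\<sigma> i) i Q" unfolding \<tau>\<sigma>[OF i] .
    show "measure_equivalent TYPE(real) (\<Gamma> i) (\<Lambda> (\<sigma> i))"
      by (rule double_product.measure_equivalent_of_splits[OF D i j F Q])
  qed
qed

lemma hyperbolic_group_properties:
  fixes G :: "('a, 'c) monoid_scheme"
  assumes "hyperbolic_group G" "\<not> virtually_cyclic G" "torsion_free G"
  shows "Group.group G" "no_reiter G" "bi_exact G" "infinite (carrier G)"
proof -
  show g: "Group.group G" using assms(1) by (simp add: hyperbolic_group_def)
  show "infinite (carrier G)" using group.virtually_cyclic_of_finite[OF g] assms(2) by blast
  obtain S \<delta> where "hyperbolic_metric G S \<delta>" using hyperbolic_group_metric[OF assms(1)] by blast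
  then show "no_reiter G" "bi_exact G" using assms by (blast intro: hyperbolic_metric.no_reiter hyperbolic_metric.bi_exact)+
qed

theorem corollary6:
  fixes \<Gamma> :: "nat \<Rightarrow> ('a, 'c) monoid_scheme"
    and \<Lambda> :: "nat \<Rightarrow> ('b, 'd) monoid_scheme"
    and n m :: nat
  assumes "\<And>i. i \<in> {1..n} \<Longrightarrow>
      hyperbolic_group (\<Gamma> i) \<and> \<not> virtually_cyclic (\<Gamma> i) \<and> torsion_free (\<Gamma> i)"
    and "\<And>j. j \<in> {1..m} \<Longrightarrow>
      hyperbolic_group (\<Lambda> j) \<and> \<not> virtually_cyclic (\<Lambda> j) \<and> torsion_free (\<Lambda> j)"
    and "measure_equivalent TYPE('s) (product_group {1..n} \<Gamma>) (product_group {1..m} \<Lambda>)"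
  shows "n = m \<and>
    (\<exists>\<pi>. \<pi> permutes {1..n} \<and>
      (\<forall>i\<in>{1..n}. measure_equivalent TYPE(real) (\<Gamma> i) (\<Lambda> (\<pi> i))))"
proof -
  have G: "Group.group (\<Gamma> i)" "no_reiter (\<Gamma> i)" "bi_exact (\<Gamma> i)" "torsion_free (\<Gamma> i)" "infinite (carrier (\<Gamma> i))"
    if "i \<in> {1..n}" for i
    using assms(1)[OF that] hyperbolic_group_properties[of "\<Gamma> i"] by simp_all
  have L: "Group.group (\<Lambda> j)" "no_reiter (\<Lambda> j)" "bi_exact (\<Lambda> j)" "torsion_free (\<Lambda> j)" "infinite (carrier (\<Lambda> j))"
    if "j \<in> {1..m}" for j
    using assms(2)[OF that] hyperbolic_group_properties[of "\<Lambda> j"] by simp_all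
  from assms(3) obtain M :: "'s measure" and \<phi> \<psi>
    where c: "countable (carrier (product_group {1..n} \<Gamma>))" "countable (carrier (product_group {1..m} \<Lambda>))"
      and mc: "measure_coupling (product_group {1..n} \<Gamma>) (product_group {1..m} \<Lambda>) M \<phi> \<psi>"
    unfolding measure_equivalent_def by (elim conjE exE)
  have "\<exists>W X Y. double_product {1..n} \<Gamma> {1..m} \<Lambda> (restrict_space M W) \<phi> X \<psi> Y"
    by (rule ex_double_product[OF _ _ G(1) L(1) c mc]) simp_all
  then obtain W X Y where D: "double_product {1..n} \<Gamma> {1..m} \<Lambda> (restrict_space M W) \<phi> X \<psi> Y"
    by (elim exE)
  have "\<exists>\<sigma>. bij_betw \<sigma> {1..n} {1..m} \<and> (\<forall>i\<in>{1..n}. measure_equivalent TYPE(real) (\<Gamma> i) (\<Lambda> (\<sigma> i)))"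
    by (rule double_product.factor_bijection[OF D G(2) L(2) G(3) L(3) G(4) L(4) G(5) L(5)])
  then obtain \<sigma> where \<sigma>: "bij_betw \<sigma> {1..n} {1..m}"
    "\<forall>i\<in>{1..n}. measure_equivalent TYPE(real) (\<Gamma> i) (\<Lambda> (\<sigma> i))"
    by (elim exE conjE)
  have nm: "n = m" using bij_betw_same_card[OF \<sigma>(1)] by simp
  \<comment> \<open>The bijection is extended by the identity, because \<open>permutes\<close> asks
    for fixed points outside \<open>{1..n}\<close>.\<close>
  let ?\<pi> = "\<lambda>i. if i \<in> {1..n} then \<sigma> i else i"
  have "bij_betw ?\<pi> {1..n} {1..n}"
    using \<sigma>(1) bij_betw_cong[of "{1..m}" ?\<pi> \<sigma> "{1..m}"] unfolding nm by auto
  then have "?\<pi> permutes {1..n}" by (rule bij_imp_permutes) (rule if_not_P)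
  moreover have "\<forall>i\<in>{1..n}. measure_equivalent TYPE(real) (\<Gamma> i) (\<Lambda> (?\<pi> i))" using \<sigma>(2) by simp
  ultimately show ?thesis using nm by blast
qed

end
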